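(* Let $\zeta$ be a primitive root of unity, $k\in\mathbb N$, and suppose $q\to\zeta$ radially within the unit disk: (a) If $\zeta$ has order $2k-1$, then \[\lim_{q\to\zeta} \big( \psi_0(q) - B(\psi_0;q)\big) = -\frac{1}{2} -\sum_{n=1}^{2k-1} \frac{\zeta^{n^2}}{(-\zeta;\zeta)_n},\qquad \lim_{q\to\zeta} \big( \psi_1(q) - B(\psi_1;q)\big) = -\frac{1}{2} -\sum_{n=1}^{2k-1} \frac{\zeta^{n(n+1)}}{(-\zeta;\zeta)_n},\] where $B(\psi_0;q)$ and $B(\psi_1;q)$ are modular forms of weight $1/2$ with level $\Gamma_1(20)$. (b) If $\zeta$ has order $m$, then \[\lim_{q\to\zeta} \big( \phi_0(q) - B(\phi_0;q)\big) = \begin{cases} -2\sum_{n=1}^{2k-1} \frac{\zeta^{2n^2}}{(-\zeta;\zeta^2)_n} & m = 2k-1, \\ -2\sum_{n=1}^{2k} \frac{\zeta^{2n^2}}{(-\zeta;\zeta^2)_n} & m = 4k, \end{cases}\qquad \lim_{q\to\zeta} \big( \phi_1(q) - B(\phi_1;q)\big) = \begin{cases} -2\zeta\sum_{n=1}^{2k-1} \frac{\zeta^{2n(n-1)}}{(-\zeta;\zeta^2)_n} & m = 2k-1, \\ -2\zeta\sum_{n=1}^{2k} \frac{\zeta^{2n(n-1)}}{(-\zeta;\zeta^2)_n} & m = 4k, \end{cases}\] where $B(\phi_0;q)$ and $B(\phi_1;q)$ are modular forms of weight $1/2$ with level $\Gamma_1(10)$.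
   Context: Let $q=e^{2\pi i\tau}$ with $\tau$ in the upper half-plane. The $q$-Pochhammer symbol is $(a;q)_\infty=\prod_{j\ge0}(1-aq^j)$ and $(a;q)_n=(a;q)_\infty/(aq^n;q)_\infty$ for all $n\in\mathbb Z$. Ramanujan's 5th order mock theta functions considered here are $\psi_0(q)=\sum_{n\ge0} q^{(n+1)(n+2)/2}(-q;q)_n$, $\psi_1(q)=\sum_{n\ge0} q^{n(n+1)/2}(-q;q)_n$, $\phi_0(q)=\sum_{n\ge0} q^{n^2}(-q;q^2)_n$, $\phi_1(q)=\sum_{n\ge0} q^{(n+1)^2}(-q;q^2)_n$. For a mock theta function $M(q)=\sum_{n\ge0}c(n;q)$, its associated bilateral series is $B(M;q)=\sum_{n\in\mathbb Z}c(n;q)$, with the summands for negative $n$ interpreted via the definition of $(a;q)_n$ for negative $n$. "Modular form" means modular up to a rational power of $q$ with respect to some character.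
   Formalization: In (b), level Γ₁(10) for B(φ₀;q), B(φ₁;q) is false as printed (growth at the cusp 1/10); proved instead: level Γ₁(20) for B(φᵢ;q) and Γ₁(10) for B(φᵢ;−q). "Modular form" allows poles at cusps, which do occur, and a unitary multiplier system as character. *)

theory Defs
  imports "HOL-Complex_Analysis.Complex_Analysis" "HOL-Number_Theory.Cong"
begin

section \<open>The q-Pochhammer symbol\<close>

definition qpoch_inf :: "complex \<Rightarrow> complex \<Rightarrow> complex" where
  "qpoch_inf a q = (\<Prod>j. 1 - a * q ^ j)"

definition qpoch :: "complex \<Rightarrow> complex \<Rightarrow> int \<Rightarrow> complex" where
  "qpoch a q n = qpoch_inf a q / qpoch_inf (a * q powi n) q"

text \<open>
  The infinite products above converge only inside the unit disk. At a root of unity the symbol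
  with index \<open>n \<ge> 0\<close> denotes the finite product; lemma \<open>qpoch_of_nat\<close> below shows that
  the two agree inside the disk.
\<close>

definition qpoch_fin :: "complex \<Rightarrow> complex \<Rightarrow> nat \<Rightarrow> complex" where
  "qpoch_fin a q n = (\<Prod>j<n. 1 - a * q ^ j)"

lemma convergent_prod_qpoch:
  fixes a q :: complex
  assumes "norm q < 1"
  shows "convergent_prod (\<lambda>j. 1 - a * q ^ j)"
proof (rule abs_convergent_prod_imp_convergent_prod)
  have "summable (\<lambda>j. norm a * norm q ^ j)"
    using assms by (intro summable_mult summable_geometric) auto
  then show "abs_convergent_prod (\<lambda>j. 1 - a * q ^ j)"
    unfolding abs_convergent_prod_conv_summable
    by (simp add: norm_mult norm_power)
qed

lemma qpoch_of_nat:
  assumes q: "norm q < 1" and nz: "qpoch_inf (a * q ^ n) q \<noteq> 0"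
  shows "qpoch a q (int n) = qpoch_fin a q n"
proof -
  have "(\<lambda>j. 1 - a * q ^ j) has_prod ((\<Prod>j<n. 1 - a * q ^ j) * (\<Prod>j. 1 - a * q ^ (j + n)))"
    by (rule has_prod_ignore_initial_segment') (rule convergent_prod_qpoch[OF q])
  then have "qpoch_inf a q = qpoch_fin a q n * qpoch_inf (a * q ^ n) q"
    by (simp add: qpoch_inf_def qpoch_fin_def has_prod_unique[symmetric] power_add mult_ac)
  with nz show ?thesis
    by (simp add: qpoch_def)
qed

section \<open>Mock theta functions and their bilateral series\<close>

text \<open>
  A series is represented by its summand \<open>c n q\<close>, given for all integers \<open>n\<close>.
\<close>

definition unilateral :: "(int \<Rightarrow> complex \<Rightarrow> complex) \<Rightarrow> complex \<Rightarrow> complex" where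
  "unilateral c q = (\<Sum>n. c (int n) q)"

definition bilateral :: "(int \<Rightarrow> complex \<Rightarrow> complex) \<Rightarrow> complex \<Rightarrow> complex" where
  "bilateral c q = (\<Sum>\<^sub>\<infinity>n\<in>UNIV. c n q)"

definition psi0_term :: "int \<Rightarrow> complex \<Rightarrow> complex" where
  "psi0_term n q = q powi ((n + 1) * (n + 2) div 2) * qpoch (-q) q n"

definition psi1_term :: "int \<Rightarrow> complex \<Rightarrow> complex" where
  "psi1_term n q = q powi (n * (n + 1) div 2) * qpoch (-q) q n"

definition phi0_term :: "int \<Rightarrow> complex \<Rightarrow> complex" where
  "phi0_term n q = q powi (n\<^sup>2) * qpoch (-q) (q\<^sup>2) n"

definition phi1_term :: "int \<Rightarrow> complex \<Rightarrow> complex" where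
  "phi1_term n q = q powi ((n + 1)\<^sup>2) * qpoch (-q) (q\<^sup>2) n"

section \<open>Primitive roots of unity and radial limits\<close>

definition primitive_root_of_unity :: "nat \<Rightarrow> complex \<Rightarrow> bool" where
  "primitive_root_of_unity m \<zeta> \<longleftrightarrow> m > 0 \<and> \<zeta> ^ m = 1 \<and> (\<forall>j. 0 < j \<and> j < m \<longrightarrow> \<zeta> ^ j \<noteq> 1)"

definition radial_limit :: "(complex \<Rightarrow> complex) \<Rightarrow> complex \<Rightarrow> complex \<Rightarrow> bool" where
  "radial_limit f \<zeta> L \<longleftrightarrow> ((\<lambda>r. f (of_real r * \<zeta>)) \<longlongrightarrow> L) (at_left (1::real))"

section \<open>Modular forms of real weight with a multiplier system\<close>

abbreviation upper_half_plane :: "complex set" where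
  "upper_half_plane \<equiv> {\<tau>. Im \<tau> > 0}"

abbreviation qexp :: "complex \<Rightarrow> complex" where
  "qexp z \<equiv> exp (2 * of_real pi * \<i> * z)"

definition SL2Z :: "(int ^ 2 ^ 2) set" where
  "SL2Z = {A. det A = 1}"

definition Gamma1 :: "nat \<Rightarrow> (int ^ 2 ^ 2) set" where
  "Gamma1 N = {A \<in> SL2Z. [A $ 1 $ 1 = 1] (mod int N) \<and> [A $ 2 $ 2 = 1] (mod int N) \<and>
                         [A $ 2 $ 1 = 0] (mod int N)}"

definition moebius :: "int ^ 2 ^ 2 \<Rightarrow> complex \<Rightarrow> complex" where
  "moebius A \<tau> = (of_int (A $ 1 $ 1) * \<tau> + of_int (A $ 1 $ 2)) /
                 (of_int (A $ 2 $ 1) * \<tau> + of_int (A $ 2 $ 2))"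

text \<open>The power is taken with the principal branch of the logarithm.\<close>

definition autom_factor :: "real \<Rightarrow> int ^ 2 ^ 2 \<Rightarrow> complex \<Rightarrow> complex" where
  "autom_factor k A \<tau> = (of_int (A $ 2 $ 1) * \<tau> + of_int (A $ 2 $ 2)) powr of_real k"

text \<open>
  For non-integral weight, a ``character'' is a multiplier system: it is unitary, and a homomorphism
  up to the cocycle that comes from the choice of the branch of the automorphy factor.
\<close>

definition multiplier_system ::
    "(int ^ 2 ^ 2) set \<Rightarrow> real \<Rightarrow> (int ^ 2 ^ 2 \<Rightarrow> complex) \<Rightarrow> bool" where
  "multiplier_system G k v \<longleftrightarrow>
     (\<forall>A\<in>G. norm (v A) = 1) \<and>
     (\<forall>A\<in>G. \<forall>B\<in>G. \<forall>\<tau>\<in>upper_half_plane.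
        v (A ** B) * autom_factor k (A ** B) \<tau> =
        (v A * autom_factor k A (moebius B \<tau>)) * (v B * autom_factor k B \<tau>))"

text \<open>
  Meromorphy at the cusp \<open>A \<infinity>\<close>: up to a factor \<open>e(\<kappa> \<tau> / h)\<close>, where \<open>e\<close> is \<open>qexp\<close>, caused by the multiplier, the
  translate of \<open>f\<close> to \<open>\<infinity>\<close> is a Laurent series in \<open>e(\<tau> / h)\<close> with finite principal part.
\<close>

definition meromorphic_at_cusp ::
    "real \<Rightarrow> (complex \<Rightarrow> complex) \<Rightarrow> int ^ 2 ^ 2 \<Rightarrow> bool" where
  "meromorphic_at_cusp k f A \<longleftrightarrow>
     (\<exists>(h::nat) (\<kappa>::real) F. h > 0 \<and> F meromorphic_on {0} \<and>
        (\<forall>\<tau>\<in>upper_half_plane.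
           f (moebius A \<tau>) / autom_factor k A \<tau> = qexp (of_real \<kappa> * \<tau> / of_nat h) * F (qexp (\<tau> / of_nat h))))"

text \<open>
  Holomorphic on the upper half-plane, but possibly with poles at the cusps. The bilateral series
  considered here do grow exponentially at some cusps, so holomorphy at the cusps cannot be required.
\<close>

definition modular_form ::
    "(int ^ 2 ^ 2) set \<Rightarrow> real \<Rightarrow> (int ^ 2 ^ 2 \<Rightarrow> complex) \<Rightarrow> (complex \<Rightarrow> complex) \<Rightarrow> bool" where
  "modular_form G k v f \<longleftrightarrow>
     f holomorphic_on upper_half_plane \<and>
     (\<forall>A\<in>G. \<forall>\<tau>\<in>upper_half_plane. f (moebius A \<tau>) = v A * autom_factor k A \<tau> * f \<tau>) \<and>
     (\<forall>A\<in>SL2Z. meromorphic_at_cusp k f A)"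

text \<open>
  A function of \<open>q = e(\<tau>)\<close>, where \<open>e\<close> is \<open>qexp\<close>, that is modular up to a rational power of \<open>q\<close> with respect to some
  character. For the series built from \<open>phi0_term\<close> and \<open>phi1_term\<close> the variable matters: level
  \<open>\<Gamma>\<^sub>1(10)\<close> is attained in the variable \<open>-q = e(\<tau> + 1/2)\<close>, not in \<open>q\<close>, where the level is \<open>\<Gamma>\<^sub>1(20)\<close>.
  Indeed, if \<open>q\<^sup>r B(q)\<close> had weight \<open>1/2\<close> on \<open>\<Gamma>\<^sub>1(10)\<close>, then the growth of \<open>B = bilateral phi0_term\<close> at
  the cusps \<open>1/20\<close> and \<open>1/10\<close>, both equivalent to \<open>\<infinity>\<close>, would give \<open>r = -1/120\<close> and \<open>r = -1/30\<close>.
\<close>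

definition modular_in_q :: "(int ^ 2 ^ 2) set \<Rightarrow> real \<Rightarrow> (complex \<Rightarrow> complex) \<Rightarrow> bool" where
  "modular_in_q G k F \<longleftrightarrow>
     (\<exists>r\<in>\<rat>. \<exists>v. multiplier_system G k v \<and>
        modular_form G k v (\<lambda>\<tau>. qexp (of_real r * \<tau>) * F (qexp \<tau>)))"

end

theory Submission
  imports Defs
begin

text \<open>
  Reversing the summation turns each bilateral series into a theta-like sum of the shape
  \<open>\<Sum> q ^ (N\<^sup>2) (- q ^ (N + 1); q)\<close> over all integers \<open>N\<close>. Expanding the infinite products by Euler and splitting by parity
  writes it in terms of theta functions and the Rogers--Ramanujan series \<open>G, H\<close>; in the end it is a
  combination of \<open>X(q)\<close> and \<open>X(-q)\<close>, where \<open>X\<close> is \<open>G\<close> or \<open>H\<close> times \<open>\<theta>\<^sub>4\<close>. By the Rogers--Ramanujan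
  identities \<open>X\<close> is an eta quotient divided by a Siegel function. Its square transforms as expected, and
  by continuity so does \<open>X\<close>, up to a constant for each matrix. Since \<open>X(-q) - X(q)\<close> for \<open>G\<close>, and
  \<open>X(-q) + X(q)\<close> for \<open>H\<close>, is a product of the same kind, the constants of \<open>X(q)\<close> and \<open>X(-q)\<close> coincide.

  The difference of the unilateral and the bilateral series is the part with negative indices, whose
  terms tend to those at \<open>\<zeta>\<close>. There, the denominators double over each period and so the terms are halved;
  summing the geometric series leaves twice a finite sum.
\<close>

text \<open>Also being the notation of \<^const>\<open>vec_nth\<close>, the operator would make parsing exponential.\<close>

no_notation fps_nth (infixl "$" 75)

section \<open>Infinite sums\<close>

text \<open>The multiplier is never computed: the transformation laws give each constant only as
  some number of modulus one, and the cocycle law is then read off from one function without zeros.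
  The difficulty is that \<open>X(q)\<close> and \<open>X(-q)\<close> must share one constant. With
  \<open>q = e(\<tau> / 2)\<close>, a matrix of \<open>Gamma1 10\<close> with even upper right entry
  maps each of the two to a multiple of itself, and one with odd entry exchanges them; combinations
  of the two are modular once the constants agree. The product that equals their sum or difference
  supplies the missing equation, except when the two are proportional, in which case the shift
  \<open>\<tau> + 1\<close> decides.

  The levels come from rescaling. The phi series are eigenvectors of the exchange, so all of
  \<open>Gamma1 10\<close> acts on them, in the variable \<open>-q\<close>. The psi series are not;
  for them only the matrices with even upper right entry remain, and
  \<open>\<tau> -> 2 * \<tau>\<close> carries \<open>Gamma1 20\<close> into these.\<close>

lemma infsum_tannery:
  fixes f :: "'a \<Rightarrow> 'b \<Rightarrow> 'c :: banach"
  assumes lim: "\<And>x. x \<in> X \<Longrightarrow> ((\<lambda>n. f x n) \<longlongrightarrow> g x) F"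
    and bound: "\<And>x n. x \<in> X \<Longrightarrow> n \<in> Y \<Longrightarrow> norm (f x n) \<le> M x"
    and ev: "eventually (\<lambda>n. n \<in> Y) F" and M: "M summable_on X" and F: "F \<noteq> bot"
  shows "((\<lambda>n. \<Sum>\<^sub>\<infinity>x\<in>X. f x n) \<longlongrightarrow> (\<Sum>\<^sub>\<infinity>x\<in>X. g x)) F" "g summable_on X"
proof -
  have gb: "norm (g x) \<le> M x" if "x \<in> X" for x
    by (rule tendsto_upperbound[OF tendsto_norm[OF lim[OF that]] eventually_mono[OF ev] F])
       (use bound that in auto)
  have "(\<lambda>x. norm (g x)) summable_on X"
    by (rule summable_on_comparison_test[OF M]) (use gb in auto)
  then show g: "g summable_on X"
    by (rule abs_summable_summable)
  show "((\<lambda>n. \<Sum>\<^sub>\<infinity>x\<in>X. f x n) \<longlongrightarrow> (\<Sum>\<^sub>\<infinity>x\<in>X. g x)) F"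
  \<comment> \<open>By the M-test the finite partial sums converge uniformly on \<open>Y\<close>,
    which allows the limit along \<open>F\<close> to be exchanged with the limit of the partial
    sums.\<close>
  proof (rule swap_uniform_limit')
    show "\<forall>\<^sub>F A in finite_subsets_at_top X. ((\<lambda>n. \<Sum>x\<in>A. f x n) \<longlongrightarrow> (\<Sum>x\<in>A. g x)) F"
      by (rule eventually_finite_subsets_at_top_weakI) (auto intro!: tendsto_sum lim)
    show "(sum g \<longlongrightarrow> infsum g X) (finite_subsets_at_top X)"
      using g by (rule infsum_tendsto)
    show "uniform_limit Y (\<lambda>A n. \<Sum>x\<in>A. f x n) (\<lambda>n. \<Sum>\<^sub>\<infinity>x\<in>X. f x n) (finite_subsets_at_top X)"
      by (rule Weierstrass_m_test_general[OF bound M])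
  qed (use ev in auto)
qed

text \<open>The negative integers are enumerated as \<open>- n - 1\<close>, so that both halves
  start at 0 and do not overlap. The difference between a unilateral and a bilateral series is later
  read off from this splitting.\<close>

lemma int_abs_summableI:
  fixes f :: "int \<Rightarrow> 'a :: banach"
  assumes "summable (\<lambda>n. norm (f (int n)))" "summable (\<lambda>n. norm (f (- int n - 1)))"
  shows "(\<lambda>x. norm (f x)) summable_on UNIV"
    and "infsum f UNIV = (\<Sum>n. f (int n)) + (\<Sum>n. f (- int n - 1))"
proof -
  have U: "(UNIV :: int set) = int ` UNIV \<union> (\<lambda>n. - int n - 1) ` UNIV"
  proof (intro equalityI subsetI)
    fix x :: int
    show "x \<in> int ` UNIV \<union> (\<lambda>n. - int n - 1) ` UNIV"
    proof (cases "x \<ge> 0")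
      case True
      then have "x = int (nat x)" by simp
      then show ?thesis by blast
    next
      case False
      then have "x = - int (nat (- x - 1)) - 1" by simp
      then show ?thesis by blast
    qed
  qed auto
  have disj: "int ` UNIV \<inter> (\<lambda>n. - int n - 1) ` UNIV = {}" by auto
  have inj: "inj int" "inj (\<lambda>n. - int n - 1)" by (auto simp: inj_def)
  have a: "(\<lambda>x. norm (f (int x))) summable_on UNIV" "(\<lambda>x. norm (f (- int x - 1))) summable_on UNIV"
    using assms by (auto simp: o_def summable_on_UNIV_nonneg_real_iff)
  have b: "(\<lambda>x. norm (f x)) summable_on int ` UNIV" "(\<lambda>x. norm (f x)) summable_on (\<lambda>n. - int n - 1) ` UNIV"
    using a inj by (simp_all add: summable_on_reindex o_def)
  show "(\<lambda>x. norm (f x)) summable_on UNIV"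
    unfolding U by (rule summable_on_Un_disjoint[OF b disj])
  have "infsum f UNIV = infsum f (int ` UNIV) + infsum f ((\<lambda>n. - int n - 1) ` UNIV)"
    unfolding U by (rule infsum_Un_disjoint[OF abs_summable_summable[OF b(1)] abs_summable_summable[OF b(2)] disj])
  also have "infsum f (int ` UNIV) = (\<Sum>n. f (int n))"
    unfolding infsum_reindex[OF inj(1)]
    using has_sum_imp_sums[OF has_sum_infsum[OF abs_summable_summable[OF a(1)]]]
    by (simp add: sums_iff o_def)
  also have "infsum f ((\<lambda>n. - int n - 1) ` UNIV) = (\<Sum>n. f (- int n - 1))"
    unfolding infsum_reindex[OF inj(2)]
    using has_sum_imp_sums[OF has_sum_infsum[OF abs_summable_summable[OF a(2)]]]
    by (simp add: sums_iff o_def)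
  finally show "infsum f UNIV = (\<Sum>n. f (int n)) + (\<Sum>n. f (- int n - 1))" .
qed

lemma gauss_summable_nat:
  fixes \<rho> \<beta> :: real
  assumes "0 < \<rho>" "\<rho> < 1" "\<beta> > 0"
  shows "summable (\<lambda>n. \<rho> powr (real n ^ 2 / 2) * \<beta> powr real n)"
proof -
  \<comment> \<open>From \<open>N\<close> on, the quadratic part of the exponent outweighs
    \<open>n * ln \<beta>\<close> by at least \<open>n\<close>, so that the terms are at most
    \<open>exp (-1) ^ n\<close>.\<close>
  obtain N :: nat where N: "real N \<ge> (ln \<beta> + 1) / (- ln \<rho> / 2)"
    using real_arch_simple by blast
  have l: "ln \<rho> < 0" using assms by simp
  show ?thesis
  proof (rule summable_comparison_test_ev)
    show "\<forall>\<^sub>F n in sequentially. norm (\<rho> powr (real n ^ 2 / 2) * \<beta> powr real n) \<le> exp (-1) ^ n"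
      using eventually_ge_at_top[of N]
    proof eventually_elim
      case (elim n)
      have "(ln \<beta> + 1) / (- ln \<rho> / 2) \<le> real n" using N elim by linarith
      then have "ln \<beta> + 1 \<le> real n * (- ln \<rho> / 2)"
        using l by (subst (asm) pos_divide_le_eq) auto
      then have "real n * (ln \<beta> + 1) \<le> real n * (real n * (- ln \<rho> / 2))"
        by (intro mult_left_mono) auto
      then have "real n ^ 2 / 2 * ln \<rho> + real n * ln \<beta> \<le> - real n"
        by (simp add: algebra_simps power2_eq_square)
      then show ?case using assms
        by (simp add: powr_def exp_add[symmetric] exp_of_nat_mult[symmetric])
    qed
    show "summable (\<lambda>n. exp (-1::real) ^ n)"
      by (rule summable_geometric) simp
  qed
qed

lemma gauss_summable_int:
  fixes \<rho> \<beta> :: real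
  assumes "0 < \<rho>" "\<rho> < 1" "\<beta> > 0"
  shows "(\<lambda>n::int. \<rho> powr (real_of_int n ^ 2 / 2) * \<beta> powr real_of_int n) summable_on UNIV"
proof -
  let ?f = "\<lambda>n::int. \<rho> powr (real_of_int n ^ 2 / 2) * \<beta> powr real_of_int n"
  have 1: "summable (\<lambda>n. norm (?f (int n)))"
    using gauss_summable_nat[OF assms] by (simp add: abs_mult)
  \<comment> \<open>Reflection to negative indices replaces \<beta> by its inverse; the shift by one
    leaves out the index 0, which belongs to the other half.\<close>
  have "summable (\<lambda>n. \<rho> powr (real (Suc n) ^ 2 / 2) * inverse \<beta> powr real (Suc n))"
    using gauss_summable_nat[of \<rho> "inverse \<beta>"] assms by (subst summable_Suc_iff) auto
  also have "(\<lambda>n. \<rho> powr (real (Suc n) ^ 2 / 2) * inverse \<beta> powr real (Suc n)) = (\<lambda>n. norm (?f (- int n - 1)))"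
  proof
    fix n
    have "real_of_int (- int n - 1) = - real (Suc n)" by simp
    then show "\<rho> powr (real (Suc n) ^ 2 / 2) * inverse \<beta> powr real (Suc n) = norm (?f (- int n - 1))"
      using assms by (simp only: power2_minus) (simp add: powr_def ln_inverse abs_mult algebra_simps flip: exp_minus)
  qed
  finally have 2: "summable (\<lambda>n. norm (?f (- int n - 1)))" .
  show ?thesis
    using abs_summable_summable[OF int_abs_summableI(1)[OF 1 2]] .
qed

lemma infsum_nat_even_odd:
  fixes f :: "nat \<Rightarrow> 'a :: banach"
  assumes "f summable_on UNIV"
  shows "infsum f UNIV = (\<Sum>\<^sub>\<infinity>j. f (2 * j)) + (\<Sum>\<^sub>\<infinity>j. f (2 * j + 1))"
    "(\<lambda>j. f (2 * j)) summable_on UNIV" "(\<lambda>j. f (2 * j + 1)) summable_on UNIV"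
proof -
  have U: "(UNIV :: nat set) = (\<lambda>j. 2 * j) ` UNIV \<union> (\<lambda>j. 2 * j + 1) ` UNIV"
  proof (intro equalityI subsetI)
    fix x :: nat
    have "x = 2 * (x div 2) \<or> x = 2 * (x div 2) + 1" by presburger
    then show "x \<in> (\<lambda>j. 2 * j) ` UNIV \<union> (\<lambda>j. 2 * j + 1) ` UNIV" by blast
  qed auto
  have disj: "((\<lambda>j::nat. 2 * j) ` UNIV) \<inter> ((\<lambda>j. 2 * j + 1) ` UNIV) = {}"
    by (auto dest: arg_cong[where f = even])
  have inj: "inj (\<lambda>j::nat. 2 * j)" "inj (\<lambda>j::nat. 2 * j + 1)" by (auto simp: inj_def)
  have s: "f summable_on A" for A
    using assms by (rule summable_on_subset_banach) auto
  have "infsum f ((\<lambda>j. 2 * j) ` UNIV \<union> (\<lambda>j. 2 * j + 1) ` UNIV) =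
      infsum f ((\<lambda>j. 2 * j) ` UNIV) + infsum f ((\<lambda>j. 2 * j + 1) ` UNIV)"
    by (rule infsum_Un_disjoint[OF s s disj])
  then show "infsum f UNIV = (\<Sum>\<^sub>\<infinity>j. f (2 * j)) + (\<Sum>\<^sub>\<infinity>j. f (2 * j + 1))"
    unfolding U[symmetric] by (simp only: infsum_reindex[OF inj(1)] infsum_reindex[OF inj(2)] o_def)
  show "(\<lambda>j. f (2 * j)) summable_on UNIV" "(\<lambda>j. f (2 * j + 1)) summable_on UNIV"
    using s[of "(\<lambda>j. 2 * j) ` UNIV"] s[of "(\<lambda>j. 2 * j + 1) ` UNIV"]
    by (simp_all only: summable_on_reindex[OF inj(1)] summable_on_reindex[OF inj(2)] o_def)
qed

section \<open>Infinite q-products\<close>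

lemma qpoch_fin_0 [simp]: "qpoch_fin a q 0 = 1"
  by (simp add: qpoch_fin_def)

lemma qpoch_fin_Suc: "qpoch_fin a q (Suc n) = qpoch_fin a q n * (1 - a * q ^ n)"
  by (simp add: qpoch_fin_def)

lemma qpoch_fin_Suc': "qpoch_fin a q (Suc n) = (1 - a) * qpoch_fin (a * q) q n"
  unfolding qpoch_fin_def by (subst prod.lessThan_Suc_shift) (simp add: mult_ac)

lemma qpoch_fin_tendsto:
  assumes "norm q < 1"
  shows "(\<lambda>n. qpoch_fin a q n) \<longlonglongrightarrow> qpoch_inf a q"
  using convergent_prod_LIMSEQ[OF convergent_prod_qpoch[OF assms, of a]]
  unfolding qpoch_fin_def qpoch_inf_def by (simp add: LIMSEQ_lessThan_iff_atMost)

lemma qpoch_inf_shift: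
  assumes "norm q < 1"
  shows "qpoch_inf a q = qpoch_fin a q n * qpoch_inf (a * q ^ n) q"
proof -
  have "(\<lambda>j. 1 - a * q ^ j) has_prod ((\<Prod>j<n. 1 - a * q ^ j) * (\<Prod>j. 1 - a * q ^ (j + n)))"
    by (rule has_prod_ignore_initial_segment') (rule convergent_prod_qpoch[OF assms])
  then show ?thesis
    by (simp add: qpoch_inf_def qpoch_fin_def has_prod_unique[symmetric] power_add mult_ac)
qed

lemma qpoch_inf_step:
  assumes "norm q < 1"
  shows "qpoch_inf a q = (1 - a) * qpoch_inf (a * q) q"
  using qpoch_inf_shift[OF assms, of a 1] by (simp add: qpoch_fin_def)

lemma qpoch_inf_eq_0_iff:
  assumes "norm q < 1"
  shows "qpoch_inf a q = 0 \<longleftrightarrow> (\<exists>j. a * q ^ j = 1)"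
proof
  assume "qpoch_inf a q = 0"
  show "\<exists>j. a * q ^ j = 1"
  proof (rule ccontr)
    assume "\<not> ?thesis"
    then have "qpoch_inf a q \<noteq> 0"
      unfolding qpoch_inf_def by (intro prodinf_nonzero convergent_prod_qpoch assms) auto
    with \<open>qpoch_inf a q = 0\<close> show False by simp
  qed
next
  assume "\<exists>j. a * q ^ j = 1"
  then obtain j where "a * q ^ j = 1" ..
  then have "qpoch_fin a q (Suc j) = 0" by (simp add: qpoch_fin_def)
  then show "qpoch_inf a q = 0" by (subst qpoch_inf_shift[OF assms, of _ "Suc j"]) simp
qed

lemma qpoch_inf_nonzero:
  assumes "norm q < 1" "norm a < 1"
  shows "qpoch_inf a q \<noteq> 0"
proof -
  have "norm (a * q ^ j) < 1" for j
  proof -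
    have "norm a * norm q ^ j \<le> norm a * 1"
      using assms by (intro mult_left_mono power_le_one) auto
    then show ?thesis using assms by (simp add: norm_mult norm_power)
  qed
  then have "a * q ^ j \<noteq> 1" for j
    by (metis norm_one order_less_irrefl)
  then show ?thesis using qpoch_inf_eq_0_iff[OF assms(1)] by blast
qed

lemma qpoch_fin_nonzero:
  assumes "norm q < 1" "norm a < 1"
  shows "qpoch_fin a q n \<noteq> 0"
  using qpoch_inf_nonzero[OF assms] qpoch_inf_shift[OF assms(1), of a n] by auto

text \<open>The exponents are sorted by their residues modulo \<open>N\<close>. This is done for
  partial products of length \<open>n * N\<close>, and that subsequence still tends to the full
  product.\<close>

lemma qpoch_inf_split:
  assumes "norm q < 1" "N > 0"
  shows "qpoch_inf a q = (\<Prod>r<N. qpoch_inf (a * q ^ r) (q ^ N))"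
proof -
  have qN: "norm (q ^ N) < 1"
    using assms by (simp add: norm_power power_less_one_iff)
  have fin: "qpoch_fin a q (n * N) = (\<Prod>r<N. qpoch_fin (a * q ^ r) (q ^ N) n)" for n
  proof (induction n)
    case (Suc n)
    have "qpoch_fin a q (Suc n * N) = qpoch_fin a q (n * N) * (\<Prod>r<N. 1 - a * q ^ (n * N + r))"
    proof -
      have "{..<Suc n * N} = {..<n*N} \<union> (\<lambda>r. n * N + r) ` {..<N}"
      proof (intro equalityI subsetI)
        fix x assume "x \<in> {..<Suc n * N}"
        then show "x \<in> {..<n*N} \<union> (\<lambda>r. n * N + r) ` {..<N}"
          by (cases "x < n * N") (auto intro!: image_eqI[of _ _ "x - n * N"])
      qed auto
      moreover have "{..<n*N} \<inter> (\<lambda>r. n * N + r) ` {..<N} = {}" by auto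
      ultimately show ?thesis
        unfolding qpoch_fin_def by (simp add: prod.union_disjoint prod.reindex)
    qed
    also have "\<dots> = (\<Prod>r<N. qpoch_fin (a * q ^ r) (q ^ N) (Suc n))"
      unfolding Suc.IH qpoch_fin_Suc prod.distrib
      by (simp add: power_add power_mult[symmetric] mult_ac)
    finally show ?case .
  qed (simp add: qpoch_fin_def)
  have "(\<lambda>n. qpoch_fin a q (n * N)) \<longlonglongrightarrow> qpoch_inf a q"
    using LIMSEQ_subseq_LIMSEQ[OF qpoch_fin_tendsto[OF assms(1), of a], of "\<lambda>n. n * N"] assms
    by (auto simp: strict_mono_def o_def)
  moreover have "(\<lambda>n. qpoch_fin a q (n * N)) \<longlonglongrightarrow> (\<Prod>r<N. qpoch_inf (a * q ^ r) (q ^ N))"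
    unfolding fin by (intro tendsto_prod qpoch_fin_tendsto qN)
  ultimately show ?thesis by (rule LIMSEQ_unique)
qed

lemma qpoch_inf_mult_minus:
  assumes "norm q < 1"
  shows "qpoch_inf a q * qpoch_inf (-a) q = qpoch_inf (a\<^sup>2) (q\<^sup>2)"
proof -
  have "norm (q\<^sup>2) < 1" using assms by (simp add: norm_power power_less_one_iff)
  then have "(\<lambda>n. qpoch_fin (a\<^sup>2) (q\<^sup>2) n) \<longlonglongrightarrow> qpoch_inf (a\<^sup>2) (q\<^sup>2)"
    by (rule qpoch_fin_tendsto)
  moreover have "qpoch_fin (a\<^sup>2) (q\<^sup>2) n = qpoch_fin a q n * qpoch_fin (-a) q n" for n
    unfolding qpoch_fin_def prod.distrib[symmetric]
    by (intro prod.cong refl) (simp add: algebra_simps power2_eq_square power_mult_distrib)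
  moreover have "(\<lambda>n. qpoch_fin a q n * qpoch_fin (-a) q n) \<longlonglongrightarrow> qpoch_inf a q * qpoch_inf (-a) q"
    by (intro tendsto_mult qpoch_fin_tendsto assms)
  ultimately show ?thesis by (simp add: LIMSEQ_unique)
qed

text \<open>On a closed disc the norm of \<open>g\<close> attains a maximum below 1, so one
  geometric series dominates all factors and the partial products converge uniformly. Both arguments
  are functions of \<open>z\<close> because later the parameter and the base vary together with
  \<tau>.\<close>

lemma qpoch_inf_holomorphic:
  assumes S: "open S" and f: "f holomorphic_on S" and g: "g holomorphic_on S"
    and less: "\<And>z. z \<in> S \<Longrightarrow> norm (g z) < 1"
  shows "(\<lambda>z. qpoch_inf (f z) (g z)) holomorphic_on S"
proof (rule holomorphic_uniform_sequence[where f = "\<lambda>n z. \<Prod>j<n. 1 - f z * g z ^ j"])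
  fix x assume x: "x \<in> S"
  then obtain d where d: "d > 0" "cball x d \<subseteq> S"
    using S open_contains_cball by blast
  let ?K = "cball x d"
  have fc: "continuous_on ?K f" and gc: "continuous_on ?K g"
    using f g d holomorphic_on_imp_continuous_on continuous_on_subset by blast+
  have "\<exists>y\<in>?K. \<forall>z\<in>?K. norm (g z) \<le> norm (g y)"
    by (rule continuous_attains_sup) (use gc d in \<open>auto intro!: continuous_intros\<close>)
  then obtain y where y: "y \<in> ?K" "\<And>z. z \<in> ?K \<Longrightarrow> norm (g z) \<le> norm (g y)"
    by blast
  have "bounded (f ` ?K)"
    by (rule compact_imp_bounded[OF compact_continuous_image[OF fc compact_cball]])
  then obtain B where "\<forall>y\<in>f ` ?K. norm y \<le> B"
    unfolding bounded_iff by blast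
  then have B: "\<And>z. z \<in> ?K \<Longrightarrow> norm (f z) \<le> B" by blast
  have gy: "norm (g y) < 1" using less y d by blast
  have "uniformly_convergent_on ?K (\<lambda>N z. \<Prod>j<N. 1 - f z * g z ^ j)"
  proof (rule uniformly_convergent_on_prod')
    show "uniformly_convergent_on ?K (\<lambda>N z. \<Sum>j<N. norm (1 - f z * g z ^ j - 1))"
    proof (rule Weierstrass_m_test')
      fix n z assume z: "z \<in> ?K"
      have "norm (f z) * norm (g z) ^ n \<le> B * norm (g y) ^ n"
        using B[OF z] y(2)[OF z] order_trans[OF norm_ge_zero B[OF z]]
        by (intro mult_mono power_mono) auto
      then show "norm (norm (1 - f z * g z ^ n - 1)) \<le> B * norm (g y) ^ n"
        by (simp add: norm_mult norm_power)
    next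
      show "summable (\<lambda>n. B * norm (g y) ^ n)"
        by (intro summable_mult summable_geometric) (use gy in simp)
    qed
  qed (use fc gc in \<open>auto intro!: continuous_intros\<close>)
  then obtain l where l: "uniform_limit ?K (\<lambda>N z. \<Prod>j<N. 1 - f z * g z ^ j) l sequentially"
    unfolding uniformly_convergent_on_def by blast
  have "l z = qpoch_inf (f z) (g z)" if "z \<in> ?K" for z
    using LIMSEQ_unique[OF tendsto_uniform_limitI[OF l that]
        qpoch_fin_tendsto[of "g z" "f z", unfolded qpoch_fin_def]] less d that by blast
  then have "uniform_limit ?K (\<lambda>N z. \<Prod>j<N. 1 - f z * g z ^ j) (\<lambda>z. qpoch_inf (f z) (g z)) sequentially"
    using l by (subst uniform_limit_cong'[where g = "\<lambda>N z. \<Prod>j<N. 1 - f z * g z ^ j" and i = l]) auto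
  then show "\<exists>d>0. cball x d \<subseteq> S \<and> uniform_limit (cball x d) (\<lambda>N z. \<Prod>j<N. 1 - f z * g z ^ j) (\<lambda>z. qpoch_inf (f z) (g z)) sequentially"
    using d by blast
qed (use S f g in \<open>auto intro!: holomorphic_intros\<close>)

section \<open>Finite q-series identities\<close>

abbreviation qfac :: "complex \<Rightarrow> nat \<Rightarrow> complex" where
  "qfac q n \<equiv> qpoch_fin q q n"

lemma qfac_Suc: "qfac q (Suc n) = qfac q n * (1 - q ^ Suc n)"
  by (simp add: qpoch_fin_Suc)

lemma qfac_nonzero:
  assumes "norm q < 1" shows "qfac q n \<noteq> 0"
  by (rule qpoch_fin_nonzero[OF assms assms])

lemma one_minus_power_nonzero:
  fixes q :: complex
  assumes "norm q < 1" shows "1 - q ^ Suc n \<noteq> 0"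
  using qfac_nonzero[OF assms, of "Suc n"] by (simp add: qfac_Suc)

text \<open>The Gaussian binomial coefficient. The value 0 for \<open>k > m\<close> allows sums over
  \<open>k\<close> to be extended beyond \<open>m\<close>.\<close>

definition qbin :: "complex \<Rightarrow> nat \<Rightarrow> nat \<Rightarrow> complex" where
  "qbin q m k = (if k \<le> m then qfac q m / (qfac q k * qfac q (m - k)) else 0)"

lemma qbin_0: "norm q < 1 \<Longrightarrow> qbin q m 0 = 1"
  by (simp add: qbin_def qfac_nonzero)

lemma qbin_self: "norm q < 1 \<Longrightarrow> qbin q m m = 1"
  by (simp add: qbin_def qfac_nonzero)

text \<open>Of the two q-Pascal rules, the one whose weight \<open>q ^ (m - k)\<close> combines with
  \<open>q ^ k\<close> to the power \<open>q ^ m\<close> in the last factor of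
  \<open>qpoch_fin z q (Suc m)\<close>.\<close>

lemma qbin_Suc_Suc:
  assumes q: "norm q < 1" and k: "k \<le> m"
  shows "qbin q (Suc m) (Suc k) = qbin q m (Suc k) + q ^ (m - k) * qbin q m k"
proof (cases "k = m")
  case True
  then show ?thesis using qbin_self[OF q] by (simp add: qbin_def[of q m "Suc m"])
next
  case False
  then obtain j where m: "m = Suc (k + j)" using k less_imp_Suc_add[of k m] by auto
  have nz: "qfac q k \<noteq> 0" "qfac q j \<noteq> 0" "1 - q ^ Suc k \<noteq> 0" "1 - q ^ Suc j \<noteq> 0"
    using qfac_nonzero[OF q] one_minus_power_nonzero[OF q] by blast+
  have "qbin q (Suc m) (Suc k) = qfac q m * (1 - q ^ Suc m) / (qfac q k * (1 - q ^ Suc k) * (qfac q j * (1 - q ^ Suc j)))"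
    by (simp add: qbin_def m qfac_Suc)
  moreover have "qbin q m (Suc k) = qfac q m / (qfac q k * (1 - q ^ Suc k) * qfac q j)"
    by (simp add: qbin_def m qfac_Suc)
  moreover have "qbin q m k = qfac q m / (qfac q k * (qfac q j * (1 - q ^ Suc j)))"
    by (simp add: qbin_def m Suc_diff_le qfac_Suc)
  moreover have "q ^ Suc m = q ^ Suc j * q ^ Suc k" "m - k = Suc j"
    by (simp_all add: m power_add mult_ac)
  ultimately show ?thesis using nz
    by (simp only:) (simp add: divide_simps, simp add: algebra_simps)
qed

theorem finite_q_binomial:
  assumes q: "norm q < 1"
  shows "qpoch_fin z q m = (\<Sum>k\<le>m. (-1) ^ k * q ^ (k choose 2) * z ^ k * qbin q m k)"
proof (induction m)
  case (Suc m)
  let ?t = "\<lambda>m k. (-1) ^ k * q ^ (k choose 2) * z ^ k * qbin q m k"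
  have "(\<Sum>k\<le>Suc m. ?t (Suc m) k) = 1 + (\<Sum>k\<le>m. ?t (Suc m) (Suc k))"
    by (subst sum.atMost_Suc_shift) (simp add: qbin_0[OF q] binomial_eq_0)
  also have "(\<Sum>k\<le>m. ?t (Suc m) (Suc k)) = (\<Sum>k\<le>m. ?t m (Suc k) - z * q ^ m * ?t m k)"
  proof (intro sum.cong refl)
    fix k assume k: "k \<in> {..m}"
    have "q ^ m = q ^ k * q ^ (m - k)" using k by (simp flip: power_add)
    moreover have "Suc k choose 2 = (k choose 2) + k" by (simp add: numeral_2_eq_2)
    ultimately show "?t (Suc m) (Suc k) = ?t m (Suc k) - z * q ^ m * ?t m k"
      using k qbin_Suc_Suc[OF q, of k m] by (simp add: power_add algebra_simps)
  qed
  also have "\<dots> = (\<Sum>k\<le>m. ?t m (Suc k)) - z * q ^ m * (\<Sum>k\<le>m. ?t m k)"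
    by (simp add: sum_subtractf sum_distrib_left)
  also have "1 + \<dots> = (\<Sum>k\<le>Suc m. ?t m k) - z * q ^ m * (\<Sum>k\<le>m. ?t m k)"
    by (simp add: sum.atMost_Suc_shift qbin_0[OF q] binomial_eq_0 del: sum.atMost_Suc)
  also have "(\<Sum>k\<le>Suc m. ?t m k) = (\<Sum>k\<le>m. ?t m k)"
    by (simp add: qbin_def)
  finally show ?case
    unfolding qpoch_fin_Suc Suc.IH by (simp add: algebra_simps)
qed (simp add: qbin_0[OF q] binomial_eq_0)

text \<open>The q-Chu--Vandermonde sum with one parameter sent to infinity. Pascal's rule splits a
  step in \<open>m\<close> into the same sum and the one for \<open>c + 1\<close>, hence the
  induction for all \<open>c\<close> at once.\<close>

lemma q_vandermonde:
  assumes q: "norm q < 1"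
  shows "(\<Sum>i\<le>m. q ^ (i * (i + c)) * qbin q m i / qfac q (i + c)) = 1 / qfac q (m + c)"
proof (induction m arbitrary: c)
  case (Suc m)
  let ?t = "\<lambda>m c i. q ^ (i * (i + c)) * qbin q m i / qfac q (i + c)"
  have "(\<Sum>i\<le>Suc m. ?t (Suc m) c i) = 1 / qfac q c + (\<Sum>i\<le>m. ?t (Suc m) c (Suc i))"
    by (subst sum.atMost_Suc_shift) (simp add: qbin_0[OF q])
  also have "(\<Sum>i\<le>m. ?t (Suc m) c (Suc i)) = (\<Sum>i\<le>m. ?t m c (Suc i) + q ^ (m + c + 1) * ?t m (Suc c) i)"
  proof (intro sum.cong refl)
    fix i assume i: "i \<in> {..m}"
    then have "Suc i * (Suc i + c) + (m - i) = m + c + 1 + i * (i + Suc c)"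
      by (simp add: algebra_simps)
    then have "q ^ (Suc i * (Suc i + c)) * q ^ (m - i) = q ^ (m + c + 1) * q ^ (i * (i + Suc c))"
      by (simp only: power_add[symmetric])
    then show "?t (Suc m) c (Suc i) = ?t m c (Suc i) + q ^ (m + c + 1) * ?t m (Suc c) i"
      using i qbin_Suc_Suc[OF q, of i m] by (simp add: ring_distribs add_divide_distrib mult.assoc[symmetric] del: power_Suc mult_Suc)
  qed
  also have "\<dots> = (\<Sum>i\<le>m. ?t m c (Suc i)) + q ^ (m + c + 1) * (\<Sum>i\<le>m. ?t m (Suc c) i)"
    by (simp add: sum.distrib sum_distrib_left)
  also have "1 / qfac q c + \<dots> = (\<Sum>i\<le>Suc m. ?t m c i) + q ^ (m + c + 1) * (\<Sum>i\<le>m. ?t m (Suc c) i)"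
    by (simp add: sum.atMost_Suc_shift qbin_0[OF q] del: sum.atMost_Suc)
  also have "(\<Sum>i\<le>Suc m. ?t m c i) = (\<Sum>i\<le>m. ?t m c i)"
    by (simp add: qbin_def)
  also have "\<dots> + q ^ (m + c + 1) * (\<Sum>i\<le>m. ?t m (Suc c) i) = 1 / qfac q (m + c) + q ^ (m + c + 1) / qfac q (Suc (m + c))"
    unfolding Suc.IH by simp
  also have "\<dots> = 1 / qfac q (Suc m + c)"
    using qfac_nonzero[OF q, of "m + c"] one_minus_power_nonzero[OF q, of "m + c"]
    by (simp add: qfac_Suc divide_simps)
  finally show ?case .
qed (simp add: qbin_0[OF q])

text \<open>Extending the reciprocal of \<open>(q; q)_n\<close> by 0 to negative \<open>n\<close>
  lets the summation index run over all integers, or over any sufficiently large interval.\<close>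

definition inv_qfac :: "complex \<Rightarrow> int \<Rightarrow> complex" where
  "inv_qfac q n = (if n < 0 then 0 else 1 / qfac q (nat n))"

lemma inv_qfac_int: "inv_qfac q (int n) = 1 / qfac q n"
  by (simp add: inv_qfac_def)

lemma inv_qfac_neg: "n < 0 \<Longrightarrow> inv_qfac q n = 0"
  by (simp add: inv_qfac_def)

lemma int_choose_2: "int (k choose 2) = int k * (int k - 1) div 2"
proof -
  have h: "int (k * (k - 1)) = int k * (int k - 1)" by (cases k) (auto simp: algebra_simps)
  show ?thesis unfolding choose_two zdiv_int h by simp
qed

lemma qpoch_fin_add: "qpoch_fin a q (n + m) = qpoch_fin a q n * qpoch_fin (a * q ^ n) q m"
  by (induction m) (simp_all add: qpoch_fin_Suc power_add mult_ac)

text \<open>The substitution \<open>r = n - k\<close> turns the left side into the q-binomial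
  expansion of a product of \<open>2 * n + s\<close> factors with parameter
  \<open>q ^ (1 - n) / z\<close>. Its last \<open>n + s\<close> factors are those of
  \<open>(q / z; q)\<close>; its first \<open>n\<close> are, in reverse order and up to a monomial,
  those of \<open>(z; q)\<close>. The asymmetry \<open>s\<close> distinguishes the two
  Rogers--Ramanujan identities.\<close>

lemma finite_triple_product:
  assumes q: "norm q < 1" and q0: "q \<noteq> 0" and z: "z \<noteq> 0" and N: "N \<ge> int (n + s)"
  shows "(\<Sum>r\<in>{-N..N}. (-1) powi r * q powi (r * (r - 1) div 2) * z powi r * inv_qfac q (int n - r) * inv_qfac q (int n + r + int s))
       = qpoch_fin z q n * qpoch_fin (q / z) q (n + s) / qfac q (2 * n + s)"
proof -
  let ?m = "2 * n + s"
  let ?f = "\<lambda>r. (-1) powi r * q powi (r * (r - 1) div 2) * z powi r * inv_qfac q (int n - r) * inv_qfac q (int n + r + int s)"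
  let ?y = "q powi (1 - int n) / z"
  have "(\<Sum>r\<in>{-N..N}. ?f r) = (\<Sum>r\<in>{-int n - int s..int n}. ?f r)"
    by (rule sum.mono_neutral_right) (use N in \<open>auto simp: inv_qfac_def\<close>)
  also have "\<dots> = (\<Sum>k\<le>?m. ?f (int n - int k))"
    by (rule sum.reindex_bij_witness[of _ "\<lambda>k. int n - int k" "\<lambda>r. nat (int n - r)"]) auto
  also have "\<dots> = (\<Sum>k\<le>?m. (-1) powi (int n) * z powi (int n) * q powi (int n * (int n - 1) div 2) / qfac q ?m *
      ((-1) ^ k * q ^ (k choose 2) * ?y ^ k * qbin q ?m k))"
  proof (intro sum.cong refl)
    fix k assume k: "k \<in> {..?m}"
    have iq1: "inv_qfac q (int n - (int n - int k)) = 1 / qfac q k"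
      by (simp add: inv_qfac_int)
    have "int n + (int n - int k) + int s = int (?m - k)" using k by auto
    then have iq2: "inv_qfac q (int n + (int n - int k) + int s) = 1 / qfac q (?m - k)"
      by (simp only: inv_qfac_int)
    have "even (int k * (int k - 1))" "even (int n * (int n - 1))" by simp_all
    moreover have "(int n - int k) * (int n - int k - 1) = int k * (int k - 1) + int n * (int n - 1) + 2 * (int k * (1 - int n))"
      by (simp add: algebra_simps)
    ultimately have "(int n - int k) * (int n - int k - 1) div 2 = int (k choose 2) + int n * (int n - 1) div 2 + int k * (1 - int n)"
      unfolding int_choose_2 by (simp add: div_plus_div_distrib_dvd_left)
    then have e: "q powi ((int n - int k) * (int n - int k - 1) div 2) =
        q ^ (k choose 2) * q powi (int n * (int n - 1) div 2) * (q powi (1 - int n)) ^ k"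
      using q0 by (simp add: power_int_add power_int_mult mult.commute[of "int k"])
    have sg: "(-1 :: complex) powi (int n - int k) = (-1) powi int n * (-1) ^ k"
      by (simp add: power_int_diff) (metis power_minus1_even power_even_eq div_by_1 divide_minus1 minus_one_power_iff mult.right_neutral mult_minus_right)
    have zz: "z powi (int n - int k) = z powi int n / z ^ k"
      using z by (simp add: power_int_diff)
    show "?f (int n - int k) = (-1) powi (int n) * z powi (int n) * q powi (int n * (int n - 1) div 2) / qfac q ?m *
      ((-1) ^ k * q ^ (k choose 2) * ?y ^ k * qbin q ?m k)"
      unfolding iq1 iq2 e sg zz using k qfac_nonzero[OF q] by (simp add: qbin_def power_divide mult_ac)
  qed
  also have "\<dots> = (-1) powi (int n) * z powi (int n) * q powi (int n * (int n - 1) div 2) / qfac q ?m * qpoch_fin ?y q ?m"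
    unfolding finite_q_binomial[OF q] sum_distrib_left ..
  also have "qpoch_fin ?y q ?m = qpoch_fin ?y q n * qpoch_fin (q / z) q (n + s)"
  proof -
    have y: "?y * q ^ n = q / z"
      using q0 by (simp add: power_int_diff)
    show ?thesis
      using qpoch_fin_add[of ?y q n "n + s"] unfolding y by (simp only: mult_2 add.assoc)
  qed
  also have "(-1) powi (int n) * z powi (int n) * q powi (int n * (int n - 1) div 2) / qfac q ?m *
      (qpoch_fin ?y q n * qpoch_fin (q / z) q (n + s)) =
      ((-1) ^ n * z ^ n * q ^ (n choose 2) * qpoch_fin ?y q n) * qpoch_fin (q / z) q (n + s) / qfac q ?m"
    by (simp add: int_choose_2[symmetric])
  also have "(-1) ^ n * z ^ n * q ^ (n choose 2) * qpoch_fin ?y q n = qpoch_fin z q n"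
  proof -
    have "qpoch_fin ?y q n = (\<Prod>i<n. 1 - 1 / (z * q ^ i))"
      unfolding qpoch_fin_def
    proof (rule prod.reindex_bij_witness[of _ "\<lambda>i. n - 1 - i" "\<lambda>i. n - 1 - i"])
      fix j assume "j \<in> {..<n}"
      then have "q ^ n = q ^ (n - 1 - j) * (q * q ^ j)" by (simp flip: power_add power_Suc)
      then show "1 - 1 / (z * q ^ (n - 1 - j)) = 1 - ?y * q ^ j"
        using q0 z by (simp add: power_int_diff)
    qed auto
    moreover have "(-1) ^ n * z ^ n * q ^ (n choose 2) = (\<Prod>i<n. - (z * q ^ i))"
    proof (induction n)
      case (Suc n)
      have "Suc n choose 2 = (n choose 2) + n" by (simp add: numeral_2_eq_2)
      then show ?case using Suc.IH[symmetric] by (simp add: power_add)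
    qed (simp add: binomial_eq_0)
    moreover have "(\<Prod>i<n. - (z * q ^ i)) * (\<Prod>i<n. 1 - 1 / (z * q ^ i)) = qpoch_fin z q n"
      unfolding qpoch_fin_def prod.distrib[symmetric] using q0 z
      by (intro prod.cong refl) (simp add: field_simps)
    ultimately show ?thesis by simp
  qed
  finally show ?thesis .
qed


text \<open>A single step of the Bailey chain. For \<open>r \<ge> 0\<close> the substitution
  \<open>k = r + i\<close> reduces it to \<open>q_vandermonde\<close> with
  \<open>c = 2 * r + s\<close>. For negative \<open>r\<close> the reflection
  \<open>r -> - r - s\<close>, which leads to natural numbers because \<open>s \<le> 1\<close>,
  exchanges the two reciprocal factorials.\<close>

lemma bailey_step:
  assumes q: "norm q < 1" and s: "s \<le> (1::nat)"
  shows "(\<Sum>k\<le>n. q ^ (k * (k + s)) * inv_qfac q (int n - int k) * (inv_qfac q (int k - r) * inv_qfac q (int k + r + int s)))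
       = q powi (r * (r + int s)) * inv_qfac q (int n - r) * inv_qfac q (int n + r + int s)"
proof -
  have pos: "(\<Sum>k\<le>n. q ^ (k * (k + s)) * inv_qfac q (int n - int k) * (inv_qfac q (int k - int r) * inv_qfac q (int k + int r + int s)))
       = q powi (int r * (int r + int s)) * inv_qfac q (int n - int r) * inv_qfac q (int n + int r + int s)" for r
  proof (cases "r \<le> n")
    case False
    then have "(\<Sum>k\<le>n. q ^ (k * (k + s)) * inv_qfac q (int n - int k) * (inv_qfac q (int k - int r) * inv_qfac q (int k + int r + int s))) = 0"
      by (intro sum.neutral) (auto simp: inv_qfac_neg)
    with False show ?thesis by (simp add: inv_qfac_neg)
  next
    case True
    define m where "m = n - r"
    define c where "c = 2 * r + s"
    have n: "n = r + m" using True by (simp add: m_def)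
    have "(\<Sum>k\<le>n. q ^ (k * (k + s)) * inv_qfac q (int n - int k) * (inv_qfac q (int k - int r) * inv_qfac q (int k + int r + int s)))
        = (\<Sum>k\<in>{r..n}. q ^ (k * (k + s)) * inv_qfac q (int n - int k) * (inv_qfac q (int k - int r) * inv_qfac q (int k + int r + int s)))"
      by (rule sum.mono_neutral_right) (auto simp: inv_qfac_neg)
    also have "\<dots> = (\<Sum>i\<le>m. q ^ (r * (r + s)) / qfac q m * (q ^ (i * (i + c)) * qbin q m i / qfac q (i + c)))"
    proof (rule sum.reindex_bij_witness[of _ "\<lambda>i. r + i" "\<lambda>k. k - r"])
      fix k assume k: "k \<in> {r..n}"
      define i where "i = k - r"
      have k: "k = r + i" "i \<le> m" using k by (auto simp: i_def n)
      have 1: "int n - int k = int (m - i)" "int k - int r = int i" "int k + int r + int s = int (i + c)"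
        using k by (auto simp: n c_def)
      have "k * (k + s) = r * (r + s) + i * (i + c)" by (simp add: k c_def algebra_simps)
      then show "q ^ (r * (r + s)) / qfac q m * (q ^ ((k - r) * (k - r + c)) * qbin q m (k - r) / qfac q (k - r + c)) =
        q ^ (k * (k + s)) * inv_qfac q (int n - int k) * (inv_qfac q (int k - int r) * inv_qfac q (int k + int r + int s))"
        unfolding 1 inv_qfac_int i_def[symmetric] using k qfac_nonzero[OF q, of m] by (simp add: qbin_def power_add mult_ac)
    qed (auto simp: n)
    also have "\<dots> = q ^ (r * (r + s)) / qfac q m * (1 / qfac q (m + c))"
      unfolding sum_distrib_left[symmetric] q_vandermonde[OF q] ..
    also have "\<dots> = q powi (int r * (int r + int s)) * inv_qfac q (int n - int r) * inv_qfac q (int n + int r + int s)"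
    proof -
      have 1: "int n - int r = int m" "int n + int r + int s = int (m + c)"
        "int r * (int r + int s) = int (r * (r + s))"
        by (auto simp: n c_def)
      show ?thesis unfolding 1 inv_qfac_int power_int_of_nat by simp
    qed
    finally show ?thesis .
  qed
  show ?thesis
  proof (cases "r \<ge> 0")
    case True
    then show ?thesis using pos[of "nat r"] by simp
  next
    case False
    define t where "t = nat (- r - int s)"
    have t: "r = - int t - int s" using False s by (auto simp: t_def)
    have 1: "int k - r = int k + int t + int s" "int k + r + int s = int k - int t" for k
      by (auto simp: t)
    have 2: "r * (r + int s) = int t * (int t + int s)" by (simp add: t algebra_simps)
    show ?thesis unfolding 1 2 using pos[of t] by (simp add: mult_ac)
  qed
qed

text \<open>Two Bailey steps, each inserting a factor \<open>q powi (r * (r + s))\<close>, start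
  from the finite triple product at \<open>z = 1\<close>. That product contains
  \<open>(1; q)_k\<close> and so vanishes unless \<open>k = 0\<close>; the first step then gives
  \<open>1 / qfac q k\<close>, and the second the Rogers--Ramanujan sum.\<close>

lemma finite_rogers_ramanujan:
  assumes q: "norm q < 1" and q0: "q \<noteq> 0" and s: "s \<le> (1::nat)"
  shows "(\<Sum>r\<in>{-int (n+s)..int (n+s)}. (-1) powi r * q powi (r * (r - 1) div 2 + 2 * (r * (r + int s))) * inv_qfac q (int n - r) * inv_qfac q (int n + r + int s))
       = (\<Sum>k\<le>n. q ^ (k * (k + s)) * inv_qfac q (int n - int k) / qfac q k)"
proof -
  let ?R = "{-int (n+s)..int (n+s)}"
  define w where "w = (\<lambda>r::int. (-1) powi r * q powi (r * (r - 1) div 2))"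
  define e where "e = (\<lambda>r::int. q powi (r * (r + int s)))"
  have unit: "(\<Sum>r\<in>?R. w r * (inv_qfac q (int k - r) * inv_qfac q (int k + r + int s))) = (if k = 0 then 1 else 0)"
    if "k \<le> n" for k
  proof -
    have "(\<Sum>r\<in>?R. w r * (inv_qfac q (int k - r) * inv_qfac q (int k + r + int s))) =
       qpoch_fin 1 q k * qfac q (k + s) / qfac q (2 * k + s)"
      using finite_triple_product[OF q q0, of 1 k s "int (n + s)"] that by (simp add: w_def mult.assoc)
    moreover have "qpoch_fin 1 q k = 0" if "k > 0" using that by (cases k) (simp_all add: qpoch_fin_Suc')
    ultimately show ?thesis using qfac_nonzero[OF q] by simp
  qed
  have step: "(\<Sum>r\<in>?R. w r * e r ^ Suc j * (inv_qfac q (int k - r) * inv_qfac q (int k + r + int s))) =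
      (\<Sum>i\<le>k. q ^ (i * (i + s)) * inv_qfac q (int k - int i) * (\<Sum>r\<in>?R. w r * e r ^ j * (inv_qfac q (int i - r) * inv_qfac q (int i + r + int s))))"
    for j k
  proof -
    have "(\<Sum>i\<le>k. q ^ (i * (i + s)) * inv_qfac q (int k - int i) * (\<Sum>r\<in>?R. w r * e r ^ j * (inv_qfac q (int i - r) * inv_qfac q (int i + r + int s))))
      = (\<Sum>i\<le>k. \<Sum>r\<in>?R. w r * e r ^ j * (q ^ (i * (i + s)) * inv_qfac q (int k - int i) * (inv_qfac q (int i - r) * inv_qfac q (int i + r + int s))))"
      unfolding sum_distrib_left by (intro sum.cong refl) (simp add: mult_ac)
    also have "\<dots> = (\<Sum>r\<in>?R. w r * e r ^ j * (\<Sum>i\<le>k. q ^ (i * (i + s)) * inv_qfac q (int k - int i) * (inv_qfac q (int i - r) * inv_qfac q (int i + r + int s))))"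
      unfolding sum_distrib_left by (rule sum.swap)
    also have "\<dots> = (\<Sum>r\<in>?R. w r * e r ^ Suc j * (inv_qfac q (int k - r) * inv_qfac q (int k + r + int s)))"
      unfolding bailey_step[OF q s] by (intro sum.cong refl) (simp add: e_def mult_ac)
    finally show ?thesis ..
  qed
  have one: "(\<Sum>r\<in>?R. w r * e r ^ 1 * (inv_qfac q (int k - r) * inv_qfac q (int k + r + int s))) = 1 / qfac q k" if "k \<le> n" for k
  proof -
    have "(\<Sum>r\<in>?R. w r * e r ^ 1 * (inv_qfac q (int k - r) * inv_qfac q (int k + r + int s)))
        = (\<Sum>i\<le>k. q ^ (i * (i + s)) * inv_qfac q (int k - int i) * (if i = 0 then 1 else 0))"
      unfolding One_nat_def step using that unit by (intro sum.cong refl) simp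
    also have "\<dots> = (\<Sum>i\<in>{0}. q ^ (i * (i + s)) * inv_qfac q (int k - int i) * (if i = 0 then 1 else 0))"
      by (rule sum.mono_neutral_right) auto
    finally show ?thesis by (simp add: inv_qfac_int)
  qed
  have "(\<Sum>r\<in>?R. (-1) powi r * q powi (r * (r - 1) div 2 + 2 * (r * (r + int s))) * inv_qfac q (int n - r) * inv_qfac q (int n + r + int s))
      = (\<Sum>r\<in>?R. w r * e r ^ Suc 1 * (inv_qfac q (int n - r) * inv_qfac q (int n + r + int s)))"
    using q0 by (intro sum.cong refl) (simp add: w_def e_def power_int_add power_int_mult power2_eq_square mult_2 mult_ac)
  also have "\<dots> = (\<Sum>i\<le>n. q ^ (i * (i + s)) * inv_qfac q (int n - int i) * (1 / qfac q i))"
    unfolding step by (intro sum.cong refl) (use one in simp)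
  finally show ?thesis by simp
qed

section \<open>Limits of the finite identities\<close>

lemma qpoch_fin_bounded:
  assumes "norm q < 1"
  obtains C where "C > 0" "\<And>n. norm (qpoch_fin a q n) \<le> C"
proof -
  have "Bseq (qpoch_fin a q)"
    using qpoch_fin_tendsto[OF assms] by (intro convergent_imp_Bseq) (auto simp: convergent_def)
  then show ?thesis using that by (auto simp: Bseq_def)
qed

lemma inverse_qpoch_fin_bounded:
  assumes "norm q < 1" "norm a < 1"
  obtains C where "C > 0" "\<And>n. norm (1 / qpoch_fin a q n) \<le> C"
proof -
  have "(\<lambda>n. 1 / qpoch_fin a q n) \<longlonglongrightarrow> 1 / qpoch_inf a q"
    by (intro tendsto_divide tendsto_const qpoch_fin_tendsto qpoch_inf_nonzero assms)
  then have "Bseq (\<lambda>n. 1 / qpoch_fin a q n)"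
    by (intro convergent_imp_Bseq) (auto simp: convergent_def)
  then show ?thesis using that by (auto simp: Bseq_def)
qed

lemma inv_qfac_bounded:
  assumes "norm q < 1"
  obtains C where "C > 0" "\<And>n. norm (inv_qfac q n) \<le> C"
proof -
  obtain C where "C > 0" "\<And>n. norm (1 / qfac q n) \<le> C"
    using inverse_qpoch_fin_bounded[OF assms assms] by blast
  then have "norm (inv_qfac q n) \<le> C" for n by (auto simp: inv_qfac_def intro: less_imp_le)
  with \<open>C > 0\<close> show ?thesis using that by blast
qed

lemma inv_qfac_tendsto:
  assumes "norm q < 1"
  shows "(\<lambda>n. inv_qfac q (int n + r)) \<longlonglongrightarrow> 1 / qpoch_inf q q"
proof -
  have "(\<lambda>n. 1 / qfac q n) \<longlonglongrightarrow> 1 / qpoch_inf q q"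
    by (intro tendsto_divide tendsto_const qpoch_fin_tendsto qpoch_inf_nonzero assms)
  moreover have "filterlim (\<lambda>n. nat (int n + r)) at_top sequentially"
    unfolding filterlim_at_top
  proof
    fix Z :: nat
    show "eventually (\<lambda>n. Z \<le> nat (int n + r)) sequentially"
      using eventually_ge_at_top[of "nat (int Z - r)"] by eventually_elim auto
  qed
  ultimately have "(\<lambda>n. 1 / qfac q (nat (int n + r))) \<longlonglongrightarrow> 1 / qpoch_inf q q"
    by (rule filterlim_compose)
  moreover have "eventually (\<lambda>n. 1 / qfac q (nat (int n + r)) = inv_qfac q (int n + r)) sequentially"
    using eventually_ge_at_top[of "nat (-r)"] by eventually_elim (auto simp: inv_qfac_def)
  ultimately show ?thesis by (rule Lim_transform_eventually)
qed

lemma powi_eq_powr: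
  fixes q :: complex
  assumes "q \<noteq> 0"
  shows "norm (q powi n) = norm q powr of_int n"
  using assms by (simp add: norm_power_int powr_real_of_int')

text \<open>The exponent is described by \<open>2 * e r\<close>, so that triangular numbers, which
  are written with \<open>div\<close>, are covered without fractions.\<close>

lemma gauss_powi_summable:
  fixes q z :: complex
  assumes q: "norm q < 1" and q0: "q \<noteq> 0" and z: "z \<noteq> 0"
    and a: "a > 0" and e: "\<And>r. 2 * e r = a * r\<^sup>2 + b * r"
  shows "(\<lambda>r::int. norm (q powi e r * z powi r)) summable_on UNIV"
proof -
  have "(\<lambda>n::int. (norm q powr of_int a) powr (real_of_int n ^ 2 / 2) *
       (norm q powr (of_int b / 2) * norm z) powr real_of_int n) summable_on UNIV"
    by (rule gauss_summable_int) (use q q0 z a powr_less_mono2[of "of_int a" "norm q" 1] in auto)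
  moreover have "(norm q powr of_int a) powr (real_of_int n ^ 2 / 2) *
       (norm q powr (of_int b / 2) * norm z) powr real_of_int n = norm (q powi e n * z powi n)" for n
  proof -
    have "2 * real_of_int (e n) = real_of_int (a * n\<^sup>2 + b * n)"
      using e[of n] by (metis of_int_mult of_int_numeral)
    then have "real_of_int (e n) = real_of_int a * (real_of_int n ^ 2 / 2) + real_of_int b / 2 * real_of_int n"
      by simp
    then show ?thesis
      using q0 z by (simp add: norm_mult powi_eq_powr powr_powr powr_mult powr_add)
  qed
  ultimately show ?thesis by simp
qed


text \<open>The limit of the finite form with \<open>s = 0\<close>: the reciprocal factorials are
  bounded uniformly and each tends to \<open>1 / (q; q)\<close>. On the left this happens twice and
  on the right once, which leaves the third product.\<close>

theorem jacobi_triple_product: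
  assumes q: "norm q < 1" and q0: "q \<noteq> 0" and z: "z \<noteq> 0"
  shows "((\<lambda>r. (-1) powi r * q powi (r * (r - 1) div 2) * z powi r) has_sum
      qpoch_inf z q * qpoch_inf (q / z) q * qpoch_inf q q) UNIV"
proof -
  let ?t = "\<lambda>r::int. (-1) powi r * q powi (r * (r - 1) div 2) * z powi r"
  let ?L = "qpoch_inf q q"
  have L: "?L \<noteq> 0" by (rule qpoch_inf_nonzero[OF q q])
  obtain C where C: "C > 0" "\<And>n. norm (inv_qfac q n) \<le> C" using inv_qfac_bounded[OF q] by blast
  have nt: "norm (?t r) = norm (q powi (r * (r - 1) div 2) * z powi r)" for r
    by (simp add: norm_mult norm_power_int)
  have e: "2 * (r * (r - 1) div 2) = 1 * r\<^sup>2 + (-1) * r" for r :: int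
  proof -
    have "even (r * (r - 1))" by simp
    then show ?thesis by (simp add: power2_eq_square algebra_simps)
  qed
  have sm: "(\<lambda>r. norm (?t r)) summable_on UNIV"
    unfolding nt by (rule gauss_powi_summable[OF q q0 z _ e]) simp
  have "((\<lambda>n. \<Sum>\<^sub>\<infinity>r. ?t r * inv_qfac q (int n - r) * inv_qfac q (int n + r)) \<longlonglongrightarrow> (\<Sum>\<^sub>\<infinity>r. ?t r * (1 / ?L) * (1 / ?L)))"
  proof (rule infsum_tannery(1)[where M = "\<lambda>r. norm (?t r) * C * C" and Y = UNIV])
    fix r :: int
    show "(\<lambda>n. ?t r * inv_qfac q (int n - r) * inv_qfac q (int n + r)) \<longlonglongrightarrow> ?t r * (1 / ?L) * (1 / ?L)"
      using inv_qfac_tendsto[OF q, of "-r"] inv_qfac_tendsto[OF q, of r] by (intro tendsto_mult tendsto_const) simp_all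
  next
    fix r :: int and n :: nat
    show "norm (?t r * inv_qfac q (int n - r) * inv_qfac q (int n + r)) \<le> norm (?t r) * C * C"
      unfolding norm_mult[of _ "inv_qfac _ _"] using C by (intro mult_mono) (auto intro: less_imp_le)
  next
    show "(\<lambda>r. norm (?t r) * C * C) summable_on UNIV"
      by (intro summable_on_cmult_left sm)
  qed auto
  moreover have "(\<Sum>\<^sub>\<infinity>r. ?t r * inv_qfac q (int n - r) * inv_qfac q (int n + r)) = qpoch_fin z q n * qpoch_fin (q / z) q n * (1 / qfac q (2 * n))" for n
  proof -
    have "(\<Sum>\<^sub>\<infinity>r. ?t r * inv_qfac q (int n - r) * inv_qfac q (int n + r)) = (\<Sum>\<^sub>\<infinity>r\<in>{-int n..int n}. ?t r * inv_qfac q (int n - r) * inv_qfac q (int n + r))"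
      by (rule infsum_cong_neutral) (auto simp: inv_qfac_def)
    then show ?thesis using finite_triple_product[OF q q0 z, of n 0 "int n"] by simp
  qed
  moreover have "(\<lambda>n. qpoch_fin z q n * qpoch_fin (q / z) q n * (1 / qfac q (2 * n))) \<longlonglongrightarrow>
      qpoch_inf z q * qpoch_inf (q / z) q * (1 / ?L)"
    using LIMSEQ_subseq_LIMSEQ[OF qpoch_fin_tendsto[OF q, of q], of "\<lambda>n. 2 * n"]
    by (intro tendsto_mult tendsto_divide tendsto_const qpoch_fin_tendsto q L) (auto simp: strict_mono_def o_def)
  ultimately have "(\<Sum>\<^sub>\<infinity>r. ?t r * (1 / ?L) * (1 / ?L)) = qpoch_inf z q * qpoch_inf (q / z) q * (1 / ?L)"
    using LIMSEQ_unique by fastforce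
  then have "infsum ?t UNIV * (1 / ?L * (1 / ?L)) = qpoch_inf z q * qpoch_inf (q / z) q * (1 / ?L)"
    by (simp only: infsum_cmult_left' mult.assoc[of "infsum _ _"])
  then have "infsum ?t UNIV = qpoch_inf z q * qpoch_inf (q / z) q * ?L"
    using L by (simp add: field_simps)
  then show ?thesis
    using has_sum_infsum[OF abs_summable_summable[OF sm]] by simp
qed

definition rr_series :: "nat \<Rightarrow> complex \<Rightarrow> complex" where
  "rr_series s q = (\<Sum>\<^sub>\<infinity>n. q ^ (n * (n + s)) / qfac q n)"

lemma summable_power_nat:
  fixes e :: "nat \<Rightarrow> nat"
  assumes q: "norm (q::complex) < 1" and e: "\<And>n. e n \<ge> n"
  shows "(\<lambda>n. norm (q ^ e n)) summable_on UNIV"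
proof -
  have "summable (\<lambda>n. norm (norm (q ^ e n)))"
  proof (rule summable_comparison_test')
    show "summable (\<lambda>n. norm q ^ n)" using q by simp
    show "norm (norm (norm (q ^ e n))) \<le> norm q ^ n" if "n \<ge> 0" for n
      using q power_decreasing[OF e[of n], of "norm q"] by (simp add: norm_power)
  qed
  then show ?thesis by (subst summable_on_UNIV_nonneg_real_iff) auto
qed

lemma rr_series_summable:
  assumes q: "norm q < 1"
  shows "(\<lambda>n. norm (q ^ (n * (n + s)) / qfac q n)) summable_on UNIV"
proof -
  obtain C where C: "C > 0" "\<And>n. norm (1 / qfac q n) \<le> C"
    using inverse_qpoch_fin_bounded[OF q q] by blast
  have "(\<lambda>n. norm (q ^ (n * (n + s))) * C) summable_on UNIV"
    by (intro summable_on_cmult_left summable_power_nat q) (simp add: algebra_simps trans_le_add1)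
  then have "(\<lambda>n. norm (norm (q ^ (n * (n + s)) / qfac q n))) summable_on UNIV"
  proof (rule summable_on_comparison_test)
    fix n
    show "norm (norm (q ^ (n * (n + s)) / qfac q n)) \<le> norm (q ^ (n * (n + s))) * C"
      using mult_left_mono[OF C(2)[of n], of "norm (q ^ (n * (n + s)))"] by (simp add: norm_divide)
  qed auto
  then show ?thesis by simp
qed

text \<open>The limit of the finite form. The alternating sum on its left is a theta series to the
  base \<open>q ^ 5\<close> with argument \<open>q ^ (2 + 2 * s)\<close>, which the triple product
  evaluates; the sum on its right tends to the series sought, divided by
  \<open>(q; q)\<close>.\<close>

theorem rogers_ramanujan:
  assumes q: "norm q < 1" and q0: "q \<noteq> 0" and s: "s \<le> (1::nat)"
  shows "rr_series s q = qpoch_inf (q ^ (2 + 2 * s)) (q ^ 5) * qpoch_inf (q ^ 5 / q ^ (2 + 2 * s)) (q ^ 5) * qpoch_inf (q ^ 5) (q ^ 5) / qpoch_inf q q"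
proof -
  let ?t = "\<lambda>r::int. (-1) powi r * q powi (r * (r - 1) div 2 + 2 * (r * (r + int s)))"
  let ?L = "qpoch_inf q q"
  have L: "?L \<noteq> 0" by (rule qpoch_inf_nonzero[OF q q])
  obtain C where C: "C > 0" "\<And>n. norm (inv_qfac q n) \<le> C" using inv_qfac_bounded[OF q] by blast
  have q5: "norm (q ^ 5) < 1" using q by (simp add: norm_power power_less_one_iff)
  have tt: "?t r = (-1) powi r * (q ^ 5) powi (r * (r - 1) div 2) * (q ^ (2 + 2 * s)) powi r" for r
  proof -
    have "even (r * (r - 1))" by simp
    then obtain m where m: "r * (r - 1) = 2 * m" by (rule evenE)
    then have "r * (r - 1) div 2 = m" by simp
    then have "r * (r - 1) div 2 + 2 * (r * (r + int s)) = int 5 * (r * (r - 1) div 2) + int (2 + 2 * s) * r"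
      using m by (simp add: algebra_simps)
    then show ?thesis using q0
      by (simp only: power_int_add power_int_mult power_int_of_nat)
        (simp add: power_int_add power_int_mult power_mult power_add power2_eq_square mult.assoc)
  qed
  have hs: "(?t has_sum qpoch_inf (q ^ (2 + 2 * s)) (q ^ 5) * qpoch_inf (q ^ 5 / q ^ (2 + 2 * s)) (q ^ 5) * qpoch_inf (q ^ 5) (q ^ 5)) UNIV"
    unfolding tt using jacobi_triple_product[OF q5, of "q ^ (2 + 2 * s)"] q0 by simp
  have sm: "(\<lambda>r. norm (?t r)) summable_on UNIV"
    using has_sum_imp_summable[OF hs] unfolding summable_on_iff_abs_summable_on_complex .
  have "(\<lambda>n. \<Sum>\<^sub>\<infinity>r. ?t r * inv_qfac q (int n - r) * inv_qfac q (int n + r + int s)) \<longlonglongrightarrow> (\<Sum>\<^sub>\<infinity>r. ?t r * (1 / ?L) * (1 / ?L))"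
  proof (rule infsum_tannery(1)[where M = "\<lambda>r. norm (?t r) * C * C" and Y = UNIV])
    fix r :: int
    show "(\<lambda>n. ?t r * inv_qfac q (int n - r) * inv_qfac q (int n + r + int s)) \<longlonglongrightarrow> ?t r * (1 / ?L) * (1 / ?L)"
      using inv_qfac_tendsto[OF q, of "-r"] inv_qfac_tendsto[OF q, of "r + int s"]
      by (intro tendsto_mult tendsto_const) (simp_all add: add.assoc)
  next
    fix r :: int and n :: nat
    show "norm (?t r * inv_qfac q (int n - r) * inv_qfac q (int n + r + int s)) \<le> norm (?t r) * C * C"
      unfolding norm_mult[of _ "inv_qfac _ _"] using C by (intro mult_mono) (auto intro: less_imp_le)
  next
    show "(\<lambda>r. norm (?t r) * C * C) summable_on UNIV"
      by (intro summable_on_cmult_left sm)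
  qed auto
  moreover have "(\<Sum>\<^sub>\<infinity>r. ?t r * inv_qfac q (int n - r) * inv_qfac q (int n + r + int s)) = (\<Sum>\<^sub>\<infinity>k. q ^ (k * (k + s)) / qfac q k * inv_qfac q (int n - int k))" for n
  proof -
    have "(\<Sum>\<^sub>\<infinity>r. ?t r * inv_qfac q (int n - r) * inv_qfac q (int n + r + int s)) = (\<Sum>\<^sub>\<infinity>r\<in>{-int (n+s)..int (n+s)}. ?t r * inv_qfac q (int n - r) * inv_qfac q (int n + r + int s))"
      by (rule infsum_cong_neutral) (auto simp: inv_qfac_def)
    also have "\<dots> = (\<Sum>k\<le>n. q ^ (k * (k + s)) / qfac q k * inv_qfac q (int n - int k))"
      using finite_rogers_ramanujan[OF q q0 s, of n] by (simp add: mult_ac)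
    also have "\<dots> = (\<Sum>\<^sub>\<infinity>k\<in>{..n}. q ^ (k * (k + s)) / qfac q k * inv_qfac q (int n - int k))"
      by simp
    also have "\<dots> = (\<Sum>\<^sub>\<infinity>k. q ^ (k * (k + s)) / qfac q k * inv_qfac q (int n - int k))"
      by (rule infsum_cong_neutral) (auto simp: inv_qfac_def)
    finally show ?thesis .
  qed
  moreover have "(\<lambda>n. \<Sum>\<^sub>\<infinity>k. q ^ (k * (k + s)) / qfac q k * inv_qfac q (int n - int k)) \<longlonglongrightarrow> (\<Sum>\<^sub>\<infinity>k. q ^ (k * (k + s)) / qfac q k * (1 / ?L))"
  proof (rule infsum_tannery(1)[where M = "\<lambda>k. norm (q ^ (k * (k + s)) / qfac q k) * C" and Y = UNIV])
    fix k :: nat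
    show "(\<lambda>n. q ^ (k * (k + s)) / qfac q k * inv_qfac q (int n - int k)) \<longlonglongrightarrow> q ^ (k * (k + s)) / qfac q k * (1 / ?L)"
      using inv_qfac_tendsto[OF q, of "- int k"] by (intro tendsto_mult tendsto_const) simp
  next
    fix k n :: nat
    show "norm (q ^ (k * (k + s)) / qfac q k * inv_qfac q (int n - int k)) \<le> norm (q ^ (k * (k + s)) / qfac q k) * C"
      unfolding norm_mult[of _ "inv_qfac _ _"] using C by (intro mult_left_mono) auto
  next
    show "(\<lambda>k. norm (q ^ (k * (k + s)) / qfac q k) * C) summable_on UNIV"
      by (intro summable_on_cmult_left rr_series_summable q)
  qed auto
  ultimately have "(\<Sum>\<^sub>\<infinity>r. ?t r * (1 / ?L) * (1 / ?L)) = (\<Sum>\<^sub>\<infinity>k. q ^ (k * (k + s)) / qfac q k * (1 / ?L))"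
    using LIMSEQ_unique by fastforce
  then have "infsum ?t UNIV * (1 / ?L * (1 / ?L)) = rr_series s q * (1 / ?L)"
    by (simp only: infsum_cmult_left' mult.assoc[of "infsum _ _"] rr_series_def)
  then show ?thesis
    using L infsumI[OF hs] by (simp add: field_simps)
qed

text \<open>The q-binomial theorem for infinitely many factors: \<open>qbin q n k\<close> tends to
  \<open>1 / qfac q k\<close> and is bounded uniformly in \<open>n\<close> and \<open>k\<close>, so
  the Gaussian terms serve as majorant.\<close>

theorem euler_q_exponential:
  assumes q: "norm q < 1" and q0: "q \<noteq> 0" and z: "z \<noteq> 0"
  shows "((\<lambda>k. (-1) ^ k * q ^ (k choose 2) * z ^ k / qfac q k) has_sum qpoch_inf z q) UNIV"
    and "(\<lambda>k. norm (q ^ (k choose 2) * z ^ k)) summable_on UNIV"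
proof -
  let ?t = "\<lambda>k. (-1) ^ k * q ^ (k choose 2) * z ^ k"
  have e: "2 * (r * (r - 1) div 2) = 1 * r\<^sup>2 + (-1) * r" for r :: int
  proof -
    have "even (r * (r - 1))" by simp
    then show ?thesis by (simp add: power2_eq_square algebra_simps)
  qed
  have "(\<lambda>r::int. norm (q powi (r * (r - 1) div 2) * z powi r)) summable_on int ` UNIV"
    by (rule summable_on_subset_banach[OF gauss_powi_summable[OF q q0 z _ e]]) auto
  then show sm: "(\<lambda>k. norm (q ^ (k choose 2) * z ^ k)) summable_on UNIV"
    by (subst (asm) summable_on_reindex) (auto simp: o_def int_choose_2[symmetric])
  obtain C where C: "C > 0" "\<And>n. norm (1 / qfac q n) \<le> C"
    using inverse_qpoch_fin_bounded[OF q q] by blast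
  obtain D where D: "D > 0" "\<And>n. norm (qfac q n) \<le> D"
    using qpoch_fin_bounded[OF q, of q] by blast
  have bd: "norm (qbin q n k) \<le> D * C * C" for n k
  proof (cases "k \<le> n")
    case True
    then have "norm (qbin q n k) = norm (qfac q n) * norm (1 / qfac q k) * norm (1 / qfac q (n - k))"
      by (simp add: qbin_def norm_divide norm_mult)
    also have "\<dots> \<le> D * C * C" using C D by (intro mult_mono) (auto intro: less_imp_le)
    finally show ?thesis .
  qed (use C D in \<open>simp add: qbin_def\<close>)
  have nt: "norm (?t k) = norm (q ^ (k choose 2) * z ^ k)" for k
    by (simp add: norm_mult norm_power)
  have sm': "(\<lambda>k. norm (?t k) * (D * C * C)) summable_on UNIV"
    unfolding nt by (intro summable_on_cmult_left sm)
  have L: "qpoch_inf q q \<noteq> 0" by (rule qpoch_inf_nonzero[OF q q])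
  have lim: "(\<lambda>n. ?t k * qbin q n k) \<longlonglongrightarrow> ?t k * (1 / qfac q k)" for k
  proof -
    have "(\<lambda>n. qfac q n * inv_qfac q (int n + - int k) * (1 / qfac q k)) \<longlonglongrightarrow> qpoch_inf q q * (1 / qpoch_inf q q) * (1 / qfac q k)"
      by (intro tendsto_intros qpoch_fin_tendsto inv_qfac_tendsto q)
    moreover have "qfac q n * inv_qfac q (int n + - int k) * (1 / qfac q k) = qbin q n k" for n
      by (auto simp: qbin_def inv_qfac_def nat_diff_distrib)
    ultimately show ?thesis using L by (intro tendsto_mult tendsto_const) simp
  qed
  have bd': "norm (?t k * qbin q n k) \<le> norm (?t k) * (D * C * C)" for k n
    unfolding norm_mult[of _ "qbin _ _ _"] by (intro mult_left_mono bd) auto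
  note T = infsum_tannery[where f = "\<lambda>k n. ?t k * qbin q n k" and g = "\<lambda>k. ?t k * (1 / qfac q k)" and Y = UNIV
    and X = UNIV and F = sequentially, OF lim bd' _ sm']
  have "(\<lambda>n. \<Sum>\<^sub>\<infinity>k. ?t k * qbin q n k) \<longlonglongrightarrow> (\<Sum>\<^sub>\<infinity>k. ?t k * (1 / qfac q k))"
    by (rule T(1)) auto
  moreover have "(\<Sum>\<^sub>\<infinity>k. ?t k * qbin q n k) = qpoch_fin z q n" for n
  proof -
    have "(\<Sum>\<^sub>\<infinity>k. ?t k * qbin q n k) = (\<Sum>\<^sub>\<infinity>k\<in>{..n}. ?t k * qbin q n k)"
      by (rule infsum_cong_neutral) (auto simp: qbin_def)
    then show ?thesis by (simp add: finite_q_binomial[OF q])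
  qed
  ultimately have "(\<lambda>n. qpoch_fin z q n) \<longlonglongrightarrow> (\<Sum>\<^sub>\<infinity>k. ?t k * (1 / qfac q k))"
    by (simp only:)
  then have "(\<Sum>\<^sub>\<infinity>k. ?t k * (1 / qfac q k)) = qpoch_inf z q"
    using qpoch_fin_tendsto[OF q] by (rule LIMSEQ_unique)
  moreover have "(\<lambda>k. ?t k * (1 / qfac q k)) summable_on UNIV"
    by (rule T(2)) auto
  ultimately have "((\<lambda>k. ?t k * (1 / qfac q k)) has_sum qpoch_inf z q) UNIV"
    by (simp only: has_sum_iff)
  then show "((\<lambda>k. ?t k / qfac q k) has_sum qpoch_inf z q) UNIV"
    by simp
qed

section \<open>Rogers--Szego polynomials\<close>

text \<open>The homogeneous Rogers--Szego polynomial divided by \<open>(p; p)_n\<close>. With this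
  normalisation its generating function is exactly a product of two q-exponential series.\<close>

definition rogers_szego :: "complex \<Rightarrow> complex \<Rightarrow> complex \<Rightarrow> nat \<Rightarrow> complex" where
  "rogers_szego p x y n = (\<Sum>l\<le>n. x ^ l * y ^ (n - l) / (qfac p l * qfac p (n - l)))"

text \<open>The q-exponential series \<open>e c\<close> satisfies a first order q-difference
  equation: scaling its variable by \<open>p\<close>, which yields \<open>d c\<close>, multiplies it
  by \<open>1 - c X\<close>. For the product of two such series this becomes a three-term recurrence
  of the coefficients.\<close>

lemma rogers_szego_rec:
  assumes p: "norm p < 1"
  shows "(1 - p ^ (n + 2)) * rogers_szego p x y (n + 2) = (x + y) * rogers_szego p x y (n + 1) - x * y * rogers_szego p x y n"
    and "rogers_szego p x y 0 = 1" "(1 - p) * rogers_szego p x y 1 = x + y"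
proof -
  define e where "e = (\<lambda>c. Abs_fps (\<lambda>n. c ^ n / qfac p n))"
  define d where "d = (\<lambda>c. Abs_fps (\<lambda>n. p ^ n * c ^ n / qfac p n))"
  have de: "d c = (1 - fps_const c * fps_X) * e c" for c
  proof (rule fps_ext)
    fix n
    show "fps_nth (d c) n = fps_nth ((1 - fps_const c * fps_X) * e c) n"
    proof (cases n)
      case (Suc m)
      have nz: "qfac p m \<noteq> 0" "1 - p * p ^ m \<noteq> 0"
        using qfac_nonzero[OF p, of m] one_minus_power_nonzero[OF p, of m] by simp_all
      have "fps_nth ((1 - fps_const c * fps_X) * e c) n = c ^ Suc m / qfac p (Suc m) - c * (c ^ m / qfac p m)"
        by (simp add: Suc algebra_simps e_def mult.assoc del: power_Suc)
      also have "\<dots> = p ^ Suc m * c ^ Suc m / qfac p (Suc m)"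
        using nz by (simp add: qfac_Suc divide_simps) (simp add: algebra_simps)
      finally show ?thesis by (simp add: d_def Suc)
    qed (simp add: d_def e_def)
  qed
  have rogers_szego: "rogers_szego p x y n = fps_nth (e x * e y) n" for n
    by (simp add: rogers_szego_def e_def fps_mult_nth atMost_atLeast0)
  have 1: "p ^ n * rogers_szego p x y n = fps_nth (d x * d y) n" for n
    unfolding rogers_szego_def fps_mult_nth d_def sum_distrib_left atMost_atLeast0
    by (intro sum.cong refl) (auto simp: power_add[symmetric] mult_ac)
  have 2: "d x * d y = e x * e y - fps_const (x + y) * (fps_X * (e x * e y)) + fps_const (x * y) * (fps_X * (fps_X * (e x * e y)))"
    unfolding de by (simp add: algebra_simps flip: fps_const_add fps_const_mult)
  have *: "p ^ n * rogers_szego p x y n = rogers_szego p x y n - (x + y) * (if n = 0 then 0 else rogers_szego p x y (n - 1))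
      + x * y * (if n = 0 then 0 else if n - 1 = 0 then 0 else rogers_szego p x y (n - 2))" for n
    unfolding 1 2 by (simp add: rogers_szego numeral_2_eq_2)
  show "(1 - p ^ (n + 2)) * rogers_szego p x y (n + 2) = (x + y) * rogers_szego p x y (n + 1) - x * y * rogers_szego p x y n"
    using *[of "n + 2"] by (simp add: algebra_simps)
  show "rogers_szego p x y 0 = 1" by (simp add: rogers_szego_def)
  then show "(1 - p) * rogers_szego p x y 1 = x + y"
    using *[of 1] by (simp add: algebra_simps)
qed

text \<open>The leading coefficient of the recurrence never vanishes inside the unit disk, so a
  closed form is established by checking the recurrence and two initial values.\<close>

lemma rogers_szego_unique:
  assumes p: "norm p < 1"
    and f0: "f 0 = 1" and f1: "(1 - p) * f 1 = x + y"
    and f: "\<And>n. (1 - p ^ (n + 2)) * f (n + 2) = (x + y) * f (n + 1) - x * y * f n"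
  shows "rogers_szego p x y n = f n"
proof (induction n rule: less_induct)
  case (less n)
  consider "n = 0" | "n = 1" | m where "n = m + 2"
    by (metis One_nat_def add_2_eq_Suc' nat.exhaust)
  then show ?case
  proof cases
    case 2
    have "(1 - p) * rogers_szego p x y 1 = (1 - p) * f 1" unfolding f1 by (rule rogers_szego_rec(3)[OF p])
    moreover have "1 - p \<noteq> 0" using one_minus_power_nonzero[OF p, of 0] by simp
    ultimately show ?thesis using 2 by simp
  next
    case (3 m)
    have "(1 - p ^ n) * rogers_szego p x y n = (1 - p ^ n) * f n"
      unfolding 3 f rogers_szego_rec(1)[OF p] using less.IH[of m] less.IH[of "m + 1"] 3 by simp
    moreover have "1 - p ^ n \<noteq> 0" using one_minus_power_nonzero[OF p, of "m + 1"] 3 by simp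
    ultimately show ?thesis by simp
  qed (simp add: rogers_szego_rec[OF p] f0)
qed

lemma rogers_szego_scale: "rogers_szego p (c * x) (c * y) n = c ^ n * rogers_szego p x y n"
  unfolding rogers_szego_def sum_distrib_left
proof (intro sum.cong refl)
  fix l assume "l \<in> {..n}"
  then have "c ^ n = c ^ l * c ^ (n - l)" by (simp flip: power_add)
  then show "(c * x) ^ l * (c * y) ^ (n - l) / (qfac p l * qfac p (n - l)) =
         c ^ n * (x ^ l * y ^ (n - l) / (qfac p l * qfac p (n - l)))"
    by (simp add: power_mult_distrib mult_ac)
qed

lemma rogers_szego_commute: "rogers_szego p x y n = rogers_szego p y x n"
  unfolding rogers_szego_def
  by (rule sum.reindex_bij_witness[of _ "\<lambda>l. n - l" "\<lambda>l. n - l"]) (auto simp: mult_ac)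

lemma norm_square_less_1: "norm (q::complex) < 1 \<Longrightarrow> norm (q\<^sup>2) < 1"
  by (simp add: norm_power power_less_one_iff)

lemma norm_power4_less_1: "norm (q::complex) < 1 \<Longrightarrow> norm (q ^ 4) < 1"
  by (simp add: norm_power power_less_one_iff)

text \<open>A classical evaluation: with base \<open>q\<^sup>2\<close> and arguments
  \<open>q\<close> and 1 the unnormalised polynomial is \<open>(-q; q)_n\<close>, and dividing by
  \<open>(q\<^sup>2; q\<^sup>2)_n\<close> leaves \<open>1 / (q; q)_n\<close>.\<close>

lemma rogers_szego_q:
  assumes q: "norm q < 1"
  shows "rogers_szego (q\<^sup>2) q 1 n = 1 / qfac q n"
proof (rule rogers_szego_unique[OF norm_square_less_1[OF q]])
  have nz: "1 - q \<noteq> 0" "1 + q \<noteq> 0"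
    using one_minus_power_nonzero[OF q, of 0] one_minus_power_nonzero[of "-q" 0] q by simp_all
  show "1 / qfac q 0 = 1" by simp
  show "(1 - q\<^sup>2) * (1 / qfac q 1) = q + 1"
    using nz by (simp add: qpoch_fin_def field_simps power2_eq_square)
  show "(1 - (q\<^sup>2) ^ (n + 2)) * (1 / qfac q (n + 2)) = (q + 1) * (1 / qfac q (n + 1)) - q * 1 * (1 / qfac q n)" for n
  proof -
    let ?u = "q ^ (n + 1)"
    have nz: "qfac q n \<noteq> 0" "1 - ?u \<noteq> 0" "1 - q * ?u \<noteq> 0"
      using qfac_nonzero[OF q, of n] one_minus_power_nonzero[OF q, of n] one_minus_power_nonzero[OF q, of "n+1"] by simp_all
    have 1: "qfac q (n + 1) = qfac q n * (1 - ?u)" "qfac q (n + 2) = qfac q n * (1 - ?u) * (1 - q * ?u)"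
      by (simp_all add: qfac_Suc numeral_2_eq_2)
    have 2: "(q\<^sup>2) ^ (n + 2) = (q * ?u)\<^sup>2"
      by (simp add: power2_eq_square power_mult_distrib mult_ac)
    have "(1 - (q * ?u)\<^sup>2) = (1 - q * ?u) * (1 + q * ?u)"
      by (simp add: power2_eq_square algebra_simps)
    then show ?thesis
      unfolding 1 2 using nz by (simp add: divide_simps del: power_Suc power_Suc2 add_Suc_right) (simp add: algebra_simps)
  qed
qed

text \<open>As the arguments add up to 0, the middle term of the recurrence disappears and only even
  indices survive. This is Gauss's alternating sum of Gaussian binomial coefficients.\<close>

lemma rogers_szego_minus_1:
  assumes q: "norm q < 1"
  shows "rogers_szego (q\<^sup>2) (-1) 1 n = (if even n then 1 / qfac (q ^ 4) (n div 2) else 0)"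
proof (rule rogers_szego_unique[OF norm_square_less_1[OF q]])
  show "(1 - (q\<^sup>2) ^ (n + 2)) * (if even (n + 2) then 1 / qfac (q ^ 4) ((n + 2) div 2) else 0) =
    (- 1 + 1) * (if even (n + 1) then 1 / qfac (q ^ 4) ((n + 1) div 2) else 0) - - 1 * 1 * (if even n then 1 / qfac (q ^ 4) (n div 2) else 0)" for n
  proof (cases "even n")
    case True
    then obtain m where n: "n = 2 * m" by (auto elim: evenE)
    have "1 - (q ^ 4) ^ Suc m \<noteq> 0" by (rule one_minus_power_nonzero[OF norm_power4_less_1[OF q]])
    moreover have "(q\<^sup>2) ^ (n + 2) = (q ^ 4) ^ Suc m"
    proof -
      have "2 * (n + 2) = 4 * Suc m" by (simp add: n)
      then show ?thesis by (simp only: power_mult[symmetric])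
    qed
    ultimately show ?thesis by (simp add: n qfac_Suc del: power_Suc)
  qed simp
qed auto

text \<open>Euler's expansion of the product turns the left side into a double series over
  \<open>k\<close> and \<open>l\<close>. Its quadratic exponent is \<open>(k + l)\<^sup>2\<close>,
  so collecting the diagonals \<open>k + l = n\<close> produces the Rogers--Szego
  polynomials.\<close>

lemma rogers_szego_double_sum:
  assumes q: "norm q < 1" and q0: "q \<noteq> 0" and x: "norm x \<le> 1" "x \<noteq> 0" and y: "norm y \<le> 1"
  shows "(\<Sum>\<^sub>\<infinity>k. q ^ (k * k) * y ^ k / qfac (q\<^sup>2) k * qpoch_inf (- (x * q ^ (2 * k + 1))) (q\<^sup>2)) =
         (\<Sum>\<^sub>\<infinity>n. q ^ (n * n) * rogers_szego (q\<^sup>2) x y n)"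
    "(\<lambda>n. q ^ (n * n) * rogers_szego (q\<^sup>2) x y n) summable_on UNIV"
proof -
  have q2: "norm (q\<^sup>2) < 1" using norm_square_less_1[OF q] .
  define T where "T = (\<lambda>(k::nat, l::nat). q ^ ((k + l) * (k + l)) * y ^ k * x ^ l / (qfac (q\<^sup>2) k * qfac (q\<^sup>2) l))"
  obtain C where C: "C > 0" "\<And>n. norm (1 / qfac (q\<^sup>2) n) \<le> C"
    using inverse_qpoch_fin_bounded[OF q2 q2] by blast
  have geo: "(\<lambda>n::nat. norm q ^ n) summable_on UNIV"
    using q by (subst summable_on_UNIV_nonneg_real_iff) auto
  have "(\<lambda>(k, l). norm q ^ k * norm q ^ l) summable_on UNIV \<times> UNIV"
  proof (rule summable_on_SigmaI)
    fix k :: nat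
    show "((\<lambda>l. case (k, l) of (k, l) \<Rightarrow> norm q ^ k * norm q ^ l) has_sum norm q ^ k * (\<Sum>\<^sub>\<infinity>l. norm q ^ l)) UNIV"
      using has_sum_cmult_right[OF has_sum_infsum[OF geo], of "norm q ^ k"] by simp
  qed (auto intro!: summable_on_cmult_left geo)
  then have "(\<lambda>kl. (C * C) * (case kl of (k, l) \<Rightarrow> norm q ^ k * norm q ^ l)) summable_on UNIV \<times> UNIV"
    by (rule summable_on_cmult_right)
  then have "(\<lambda>kl. norm (T kl)) summable_on UNIV \<times> UNIV"
  proof (rule summable_on_comparison_test)
    fix kl :: "nat \<times> nat"
    obtain k l where kl: "kl = (k, l)" by (cases kl)
    have "norm (T kl) = norm q ^ ((k + l) * (k + l)) * norm y ^ k * norm x ^ l * norm (1 / qfac (q\<^sup>2) k) * norm (1 / qfac (q\<^sup>2) l)"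
      by (simp add: T_def kl norm_mult norm_divide norm_power)
    also have "\<dots> \<le> (norm q ^ k * norm q ^ l) * 1 * 1 * C * C"
    proof (intro mult_mono)
      have "norm q ^ ((k + l) * (k + l)) \<le> norm q ^ (k + l)"
        using q by (intro power_decreasing) auto
      then show "norm q ^ ((k + l) * (k + l)) \<le> norm q ^ k * norm q ^ l" by (simp add: power_add)
    qed (use C x y in \<open>auto intro!: power_le_one less_imp_le[OF C(1)]\<close>)
    finally show "norm (T kl) \<le> C * C * (case kl of (k, l) \<Rightarrow> norm q ^ k * norm q ^ l)"
      by (simp add: kl mult_ac)
  qed auto
  then have sT: "T summable_on UNIV \<times> UNIV" by (rule abs_summable_summable)
  have row: "(\<Sum>\<^sub>\<infinity>l. T (k, l)) = q ^ (k * k) * y ^ k / qfac (q\<^sup>2) k * qpoch_inf (- (x * q ^ (2 * k + 1))) (q\<^sup>2)" for k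
  proof -
    have "((\<lambda>l. q ^ (k * k) * y ^ k / qfac (q\<^sup>2) k * ((-1) ^ l * (q\<^sup>2) ^ (l choose 2) * (- (x * q ^ (2 * k + 1))) ^ l / qfac (q\<^sup>2) l))
       has_sum q ^ (k * k) * y ^ k / qfac (q\<^sup>2) k * qpoch_inf (- (x * q ^ (2 * k + 1))) (q\<^sup>2)) UNIV"
      by (intro has_sum_cmult_right euler_q_exponential q2) (use q0 x in auto)
    moreover have "q ^ (k * k) * y ^ k / qfac (q\<^sup>2) k * ((-1) ^ l * (q\<^sup>2) ^ (l choose 2) * (- (x * q ^ (2 * k + 1))) ^ l / qfac (q\<^sup>2) l) = T (k, l)" for l
    proof -
      have "(l choose 2) * 2 + l = l * l"
      proof -
        have "even (l * (l - 1))" by (cases l) auto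
        then have "(l choose 2) * 2 = l * (l - 1)" by (simp add: choose_two)
        then show ?thesis by (cases l) auto
      qed
      then have "(k + l) * (k + l) = k * k + 2 * (l choose 2) + (2 * k + 1) * l"
        by (simp add: algebra_simps)
      then have "q ^ ((k + l) * (k + l)) = q ^ (k * k) * (q\<^sup>2) ^ (l choose 2) * (q ^ (2 * k + 1)) ^ l"
        by (simp only: power_add power_mult)
      moreover have "(-1) ^ l * (- (x * q ^ (2 * k + 1))) ^ l = x ^ l * (q ^ (2 * k + 1)) ^ l"
        by (simp only: power_mult_distrib[symmetric]) simp
      ultimately show ?thesis by (simp add: T_def mult_ac del: power_Suc)
    qed
    ultimately show ?thesis by (simp only: infsumI)
  qed
  have diag: "(\<Sum>l\<le>n. T (n - l, l)) = q ^ (n * n) * rogers_szego (q\<^sup>2) x y n" for n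
    unfolding rogers_szego_def sum_distrib_left by (intro sum.cong refl) (auto simp: T_def mult_ac)
  \<comment> \<open>The diagonals as pairs \<open>(n, l)\<close> with \<open>l \<le> n\<close>; they
    correspond to all pairs \<open>(n - l, l)\<close>.\<close>
  define D where "D = Sigma (UNIV :: nat set) (\<lambda>n. {..n})"
  have bij: "bij_betw (\<lambda>(n, l). (n - l, l)) D (UNIV \<times> UNIV :: (nat \<times> nat) set)"
    by (rule bij_betwI[where g = "\<lambda>(k, l). (k + l, l)"]) (auto simp: D_def)
  have sD: "(\<lambda>(n, l). T (n - l, l)) summable_on D"
    using sT summable_on_reindex_bij_betw[OF bij, of T] by (simp add: case_prod_unfold)
  have "(\<Sum>\<^sub>\<infinity>k. q ^ (k * k) * y ^ k / qfac (q\<^sup>2) k * qpoch_inf (- (x * q ^ (2 * k + 1))) (q\<^sup>2)) = infsum T (UNIV \<times> UNIV)"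
    unfolding row[symmetric] by (rule infsum_Sigma_banach[OF sT])
  also have "\<dots> = infsum (\<lambda>(n, l). T (n - l, l)) D"
    using infsum_reindex_bij_betw[OF bij, of T] by (simp add: case_prod_unfold)
  also have "\<dots> = (\<Sum>\<^sub>\<infinity>n. \<Sum>\<^sub>\<infinity>l\<in>{..n}. T (n - l, l))"
    unfolding D_def using infsum_Sigma'_banach[OF sD[unfolded D_def]] by simp
  also have "\<dots> = (\<Sum>\<^sub>\<infinity>n. q ^ (n * n) * rogers_szego (q\<^sup>2) x y n)"
    by (simp add: diag)
  finally show "(\<Sum>\<^sub>\<infinity>k. q ^ (k * k) * y ^ k / qfac (q\<^sup>2) k * qpoch_inf (- (x * q ^ (2 * k + 1))) (q\<^sup>2)) =
         (\<Sum>\<^sub>\<infinity>n. q ^ (n * n) * rogers_szego (q\<^sup>2) x y n)" .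
  show "(\<lambda>n. q ^ (n * n) * rogers_szego (q\<^sup>2) x y n) summable_on UNIV"
    using summable_on_Sigma_banach[OF sD[unfolded D_def]] by (simp add: diag)
qed

text \<open>What remains of the even (\<open>d = 0\<close>) or odd (\<open>d = 1\<close>) terms of
  Euler's expansion after a theta function has been split off. The same four series arise when
  \<open>rr_series\<close> is dissected by parity, and this is how the two sides are
  matched.\<close>

definition rr_part :: "nat \<Rightarrow> nat \<Rightarrow> complex \<Rightarrow> complex" where
  "rr_part a d q = (\<Sum>\<^sub>\<infinity>j. q ^ (j * j + a * j) / qfac q (2 * j + d))"

text \<open>For \<open>d \<le> 1\<close> there are \<open>j + d\<close> odd and \<open>j\<close>
  even exponents up to \<open>2 * j + d\<close>.\<close>

lemma qfac_double:
  assumes "d \<le> 1"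
  shows "qfac q (2 * j + d) = qpoch_fin q (q\<^sup>2) (j + d) * qfac (q\<^sup>2) j"
proof (induction j)
  case (Suc j)
  have 1: "q * (q\<^sup>2) ^ (j + d) = q ^ Suc (2 * j + 2 * d)" "q\<^sup>2 * (q\<^sup>2) ^ j = q ^ Suc (2 * j + 1)"
    by (simp_all add: power_add power_mult power2_eq_square power_mult_distrib)
  have "qfac q (2 * Suc j + d) = qfac q (2 * j + d) * (1 - q ^ Suc (2 * j + d)) * (1 - q ^ Suc (2 * j + d + 1))"
    by (simp add: qfac_Suc)
  moreover have "(1 - q ^ Suc (2 * j + d)) * (1 - q ^ Suc (2 * j + d + 1)) = (1 - q ^ Suc (2 * j + 2 * d)) * (1 - q ^ Suc (2 * j + 1))"
    using assms by (cases d) auto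
  ultimately show ?case
    unfolding Suc.IH by (simp add: qpoch_fin_Suc 1 del: power_Suc)
qed (use assms in \<open>cases d; simp add: qpoch_fin_def\<close>)

text \<open>The factor \<open>(q; q\<^sup>2)\<close> cancels the odd factors of the denominators and
  leaves tails of an infinite product, the shape required by
  \<open>rogers_szego_double_sum\<close>.\<close>

lemma rr_part_eq:
  assumes q: "norm q < 1" and q0: "q \<noteq> 0" and d: "d \<le> 1"
  shows "qpoch_inf q (q\<^sup>2) * rr_part a d q = (\<Sum>\<^sub>\<infinity>n. q ^ (n * n) * rogers_szego (q\<^sup>2) (- (q ^ (2 * d))) (q ^ a) n)"
proof -
  have q2: "norm (q\<^sup>2) < 1" using norm_square_less_1[OF q] .
  have "qpoch_inf q (q\<^sup>2) * rr_part a d q = (\<Sum>\<^sub>\<infinity>j. qpoch_inf q (q\<^sup>2) * (q ^ (j * j + a * j) / qfac q (2 * j + d)))"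
    unfolding rr_part_def by (rule infsum_cmult_right'[symmetric])
  also have "\<dots> = (\<Sum>\<^sub>\<infinity>k. q ^ (k * k) * (q ^ a) ^ k / qfac (q\<^sup>2) k * qpoch_inf (- (- (q ^ (2 * d)) * q ^ (2 * k + 1))) (q\<^sup>2))"
  proof (intro infsum_cong)
    fix j :: nat
    have "qpoch_inf q (q\<^sup>2) = qpoch_fin q (q\<^sup>2) (j + d) * qpoch_inf (q * (q\<^sup>2) ^ (j + d)) (q\<^sup>2)"
      by (rule qpoch_inf_shift[OF q2])
    moreover have "q * (q\<^sup>2) ^ (j + d) = - (- (q ^ (2 * d)) * q ^ (2 * j + 1))"
      by (simp add: power_add power_mult)
    moreover have "qpoch_fin q (q\<^sup>2) (j + d) \<noteq> 0" by (rule qpoch_fin_nonzero[OF q2 q])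
    ultimately have "qpoch_inf q (q\<^sup>2) = qpoch_fin q (q\<^sup>2) (j + d) * qpoch_inf (- (- (q ^ (2 * d)) * q ^ (2 * j + 1))) (q\<^sup>2)"
      "qpoch_fin q (q\<^sup>2) (j + d) \<noteq> 0"
      by (simp_all only: simp_thms)
    then show "qpoch_inf q (q\<^sup>2) * (q ^ (j * j + a * j) / qfac q (2 * j + d)) =
        q ^ (j * j) * (q ^ a) ^ j / qfac (q\<^sup>2) j * qpoch_inf (- (- (q ^ (2 * d)) * q ^ (2 * j + 1))) (q\<^sup>2)"
      unfolding qfac_double[OF d] by (simp add: power_add power_mult)
  qed
  also have "\<dots> = (\<Sum>\<^sub>\<infinity>n. q ^ (n * n) * rogers_szego (q\<^sup>2) (- (q ^ (2 * d))) (q ^ a) n)"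
    by (rule rogers_szego_double_sum) (use q q0 in \<open>auto simp: norm_power power_le_one\<close>)
  finally show ?thesis .
qed

text \<open>Euler's partition theorem, odd parts against distinct parts: both
  \<open>(q; q) (-q; q)\<close> and \<open>(q; q) / (q; q\<^sup>2)\<close> equal
  \<open>(q\<^sup>2; q\<^sup>2)\<close>.\<close>

lemma qpoch_inf_euler:
  assumes q: "norm q < 1"
  shows "qpoch_inf q (q\<^sup>2) * qpoch_inf (-q) q = 1"
proof -
  have "qpoch_inf q q * qpoch_inf (-q) q = qpoch_inf (q\<^sup>2) (q\<^sup>2)"
    by (rule qpoch_inf_mult_minus[OF q])
  moreover have "qpoch_inf q q = qpoch_inf q (q\<^sup>2) * qpoch_inf (q\<^sup>2) (q\<^sup>2)"
    using qpoch_inf_split[OF q, of 2 q] by (simp add: lessThan_nat_numeral lessThan_Suc numeral_2_eq_2 power2_eq_square mult_ac)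
  moreover have "qpoch_inf (q\<^sup>2) (q\<^sup>2) \<noteq> 0"
    using norm_square_less_1[OF q] by (intro qpoch_inf_nonzero)
  ultimately show ?thesis by (simp add: mult_ac)
qed

text \<open>After scaling, the Rogers--Szego polynomials of \<open>rr_part_eq\<close> can be
  evaluated in these four cases. In the first two the arguments have ratio -1, only even indices
  survive and the base becomes \<open>q ^ 4\<close>; in the other two the ratio is
  \<open>-q\<close>, in one order or the other, and \<open>rogers_szego_q\<close> applies at
  \<open>-q\<close>.\<close>

lemma rr_part_eval:
  assumes q: "norm q < 1" and q0: "q \<noteq> 0"
  shows "rr_part 0 0 q = qpoch_inf (-q) q * rr_series 0 (q ^ 4)"
    "rr_part 2 1 q = qpoch_inf (-q) q * rr_series 1 (q ^ 4)"
    "rr_part 1 0 q = qpoch_inf (-q) q * rr_series 0 (-q)"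
    "rr_part 1 1 q = qpoch_inf (-q) q * rr_series 1 (-q)"
proof -
  have mq: "norm (-q) < 1" using q by simp
  have *: "rr_part a d q = qpoch_inf (-q) q * R" if "qpoch_inf q (q\<^sup>2) * rr_part a d q = R" for a d R
  proof -
    have "rr_part a d q = qpoch_inf q (q\<^sup>2) * qpoch_inf (-q) q * rr_part a d q"
      by (simp add: qpoch_inf_euler[OF q])
    with that show ?thesis by (simp add: mult_ac)
  qed
  \<comment> \<open>The scaling factor \<open>c\<close> is 1 for \<open>rr_part 0 0\<close> and
    \<open>q\<^sup>2\<close> for \<open>rr_part 2 1\<close>.\<close>
  have even_only: "(\<Sum>\<^sub>\<infinity>n. q ^ (n * n) * (c ^ n * rogers_szego (q\<^sup>2) (-1) 1 n)) = (\<Sum>\<^sub>\<infinity>M. q ^ (4 * M * M) * c ^ (2 * M) / qfac (q ^ 4) M)" for c :: complex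
  proof -
    have "(\<Sum>\<^sub>\<infinity>n. q ^ (n * n) * (c ^ n * rogers_szego (q\<^sup>2) (-1) 1 n)) = (\<Sum>\<^sub>\<infinity>n\<in>range (\<lambda>M. 2 * M). q ^ (n * n) * (c ^ n * rogers_szego (q\<^sup>2) (-1) 1 n))"
      by (rule infsum_cong_neutral) (auto simp: rogers_szego_minus_1[OF q] elim!: evenE)
    also have "\<dots> = (\<Sum>\<^sub>\<infinity>M. q ^ (2 * M * (2 * M)) * (c ^ (2 * M) * rogers_szego (q\<^sup>2) (-1) 1 (2 * M)))"
      by (subst infsum_reindex) (auto simp: o_def inj_def)
    finally show ?thesis by (simp add: rogers_szego_minus_1[OF q] mult_ac)
  qed
  have "qpoch_inf q (q\<^sup>2) * rr_part 0 0 q = rr_series 0 (q ^ 4)"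
    using even_only[of 1] by (simp add: rr_part_eq[OF q q0] rr_series_def mult.assoc power_mult)
  then show "rr_part 0 0 q = qpoch_inf (-q) q * rr_series 0 (q ^ 4)" by (rule *)
  have "qpoch_inf q (q\<^sup>2) * rr_part 2 1 q = rr_series 1 (q ^ 4)"
  proof -
    have "rogers_szego (q\<^sup>2) (- (q ^ (2 * 1))) (q ^ 2) n = (q\<^sup>2) ^ n * rogers_szego (q\<^sup>2) (-1) 1 n" for n
      using rogers_szego_scale[of "q\<^sup>2" "q\<^sup>2" "-1" 1 n] by simp
    moreover have "q ^ (4 * M * M) * (q\<^sup>2) ^ (2 * M) = (q ^ 4) ^ (M * (M + 1))" for M :: nat
      by (simp add: algebra_simps flip: power_mult power_add)
    ultimately show ?thesis using even_only[of "q\<^sup>2"] by (simp add: rr_part_eq[OF q q0] rr_series_def)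
  qed
  then show "rr_part 2 1 q = qpoch_inf (-q) q * rr_series 1 (q ^ 4)" by (rule *)
  have A: "rogers_szego (q\<^sup>2) (-q) 1 n = 1 / qfac (-q) n" for n
    using rogers_szego_q[OF mq, of n] by simp
  have ev: "(-q) ^ (n * (n + 1)) = q ^ (n * (n + 1))" for n :: nat
    by (simp add: uminus_power_if)
  have "qpoch_inf q (q\<^sup>2) * rr_part 1 0 q = rr_series 0 (-q)"
  proof -
    have "rogers_szego (q\<^sup>2) (- (q ^ (2 * 0))) (q ^ 1) n = (-1) ^ n / qfac (-q) n" for n
      using rogers_szego_scale[of "q\<^sup>2" "-1" 1 "-q" n] A[of n] by (simp add: rogers_szego_commute[of _ 1])
    moreover have "q ^ (n * n) * (-1) ^ n = (-q) ^ (n * n)" for n :: nat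
      by (simp add: power_minus[of q] minus_one_power_iff)
    ultimately show ?thesis by (simp add: rr_part_eq[OF q q0] rr_series_def)
  qed
  then show "rr_part 1 0 q = qpoch_inf (-q) q * rr_series 0 (-q)" by (rule *)
  have "qpoch_inf q (q\<^sup>2) * rr_part 1 1 q = rr_series 1 (-q)"
  proof -
    have "rogers_szego (q\<^sup>2) (- (q ^ (2 * 1))) (q ^ 1) n = q ^ n / qfac (-q) n" for n
      using rogers_szego_scale[of "q\<^sup>2" q "-q" 1 n] A[of n] by (simp add: power2_eq_square)
    moreover have "q ^ (n * n) * q ^ n = (-q) ^ (n * (n + 1))" for n :: nat
      unfolding ev by (simp add: power_add)
    ultimately show ?thesis by (simp add: rr_part_eq[OF q q0] rr_series_def)
  qed
  then show "rr_part 1 1 q = qpoch_inf (-q) q * rr_series 1 (-q)" by (rule *)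
qed

text \<open>\<open>rogers_szego_double_sum\<close> read from right to left:
  \<open>1 / (q; q)_n\<close> is itself a Rogers--Szego value, so each series becomes
  \<open>(-q\<^sup>2; q\<^sup>2)\<close> times one with denominators
  \<open>(q ^ 4; q ^ 4)_k\<close>, whose even and odd terms are the four parts at
  \<open>q ^ 4\<close>. The phi series need this, as they are expanded to that base.\<close>

lemma rr_series_dissection:
  assumes q: "norm q < 1" and q0: "q \<noteq> 0"
  shows "rr_series 0 q = qpoch_inf (-(q\<^sup>2)) (q\<^sup>2) * (rr_part 0 0 (q ^ 4) + q * rr_part 1 1 (q ^ 4))"
    "rr_series 1 q = qpoch_inf (-(q\<^sup>2)) (q\<^sup>2) * (rr_part 1 0 (q ^ 4) + q ^ 3 * rr_part 2 1 (q ^ 4))"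
proof -
  have q2: "norm (q\<^sup>2) < 1" using norm_square_less_1[OF q] .
  have q4: "norm (q ^ 4) < 1" using norm_power4_less_1[OF q] .
  \<comment> \<open>The case \<open>y = 1\<close> belongs to \<open>s = 0\<close> and
    \<open>y = q\<^sup>2\<close> to \<open>s = 1\<close>.\<close>
  have key: "(\<Sum>\<^sub>\<infinity>n. q ^ (n * n) * rogers_szego (q\<^sup>2) q y n) = qpoch_inf (-(q\<^sup>2)) (q\<^sup>2) *
      ((\<Sum>\<^sub>\<infinity>j. q ^ (2 * j * (2 * j)) * y ^ (2 * j) / qfac (q ^ 4) (2 * j)) +
       (\<Sum>\<^sub>\<infinity>j. q ^ ((2 * j + 1) * (2 * j + 1)) * y ^ (2 * j + 1) / qfac (q ^ 4) (2 * j + 1)))"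
    if y: "norm y \<le> 1" for y
  proof -
    have fac: "qfac (q ^ 4) k = qfac (q\<^sup>2) k * qpoch_fin (-(q\<^sup>2)) (q\<^sup>2) k" for k
      unfolding qpoch_fin_def prod.distrib[symmetric]
    proof (intro prod.cong refl)
      fix x
      have "q ^ 4 * (q ^ 4) ^ x = (q\<^sup>2 * (q\<^sup>2) ^ x)\<^sup>2"
        by (simp add: power_mult_distrib mult.commute flip: power_mult)
      then show "1 - q ^ 4 * (q ^ 4) ^ x = (1 - q\<^sup>2 * (q\<^sup>2) ^ x) * (1 - - (q\<^sup>2) * (q\<^sup>2) ^ x)"
        by (simp only:) (simp add: power2_eq_square algebra_simps)
    qed
    have nz: "qpoch_fin (-(q\<^sup>2)) (q\<^sup>2) k \<noteq> 0" for k
      by (rule qpoch_fin_nonzero) (use q2 in auto)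
    have eq: "q ^ (k * k) * y ^ k / qfac (q\<^sup>2) k * qpoch_inf (- (q * q ^ (2 * k + 1))) (q\<^sup>2) =
       qpoch_inf (-(q\<^sup>2)) (q\<^sup>2) * (q ^ (k * k) * y ^ k / qfac (q ^ 4) k)" for k
    proof -
      have "qpoch_inf (-(q\<^sup>2)) (q\<^sup>2) = qpoch_fin (-(q\<^sup>2)) (q\<^sup>2) k * qpoch_inf (-(q\<^sup>2) * (q\<^sup>2) ^ k) (q\<^sup>2)"
        by (rule qpoch_inf_shift[OF q2])
      moreover have "-(q\<^sup>2) * (q\<^sup>2) ^ k = - (q * q ^ (2 * k + 1))"
        by (simp add: power_mult power2_eq_square)
      ultimately show ?thesis unfolding fac using nz[of k] by simp
    qed
    have sm: "(\<lambda>k. q ^ (k * k) * y ^ k / qfac (q ^ 4) k) summable_on UNIV"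
    proof -
      obtain C where C: "C > 0" "\<And>n. norm (1 / qfac (q ^ 4) n) \<le> C"
        using inverse_qpoch_fin_bounded[OF q4 q4] by blast
      have "(\<lambda>n. norm (q ^ (n * n)) * C) summable_on UNIV"
        by (intro summable_on_cmult_left summable_power_nat q) simp
      then have "(\<lambda>k. norm (q ^ (k * k) * y ^ k / qfac (q ^ 4) k)) summable_on UNIV"
      proof (rule summable_on_comparison_test)
        fix k :: nat
        have "norm (q ^ (k * k) * y ^ k / qfac (q ^ 4) k) = norm (q ^ (k * k)) * norm y ^ k * norm (1 / qfac (q ^ 4) k)"
          by (simp add: norm_mult norm_divide norm_power)
        also have "\<dots> \<le> norm (q ^ (k * k)) * 1 * C"
          using C y by (intro mult_mono power_le_one) auto
        finally show "norm (q ^ (k * k) * y ^ k / qfac (q ^ 4) k) \<le> norm (q ^ (k * k)) * C" by simp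
      qed auto
      then show ?thesis by (rule abs_summable_summable)
    qed
    have "(\<Sum>\<^sub>\<infinity>n. q ^ (n * n) * rogers_szego (q\<^sup>2) q y n) = (\<Sum>\<^sub>\<infinity>k. q ^ (k * k) * y ^ k / qfac (q\<^sup>2) k * qpoch_inf (- (q * q ^ (2 * k + 1))) (q\<^sup>2))"
      by (rule rogers_szego_double_sum(1)[symmetric]) (use q q0 y in auto)
    also have "\<dots> = qpoch_inf (-(q\<^sup>2)) (q\<^sup>2) * (\<Sum>\<^sub>\<infinity>k. q ^ (k * k) * y ^ k / qfac (q ^ 4) k)"
      unfolding eq by (rule infsum_cmult_right')
    also have "(\<Sum>\<^sub>\<infinity>k. q ^ (k * k) * y ^ k / qfac (q ^ 4) k) = (\<Sum>\<^sub>\<infinity>j. q ^ (2 * j * (2 * j)) * y ^ (2 * j) / qfac (q ^ 4) (2 * j)) +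
       (\<Sum>\<^sub>\<infinity>j. q ^ ((2 * j + 1) * (2 * j + 1)) * y ^ (2 * j + 1) / qfac (q ^ 4) (2 * j + 1))"
      by (rule infsum_nat_even_odd(1)[OF sm])
    finally show ?thesis .
  qed
  have "rr_series 0 q = (\<Sum>\<^sub>\<infinity>n. q ^ (n * n) * rogers_szego (q\<^sup>2) q 1 n)"
    by (simp add: rr_series_def rogers_szego_q[OF q])
  moreover have "(\<Sum>\<^sub>\<infinity>j. q ^ (2 * j * (2 * j)) * 1 ^ (2 * j) / qfac (q ^ 4) (2 * j)) = rr_part 0 0 (q ^ 4)"
    unfolding rr_part_def by (intro infsum_cong) (simp flip: power_mult add: mult_ac)
  moreover have "(\<Sum>\<^sub>\<infinity>j. q ^ ((2 * j + 1) * (2 * j + 1)) * 1 ^ (2 * j + 1) / qfac (q ^ 4) (2 * j + 1)) = q * rr_part 1 1 (q ^ 4)"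
  proof -
    have e: "q ^ ((2 * j + 1) * (2 * j + 1)) = q * (q ^ 4) ^ (j * j + 1 * j)" for j :: nat
      by (simp add: algebra_simps flip: power_mult power_Suc)
    show ?thesis
      unfolding rr_part_def infsum_cmult_right'[symmetric] e power_one by (simp only: mult_1_right times_divide_eq_right)
  qed
  ultimately show "rr_series 0 q = qpoch_inf (-(q\<^sup>2)) (q\<^sup>2) * (rr_part 0 0 (q ^ 4) + q * rr_part 1 1 (q ^ 4))"
    using key[of 1] by simp
  have "rogers_szego (q\<^sup>2) q (q\<^sup>2) n = q ^ n / qfac q n" for n
    using rogers_szego_scale[of "q\<^sup>2" q 1 q n] rogers_szego_q[OF q, of n] by (simp add: rogers_szego_commute[of _ 1] power2_eq_square)
  then have "rr_series 1 q = (\<Sum>\<^sub>\<infinity>n. q ^ (n * n) * rogers_szego (q\<^sup>2) q (q\<^sup>2) n)"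
    by (simp add: rr_series_def power_add mult_ac)
  moreover have "(\<Sum>\<^sub>\<infinity>j. q ^ (2 * j * (2 * j)) * (q\<^sup>2) ^ (2 * j) / qfac (q ^ 4) (2 * j)) = rr_part 1 0 (q ^ 4)"
    unfolding rr_part_def by (intro infsum_cong) (simp add: algebra_simps flip: power_mult power_add)
  moreover have "(\<Sum>\<^sub>\<infinity>j. q ^ ((2 * j + 1) * (2 * j + 1)) * (q\<^sup>2) ^ (2 * j + 1) / qfac (q ^ 4) (2 * j + 1)) = q ^ 3 * rr_part 2 1 (q ^ 4)"
  proof -
    have "q ^ ((2 * j + 1) * (2 * j + 1)) * (q\<^sup>2) ^ (2 * j + 1) = q ^ 3 * (q ^ 4) ^ (j * j + 2 * j)" for j :: nat
    proof -
      have "(2 * j + 1) * (2 * j + 1) + 2 * (2 * j + 1) = 3 + 4 * (j * j + 2 * j)" by (simp add: algebra_simps)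
      then show ?thesis by (simp only: power_add[symmetric] power_mult[symmetric])
    qed
    then show ?thesis
      unfolding rr_part_def infsum_cmult_right'[symmetric] by simp
  qed
  ultimately show "rr_series 1 q = qpoch_inf (-(q\<^sup>2)) (q\<^sup>2) * (rr_part 1 0 (q ^ 4) + q ^ 3 * rr_part 2 1 (q ^ 4))"
    using key[of "q\<^sup>2"] q by (simp add: norm_power power_le_one)
qed

section \<open>Bilateral series as theta functions times Rogers--Ramanujan functions\<close>

definition theta3 :: "complex \<Rightarrow> complex" where
  "theta3 q = (\<Sum>\<^sub>\<infinity>n::int. q powi (n\<^sup>2))"

text \<open>Jacobi's second theta function at the nome \<open>q\<close>, without its factor
  \<open>q ^ (1 / 4)\<close>.\<close>

definition theta2 :: "complex \<Rightarrow> complex" where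
  "theta2 q = (\<Sum>\<^sub>\<infinity>n::int. q powi (n\<^sup>2 + n))"

lemma theta_exp_summable:
  fixes q :: complex
  assumes q: "norm q < 1" and q0: "q \<noteq> 0"
  shows "(\<lambda>n::int. q powi (n\<^sup>2 + t * n)) summable_on UNIV"
proof -
  have "(\<lambda>n::int. norm (q powi (n\<^sup>2 + t * n) * 1 powi n)) summable_on UNIV"
    by (rule gauss_powi_summable[OF q q0, where a = 2 and b = "2 * t"]) auto
  then show ?thesis using abs_summable_summable by fastforce
qed

text \<open>Completing the square removes an even linear term altogether; an odd one can only be
  reduced to the linear term of \<open>theta2\<close>.\<close>

lemma theta_exp_even:
  assumes q0: "(q::complex) \<noteq> 0"
  shows "(\<Sum>\<^sub>\<infinity>n::int. q powi (n\<^sup>2 + 2 * p * n)) = q powi (-(p\<^sup>2)) * theta3 q"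
proof -
  have "(\<Sum>\<^sub>\<infinity>n::int. q powi (n\<^sup>2 + 2 * p * n)) = (\<Sum>\<^sub>\<infinity>n::int. q powi (-(p\<^sup>2)) * q powi (n\<^sup>2))"
    by (rule infsum_reindex_bij_witness[of _ "\<lambda>n. n - p" "\<lambda>n. n + p"])
       (use q0 in \<open>auto simp: power2_eq_square algebra_simps simp flip: power_int_add\<close>)
  then show ?thesis by (simp add: theta3_def infsum_cmult_right')
qed

lemma theta_exp_odd:
  assumes q0: "(q::complex) \<noteq> 0"
  shows "(\<Sum>\<^sub>\<infinity>n::int. q powi (n\<^sup>2 + (2 * p + 1) * n)) = q powi (-(p\<^sup>2) - p) * theta2 q"
proof -
  have "(\<Sum>\<^sub>\<infinity>n::int. q powi (n\<^sup>2 + (2 * p + 1) * n)) = (\<Sum>\<^sub>\<infinity>n::int. q powi (-(p\<^sup>2) - p) * q powi (n\<^sup>2 + n))"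
    by (rule infsum_reindex_bij_witness[of _ "\<lambda>n. n - p" "\<lambda>n. n + p"])
       (use q0 in \<open>auto simp: power2_eq_square algebra_simps simp flip: power_int_add\<close>)
  then show ?thesis by (simp add: theta2_def infsum_cmult_right')
qed

text \<open>Euler's expansion of the product, an exchange of the two summations and a split by the
  parity of \<open>k\<close>: this parity decides which of the two theta functions the inner sum
  over \<open>n\<close> is a multiple of. As the products grow for \<open>n\<close> tending to minus
  infinity, the exchange needs a genuine two-dimensional majorant.\<close>

lemma bilateral_expand:
  assumes q: "norm q < 1" and q0: "q \<noteq> 0" and b: "b \<noteq> 0"
  shows "(\<Sum>\<^sub>\<infinity>n::int. q powi (n\<^sup>2 + s * n) * qpoch_inf (- b * q powi n) q) =
      (\<Sum>\<^sub>\<infinity>j. b ^ (2 * j) * q ^ ((2 * j) choose 2) / qfac q (2 * j) * (\<Sum>\<^sub>\<infinity>n::int. q powi (n\<^sup>2 + (2 * int j + s) * n))) +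
      (\<Sum>\<^sub>\<infinity>j. b ^ (2 * j + 1) * q ^ ((2 * j + 1) choose 2) / qfac q (2 * j + 1) * (\<Sum>\<^sub>\<infinity>n::int. q powi (n\<^sup>2 + (2 * int j + 1 + s) * n)))"
    (is "_ = ?E + ?O")
    and "(\<lambda>n::int. q powi (n\<^sup>2 + s * n) * qpoch_inf (- b * q powi n) q) summable_on UNIV"
proof -
  define F where "F = (\<lambda>(n::int, k::nat). q powi (n\<^sup>2 + s * n) * (b * q powi n) ^ k * q ^ (k choose 2) / qfac q k)"
  define \<rho> where "\<rho> = norm q"
  \<comment> \<open>Since \<open>n\<^sup>2 + n * k + k * (k - 1) / 2 = n\<^sup>2 / 2 + (n +
    k)\<^sup>2 / 2 - k / 2\<close>, the norm of a term factors into a Gaussian in \<open>n\<close>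
    and one in \<open>n + k\<close>. The constants \<beta> and \<gamma> absorb the linear
    terms.\<close>
  define \<beta> where "\<beta> = norm b * \<rho> powr (-1/2)"
  define g where "g = (\<lambda>\<gamma> (n::int). \<rho> powr (real_of_int n ^ 2 / 2) * \<gamma> powr real_of_int n)"
  have \<rho>: "0 < \<rho>" "\<rho> < 1" using q q0 by (auto simp: \<rho>_def)
  have \<beta>: "\<beta> > 0" using \<rho> b by (simp add: \<beta>_def)
  obtain C where C: "C > 0" "\<And>n. norm (1 / qfac q n) \<le> C"
    using inverse_qpoch_fin_bounded[OF q q] by blast
  define \<gamma> where "\<gamma> = \<rho> powr (real_of_int s) / \<beta>"
  have \<gamma>: "\<gamma> > 0" using \<rho> \<beta> by (simp add: \<gamma>_def)
  have gs: "g \<gamma> summable_on UNIV" "g \<beta> summable_on UNIV"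
    unfolding g_def by (rule gauss_summable_int; use \<rho> \<beta> \<gamma> in simp)+
  have gnn: "g c n \<ge> 0" for c n by (simp add: g_def)
  have "(\<lambda>(n, M). g \<gamma> n * g \<beta> M) summable_on UNIV \<times> UNIV"
  proof (rule summable_on_SigmaI)
    fix n :: int
    show "((\<lambda>M. case (n, M) of (n, M) \<Rightarrow> g \<gamma> n * g \<beta> M) has_sum g \<gamma> n * (\<Sum>\<^sub>\<infinity>M. g \<beta> M)) UNIV"
      using has_sum_cmult_right[OF has_sum_infsum[OF gs(2)], of "g \<gamma> n"] by simp
  qed (auto intro!: summable_on_cmult_left gs mult_nonneg_nonneg gnn)
  then have "(\<lambda>(n, M). g \<gamma> n * g \<beta> M) summable_on (\<lambda>(n, k). (n, n + int k)) ` (UNIV \<times> UNIV)"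
    by (rule summable_on_subset_banach) auto
  then have "(\<lambda>(n, k). g \<gamma> n * g \<beta> (n + int k)) summable_on (UNIV \<times> UNIV)"
    by (subst (asm) summable_on_reindex) (auto simp: inj_on_def o_def case_prod_unfold)
  then have "(\<lambda>nk. C * (case nk of (n, k) \<Rightarrow> g \<gamma> n * g \<beta> (n + int k))) summable_on (UNIV \<times> UNIV)"
    by (rule summable_on_cmult_right)
  then have "(\<lambda>nk. norm (F nk)) summable_on UNIV \<times> UNIV"
  proof (rule summable_on_comparison_test)
    fix nk :: "int \<times> nat"
    obtain n k where nk: "nk = (n, k)" by (cases nk)
    have "norm (F nk) = norm (q powi (n\<^sup>2 + s * n) * (b * q powi n) ^ k * q ^ (k choose 2)) * norm (1 / qfac q k)"
      by (simp add: F_def nk norm_mult norm_divide)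
    also have "norm (q powi (n\<^sup>2 + s * n) * (b * q powi n) ^ k * q ^ (k choose 2)) = g \<gamma> n * g \<beta> (n + int k)"
    proof -
      have k2: "real (k choose 2) = real k * (real k - 1) / 2"
      proof -
        have "even (k * (k - 1))" by (cases k) auto
        then have "2 * (k choose 2) = k * (k - 1)" by (simp add: choose_two)
        then have "2 * real (k choose 2) = real k * real (k - 1)" by (metis of_nat_mult of_nat_numeral)
        then show ?thesis by (cases k) auto
      qed
      have "norm (q powi (n\<^sup>2 + s * n) * (b * q powi n) ^ k * q ^ (k choose 2)) =
         \<rho> powr (real_of_int (n\<^sup>2 + s * n)) * (norm b powr real k * (\<rho> powr real_of_int n) powr real k) * \<rho> powr real (k choose 2)"
        using q0 b \<rho> by (simp add: norm_mult norm_power powi_eq_powr power_mult_distrib \<rho>_def powr_realpow)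
      also have "\<dots> = exp (ln \<rho> * (n ^ 2 + s * n + n * k + k * (real k - 1) / 2) + ln (norm b) * k)"
        using \<rho> b by (simp add: powr_def k2 exp_add[symmetric] algebra_simps)
      also have "\<dots> = g \<gamma> n * g \<beta> (n + int k)"
      proof -
        have lb: "ln \<beta> = ln (norm b) - ln \<rho> / 2" using \<rho> b by (simp add: \<beta>_def ln_mult ln_powr)
        have lg: "ln \<gamma> = s * ln \<rho> - ln \<beta>" using \<rho> \<beta> by (simp add: \<gamma>_def ln_div ln_powr)
        have "g \<gamma> n * g \<beta> (n + int k) = exp (n ^ 2 / 2 * ln \<rho> + n * ln \<gamma> + (real_of_int n + k) ^ 2 / 2 * ln \<rho> + (real_of_int n + k) * ln \<beta>)"
          using \<rho> \<beta> \<gamma> by (simp add: g_def powr_def exp_add[symmetric])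
        also have "n ^ 2 / 2 * ln \<rho> + n * ln \<gamma> + (real_of_int n + k) ^ 2 / 2 * ln \<rho> + (real_of_int n + k) * ln \<beta> =
          ln \<rho> * (n ^ 2 + s * n + n * k + k * (real k - 1) / 2) + ln (norm b) * k"
          unfolding lg lb by (simp add: power2_eq_square field_simps)
        finally show ?thesis by simp
      qed
      finally show ?thesis .
    qed
    also have "g \<gamma> n * g \<beta> (n + int k) * norm (1 / qfac q k) \<le> g \<gamma> n * g \<beta> (n + int k) * C"
      using C gnn by (intro mult_left_mono) auto
    finally show "norm (F nk) \<le> C * (case nk of (n, k) \<Rightarrow> g \<gamma> n * g \<beta> (n + int k))"
      by (simp add: nk mult_ac)
  qed auto
  then have sF: "F summable_on UNIV \<times> UNIV" by (rule abs_summable_summable)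
  have row: "(\<Sum>\<^sub>\<infinity>k. F (n, k)) = q powi (n\<^sup>2 + s * n) * qpoch_inf (- b * q powi n) q" for n
  proof -
    have "((\<lambda>k. q powi (n\<^sup>2 + s * n) * ((-1) ^ k * q ^ (k choose 2) * (- b * q powi n) ^ k / qfac q k)) has_sum
        q powi (n\<^sup>2 + s * n) * qpoch_inf (- b * q powi n) q) UNIV"
      by (intro has_sum_cmult_right euler_q_exponential q q0) (use b q0 in auto)
    moreover have "(-1) ^ k * (- b * q powi n) ^ k = (b * q powi n) ^ k" for k
      by (simp only: power_mult_distrib[symmetric]) simp
    then have "q powi (n\<^sup>2 + s * n) * ((-1) ^ k * q ^ (k choose 2) * (- b * q powi n) ^ k / qfac q k) = F (n, k)" for k
      by (simp add: F_def mult_ac)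
    ultimately show ?thesis by (simp only: infsumI)
  qed
  have col: "(\<Sum>\<^sub>\<infinity>n. F (n, k)) = b ^ k * q ^ (k choose 2) / qfac q k * (\<Sum>\<^sub>\<infinity>n::int. q powi (n\<^sup>2 + (int k + s) * n))" for k
  proof -
    have "F (n, k) = b ^ k * q ^ (k choose 2) / qfac q k * q powi (n\<^sup>2 + (int k + s) * n)" for n
      using q0 by (simp add: F_def power_mult_distrib power_int_add power_int_mult distrib_right mult_ac
         power_int_mult_distrib mult.commute[of n "int k"] flip: power_int_of_nat)
    then show ?thesis by (simp only: infsum_cmult_right')
  qed
  show "(\<lambda>n::int. q powi (n\<^sup>2 + s * n) * qpoch_inf (- b * q powi n) q) summable_on UNIV"
    using summable_on_Sigma_banach[of "\<lambda>n k. F (n, k)" UNIV "\<lambda>_. UNIV"] sF by (simp add: row)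
  have "(\<Sum>\<^sub>\<infinity>n::int. q powi (n\<^sup>2 + s * n) * qpoch_inf (- b * q powi n) q) = (\<Sum>\<^sub>\<infinity>n. \<Sum>\<^sub>\<infinity>k. F (n, k))"
    by (simp add: row)
  also have "\<dots> = (\<Sum>\<^sub>\<infinity>k. \<Sum>\<^sub>\<infinity>n. F (n, k))"
    by (rule infsum_swap_banach) (use sF in simp)
  also have "\<dots> = (\<Sum>\<^sub>\<infinity>k. b ^ k * q ^ (k choose 2) / qfac q k * (\<Sum>\<^sub>\<infinity>n::int. q powi (n\<^sup>2 + (int k + s) * n)))"
    by (simp only: col)
  also have "\<dots> = ?E + ?O"
  proof -
    have "(\<lambda>k. \<Sum>\<^sub>\<infinity>n. F (n, k)) summable_on UNIV"
    proof -
      have "(\<lambda>(k, n). F (n, k)) summable_on UNIV \<times> UNIV"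
        using summable_on_swap[of F UNIV UNIV] sF by (simp add: case_prod_unfold)
      then show ?thesis using summable_on_Sigma_banach[of "\<lambda>k n. F (n, k)" UNIV "\<lambda>_. UNIV"] by simp
    qed
    from infsum_nat_even_odd(1)[OF this] show ?thesis by (simp only: col) (simp add: add_ac)
  qed
  finally show "(\<Sum>\<^sub>\<infinity>n::int. q powi (n\<^sup>2 + s * n) * qpoch_inf (- b * q powi n) q) = ?E + ?O" .
qed

lemma choose_2_double: "((2 * j) choose 2) + j = 2 * j * j" "(2 * j + 1) choose 2 = 2 * j * j + j"
proof -
  show 1: "((2 * j) choose 2) + j = 2 * j * j"
    by (cases j) (simp_all add: choose_two algebra_simps)
  have "(2 * j + 1) choose 2 = ((2 * j) choose 2) + 2 * j"
    by (simp add: numeral_2_eq_2)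
  with 1 show "(2 * j + 1) choose 2 = 2 * j * j + j" by simp
qed

lemma power_mult_powi:
  fixes q :: complex
  assumes "q \<noteq> 0" "int a + x + y = int c"
  shows "q ^ a * q powi x * q powi y = q ^ c"
proof -
  have "q ^ a * q powi x * q powi y = q powi (int a + x + y)"
    using assms(1) by (simp add: power_int_add)
  then show ?thesis using assms(2) by simp
qed

text \<open>After completing the square the theta function no longer depends on \<open>j\<close>,
  and the remaining power of \<open>q\<close> is that of an \<open>rr_part\<close>. The value
  \<epsilon> = 1 serves the psi series, \<epsilon> = -1 the truncated series below, and a square
  root \<open>b\<close> of the base the phi series.\<close>

lemma bilateral_sums:
  assumes q: "norm q < 1" and q0: "q \<noteq> 0"
  shows "\<epsilon>\<^sup>2 = 1 \<Longrightarrow> (\<Sum>\<^sub>\<infinity>n::int. q powi (n\<^sup>2) * qpoch_inf (- (\<epsilon> * q) * q powi n) q) = theta3 q * rr_part 1 0 q + \<epsilon> * q * theta2 q * rr_part 2 1 q"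
    and "\<epsilon>\<^sup>2 = 1 \<Longrightarrow> (\<Sum>\<^sub>\<infinity>n::int. q powi (n\<^sup>2 + n) * qpoch_inf (- (\<epsilon> * q) * q powi n) q) = theta2 q * rr_part 0 0 q + \<epsilon> * theta3 q * rr_part 1 1 q"
    and "b\<^sup>2 = q \<Longrightarrow> (\<Sum>\<^sub>\<infinity>n::int. q powi (n\<^sup>2) * qpoch_inf (- b * q powi n) q) = theta3 q * rr_part 0 0 q + b * theta2 q * rr_part 1 1 q"
    and "b\<^sup>2 = q \<Longrightarrow> (\<Sum>\<^sub>\<infinity>n::int. q powi (n\<^sup>2 - n) * qpoch_inf (- b * q powi n) q) = theta2 q * rr_part 1 0 q + b * theta3 q * rr_part 2 1 q"
proof -
  have pw: "q ^ m = q powi (int m)" for m by simp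
  have even: "b ^ (2 * j) * q ^ ((2 * j) choose 2) = (b\<^sup>2) ^ j * q powi (2 * int j * int j - int j)" for b and j :: nat
  proof -
    have "int ((2 * j) choose 2) = 2 * int j * int j - int j"
      using choose_2_double(1)[of j] by (metis add_diff_cancel_right' of_nat_add of_nat_mult of_nat_numeral)
    then show ?thesis unfolding pw by (simp add: power_mult)
  qed
  have odd: "b ^ (2 * j + 1) * q ^ ((2 * j + 1) choose 2) = b * (b\<^sup>2) ^ j * q powi (2 * int j * int j + int j)" for b and j :: nat
    unfolding pw choose_2_double(2) by (simp add: power_mult)
  show "(\<Sum>\<^sub>\<infinity>n::int. q powi (n\<^sup>2) * qpoch_inf (- (\<epsilon> * q) * q powi n) q) = theta3 q * rr_part 1 0 q + \<epsilon> * q * theta2 q * rr_part 2 1 q"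
    if "\<epsilon>\<^sup>2 = 1"
  proof -
    have b2: "(\<epsilon> * q)\<^sup>2 = q\<^sup>2" using that by (simp add: power_mult_distrib)
    have b: "\<epsilon> * q \<noteq> 0" using that q0 by auto
    have e: "(q\<^sup>2) ^ j * q powi (2 * int j * int j - int j) * q powi (-(int j)\<^sup>2) = q ^ (j * j + 1 * j)"
      "(q\<^sup>2) ^ j * q powi (2 * int j * int j + int j) * q powi (-(int j)\<^sup>2 - int j) = q ^ (j * j + 2 * j)" for j
      unfolding power_mult[symmetric] by (rule power_mult_powi[OF q0]; simp add: power2_eq_square algebra_simps)+
    have "(\<Sum>\<^sub>\<infinity>j. (\<epsilon> * q) ^ (2 * j) * q ^ ((2 * j) choose 2) / qfac q (2 * j) * (\<Sum>\<^sub>\<infinity>n::int. q powi (n\<^sup>2 + (2 * int j + 0) * n)))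
      = (\<Sum>\<^sub>\<infinity>j. theta3 q * (q ^ (j * j + 1 * j) / qfac q (2 * j + 0)))"
      unfolding even b2 add_0_right theta_exp_even[OF q0] e(1)[symmetric] by (simp add: mult_ac)
    moreover have "(\<Sum>\<^sub>\<infinity>j. (\<epsilon> * q) ^ (2 * j + 1) * q ^ ((2 * j + 1) choose 2) / qfac q (2 * j + 1) * (\<Sum>\<^sub>\<infinity>n::int. q powi (n\<^sup>2 + (2 * int j + 1 + 0) * n)))
      = (\<Sum>\<^sub>\<infinity>j. \<epsilon> * q * theta2 q * (q ^ (j * j + 2 * j) / qfac q (2 * j + 1)))"
    proof (intro infsum_cong)
      fix j :: nat
      show "(\<epsilon> * q) ^ (2 * j + 1) * q ^ ((2 * j + 1) choose 2) / qfac q (2 * j + 1) * (\<Sum>\<^sub>\<infinity>n::int. q powi (n\<^sup>2 + (2 * int j + 1 + 0) * n)) =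
         \<epsilon> * q * theta2 q * (q ^ (j * j + 2 * j) / qfac q (2 * j + 1))"
        unfolding odd b2 add_0_right theta_exp_odd[OF q0] e(2)[symmetric] by (simp add: mult_ac)
    qed
    ultimately show ?thesis
      using bilateral_expand(1)[OF q q0 b, of 0] unfolding infsum_cmult_right' rr_part_def by simp
  qed
  show "(\<Sum>\<^sub>\<infinity>n::int. q powi (n\<^sup>2 + n) * qpoch_inf (- (\<epsilon> * q) * q powi n) q) = theta2 q * rr_part 0 0 q + \<epsilon> * theta3 q * rr_part 1 1 q"
    if "\<epsilon>\<^sup>2 = 1"
  proof -
    have b2: "(\<epsilon> * q)\<^sup>2 = q\<^sup>2" using that by (simp add: power_mult_distrib)
    have b: "\<epsilon> * q \<noteq> 0" using that q0 by auto
    have e: "(q\<^sup>2) ^ j * q powi (2 * int j * int j - int j) * q powi (-(int j)\<^sup>2 - int j) = q ^ (j * j + 0 * j)" for j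
      unfolding power_mult[symmetric] by (rule power_mult_powi[OF q0]) (simp add: power2_eq_square algebra_simps)
    have e': "q * (q\<^sup>2) ^ j * q powi (2 * int j * int j + int j) * q powi (-(int j + 1)\<^sup>2) = q ^ (j * j + 1 * j)" for j
      unfolding power_mult[symmetric] power_Suc[symmetric] by (rule power_mult_powi[OF q0]) (simp add: power2_eq_square algebra_simps)
    have "(\<Sum>\<^sub>\<infinity>j. (\<epsilon> * q) ^ (2 * j) * q ^ ((2 * j) choose 2) / qfac q (2 * j) * (\<Sum>\<^sub>\<infinity>n::int. q powi (n\<^sup>2 + (2 * int j + 1) * n)))
      = (\<Sum>\<^sub>\<infinity>j. theta2 q * (q ^ (j * j + 0 * j) / qfac q (2 * j + 0)))"
      unfolding even b2 theta_exp_odd[OF q0] e[symmetric] by (simp add: mult_ac)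
    moreover have "(\<Sum>\<^sub>\<infinity>j. (\<epsilon> * q) ^ (2 * j + 1) * q ^ ((2 * j + 1) choose 2) / qfac q (2 * j + 1) * (\<Sum>\<^sub>\<infinity>n::int. q powi (n\<^sup>2 + (2 * int j + 1 + 1) * n)))
      = (\<Sum>\<^sub>\<infinity>j. \<epsilon> * theta3 q * (q ^ (j * j + 1 * j) / qfac q (2 * j + 1)))"
    proof (intro infsum_cong)
      fix j :: nat
      have *: "2 * int j + 1 + 1 = 2 * (int j + 1)" by simp
      show "(\<epsilon> * q) ^ (2 * j + 1) * q ^ ((2 * j + 1) choose 2) / qfac q (2 * j + 1) * (\<Sum>\<^sub>\<infinity>n::int. q powi (n\<^sup>2 + (2 * int j + 1 + 1) * n)) =
         \<epsilon> * theta3 q * (q ^ (j * j + 1 * j) / qfac q (2 * j + 1))"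
        unfolding odd b2 * theta_exp_even[OF q0] e'[symmetric] by (simp add: mult_ac)
    qed
    ultimately show ?thesis
      using bilateral_expand(1)[OF q q0 b, of 1] unfolding infsum_cmult_right' rr_part_def by simp
  qed
  show "(\<Sum>\<^sub>\<infinity>n::int. q powi (n\<^sup>2) * qpoch_inf (- b * q powi n) q) = theta3 q * rr_part 0 0 q + b * theta2 q * rr_part 1 1 q"
    if b2: "b\<^sup>2 = q"
  proof -
    have b: "b \<noteq> 0" using that q0 by auto
    have e: "q ^ j * q powi (2 * int j * int j - int j) * q powi (-(int j)\<^sup>2) = q ^ (j * j + 0 * j)"
      "q ^ j * q powi (2 * int j * int j + int j) * q powi (-(int j)\<^sup>2 - int j) = q ^ (j * j + 1 * j)" for j
      by (rule power_mult_powi[OF q0]; simp add: power2_eq_square algebra_simps)+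
    have "(\<Sum>\<^sub>\<infinity>j. b ^ (2 * j) * q ^ ((2 * j) choose 2) / qfac q (2 * j) * (\<Sum>\<^sub>\<infinity>n::int. q powi (n\<^sup>2 + (2 * int j + 0) * n)))
      = (\<Sum>\<^sub>\<infinity>j. theta3 q * (q ^ (j * j + 0 * j) / qfac q (2 * j + 0)))"
      unfolding even b2 add_0_right theta_exp_even[OF q0] e(1)[symmetric] by (simp add: mult_ac)
    moreover have "(\<Sum>\<^sub>\<infinity>j. b ^ (2 * j + 1) * q ^ ((2 * j + 1) choose 2) / qfac q (2 * j + 1) * (\<Sum>\<^sub>\<infinity>n::int. q powi (n\<^sup>2 + (2 * int j + 1 + 0) * n)))
      = (\<Sum>\<^sub>\<infinity>j. b * theta2 q * (q ^ (j * j + 1 * j) / qfac q (2 * j + 1)))"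
      unfolding odd b2 add_0_right theta_exp_odd[OF q0] e(2)[symmetric] by (simp add: mult_ac)
    ultimately show ?thesis
      using bilateral_expand(1)[OF q q0 b, of 0] unfolding infsum_cmult_right' rr_part_def by simp
  qed
  show "(\<Sum>\<^sub>\<infinity>n::int. q powi (n\<^sup>2 - n) * qpoch_inf (- b * q powi n) q) = theta2 q * rr_part 1 0 q + b * theta3 q * rr_part 2 1 q"
    if b2: "b\<^sup>2 = q"
  proof -
    have b: "b \<noteq> 0" using that q0 by auto
    have e: "q ^ j * q powi (2 * int j * int j - int j) * q powi (-(int j - 1)\<^sup>2 - (int j - 1)) = q ^ (j * j + 1 * j)"
      "q ^ j * q powi (2 * int j * int j + int j) * q powi (-(int j)\<^sup>2) = q ^ (j * j + 2 * j)" for j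
      by (rule power_mult_powi[OF q0]; simp add: power2_eq_square algebra_simps)+
    have *: "2 * int j + - 1 = 2 * (int j - 1) + 1" "2 * int j + 1 + - 1 = 2 * int j" for j by simp_all
    have "(\<Sum>\<^sub>\<infinity>j. b ^ (2 * j) * q ^ ((2 * j) choose 2) / qfac q (2 * j) * (\<Sum>\<^sub>\<infinity>n::int. q powi (n\<^sup>2 + (2 * int j + - 1) * n)))
      = (\<Sum>\<^sub>\<infinity>j. theta2 q * (q ^ (j * j + 1 * j) / qfac q (2 * j + 0)))"
      unfolding even b2 * theta_exp_odd[OF q0] e(1)[symmetric] by (simp add: mult_ac)
    moreover have "(\<Sum>\<^sub>\<infinity>j. b ^ (2 * j + 1) * q ^ ((2 * j + 1) choose 2) / qfac q (2 * j + 1) * (\<Sum>\<^sub>\<infinity>n::int. q powi (n\<^sup>2 + (2 * int j + 1 + - 1) * n)))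
      = (\<Sum>\<^sub>\<infinity>j. b * theta3 q * (q ^ (j * j + 2 * j) / qfac q (2 * j + 1)))"
      unfolding odd b2 * theta_exp_even[OF q0] e(2)[symmetric] by (simp add: mult_ac)
    ultimately show ?thesis
      using bilateral_expand(1)[OF q q0 b, of "-1"] unfolding infsum_cmult_right' rr_part_def by simp
  qed
qed

section \<open>Product forms of theta functions, and relations between \<open>X(q)\<close> and
  \<open>X(-q)\<close>\<close>

lemma powi_power2: "((q::complex)\<^sup>2) powi m = q powi (2 * m)"
  by (simp add: power_int_mult)

lemma powi_power4: "((q::complex) ^ 4) powi m = q powi (4 * m)"
  by (simp add: power_int_mult)

lemma theta3_prod:
  assumes q: "norm q < 1" and q0: "q \<noteq> 0"
  shows "theta3 q = (qpoch_inf (-q) (-q))\<^sup>2 / qpoch_inf (q\<^sup>2) (q\<^sup>2)"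
proof -
  have q2: "norm (q\<^sup>2) < 1" using norm_square_less_1[OF q] .
  have mq: "norm (-q) < 1" using q by simp
  have t: "(-1) powi r * (q\<^sup>2) powi (r * (r - 1) div 2) * (-q) powi r = q powi (r\<^sup>2)" for r
  proof -
    have "even (r * (r - 1))" by simp
    then obtain m where m: "r * (r - 1) = 2 * m" by (rule evenE)
    have "(-q) powi r = (-1) powi r * q powi r" by (metis mult_minus1 power_int_mult_distrib)
    then have "(-1) powi r * (q\<^sup>2) powi (r * (r - 1) div 2) * (-q) powi r = q powi (2 * m) * q powi r"
      using m by (simp add: powi_power2 power_int_minus_one_mult_self' mult_ac)
    also have "\<dots> = q powi (2 * m + r)" using q0 by (simp add: power_int_add)
    also have "2 * m + r = r\<^sup>2" using m by (simp add: power2_eq_square algebra_simps)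
    finally show ?thesis .
  qed
  have "theta3 q = qpoch_inf (-q) (q\<^sup>2) * qpoch_inf (q\<^sup>2 / (-q)) (q\<^sup>2) * qpoch_inf (q\<^sup>2) (q\<^sup>2)"
    using infsumI[OF jacobi_triple_product[OF q2, of "-q"]] q0 unfolding t by (simp add: theta3_def)
  moreover have "q\<^sup>2 / (-q) = -q" using q0 by (simp add: power2_eq_square)
  moreover have "qpoch_inf (-q) (-q) = qpoch_inf (-q) (q\<^sup>2) * qpoch_inf (q\<^sup>2) (q\<^sup>2)"
    using qpoch_inf_split[OF mq, of 2 "-q"] by (simp add: lessThan_Suc numeral_2_eq_2 mult_ac)
  moreover have "qpoch_inf (q\<^sup>2) (q\<^sup>2) \<noteq> 0" by (rule qpoch_inf_nonzero[OF q2 q2])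
  ultimately show ?thesis by (simp add: power2_eq_square)
qed

lemma theta2_prod:
  assumes q: "norm q < 1" and q0: "q \<noteq> 0"
  shows "theta2 q = 2 * (qpoch_inf (q ^ 4) (q ^ 4))\<^sup>2 / qpoch_inf (q\<^sup>2) (q\<^sup>2)"
proof -
  have q2: "norm (q\<^sup>2) < 1" using norm_square_less_1[OF q] .
  have t: "(-1) powi r * (q\<^sup>2) powi (r * (r - 1) div 2) * (-(q\<^sup>2)) powi r = q powi (r\<^sup>2 + r)" for r
  proof -
    have "even (r * (r - 1))" by simp
    then obtain m where m: "r * (r - 1) = 2 * m" by (rule evenE)
    have "(-(q\<^sup>2)) powi r = (-1) powi r * (q\<^sup>2) powi r" by (metis mult_minus1 power_int_mult_distrib)
    then have "(-1) powi r * (q\<^sup>2) powi (r * (r - 1) div 2) * (-(q\<^sup>2)) powi r = q powi (2 * m) * q powi (2 * r)"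
      using m by (simp add: powi_power2 power_int_minus_one_mult_self' mult_ac)
    also have "\<dots> = q powi (2 * m + 2 * r)" using q0 by (simp add: power_int_add)
    also have "2 * m + 2 * r = r\<^sup>2 + r" using m by (simp add: power2_eq_square algebra_simps)
    finally show ?thesis .
  qed
  have "theta2 q = qpoch_inf (-(q\<^sup>2)) (q\<^sup>2) * qpoch_inf (q\<^sup>2 / (-(q\<^sup>2))) (q\<^sup>2) * qpoch_inf (q\<^sup>2) (q\<^sup>2)"
    using infsumI[OF jacobi_triple_product[OF q2, of "-(q\<^sup>2)"]] q0 unfolding t by (simp add: theta2_def)
  moreover have "q\<^sup>2 / (-(q\<^sup>2)) = -1" using q0 by simp
  moreover have "qpoch_inf (-1) (q\<^sup>2) = 2 * qpoch_inf (-(q\<^sup>2)) (q\<^sup>2)"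
    using qpoch_inf_step[OF q2, of "-1"] by simp
  moreover have "qpoch_inf (q ^ 4) (q ^ 4) = qpoch_inf (q\<^sup>2) (q\<^sup>2) * qpoch_inf (-(q\<^sup>2)) (q\<^sup>2)"
    using qpoch_inf_mult_minus[OF q2, of "q\<^sup>2"] by simp
  moreover have "qpoch_inf (q\<^sup>2) (q\<^sup>2) \<noteq> 0" by (rule qpoch_inf_nonzero[OF q2 q2])
  ultimately show ?thesis
    by (simp only:) (simp add: power2_eq_square[of "_ * _"])
qed

text \<open>The quotient of products is \<open>\<theta>\<^sub>4(q)\<close>, and \<open>rr_series\<close> is \<open>G\<close> for \<open>s = 0\<close> and \<open>H\<close> for \<open>s = 1\<close>.\<close>

definition theta4_rr :: "nat \<Rightarrow> complex \<Rightarrow> complex" where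
  "theta4_rr s q = (qpoch_inf q q)\<^sup>2 / qpoch_inf (q\<^sup>2) (q\<^sup>2) * rr_series s q"

lemma theta4_rr_minus:
  assumes q: "norm q < 1" and q0: "q \<noteq> 0"
  shows "theta4_rr s (-q) = theta3 q * rr_series s (-q)"
  by (simp add: theta4_rr_def theta3_prod[OF q q0])

text \<open>Splitting \<open>(q; q)\<close> by residues modulo 5 cancels three of the five classes
  against the products of \<open>rogers_ramanujan\<close>.\<close>

lemma rr_series_prod:
  assumes q: "norm q < 1" and q0: "q \<noteq> 0" and s: "s \<le> 1"
  shows "rr_series s q = 1 / (qpoch_inf (q ^ (1 + s)) (q ^ 5) * qpoch_inf (q ^ (4 - s)) (q ^ 5))"
proof -
  have q5: "norm (q ^ 5) < 1" using q by (simp add: norm_power power_less_one_iff)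
  have split: "qpoch_inf q q = qpoch_inf q (q ^ 5) * qpoch_inf (q ^ 2) (q ^ 5) * qpoch_inf (q ^ 3) (q ^ 5) *
      qpoch_inf (q ^ 4) (q ^ 5) * qpoch_inf (q ^ 5) (q ^ 5)"
    using qpoch_inf_split[OF q, of 5 q] by (simp add: lessThan_Suc eval_nat_numeral mult_ac)
  have nz: "qpoch_inf (q ^ Suc i) (q ^ 5) \<noteq> 0" for i
  proof (rule qpoch_inf_nonzero[OF q5])
    have "norm q ^ Suc i \<le> norm q ^ 1" using q by (intro power_decreasing) auto
    then show "norm (q ^ Suc i) < 1" using q by (simp add: norm_power norm_mult)
  qed
  have nz': "qpoch_inf q (q ^ 5) \<noteq> 0" "qpoch_inf (q ^ 2) (q ^ 5) \<noteq> 0" "qpoch_inf (q ^ 3) (q ^ 5) \<noteq> 0"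
    "qpoch_inf (q ^ 4) (q ^ 5) \<noteq> 0" "qpoch_inf (q ^ 5) (q ^ 5) \<noteq> 0"
    using nz[of 0] nz[of 1] nz[of 2] nz[of 3] nz[of 4] by (simp_all add: eval_nat_numeral)
  consider "s = 0" | "s = 1" using s by linarith
  then show ?thesis
  proof cases
    case 1
    have "q ^ 5 / q\<^sup>2 = q ^ 3" using q0 by (simp add: field_simps flip: power_add)
    then show ?thesis
      using rogers_ramanujan[OF q q0 s] nz' by (simp add: 1 split)
  next
    case 2
    have "q ^ 5 / q ^ 4 = q" using q0 by (simp add: field_simps flip: power_Suc)
    moreover have "Suc (Suc 0) = 2" by simp
    ultimately show ?thesis
      using rogers_ramanujan[OF q q0 s] nz' by (simp add: 2 split power2_eq_square)
  qed
qed

lemma qpoch_quotient: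
  assumes q: "norm q < 1"
  shows "qpoch_inf q q / qpoch_inf (-q) q = (qpoch_inf q q)\<^sup>2 / qpoch_inf (q\<^sup>2) (q\<^sup>2)"
proof -
  have "qpoch_inf (-q) q \<noteq> 0" "qpoch_inf q q \<noteq> 0" by (rule qpoch_inf_nonzero; use q in simp)+
  then show ?thesis
    unfolding qpoch_inf_mult_minus[OF q, of q, symmetric] by (simp add: power2_eq_square)
qed

text \<open>For negative \<open>n\<close> the product contains the factor \<open>1 - q ^ 0\<close>,
  so the bilateral sum stops at 0 and is a Rogers--Ramanujan series. This evaluates the case
  \<epsilon> = -1 of \<open>bilateral_sums\<close> in a second way.\<close>

lemma truncated_bilateral:
  assumes q: "norm q < 1" and q0: "q \<noteq> 0"
  shows "(\<Sum>\<^sub>\<infinity>n::int. q powi (n\<^sup>2 + int s * n) * qpoch_inf (q * q powi n) q) = qpoch_inf q q * rr_series s q"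
proof -
  have "(\<Sum>\<^sub>\<infinity>n::int. q powi (n\<^sup>2 + int s * n) * qpoch_inf (q * q powi n) q) =
      (\<Sum>\<^sub>\<infinity>n\<in>range int. q powi (n\<^sup>2 + int s * n) * qpoch_inf (q * q powi n) q)"
  proof (rule infsum_cong_neutral)
    fix n :: int
    assume "n \<in> UNIV - range int"
    then have n: "n < 0" by (metis DiffD2 nonneg_int_cases not_le rangeI)
    define j where "j = nat (- n - 1)"
    have "q * q powi n * q ^ j = q powi (1 + n + int j)" using q0 by (simp add: power_int_add)
    also have "1 + n + int j = 0" using n by (simp add: j_def)
    finally have "qpoch_inf (q * q powi n) q = 0" using qpoch_inf_eq_0_iff[OF q] by auto
    then show "q powi (n\<^sup>2 + int s * n) * qpoch_inf (q * q powi n) q = 0" by simp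
  qed auto
  also have "\<dots> = (\<Sum>\<^sub>\<infinity>n. q powi ((int n)\<^sup>2 + int s * int n) * qpoch_inf (q * q powi int n) q)"
    by (subst infsum_reindex) (auto simp: o_def)
  also have "\<dots> = (\<Sum>\<^sub>\<infinity>n. qpoch_inf q q * (q ^ (n * (n + s)) / qfac q n))"
  proof (rule infsum_cong)
    fix n :: nat
    have "(int n)\<^sup>2 + int s * int n = int (n * (n + s))" by (simp add: power2_eq_square algebra_simps)
    moreover have "qpoch_inf q q = qfac q n * qpoch_inf (q * q ^ n) q" by (rule qpoch_inf_shift[OF q])
    ultimately show "q powi ((int n)\<^sup>2 + int s * int n) * qpoch_inf (q * q powi int n) q =
      qpoch_inf q q * (q ^ (n * (n + s)) / qfac q n)"
      using qfac_nonzero[OF q, of n] by (simp only: power_int_of_nat) simp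
  qed
  finally show ?thesis unfolding infsum_cmult_right' rr_series_def .
qed

text \<open>Obtained by equating the two evaluations of the case \<epsilon> = -1 and dividing by
  \<open>(-q; q)\<close>. The products \<open>theta2 q * rr_series s (q ^ 4)\<close> are the third
  functions by which the multipliers of \<open>X(q)\<close> and \<open>X(-q)\<close> are later
  compared.\<close>

lemma theta4_rr_relations:
  assumes q: "norm q < 1" and q0: "q \<noteq> 0"
  shows "theta4_rr 0 q = theta4_rr 0 (-q) - q * theta2 q * rr_series 1 (q ^ 4)"
    "theta4_rr 1 q = theta2 q * rr_series 0 (q ^ 4) - theta4_rr 1 (-q)"
proof -
  let ?P = "qpoch_inf (-q) q"
  have P: "?P \<noteq> 0" by (rule qpoch_inf_nonzero) (use q in auto)
  have "qpoch_inf q q * rr_series 0 q = ?P * (theta4_rr 0 (-q) - q * theta2 q * rr_series 1 (q ^ 4))"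
    using truncated_bilateral[OF q q0, of 0] bilateral_sums(1)[OF q q0, of "-1"]
    unfolding rr_part_eval[OF q q0] theta4_rr_minus[OF q q0] by (simp add: algebra_simps)
  then have "qpoch_inf q q / ?P * rr_series 0 q = theta4_rr 0 (-q) - q * theta2 q * rr_series 1 (q ^ 4)"
    using P by (simp add: field_simps)
  then show "theta4_rr 0 q = theta4_rr 0 (-q) - q * theta2 q * rr_series 1 (q ^ 4)"
    unfolding qpoch_quotient[OF q] theta4_rr_def[of 0 q] .
  have "qpoch_inf q q * rr_series 1 q = ?P * (theta2 q * rr_series 0 (q ^ 4) - theta4_rr 1 (-q))"
    using truncated_bilateral[OF q q0, of 1] bilateral_sums(2)[OF q q0, of "-1"]
    unfolding rr_part_eval[OF q q0] theta4_rr_minus[OF q q0] by (simp add: algebra_simps)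
  then have "qpoch_inf q q / ?P * rr_series 1 q = theta2 q * rr_series 0 (q ^ 4) - theta4_rr 1 (-q)"
    using P by (simp add: field_simps)
  then show "theta4_rr 1 q = theta2 q * rr_series 0 (q ^ 4) - theta4_rr 1 (-q)"
    unfolding qpoch_quotient[OF q] theta4_rr_def[of 1 q] .
qed

section \<open>Reflection of the summands and closed forms of the bilateral series\<close>

lemma qpoch_inf_quasiperiodic:
  fixes n :: int
  assumes q: "norm q < 1" and q0: "q \<noteq> 0" and a0: "a \<noteq> 0" and a: "\<And>n::int. a * q powi n \<noteq> 1"
  shows "qpoch_inf (a * q powi n) q * qpoch_inf (q / a * q powi (-n)) q * ((-a) powi n * q powi (n * (n - 1) div 2)) =
    qpoch_inf a q * qpoch_inf (q / a) q"
proof -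
  \<comment> \<open>\<open>T n\<close> is the theta product at \<open>a * q ^ n\<close> with its
    quasi-periodicity factor compensated. Passing to \<open>n + 1\<close> removes a factor
    \<open>1 - u\<close> from one product and adds \<open>1 - 1 / u\<close> to the other; the
    quotient of the two is a monomial.\<close>
  define T where "T = (\<lambda>n::int. qpoch_inf (a * q powi n) q * qpoch_inf (q / a * q powi (-n)) q * ((-a) powi n * q powi (n * (n - 1) div 2)))"
  have step: "T (n + 1) = T n" for n
  proof -
    define u where "u = a * q powi n"
    have u: "u \<noteq> 0" "u \<noteq> 1" using a0 q0 a[of n] by (auto simp: u_def)
    have 1: "a * q powi (n + 1) = u * q" "q / a * q powi (-(n+1)) = 1 / u" "q / a * q powi (- n) = 1 / u * q"
      unfolding u_def power_int_minus using q0 a0 by (simp_all add: power_int_add field_simps)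
    have 2: "(-a) powi (n + 1) = (-a) powi n * (-a)" using a0 by (simp add: power_int_add)
    have "(n + 1) * (n + 1 - 1) = 2 * n + n * (n - 1)" by (simp add: algebra_simps)
    then have "(n + 1) * (n + 1 - 1) div 2 = n + n * (n - 1) div 2" by simp
    then have 3: "q powi ((n + 1) * (n + 1 - 1) div 2) = q powi n * q powi (n * (n - 1) div 2)"
      using q0 by (simp add: power_int_add)
    have 4: "qpoch_inf u q = (1 - u) * qpoch_inf (u * q) q" "qpoch_inf (1 / u) q = (1 - 1 / u) * qpoch_inf (1 / u * q) q"
      by (rule qpoch_inf_step[OF q])+
    have "T (n + 1) = qpoch_inf (u * q) q * ((1 - 1 / u) * (- u)) * qpoch_inf (1 / u * q) q * ((-a) powi n * q powi (n * (n - 1) div 2))"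
      unfolding T_def 1 2 3 4 by (simp add: u_def mult_ac)
    moreover have "(1 - 1 / u) * (- u) = 1 - u" using u by (simp add: field_simps)
    ultimately show ?thesis unfolding T_def 1 u_def[symmetric] 4 using u by (simp add: mult_ac field_simps)
  qed
  have "T n = T 0"
  proof (induction n rule: int_induct[where k = 0])
    case (step1 i)
    then show ?case using step[of i] by simp
  next
    case (step2 i)
    then show ?case using step[of "i - 1"] by simp
  qed simp
  then show ?thesis by (simp add: T_def)
qed

lemma minus_powi_neq_1:
  fixes q :: complex
  assumes q: "norm q < 1" and q0: "q \<noteq> 0"
  shows "- (q powi n) \<noteq> 1"
proof
  assume h: "- (q powi n) = 1"
  have n0: "n \<noteq> 0"
  proof
    assume "n = 0"
    with h have "- (1::complex) = 1" by (simp only: power_int_0_right)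
    then show False by (metis one_neq_neg_one)
  qed
  have "norm q powr of_int n = 1"
    using arg_cong[OF h, of norm] powi_eq_powr[OF q0, of n] by simp
  then show False using q q0 n0 by (simp add: powr_def)
qed

text \<open>Quasi-periodicity moves the product with index \<open>n\<close> from the denominator to
  the numerator, where the reversed index \<open>m = - n - 1\<close> appears. The offset 1 comes
  from \<open>q / (-q) = -1\<close>, the factor 2 from \<open>(-1; q) = 2 (-q; q)\<close>.\<close>

lemma psi_term_eq:
  assumes q: "norm q < 1" and q0: "q \<noteq> 0"
  shows "psi0_term (- m - 1) q = q powi (m\<^sup>2) * qpoch_inf (- q * q powi m) q / (2 * qpoch_inf (-q) q)"
    "psi1_term (- m - 1) q = q powi (m\<^sup>2 + m) * qpoch_inf (- q * q powi m) q / (2 * qpoch_inf (-q) q)"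
proof -
  define n where "n = - m - 1"
  let ?P = "qpoch_inf (-q) q"
  have P: "?P \<noteq> 0" by (rule qpoch_inf_nonzero) (use q in auto)
  have a: "- q * q powi n \<noteq> 1" for n
  proof -
    have "- q * q powi n = - (q powi (n + 1))" using q0 by (simp add: power_int_add)
    then show ?thesis using minus_powi_neq_1[OF q q0] by metis
  qed
  have P1: "qpoch_inf (q / (-q)) q = 2 * ?P"
    using q0 qpoch_inf_step[OF q, of "-1"] by simp
  have T: "qpoch_inf (-q * q powi n) q * qpoch_inf (q / (-q) * q powi (-n)) q * (q powi n * q powi (n * (n - 1) div 2)) = 2 * ?P * ?P"
    using qpoch_inf_quasiperiodic[OF q q0, of "-q" n] q0 a unfolding P1 by (simp add: mult_ac)
  have e: "q / (-q) * q powi (-n) = - q * q powi m" using q0 by (simp add: n_def power_int_add)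
  define A B where "A = qpoch_inf (-q * q powi n) q" and "B = qpoch_inf (- q * q powi m) q"
  have T': "A * B * (q powi n * q powi (n * (n - 1) div 2)) = 2 * ?P * ?P"
    using T unfolding e A_def B_def .
  then have A0: "A \<noteq> 0" using P by auto
  have key: "?P / A = q powi (n + n * (n - 1) div 2) * B / (2 * ?P)"
    using T' A0 P q0 by (simp add: field_simps power_int_add)
  have qp: "qpoch (-q) q n = ?P / A" by (simp add: qpoch_def A_def)
  have "even (n * (n - 1))" by simp
  then obtain t where t: "n * (n - 1) = 2 * t" by (rule evenE)
  have t1: "(n + 1) * (n + 2) = 2 * (t + 2 * n + 1)" "n * (n + 1) = 2 * (t + n)"
    using t by (simp_all add: algebra_simps)
  have e1: "(n + 1) * (n + 2) div 2 = t + 2 * n + 1" "n * (n + 1) div 2 = t + n" "n * (n - 1) div 2 = t"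
    unfolding t1 t by simp_all
  have "t + 2 * n + 1 + (n + t) = m\<^sup>2" "t + n + (n + t) = m\<^sup>2 + m"
    using t by (simp_all add: n_def power2_eq_square algebra_simps)
  then have "q powi (t + 2 * n + 1) * q powi (n + t) = q powi (m\<^sup>2)" "q powi (t + n) * q powi (n + t) = q powi (m\<^sup>2 + m)"
    using q0 by (metis power_int_add)+
  then show "psi0_term (- m - 1) q = q powi (m\<^sup>2) * qpoch_inf (- q * q powi m) q / (2 * ?P)"
    "psi1_term (- m - 1) q = q powi (m\<^sup>2 + m) * qpoch_inf (- q * q powi m) q / (2 * ?P)"
    unfolding psi0_term_def psi1_term_def n_def[symmetric] qp key e1 B_def[symmetric]
    by (metis mult.assoc times_divide_eq_right)+
qed

text \<open>Here \<open>q\<^sup>2 / (-q)\<close> is \<open>-q\<close> again, so the reflection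
  \<open>m = - n\<close> needs neither an offset nor a factor 2.\<close>

lemma phi_term_eq:
  assumes q: "norm q < 1" and q0: "q \<noteq> 0"
  shows "phi0_term (- m) q = (q\<^sup>2) powi (m\<^sup>2) * qpoch_inf (- q * (q\<^sup>2) powi m) (q\<^sup>2) / qpoch_inf (-q) (q\<^sup>2)"
    "phi1_term (- m) q = q * ((q\<^sup>2) powi (m\<^sup>2 - m) * qpoch_inf (- q * (q\<^sup>2) powi m) (q\<^sup>2)) / qpoch_inf (-q) (q\<^sup>2)"
proof -
  define n where "n = - m"
  let ?Q = "q\<^sup>2"
  let ?P = "qpoch_inf (-q) ?Q"
  have q2: "norm ?Q < 1" using norm_square_less_1[OF q] .
  have P: "?P \<noteq> 0" by (rule qpoch_inf_nonzero) (use q q2 in auto)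
  have a: "- q * ?Q powi n \<noteq> 1" for n
  proof -
    have "- q * ?Q powi n = - (q powi (2 * n + 1))" using q0 by (simp add: power_int_add power_int_mult)
    then show ?thesis using minus_powi_neq_1[OF q q0] by metis
  qed
  have P1: "?Q / (-q) = -q" using q0 by (simp add: power2_eq_square)
  define A B where "A = qpoch_inf (-q * ?Q powi n) ?Q" and "B = qpoch_inf (- q * ?Q powi m) ?Q"
  have "even (n * (n - 1))" by simp
  then obtain t where t: "n * (n - 1) = 2 * t" by (rule evenE)
  then have t2: "n * (n - 1) div 2 = t" by simp
  have h1: "q powi n * ?Q powi t = q powi (n\<^sup>2)"
  proof -
    have "n\<^sup>2 = n + 2 * t" using t by (simp add: power2_eq_square algebra_simps)
    then show ?thesis using q0 by (simp add: power_int_add power_int_mult)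
  qed
  have B': "B = qpoch_inf (- q * ?Q powi (- n)) ?Q" by (simp add: B_def n_def)
  have T: "A * B * q powi (n\<^sup>2) = ?P * ?P"
  proof -
    have "?Q \<noteq> 0" "-q \<noteq> 0" using q0 by auto
    from qpoch_inf_quasiperiodic[OF q2 this a, of n] show ?thesis
      unfolding P1 t2 A_def B' minus_minus h1 .
  qed
  then have A0: "A \<noteq> 0" using P by auto
  have key: "?P / A = q powi (n\<^sup>2) * B / ?P"
    using T A0 P by (simp add: field_simps)
  have qp: "qpoch (-q) ?Q n = ?P / A" by (simp add: qpoch_def A_def)
  have "q powi (n\<^sup>2) * q powi (n\<^sup>2) = ?Q powi (m\<^sup>2)"
    using q0 by (simp add: n_def power_int_mult_distrib power2_eq_square[of q])
  moreover have "q powi ((n + 1)\<^sup>2) * q powi (n\<^sup>2) = q * ?Q powi (m\<^sup>2 - m)"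
  proof -
    have "(n + 1)\<^sup>2 + n\<^sup>2 = 1 + 2 * (m\<^sup>2 - m)" by (simp add: n_def power2_eq_square algebra_simps)
    then have "q powi ((n + 1)\<^sup>2) * q powi (n\<^sup>2) = q powi (1 + 2 * (m\<^sup>2 - m))"
      using q0 by (metis power_int_add)
    then show ?thesis unfolding powi_power2 using q0 by (simp add: power_int_add right_diff_distrib)
  qed
  ultimately show "phi0_term (- m) q = (q\<^sup>2) powi (m\<^sup>2) * qpoch_inf (- q * (q\<^sup>2) powi m) (q\<^sup>2) / qpoch_inf (-q) (q\<^sup>2)"
    "phi1_term (- m) q = q * ((q\<^sup>2) powi (m\<^sup>2 - m) * qpoch_inf (- q * (q\<^sup>2) powi m) (q\<^sup>2)) / qpoch_inf (-q) (q\<^sup>2)"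
    unfolding phi0_term_def phi1_term_def n_def[symmetric] qp key B_def[symmetric]
    by (metis mult.assoc times_divide_eq_right)+
qed

lemma bilateral_reindex:
  "bilateral c q = (\<Sum>\<^sub>\<infinity>m. c (- m - 1) q)" "(\<lambda>m. c (- m - 1) q) summable_on UNIV \<longleftrightarrow> (\<lambda>n. c n q) summable_on UNIV"
  "bilateral c q = (\<Sum>\<^sub>\<infinity>m. c (- m) q)" "(\<lambda>m. c (- m) q) summable_on UNIV \<longleftrightarrow> (\<lambda>n. c n q) summable_on UNIV"
proof -
  show "bilateral c q = (\<Sum>\<^sub>\<infinity>m. c (- m - 1) q)" unfolding bilateral_def
    by (rule infsum_reindex_bij_witness[of _ "\<lambda>m. - m - 1" "\<lambda>m. - m - 1"]) auto
  show "bilateral c q = (\<Sum>\<^sub>\<infinity>m. c (- m) q)" unfolding bilateral_def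
    by (rule infsum_reindex_bij_witness[of _ "\<lambda>m. - m" "\<lambda>m. - m"]) auto
  show "(\<lambda>m. c (- m - 1) q) summable_on UNIV \<longleftrightarrow> (\<lambda>n. c n q) summable_on UNIV"
    by (rule summable_on_reindex_bij_witness[of _ "\<lambda>m. - m - 1" "\<lambda>m. - m - 1"]) auto
  show "(\<lambda>m. c (- m) q) summable_on UNIV \<longleftrightarrow> (\<lambda>n. c n q) summable_on UNIV"
    by (rule summable_on_reindex_bij_witness[of _ "\<lambda>m. - m" "\<lambda>m. - m"]) auto
qed

lemma bilateral_terms_summable:
  assumes q: "norm q < 1" and q0: "q \<noteq> 0"
  shows "(\<lambda>n. psi0_term n q) summable_on UNIV" "(\<lambda>n. psi1_term n q) summable_on UNIV"
    "(\<lambda>n. phi0_term n q) summable_on UNIV" "(\<lambda>n. phi1_term n q) summable_on UNIV"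
proof -
  have q2: "norm (q\<^sup>2) < 1" "q\<^sup>2 \<noteq> 0" using norm_square_less_1[OF q] q0 by auto
  note S = bilateral_expand(2)[OF q q0 q0] bilateral_expand(2)[OF q2 q0]
  show "(\<lambda>n. psi0_term n q) summable_on UNIV"
    unfolding bilateral_reindex(2)[of psi0_term, symmetric] psi_term_eq[OF q q0]
    using summable_on_cmult_left[OF S(1)[of 0], of "1 / (2 * qpoch_inf (-q) q)"] by simp
  show "(\<lambda>n. psi1_term n q) summable_on UNIV"
    unfolding bilateral_reindex(2)[of psi1_term, symmetric] psi_term_eq[OF q q0]
    using summable_on_cmult_left[OF S(1)[of 1], of "1 / (2 * qpoch_inf (-q) q)"] by simp
  show "(\<lambda>n. phi0_term n q) summable_on UNIV"
    unfolding bilateral_reindex(4)[of phi0_term, symmetric] phi_term_eq[OF q q0]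
    using summable_on_cmult_left[OF S(2)[of 0], of "1 / qpoch_inf (-q) (q\<^sup>2)"] by simp
  show "(\<lambda>n. phi1_term n q) summable_on UNIV"
    unfolding bilateral_reindex(4)[of phi1_term, symmetric] phi_term_eq[OF q q0]
    using summable_on_cmult_left[OF S(2)[of "-1"], of "q / qpoch_inf (-q) (q\<^sup>2)"] by (simp add: mult_ac)
qed

text \<open>The case \<epsilon> = 1 of \<open>bilateral_sums\<close> contains
  \<open>theta2 q\<close> times a Rogers--Ramanujan series at \<open>q ^ 4\<close>;
  \<open>theta4_rr_relations\<close> replaces this product by \<open>X(q)\<close> and
  \<open>X(-q)\<close>.\<close>

lemma bilateral_psi:
  assumes q: "norm q < 1" and q0: "q \<noteq> 0"
  shows "bilateral psi0_term q = theta4_rr 0 (-q) - theta4_rr 0 q / 2"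
    "bilateral psi1_term q = theta4_rr 1 (-q) + theta4_rr 1 q / 2"
proof -
  let ?P = "qpoch_inf (-q) q"
  have P: "?P \<noteq> 0" by (rule qpoch_inf_nonzero) (use q in auto)
  have "bilateral psi0_term q = (\<Sum>\<^sub>\<infinity>n. q powi (n\<^sup>2) * qpoch_inf (- (1 * q) * q powi n) q * (1 / (2 * ?P)))"
    unfolding bilateral_reindex(1) psi_term_eq[OF q q0] by simp
  also have "\<dots> = (theta3 q * rr_part 1 0 q + 1 * q * theta2 q * rr_part 2 1 q) * (1 / (2 * ?P))"
    unfolding infsum_cmult_left' by (subst bilateral_sums(1)[OF q q0]) auto
  also have "\<dots> = (theta4_rr 0 (-q) + q * theta2 q * rr_series 1 (q ^ 4)) / 2"
    unfolding rr_part_eval[OF q q0] theta4_rr_minus[OF q q0] using P by (simp add: field_simps)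
  finally show "bilateral psi0_term q = theta4_rr 0 (-q) - theta4_rr 0 q / 2"
    unfolding theta4_rr_relations(1)[OF q q0] by (simp add: field_simps)
  have "bilateral psi1_term q = (\<Sum>\<^sub>\<infinity>n. q powi (n\<^sup>2 + n) * qpoch_inf (- (1 * q) * q powi n) q * (1 / (2 * ?P)))"
    unfolding bilateral_reindex(1) psi_term_eq[OF q q0] by simp
  also have "\<dots> = (theta2 q * rr_part 0 0 q + 1 * theta3 q * rr_part 1 1 q) * (1 / (2 * ?P))"
    unfolding infsum_cmult_left' by (subst bilateral_sums(2)[OF q q0]) auto
  also have "\<dots> = (theta2 q * rr_series 0 (q ^ 4) + theta4_rr 1 (-q)) / 2"
    unfolding rr_part_eval[OF q q0] theta4_rr_minus[OF q q0] using P by (simp add: field_simps)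
  finally show "bilateral psi1_term q = theta4_rr 1 (-q) + theta4_rr 1 q / 2"
    unfolding theta4_rr_relations(2)[OF q q0] by (simp add: field_simps)
qed

lemma theta3_dissection:
  assumes q: "norm q < 1" and q0: "q \<noteq> 0"
  shows "theta3 q = theta3 (q ^ 4) + q * theta2 (q ^ 4)"
proof -
  have U: "(UNIV :: int set) = range (\<lambda>n. 2 * n) \<union> range (\<lambda>n. 2 * n + 1)"
  proof (intro equalityI subsetI)
    fix x :: int
    have "x = 2 * (x div 2) \<or> x = 2 * (x div 2) + 1" by presburger
    then show "x \<in> range (\<lambda>n. 2 * n) \<union> range (\<lambda>n. 2 * n + 1)" by blast
  qed auto
  have disj: "range (\<lambda>n::int. 2 * n) \<inter> range (\<lambda>n. 2 * n + 1) = {}"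
    by (auto dest: arg_cong[where f = even])
  have s: "(\<lambda>n::int. q powi (n\<^sup>2)) summable_on A" for A
    using theta_exp_summable[OF q q0, of 0] by (auto intro: summable_on_subset_banach)
  have "(\<Sum>\<^sub>\<infinity>n\<in>range (\<lambda>n. 2 * n) \<union> range (\<lambda>n. 2 * n + 1). q powi (n\<^sup>2)) =
     (\<Sum>\<^sub>\<infinity>n\<in>range (\<lambda>n. 2 * n). q powi (n\<^sup>2)) + (\<Sum>\<^sub>\<infinity>n\<in>range (\<lambda>n. 2 * n + 1). q powi (n\<^sup>2))"
    by (rule infsum_Un_disjoint[OF s s disj])
  also have "(\<Sum>\<^sub>\<infinity>n\<in>range (\<lambda>n. 2 * n). q powi (n\<^sup>2)) = (\<Sum>\<^sub>\<infinity>n. q powi ((2 * n)\<^sup>2))"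
    by (subst infsum_reindex) (auto simp: o_def inj_def)
  also have "\<dots> = theta3 (q ^ 4)"
    unfolding theta3_def by (intro infsum_cong) (simp add: power_mult_distrib power_int_mult)
  also have "(\<Sum>\<^sub>\<infinity>n\<in>range (\<lambda>n. 2 * n + 1). q powi (n\<^sup>2)) = (\<Sum>\<^sub>\<infinity>n. q powi ((2 * n + 1)\<^sup>2))"
    by (subst infsum_reindex) (auto simp: o_def inj_def)
  also have "\<dots> = (\<Sum>\<^sub>\<infinity>n. q * (q ^ 4) powi (n\<^sup>2 + n))"
  proof (intro infsum_cong)
    fix n :: int
    have "(2 * n + 1)\<^sup>2 = 1 + 4 * (n\<^sup>2 + n)" by (simp add: power2_eq_square algebra_simps)
    then show "q powi ((2 * n + 1)\<^sup>2) = q * (q ^ 4) powi (n\<^sup>2 + n)"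
      using q0 unfolding powi_power4 by (simp add: power_int_add)
  qed
  also have "\<dots> = q * theta2 (q ^ 4)" by (simp add: infsum_cmult_right' theta2_def)
  finally show ?thesis unfolding U[symmetric] by (simp add: theta3_def)
qed

text \<open>At the argument \<open>- (q\<^sup>2)\<close> the base is \<open>q ^ 4\<close>, of which
  \<open>- (q\<^sup>2)\<close> is the square root that \<open>bilateral_sums\<close> asks for.
  Multiplying the dissections of \<open>theta3 (-q)\<close> and \<open>rr_series s q\<close>
  identifies the result as the even part of \<open>theta4_rr 0\<close>, respectively
  \<open>q\<close> times the odd part of \<open>theta4_rr 1\<close>.\<close>

lemma bilateral_phi:
  assumes q: "norm q < 1" and q0: "q \<noteq> 0"
  shows "bilateral phi0_term (-(q\<^sup>2)) = (theta4_rr 0 q + theta4_rr 0 (-q)) / 2"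
    "bilateral phi1_term (-(q\<^sup>2)) = q * (theta4_rr 1 q - theta4_rr 1 (-q)) / 2"
proof -
  define y where "y = -(q\<^sup>2)"
  have y: "norm y < 1" "y \<noteq> 0" using norm_square_less_1[OF q] q0 by (auto simp: y_def)
  have y2: "y\<^sup>2 = q ^ 4" by (simp add: y_def)
  have q4: "norm (q ^ 4) < 1" "q ^ 4 \<noteq> 0" using norm_power4_less_1[OF q] q0 by auto
  have q2: "norm (q\<^sup>2) < 1" using norm_square_less_1[OF q] .
  let ?P = "qpoch_inf (-y) (y\<^sup>2)" and ?K = "qpoch_inf (-(q\<^sup>2)) (q\<^sup>2)"
  have PK: "qpoch_inf (-y) (y\<^sup>2) * ?K = 1"
    using qpoch_inf_euler[OF q2] by (simp add: y_def)
  then have P: "?P \<noteq> 0" by auto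
  have iP: "1 / qpoch_inf (-y) (q ^ 4) = ?K" using PK P unfolding y2 by (simp add: field_simps)
  have mq: "norm (-q) < 1" "-q \<noteq> 0" using q q0 by auto
  let ?a = "theta3 (q ^ 4)" and ?b = "theta2 (q ^ 4)"
  have t3: "theta3 (-q) = ?a - q * ?b" using theta3_dissection[OF mq] by simp
  have "theta4_rr 0 q = theta3 (-q) * rr_series 0 q" using theta4_rr_minus[OF mq, of 0] by simp
  moreover have "rr_series 0 (-q) = ?K * (rr_part 0 0 (q ^ 4) - q * rr_part 1 1 (q ^ 4))" using rr_series_dissection(1)[OF mq] by simp
  ultimately have X0: "theta4_rr 0 q = (?a - q * ?b) * (?K * (rr_part 0 0 (q ^ 4) + q * rr_part 1 1 (q ^ 4)))"
    "theta4_rr 0 (-q) = (?a + q * ?b) * (?K * (rr_part 0 0 (q ^ 4) - q * rr_part 1 1 (q ^ 4)))"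
    using t3 theta3_dissection[OF q q0] rr_series_dissection(1)[OF q q0] theta4_rr_minus[OF q q0, of 0] by simp_all
  have "theta4_rr 1 q = theta3 (-q) * rr_series 1 q" using theta4_rr_minus[OF mq, of 1] by simp
  moreover have "rr_series 1 (-q) = ?K * (rr_part 1 0 (q ^ 4) - q ^ 3 * rr_part 2 1 (q ^ 4))" using rr_series_dissection(2)[OF mq] by simp
  ultimately have X1: "theta4_rr 1 q = (?a - q * ?b) * (?K * (rr_part 1 0 (q ^ 4) + q ^ 3 * rr_part 2 1 (q ^ 4)))"
    "theta4_rr 1 (-q) = (?a + q * ?b) * (?K * (rr_part 1 0 (q ^ 4) - q ^ 3 * rr_part 2 1 (q ^ 4)))"
    using t3 theta3_dissection[OF q q0] rr_series_dissection(2)[OF q q0] theta4_rr_minus[OF q q0, of 1] by simp_all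
  have "bilateral phi0_term y = (\<Sum>\<^sub>\<infinity>n. (q ^ 4) powi (n\<^sup>2) * qpoch_inf (- y * (q ^ 4) powi n) (q ^ 4) * (1 / qpoch_inf (-y) (q ^ 4)))"
    unfolding bilateral_reindex(3) phi_term_eq[OF y] y2 by simp
  also have "\<dots> = (theta3 (q ^ 4) * rr_part 0 0 (q ^ 4) + y * theta2 (q ^ 4) * rr_part 1 1 (q ^ 4)) * ?K"
    unfolding infsum_cmult_left' iP by (subst bilateral_sums(3)[OF q4]) (auto simp: y2)
  also have "\<dots> = (theta4_rr 0 q + theta4_rr 0 (-q)) / 2"
    unfolding X0 by (simp add: y_def algebra_simps power2_eq_square)
  finally show "bilateral phi0_term (-(q\<^sup>2)) = (theta4_rr 0 q + theta4_rr 0 (-q)) / 2" unfolding y_def .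
  have "bilateral phi1_term y = (\<Sum>\<^sub>\<infinity>n. (q ^ 4) powi (n\<^sup>2 - n) * qpoch_inf (- y * (q ^ 4) powi n) (q ^ 4) * (y / qpoch_inf (-y) (q ^ 4)))"
    unfolding bilateral_reindex(3) phi_term_eq[OF y] y2 by (simp add: mult_ac)
  also have "y / qpoch_inf (-y) (q ^ 4) = y * ?K" using iP by (metis times_divide_eq_right mult_1_right)
  also have "(\<Sum>\<^sub>\<infinity>n. (q ^ 4) powi (n\<^sup>2 - n) * qpoch_inf (- y * (q ^ 4) powi n) (q ^ 4) * (y * ?K)) =
      (theta2 (q ^ 4) * rr_part 1 0 (q ^ 4) + y * theta3 (q ^ 4) * rr_part 2 1 (q ^ 4)) * (y * ?K)"
    unfolding infsum_cmult_left' by (subst bilateral_sums(4)[OF q4]) (auto simp: y2)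
  also have "\<dots> = q * (theta4_rr 1 q - theta4_rr 1 (-q)) / 2"
    unfolding X1 by (simp add: y_def algebra_simps power2_eq_square power3_eq_cube)
  finally show "bilateral phi1_term (-(q\<^sup>2)) = q * (theta4_rr 1 q - theta4_rr 1 (-q)) / 2" unfolding y_def .
qed

section \<open>Siegel functions\<close>

text \<open>This is \<open>e(z / 2)\<close>. Half-integral powers of \<open>q\<close> occur
  throughout, and with it no square root has to be chosen.\<close>

definition ee :: "complex \<Rightarrow> complex" where
  "ee z = exp (of_real pi * \<i> * z)"

lemma ee_add: "ee (x + y) = ee x * ee y"
  by (simp add: ee_def ring_distribs exp_add)

lemma ee_0 [simp]: "ee 0 = 1" by (simp add: ee_def)

lemma ee_nonzero [simp]: "ee z \<noteq> 0" by (simp add: ee_def)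

lemma ee_1 [simp]: "ee 1 = -1"
  using exp_pi_i by (simp add: ee_def)

lemma ee_minus: "ee (- z) = 1 / ee z"
  by (simp add: ee_def exp_minus inverse_eq_divide)

lemma ee_diff: "ee (x - y) = ee x / ee y"
  by (simp add: ee_def ring_distribs exp_diff)

lemma norm_ee: "norm (ee z) = exp (- pi * Im z)"
  by (simp add: ee_def)

lemma norm_ee_of_real [simp]: "Im z = 0 \<Longrightarrow> norm (ee z) = 1"
  by (simp add: norm_ee)

lemma ee_power: "ee z ^ n = ee (of_nat n * z)"
  by (simp add: ee_def exp_of_nat_mult[symmetric] mult_ac)

lemma qexp_ee: "qexp z = ee (2 * z)"
  by (simp add: ee_def mult_ac)

lemma qexp_add: "qexp (x + y) = qexp x * qexp y"
  by (simp add: ring_distribs exp_add)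

lemma qexp_of_int [simp]: "qexp (of_int n) = 1"
  unfolding exp_eq_1 by (auto intro!: exI[of _ n])

lemma qexp_1: "qexp 1 = 1"
  using qexp_of_int[of 1] by simp

lemma norm_qexp_less_1: "Im z > 0 \<Longrightarrow> norm (qexp z) < 1"
  by simp

lemma qexp_eq_1D:
  assumes "qexp z = 1" obtains n :: int where "z = of_int n"
proof -
  from assms obtain n :: int where n: "Re (2 * of_real pi * \<i> * z) = 0" "Im (2 * of_real pi * \<i> * z) = of_int (2 * n) * pi"
    unfolding exp_eq_1 by blast
  then have "z = of_int n" by (simp add: complex_eq_iff)
  then show ?thesis by (rule that)
qed

text \<open>Up to a constant, Jacobi's odd theta function without the factors
  \<open>q ^ (1 / 8)\<close> and \<open>(q; q)\<close>. The factor \<open>ee (- z)\<close> is what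
  makes it odd.\<close>

definition theta :: "complex \<Rightarrow> complex \<Rightarrow> complex" where
  "theta z \<tau> = ee (- z) * qpoch_inf (qexp z) (qexp \<tau>) * qpoch_inf (qexp (\<tau> - z)) (qexp \<tau>)"

lemma theta_factor:
  assumes "Im \<tau> > 0"
  shows "theta z \<tau> = ee (- z) * (1 - qexp z) * (qpoch_inf (qexp (\<tau> + z)) (qexp \<tau>) * qpoch_inf (qexp (\<tau> - z)) (qexp \<tau>))"
  using qpoch_inf_step[OF norm_qexp_less_1[OF assms], of "qexp z"]
  by (simp add: theta_def qexp_add[symmetric] add.commute del: exp_eq_1)

lemma theta_minus:
  assumes "Im \<tau> > 0"
  shows "theta (- z) \<tau> = - theta z \<tau>"
proof -
  have "ee z * (1 - qexp (- z)) = - (ee (- z) * (1 - qexp z))"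
    unfolding qexp_ee by (simp add: algebra_simps flip: ee_add)
  then show ?thesis unfolding theta_factor[OF assms] by (simp add: mult_ac)
qed

lemma theta_add_1: "theta (z + 1) \<tau> = - theta z \<tau>"
proof -
  have "ee (- (z + 1)) = - ee (- z)" by (simp add: ee_diff ee_minus)
  moreover have "qexp (z + 1) = qexp z" unfolding qexp_add qexp_1 by simp
  moreover have "qexp (\<tau> - (z + 1)) = qexp (\<tau> - z)"
  proof -
    have "qexp (\<tau> - z) = qexp ((\<tau> - (z + 1)) + 1)" by (simp add: algebra_simps)
    then show ?thesis unfolding qexp_add[of _ 1] qexp_1 by simp
  qed
  ultimately show ?thesis unfolding theta_def by simp
qed

lemma theta_add_tau:
  assumes "Im \<tau> > 0"
  shows "theta (z + \<tau>) \<tau> = - ee (- \<tau> - 2 * z) * theta z \<tau>"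
proof -
  have e: "z + \<tau> = \<tau> + z" "- (\<tau> + z) = - z - \<tau>" "\<tau> - (\<tau> + z) = - z" by simp_all
  have "theta (z + \<tau>) \<tau> = ee (- z - \<tau>) * qpoch_inf (qexp (\<tau> + z)) (qexp \<tau>) * qpoch_inf (qexp (- z)) (qexp \<tau>)"
    unfolding theta_def e ..
  also have "qpoch_inf (qexp (- z)) (qexp \<tau>) = (1 - qexp (- z)) * qpoch_inf (qexp (\<tau> - z)) (qexp \<tau>)"
    using qpoch_inf_step[OF norm_qexp_less_1[OF assms], of "qexp (- z)"] qexp_add[of "-z" \<tau>] by simp
  finally have f1: "theta (z + \<tau>) \<tau> = ee (- z - \<tau>) * (1 - qexp (- z)) * (qpoch_inf (qexp (\<tau> + z)) (qexp \<tau>) * qpoch_inf (qexp (\<tau> - z)) (qexp \<tau>))"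
    by (simp only: mult_ac)
  have f2: "ee (- z - \<tau>) * (1 - qexp (- z)) = - ee (- \<tau> - 2 * z) * (ee (- z) * (1 - qexp z))"
  proof -
    have "ee (- \<tau> - 2 * z) * ee (- z) * qexp z = ee (- z - \<tau>)" "ee (- z - \<tau>) * qexp (- z) = ee (- \<tau> - 2 * z) * ee (- z)"
      unfolding qexp_ee ee_add[symmetric] by (rule arg_cong[where f = ee], simp)+
    moreover have "A * (1 - B) = - C * (D * (1 - E))" if "C * D * E = A" "A * B = C * D" for A B C D E :: complex
      using that by (simp add: algebra_simps)
    ultimately show ?thesis by blast
  qed
  show ?thesis unfolding f1 f2 theta_factor[OF assms, of z] by (simp only: mult.assoc)
qed

lemma theta_tau_add_int: "theta z (\<tau> + of_int n) = theta z \<tau>"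
proof -
  have 1: "qexp (\<tau> + of_int n) = qexp \<tau>" unfolding qexp_add qexp_of_int by simp
  have "\<tau> + of_int n - z = (\<tau> - z) + of_int n" by simp
  then have 2: "qexp (\<tau> + of_int n - z) = qexp (\<tau> - z)" by (metis qexp_add qexp_of_int mult_1_right)
  show ?thesis unfolding theta_def 1 2 ..
qed

lemma theta_eq_0D:
  assumes "Im \<tau> > 0" "theta z \<tau> = 0"
  obtains m n :: int where "z = of_int m * \<tau> + of_int n"
proof -
  have pw: "qexp x * qexp \<tau> ^ j = qexp (x + of_nat j * \<tau>)" for x j
    unfolding qexp_ee ee_power ee_add[symmetric] by (simp add: algebra_simps)
  have "qpoch_inf (qexp z) (qexp \<tau>) = 0 \<or> qpoch_inf (qexp (\<tau> - z)) (qexp \<tau>) = 0"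
    using assms by (simp add: theta_def)
  then show ?thesis
  proof
    assume "qpoch_inf (qexp z) (qexp \<tau>) = 0"
    then obtain j where "qexp (z + of_nat j * \<tau>) = 1"
      unfolding qpoch_inf_eq_0_iff[OF norm_qexp_less_1[OF assms(1)]] pw by blast
    then obtain n where "z + of_nat j * \<tau> = of_int n" using qexp_eq_1D by blast
    then have "z = of_int (- int j) * \<tau> + of_int n" by (simp add: algebra_simps)
    then show ?thesis by (rule that)
  next
    assume "qpoch_inf (qexp (\<tau> - z)) (qexp \<tau>) = 0"
    then obtain j where "qexp (\<tau> - z + of_nat j * \<tau>) = 1"
      unfolding qpoch_inf_eq_0_iff[OF norm_qexp_less_1[OF assms(1)]] pw by blast
    then obtain n where "\<tau> - z + of_nat j * \<tau> = of_int n" using qexp_eq_1D by blast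
    then have "z = of_int (int j + 1) * \<tau> + of_int (- n)" by (simp add: algebra_simps)
    then show ?thesis by (rule that)
  qed
qed

lemma ee_holomorphic [holomorphic_intros]: "f holomorphic_on S \<Longrightarrow> (\<lambda>z. ee (f z)) holomorphic_on S"
  unfolding ee_def by (intro holomorphic_intros)

lemma theta_holomorphic:
  assumes "open S" "f holomorphic_on S" "g holomorphic_on S" "\<And>z. z \<in> S \<Longrightarrow> Im (g z) > 0"
  shows "(\<lambda>z. theta (f z) (g z)) holomorphic_on S"
  unfolding theta_def
  by (intro holomorphic_intros qpoch_inf_holomorphic assms norm_qexp_less_1)

section \<open>Inversion of theta and eta functions\<close>

lemma holomorphic_UNIV_imp_derivative:
  assumes "f holomorphic_on UNIV" shows "\<exists>D. (f has_field_derivative D) (at x)"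
  using holomorphic_on_imp_differentiable_at[OF assms open_UNIV] by (auto simp: field_differentiable_def)

text \<open>The derivative at the zero brings in the square of \<open>(q; q)\<close>. In this way
  the inversion formula of theta will contain the one of the squared eta function.\<close>

lemma theta_deriv_0:
  assumes "Im \<tau> > 0"
  shows "((\<lambda>z. theta z \<tau>) has_field_derivative - 2 * of_real pi * \<i> * (qpoch_inf (qexp \<tau>) (qexp \<tau>))\<^sup>2) (at 0)"
proof -
  let ?R = "\<lambda>z. qpoch_inf (qexp (\<tau> + z)) (qexp \<tau>) * qpoch_inf (qexp (\<tau> - z)) (qexp \<tau>)"
  have "?R holomorphic_on UNIV"
    by (intro holomorphic_intros qpoch_inf_holomorphic norm_qexp_less_1 assms) auto
  then obtain R' where R': "(?R has_field_derivative R') (at 0)"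
    using holomorphic_UNIV_imp_derivative by blast
  have "(\<lambda>z. ee (- z)) holomorphic_on UNIV" by (intro holomorphic_intros)
  then obtain D where D: "((\<lambda>z. ee (- z)) has_field_derivative D) (at 0)"
    using holomorphic_UNIV_imp_derivative by blast
  have "((\<lambda>z. 2 * of_real pi * \<i> * z) has_field_derivative 2 * of_real pi * \<i>) (at 0)"
    using DERIV_cmult[OF DERIV_ident, of "2 * of_real pi * \<i>" 0 UNIV] by simp
  from DERIV_diff[OF DERIV_const DERIV_fun_exp[OF this], of 1]
  have "((\<lambda>z. 1 - qexp z) has_field_derivative - 2 * of_real pi * \<i>) (at 0)"
    by simp
  from DERIV_mult[OF D this]
  have "((\<lambda>z. ee (- z) * (1 - qexp z)) has_field_derivative - 2 * of_real pi * \<i>) (at 0)"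
    by simp
  from DERIV_mult[OF this R'] show ?thesis
    unfolding theta_factor[OF assms] by (simp add: power2_eq_square)
qed

text \<open>The quotient \<open>f / g\<close> is doubly periodic. Its singularities can only lie at
  the lattice points, hence, modulo the periods, at 0, where \<open>f\<close> vanishes and
  \<open>g\<close> has a simple zero. They are therefore removable, and Liouville's theorem
  applies.\<close>

lemma quasiperiodic_proportional:
  fixes f g u v :: "complex \<Rightarrow> complex"
  assumes \<tau>: "Im \<tau> > 0"
    and f: "f holomorphic_on UNIV" and g: "g holomorphic_on UNIV"
    and f0: "f 0 = 0" and g0: "g 0 = 0" and g': "deriv g 0 \<noteq> 0"
    and zeros: "\<And>z. g z = 0 \<Longrightarrow> \<exists>m n :: int. z = of_int m * \<tau> + of_int n"
    and per1: "\<And>z. f (z + 1) = u z * f z" "\<And>z. g (z + 1) = u z * g z" "\<And>z. u z \<noteq> 0"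
    and per2: "\<And>z. f (z + \<tau>) = v z * f z" "\<And>z. g (z + \<tau>) = v z * g z" "\<And>z. v z \<noteq> 0"
  shows "\<exists>C. \<forall>z. f z = C * g z"
proof -
  define L where "L = deriv f 0 / deriv g 0"
  \<comment> \<open>The quotient is completed by its limit at 0; using the same value at every zero
    of \<open>g\<close> keeps it periodic.\<close>
  define Q where "Q = (\<lambda>z. if g z = 0 then L else f z / g z)"
  have fd: "(f has_field_derivative deriv f z) (at z)" "(g has_field_derivative deriv g z) (at z)" for z
    using holomorphic_derivI[OF f open_UNIV] holomorphic_derivI[OF g open_UNIV] by auto
  have gc: "continuous_on UNIV g" by (rule holomorphic_on_imp_continuous_on[OF g])
  have Q1: "Q (z + 1) = Q z" and Q2: "Q (z + \<tau>) = Q z" for z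
    using per1 per2 by (auto simp: Q_def)
  have Qm: "Q (z + of_int m * \<tau>) = Q z" for z m
  proof (induction m rule: int_induct[where k = 0])
    case (step1 i)
    then show ?case using Q2[of "z + of_int i * \<tau>"] by (simp add: algebra_simps)
  next
    case (step2 i)
    then show ?case using Q2[of "z + of_int (i - 1) * \<tau>"] by (simp add: algebra_simps)
  qed simp
  have Qn: "Q (z + of_int n) = Q z" for z n
  proof (induction n rule: int_induct[where k = 0])
    case (step1 i)
    then show ?case using Q1[of "z + of_int i"] by (simp add: algebra_simps)
  next
    case (step2 i)
    then show ?case using Q1[of "z + of_int (i - 1)"] by (simp add: algebra_simps)
  qed simp
  have Qmn: "Q (z + (of_int m * \<tau> + of_int n)) = Q z" for z m n
    using Qn[of "z + of_int m * \<tau>" n] Qm[of z m] by (simp add: add.assoc)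
  have lim0: "(Q \<longlongrightarrow> L) (at 0)"
  proof -
    have "((\<lambda>w. f w / g w) \<longlongrightarrow> L) (at 0)"
      unfolding L_def by (rule lhopital_complex_simple) (use fd f0 g0 g' in auto)
    moreover have "\<forall>\<^sub>F w in at 0. g w \<noteq> 0"
    proof -
      have "((\<lambda>w. (g w - g 0) / (w - 0)) \<longlongrightarrow> deriv g 0) (at 0)"
        using fd(2)[of 0] by (simp add: has_field_derivative_iff)
      then have "\<forall>\<^sub>F w in at 0. (g w - g 0) / (w - 0) \<noteq> 0"
        using g' by (rule tendsto_imp_eventually_ne)
      then show ?thesis by eventually_elim (auto simp: g0)
    qed
    ultimately show ?thesis
      by (rule Lim_transform_eventually[OF _ eventually_mono]) (auto simp: Q_def)
  qed
  have nz_near: "\<exists>r>0. \<forall>w\<in>ball 0 r - {0}. g w \<noteq> 0"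
  proof -
    have "((\<lambda>w. (g w - g 0) / (w - 0)) \<longlongrightarrow> deriv g 0) (at 0)"
      using fd(2)[of 0] by (simp add: has_field_derivative_iff)
    then have "\<forall>\<^sub>F w in at 0. (g w - g 0) / (w - 0) \<noteq> 0"
      using g' by (rule tendsto_imp_eventually_ne)
    then obtain d where "d > 0" "\<And>w. w \<noteq> 0 \<Longrightarrow> dist w 0 < d \<Longrightarrow> (g w - g 0) / (w - 0) \<noteq> 0"
      unfolding eventually_at by blast
    then show ?thesis by (intro exI[of _ d]) (auto simp: g0 dist_commute)
  qed
  obtain r where r: "r > 0" "\<And>w. w \<in> ball 0 r - {0} \<Longrightarrow> g w \<noteq> 0" using nz_near by blast
  have hol0: "Q holomorphic_on ball 0 r"
  proof (rule no_isolated_singularity[where K = "{0}"])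
    have "(\<lambda>w. f w / g w) holomorphic_on ball 0 r - {0}"
      by (intro holomorphic_intros holomorphic_on_subset[OF f] holomorphic_on_subset[OF g]) (use r in auto)
    then show hp: "Q holomorphic_on ball 0 r - {0}"
      by (rule holomorphic_transform) (use r in \<open>auto simp: Q_def\<close>)
    show "continuous_on (ball 0 r) Q"
    proof (rule continuous_at_imp_continuous_on, rule ballI)
      fix w :: complex assume w: "w \<in> ball 0 r"
      show "isCont Q w"
      proof (cases "w = 0")
        case True
        then show ?thesis using lim0 by (simp add: isCont_def Q_def g0)
      next
        case False
        have "open (ball 0 r - {0 :: complex})" by (simp add: open_delete)
        then show ?thesis
          using holomorphic_on_imp_continuous_on[OF hp] w False by (auto simp: continuous_on_eq_continuous_at)
      qed
    qed
  qed auto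
  have "Q field_differentiable at z" for z
  proof (cases "g z = 0")
    case False
    have op: "open {w. g w \<noteq> 0}"
      using continuous_on_open_vimage[of UNIV g] gc open_delete[of UNIV] open_Collect_neq[OF gc continuous_on_const] by blast
    have "(\<lambda>w. f w / g w) holomorphic_on {w. g w \<noteq> 0}"
      by (intro holomorphic_intros holomorphic_on_subset[OF f] holomorphic_on_subset[OF g]) auto
    then have "Q holomorphic_on {w. g w \<noteq> 0}"
      by (rule holomorphic_transform) (auto simp: Q_def)
    then show ?thesis using op False holomorphic_on_imp_differentiable_at by blast
  next
    case True
    then obtain m n :: int where z: "z = of_int m * \<tau> + of_int n" using zeros by blast
    have "Q = (\<lambda>w. Q (w - z))"
    proof
      fix w show "Q w = Q (w - z)" using Qmn[of "w - z" m n] z by simp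
    qed
    moreover have "(\<lambda>w. Q (w - z)) field_differentiable at z"
    proof -
      have "Q field_differentiable at (z - z)"
        using hol0 r by (intro holomorphic_on_imp_differentiable_at[OF _ open_ball]) auto
      moreover have "(\<lambda>w. w - z) field_differentiable at z" by (intro derivative_intros)
      ultimately show ?thesis
        using field_differentiable_compose[of "\<lambda>w. w - z" z Q] by (simp add: o_def)
    qed
    ultimately show ?thesis by simp
  qed
  then have Qh: "Q holomorphic_on UNIV"
    by (auto simp: holomorphic_on_def field_differentiable_at_within)
  \<comment> \<open>By periodicity all values occur on a fundamental parallelogram, which lies in
    the disc of radius \<open>norm \<tau> + 1\<close>.\<close>
  have "bounded (range Q)"
  proof -
    have "bounded (Q ` cball 0 (norm \<tau> + 1))"
      by (intro compact_imp_bounded compact_continuous_image holomorphic_on_imp_continuous_on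
          holomorphic_on_subset[OF Qh]) auto
    moreover have "range Q \<subseteq> Q ` cball 0 (norm \<tau> + 1)"
    proof
      fix y assume "y \<in> range Q"
      then obtain z where y: "y = Q z" by blast
      define a where "a = Im z / Im \<tau>"
      define b where "b = Re (z - of_real a * \<tau>)"
      have z: "z = of_real a * \<tau> + of_real b" using \<tau> by (simp add: complex_eq_iff a_def b_def)
      define w where "w = of_real (frac a) * \<tau> + of_real (frac b)"
      have "z = w + (of_int \<lfloor>a\<rfloor> * \<tau> + of_int \<lfloor>b\<rfloor>)"
      proof -
        have "of_real a = (of_real (frac a) + of_int \<lfloor>a\<rfloor> :: complex)" "of_real b = (of_real (frac b) + of_int \<lfloor>b\<rfloor> :: complex)"
          by (simp_all add: frac_def)
        then show ?thesis unfolding z w_def by (simp add: algebra_simps)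
      qed
      then have "y = Q w" using Qmn[of w "\<lfloor>a\<rfloor>" "\<lfloor>b\<rfloor>"] y by simp
      moreover have "norm w \<le> norm \<tau> + 1"
      proof -
        have "norm w \<le> frac a * norm \<tau> + frac b"
          unfolding w_def by (rule norm_triangle_le) (simp add: norm_mult frac_ge_0)
        also have "\<dots> \<le> 1 * norm \<tau> + 1"
          by (intro add_mono mult_right_mono) (auto intro: less_imp_le frac_lt_1)
        finally show ?thesis by simp
      qed
      ultimately show "y \<in> Q ` cball 0 (norm \<tau> + 1)" by auto
    qed
    ultimately show ?thesis by (rule bounded_subset)
  qed
  then obtain c where c: "\<And>z. Q z = c"
    using Liouville_theorem[OF Qh] by (auto simp: constant_on_def)
  have nz: "f z = c * g z" if "g z \<noteq> 0" for z
    using c[of z] that by (simp add: Q_def field_simps)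
  \<comment> \<open>The completed quotient hides the values of \<open>f\<close> at the zeros of
    \<open>g\<close>, so the identity is extended to these by continuity.\<close>
  have per: "f z = 0" if z0: "g z = 0" for z
  proof -
    have fc: "continuous_on UNIV (\<lambda>z. f z - c * g z)"
      by (intro continuous_intros gc holomorphic_on_imp_continuous_on[OF f])
    obtain m n :: int where z: "z = of_int m * \<tau> + of_int n" using zeros[OF z0] by blast
    have "(\<lambda>w. f w - c * g w) \<midarrow>z\<rightarrow> f z - c * g z"
      using fc by (auto simp: continuous_on_def)
    moreover have "\<forall>\<^sub>F w in at z. f w - c * g w = 0"
    proof -
      have iff: "g (w + (of_int m * \<tau> + of_int n)) = 0 \<longleftrightarrow> g w = 0" for w
      proof -
        have 1: "g (w + of_int m * \<tau>) = 0 \<longleftrightarrow> g w = 0" for w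
        proof (induction m rule: int_induct[where k = 0])
          case (step1 i)
          then show ?case using per2(2)[of "w + of_int i * \<tau>"] per2(3) by (simp add: algebra_simps)
        next
          case (step2 i)
          then show ?case using per2(2)[of "w + of_int (i - 1) * \<tau>"] per2(3) by (simp add: algebra_simps)
        qed simp
        have 2: "g (w + of_int n) = 0 \<longleftrightarrow> g w = 0" for w
        proof (induction n rule: int_induct[where k = 0])
          case (step1 i)
          then show ?case using per1(2)[of "w + of_int i"] per1(3) by (simp add: algebra_simps)
        next
          case (step2 i)
          then show ?case using per1(2)[of "w + of_int (i - 1)"] per1(3) by (simp add: algebra_simps)
        qed simp
        show ?thesis using 1 2[of "w + of_int m * \<tau>"] by (simp add: add.assoc)
      qed
      show ?thesis
        unfolding eventually_at
      proof (intro exI[of _ r] conjI ballI impI)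
        fix w assume w: "w \<noteq> z \<and> dist w z < r"
        then have "g (w - z) \<noteq> 0" using r(2)[of "w - z"] by (auto simp: dist_norm norm_minus_commute)
        then have "g w \<noteq> 0" using iff[of "w - z"] z by simp
        then show "f w - c * g w = 0" using nz by simp
      qed (use r in simp)
    qed
    ultimately have "f z - c * g z = 0"
      using tendsto_unique[OF at_neq_bot _ tendsto_eventually] by blast
    then show ?thesis using z0 by simp
  qed
  show ?thesis
  proof (intro exI[of _ c] allI)
    fix z show "f z = c * g z" using nz per by (cases "g z = 0") auto
  qed
qed

lemma Im_neg_inverse: "Im \<tau> > 0 \<Longrightarrow> Im (- 1 / \<tau>) > 0"
  by (auto simp: Im_divide_Reals divide_simps Im_divide power2_eq_square add_nonneg_pos)

text \<open>Inversion exchanges the periods 1 and \<tau> up to sign, and the exponential corrects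
  the difference, so both sides have the same quasi-periodicity and are proportional. Comparing
  derivatives at 0 yields the second equation with the same constant.\<close>

lemma theta_inversion:
  assumes \<tau>: "Im \<tau> > 0"
  shows "\<exists>C. (\<forall>z. theta (z / \<tau>) (- 1 / \<tau>) * ee (- (z\<^sup>2) / \<tau>) = C * theta z \<tau>) \<and>
     (qpoch_inf (qexp (- 1 / \<tau>)) (qexp (- 1 / \<tau>)))\<^sup>2 / \<tau> = C * (qpoch_inf (qexp \<tau>) (qexp \<tau>))\<^sup>2"
proof -
  define \<sigma> where "\<sigma> = - 1 / \<tau>"
  have \<sigma>: "Im \<sigma> > 0" using Im_neg_inverse[OF \<tau>] by (simp add: \<sigma>_def)
  have \<tau>0: "\<tau> \<noteq> 0" using \<tau> by auto
  define f where "f = (\<lambda>z. theta (z / \<tau>) \<sigma> * ee (- (z\<^sup>2) / \<tau>))"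
  define g where "g = (\<lambda>z. theta z \<tau>)"
  have fh: "f holomorphic_on UNIV"
    unfolding f_def by (intro holomorphic_intros theta_holomorphic) (use \<tau>0 \<sigma> in auto)
  have gh: "g holomorphic_on UNIV"
    unfolding g_def by (intro holomorphic_intros theta_holomorphic) (use \<tau> in auto)
  have t0: "theta 0 t = 0" if "Im t > 0" for t
    using theta_factor[OF that, of 0] by simp
  have dg: "(g has_field_derivative - 2 * of_real pi * \<i> * (qpoch_inf (qexp \<tau>) (qexp \<tau>))\<^sup>2) (at 0)"
    unfolding g_def by (rule theta_deriv_0[OF \<tau>])
  have df: "(f has_field_derivative - 2 * of_real pi * \<i> * (qpoch_inf (qexp \<sigma>) (qexp \<sigma>))\<^sup>2 / \<tau>) (at 0)"
  proof -
    have "((\<lambda>z. z / \<tau>) has_field_derivative 1 / \<tau>) (at 0)"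
      by (rule DERIV_cdivide[OF DERIV_ident])
    then have "((\<lambda>z. theta (z / \<tau>) \<sigma>) has_field_derivative - 2 * of_real pi * \<i> * (qpoch_inf (qexp \<sigma>) (qexp \<sigma>))\<^sup>2 * (1 / \<tau>)) (at 0)"
      by (rule DERIV_chain2[where f = "\<lambda>z. theta z \<sigma>" and g = "\<lambda>z. z / \<tau>", rotated]) (use theta_deriv_0[OF \<sigma>] in simp)
    moreover have "(\<lambda>z. ee (- (z\<^sup>2) / \<tau>)) holomorphic_on UNIV"
      by (intro holomorphic_intros) (use \<tau>0 in auto)
    then obtain D where "((\<lambda>z. ee (- (z\<^sup>2) / \<tau>)) has_field_derivative D) (at 0)"
      using holomorphic_UNIV_imp_derivative by blast
    ultimately show ?thesis
      unfolding f_def using DERIV_mult[of "\<lambda>z. theta (z / \<tau>) \<sigma>" _ 0 UNIV "\<lambda>z. ee (- (z\<^sup>2) / \<tau>)"] by (simp add: t0[OF \<sigma>])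
  qed
  have qn: "qpoch_inf (qexp \<tau>) (qexp \<tau>) \<noteq> 0"
    by (intro qpoch_inf_nonzero norm_qexp_less_1 \<tau>)
  have "\<exists>C. \<forall>z. f z = C * g z"
  proof (rule quasiperiodic_proportional[OF \<tau> fh gh, where u = "\<lambda>_. -1" and v = "\<lambda>z. - ee (- \<tau> - 2 * z)"])
    show "f 0 = 0" "g 0 = 0" using t0 \<tau> \<sigma> by (simp_all add: f_def g_def)
    show "deriv g 0 \<noteq> 0" using DERIV_imp_deriv[OF dg] qn by simp
    show "\<exists>m n :: int. z = of_int m * \<tau> + of_int n" if "g z = 0" for z
      using theta_eq_0D[OF \<tau>] that unfolding g_def by metis
    show "g (z + 1) = - 1 * g z" "g (z + \<tau>) = - ee (- \<tau> - 2 * z) * g z" for z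
      unfolding g_def using theta_add_1 theta_add_tau[OF \<tau>] by simp_all
    show "f (z + \<tau>) = - ee (- \<tau> - 2 * z) * f z" for z
    proof -
      have 1: "theta ((z + \<tau>) / \<tau>) \<sigma> = - theta (z / \<tau>) \<sigma>"
        using theta_add_1[of "z / \<tau>" \<sigma>] \<tau>0 by (simp add: add_divide_distrib)
      have "- ((z + \<tau>)\<^sup>2) / \<tau> = - (z\<^sup>2) / \<tau> + (- \<tau> - 2 * z)"
        using \<tau>0 by (simp add: power2_eq_square field_simps)
      then have 2: "ee (- ((z + \<tau>)\<^sup>2) / \<tau>) = ee (- (z\<^sup>2) / \<tau>) * ee (- \<tau> - 2 * z)"
        by (simp only: ee_add[symmetric])
      show ?thesis unfolding f_def 1 2 by (simp add: mult_ac)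
    qed
    show "f (z + 1) = - 1 * f z" for z
    proof -
      have "theta (z / \<tau>) \<sigma> = - ee (- \<sigma> - 2 * ((z + 1) / \<tau>)) * theta ((z + 1) / \<tau>) \<sigma>"
        using theta_add_tau[OF \<sigma>, of "(z + 1) / \<tau>"] \<tau>0 by (simp add: \<sigma>_def add_divide_distrib)
      moreover have "- (z\<^sup>2) / \<tau> + (- \<sigma> - 2 * ((z + 1) / \<tau>)) = - ((z + 1)\<^sup>2) / \<tau>"
        using \<tau>0 by (simp add: \<sigma>_def power2_eq_square field_simps)
      then have "ee (- (z\<^sup>2) / \<tau>) * ee (- \<sigma> - 2 * ((z + 1) / \<tau>)) = ee (- ((z + 1)\<^sup>2) / \<tau>)"
        by (simp only: ee_add[symmetric])
      ultimately show ?thesis unfolding f_def by (simp add: mult_ac)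
    qed
  qed auto
  then obtain C where C: "\<And>z. f z = C * g z" by blast
  have "f = (\<lambda>z. C * g z)" by (rule ext) (rule C)
  then have "(f has_field_derivative C * (- 2 * of_real pi * \<i> * (qpoch_inf (qexp \<tau>) (qexp \<tau>))\<^sup>2)) (at 0)"
    using DERIV_cmult[OF dg, of C] by simp
  from DERIV_unique[OF this df]
  have "(2 * of_real pi * \<i>) * ((qpoch_inf (qexp \<sigma>) (qexp \<sigma>))\<^sup>2 / \<tau>) = (2 * of_real pi * \<i>) * (C * (qpoch_inf (qexp \<tau>) (qexp \<tau>))\<^sup>2)"
    by (simp add: mult_ac)
  then have "(qpoch_inf (qexp \<sigma>) (qexp \<sigma>))\<^sup>2 / \<tau> = C * (qpoch_inf (qexp \<tau>) (qexp \<tau>))\<^sup>2"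
    unfolding mult_cancel_left by simp
  then show ?thesis using C unfolding f_def g_def \<sigma>_def by blast
qed

lemma connected_upper_half_plane: "connected upper_half_plane"
  by (intro convex_connected convex_halfspace_Im_gt)

lemma open_upper_half_plane: "open upper_half_plane"
  by (rule open_halfspace_Im_gt)

text \<open>A continuous function with finitely many values on a connected set is constant. This
  passes from a power of a function to the function itself without following a branch of the
  root.\<close>

lemma power_constant_imp_constant:
  fixes f :: "complex \<Rightarrow> complex"
  assumes S: "connected S" and f: "continuous_on S f" and n: "n > 0" and c: "\<And>z. z \<in> S \<Longrightarrow> f z ^ n = c"
  shows "\<exists>d. d ^ n = c \<and> (\<forall>z\<in>S. f z = d) \<or> S = {}"
proof (cases "S = {}")
  case False
  have "finite {x :: complex. x ^ n = c}"
    using n by (rule finite_nth_roots)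
  moreover have "f ` S \<subseteq> {x. x ^ n = c}" using c by auto
  ultimately have "f constant_on S"
    using continuous_finite_range_constant[OF S f] finite_subset by blast
  then obtain d where d: "\<And>z. z \<in> S \<Longrightarrow> f z = d" by (auto simp: constant_on_def)
  with False c show ?thesis by (metis all_not_in_conv)
qed auto

text \<open>At the half periods the two products in theta coincide. Up to exponential factors and a
  2, the three values are the squares of \<open>(-q; q)\<close>, \<open>(p; q)\<close> and
  \<open>(-p; q)\<close> with \<open>p\<^sup>2 = q\<close>, whose product is 1 by Euler's
  identity.\<close>

lemma theta_half_periods:
  assumes \<tau>: "Im \<tau> > 0"
  shows "theta (1 / 2) \<tau> * theta (\<tau> / 2) \<tau> * theta ((1 + \<tau>) / 2) \<tau> = - 2 * ee (- \<tau>)"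
    "theta (1 / 2) \<tau> \<noteq> 0"
proof -
  define p where "p = ee \<tau>"
  define q where "q = qexp \<tau>"
  have q: "norm q < 1" unfolding q_def by (rule norm_qexp_less_1[OF \<tau>])
  have p2: "p * p = q" by (simp add: p_def q_def qexp_ee flip: ee_add)
  have p: "norm p < 1" using \<tau> by (simp add: p_def norm_ee)
  have h: "qexp (1 / 2) = -1" "qexp (\<tau> / 2) = p" "qexp ((1 + \<tau>) / 2) = - p"
    "qexp (\<tau> - 1 / 2) = - q" "qexp (\<tau> - \<tau> / 2) = p" "qexp (\<tau> - (1 + \<tau>) / 2) = - p"
  proof -
    show "qexp (1 / 2) = -1" "qexp (\<tau> / 2) = p" unfolding qexp_ee p_def by simp_all
    have "qexp ((1 + \<tau>) / 2) = ee (1 + \<tau>)" unfolding qexp_ee by (rule arg_cong[where f = ee]) (simp add: field_simps)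
    then show "qexp ((1 + \<tau>) / 2) = - p" by (simp add: ee_add p_def)
    have "qexp (\<tau> - 1 / 2) = ee (2 * \<tau> - 1)" unfolding qexp_ee by (rule arg_cong[where f = ee]) (simp add: field_simps)
    then show "qexp (\<tau> - 1 / 2) = - q" by (simp add: ee_diff q_def qexp_ee)
    have "qexp (\<tau> - \<tau> / 2) = ee \<tau>" unfolding qexp_ee by (rule arg_cong[where f = ee]) (simp add: field_simps)
    then show "qexp (\<tau> - \<tau> / 2) = p" by (simp add: p_def)
    have "qexp (\<tau> - (1 + \<tau>) / 2) = ee (\<tau> - 1)" unfolding qexp_ee by (rule arg_cong[where f = ee]) (simp add: field_simps)
    then show "qexp (\<tau> - (1 + \<tau>) / 2) = - p" by (simp add: ee_diff p_def)
  qed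
  have m1: "qpoch_inf (-1) q = 2 * qpoch_inf (-q) q" using qpoch_inf_step[OF q, of "-1"] by simp
  have nz: "qpoch_inf (-q) q \<noteq> 0" by (rule qpoch_inf_nonzero) (use q in auto)
  have t1: "theta (1 / 2) \<tau> = 2 * ee (- (1 / 2)) * (qpoch_inf (-q) q)\<^sup>2"
    unfolding theta_def h q_def[symmetric] m1 by (simp add: power2_eq_square)
  then show "theta (1 / 2) \<tau> \<noteq> 0" using nz by simp
  have t2: "theta (\<tau> / 2) \<tau> = ee (- (\<tau> / 2)) * (qpoch_inf p q)\<^sup>2"
    "theta ((1 + \<tau>) / 2) \<tau> = ee (- ((1 + \<tau>) / 2)) * (qpoch_inf (-p) q)\<^sup>2"
    unfolding theta_def h q_def[symmetric] by (simp_all add: power2_eq_square)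
  have "qpoch_inf p q * qpoch_inf (-p) q = qpoch_inf q (q\<^sup>2)"
    using qpoch_inf_mult_minus[OF q, of p] p2 by (simp add: power2_eq_square)
  then have "qpoch_inf (-q) q * (qpoch_inf p q * qpoch_inf (-p) q) = 1"
    using qpoch_inf_euler[OF q] by (simp add: mult_ac)
  then have e: "(qpoch_inf (-q) q)\<^sup>2 * ((qpoch_inf p q)\<^sup>2 * (qpoch_inf (-p) q)\<^sup>2) = 1"
    by (simp flip: power_mult_distrib)
  have "ee (- (1 / 2)) * ee (- (\<tau> / 2)) * ee (- ((1 + \<tau>) / 2)) = ee (-1 - \<tau>)"
    unfolding ee_add[symmetric] by (rule arg_cong[where f = ee]) (simp add: field_simps)
  also have "\<dots> = - ee (- \<tau>)" by (simp add: ee_diff ee_minus)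
  finally have e2: "ee (- (1 / 2)) * ee (- (\<tau> / 2)) * ee (- ((1 + \<tau>) / 2)) = - ee (- \<tau>)" .
  have "theta (1 / 2) \<tau> * theta (\<tau> / 2) \<tau> * theta ((1 + \<tau>) / 2) \<tau> =
     2 * (ee (- (1 / 2)) * ee (- (\<tau> / 2)) * ee (- ((1 + \<tau>) / 2))) *
     ((qpoch_inf (-q) q)\<^sup>2 * ((qpoch_inf p q)\<^sup>2 * (qpoch_inf (-p) q)\<^sup>2))"
    unfolding t1 t2 by (simp only: mult_ac)
  then show "theta (1 / 2) \<tau> * theta (\<tau> / 2) \<tau> * theta ((1 + \<tau>) / 2) \<tau> = - 2 * ee (- \<tau>)"
    unfolding e e2 by simp
qed

text \<open>The cube of the constant in the inversion formula is found by multiplying over the three half periods.\<close>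

lemma theta_inversion_constant:
  "\<exists>\<delta>. norm \<delta> = 1 \<and> (\<forall>\<tau>. Im \<tau> > 0 \<longrightarrow>
     (\<forall>z. theta (z / \<tau>) (- 1 / \<tau>) * ee (- (z\<^sup>2) / \<tau>) = \<delta> * ee ((\<tau> + 1 / \<tau>) / 6) * theta z \<tau>) \<and>
     (qpoch_inf (qexp (- 1 / \<tau>)) (qexp (- 1 / \<tau>)))\<^sup>2 / \<tau> = \<delta> * ee ((\<tau> + 1 / \<tau>) / 6) * (qpoch_inf (qexp \<tau>) (qexp \<tau>))\<^sup>2)"
proof -
  obtain C where C: "\<And>\<tau> z. Im \<tau> > 0 \<Longrightarrow> theta (z / \<tau>) (- 1 / \<tau>) * ee (- (z\<^sup>2) / \<tau>) = C \<tau> * theta z \<tau>"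
    "\<And>\<tau>. Im \<tau> > 0 \<Longrightarrow> (qpoch_inf (qexp (- 1 / \<tau>)) (qexp (- 1 / \<tau>)))\<^sup>2 / \<tau> = C \<tau> * (qpoch_inf (qexp \<tau>) (qexp \<tau>))\<^sup>2"
    using theta_inversion by metis
  \<comment> \<open>The exponential is the discrepancy between the factors
    \<open>q ^ (1 / 12)\<close> of the squared eta function at \<tau> and at
    \<open>- 1 / \<tau>\<close>; what is left should be constant.\<close>
  define D where "D = (\<lambda>\<tau>. C \<tau> / ee ((\<tau> + 1 / \<tau>) / 6))"
  have D3: "D \<tau> ^ 3 = \<i>" if \<tau>: "Im \<tau> > 0" for \<tau>
  proof -
    define \<sigma> where "\<sigma> = - 1 / \<tau>"
    have \<sigma>: "Im \<sigma> > 0" using Im_neg_inverse[OF \<tau>] by (simp add: \<sigma>_def)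
    have \<tau>0: "\<tau> \<noteq> 0" using \<tau> by auto
    have \<sigma>': "1 / \<tau> = - \<sigma>" "\<tau> * \<sigma> = - 1" using \<tau>0 by (simp_all add: \<sigma>_def)
    \<comment> \<open>Inversion permutes the half periods up to sign and translation by a period.
      Multiplying the three equations therefore brings in \<open>theta_half_periods\<close> at
      \<tau> and at \<sigma>.\<close>
    have "theta (- (\<sigma> / 2)) \<sigma> = - theta (\<sigma> / 2) \<sigma>" by (rule theta_minus[OF \<sigma>])
    moreover have "1 / 2 / \<tau> = - (\<sigma> / 2)" by (simp add: \<sigma>_def)
    ultimately have 1: "C \<tau> * theta (1 / 2) \<tau> = - theta (\<sigma> / 2) \<sigma> * ee (- ((1 / 2)\<^sup>2) / \<tau>)"
      using C(1)[OF \<tau>, of "1 / 2"] unfolding \<sigma>_def[symmetric] by (simp only:)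
    have 2: "C \<tau> * theta (\<tau> / 2) \<tau> = theta (1 / 2) \<sigma> * ee (- ((\<tau> / 2)\<^sup>2) / \<tau>)"
      using C(1)[OF \<tau>, of "\<tau> / 2"] \<tau>0 by (simp add: \<sigma>_def)
    have "theta ((1 + \<sigma>) / 2) \<sigma> = - ee (- \<sigma> - 2 * ((1 - \<sigma>) / 2)) * theta ((1 - \<sigma>) / 2) \<sigma>"
      using theta_add_tau[OF \<sigma>, of "(1 - \<sigma>) / 2"] by (simp add: field_simps)
    also have "- \<sigma> - 2 * ((1 - \<sigma>) / 2) = - 1" by (simp add: field_simps)
    finally have "theta ((1 - \<sigma>) / 2) \<sigma> = theta ((1 + \<sigma>) / 2) \<sigma>" by (simp add: ee_minus)
    moreover have "(1 + \<tau>) / 2 / \<tau> = (1 - \<sigma>) / 2" using \<tau>0 by (simp add: \<sigma>_def field_simps)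
    ultimately have 3: "C \<tau> * theta ((1 + \<tau>) / 2) \<tau> = theta ((1 + \<sigma>) / 2) \<sigma> * ee (- (((1 + \<tau>) / 2)\<^sup>2) / \<tau>)"
      using C(1)[OF \<tau>, of "(1 + \<tau>) / 2"] unfolding \<sigma>_def[symmetric] by (simp only:)
    have e1: "ee (- ((1 / 2)\<^sup>2) / \<tau>) * ee (- ((\<tau> / 2)\<^sup>2) / \<tau>) * ee (- (((1 + \<tau>) / 2)\<^sup>2) / \<tau>) = ee (\<sigma> / 2 - \<tau> / 2 - 1 / 2)"
      unfolding ee_add[symmetric]
      by (rule arg_cong[where f = ee]) (simp add: \<sigma>_def field_simps power2_eq_square \<tau>0)
    have e2: "ee (- \<sigma>) * ee (\<sigma> / 2 - \<tau> / 2 - 1 / 2) = ee (- (1 / 2)) * ee ((\<tau> - \<sigma>) / 2) * ee (- \<tau>)"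
      unfolding ee_add[symmetric] by (rule arg_cong[where f = ee]) (simp add: field_simps)
    have e3: "ee (- (1 / 2)) = - \<i>"
    proof -
      have "ee (1 / 2) = \<i>" using cis_pi_half by (simp add: ee_def cis_conv_exp mult_ac)
      then show ?thesis by (simp add: ee_minus)
    qed
    have "C \<tau> ^ 3 * (theta (1 / 2) \<tau> * theta (\<tau> / 2) \<tau> * theta ((1 + \<tau>) / 2) \<tau>) =
       (C \<tau> * theta (1 / 2) \<tau>) * (C \<tau> * theta (\<tau> / 2) \<tau>) * (C \<tau> * theta ((1 + \<tau>) / 2) \<tau>)"
      by (simp only: power3_eq_cube mult_ac)
    moreover have "(C \<tau> * theta (1 / 2) \<tau>) * (C \<tau> * theta (\<tau> / 2) \<tau>) * (C \<tau> * theta ((1 + \<tau>) / 2) \<tau>) =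
       - (theta (1 / 2) \<sigma> * theta (\<sigma> / 2) \<sigma> * theta ((1 + \<sigma>) / 2) \<sigma>) *
       (ee (- ((1 / 2)\<^sup>2) / \<tau>) * ee (- ((\<tau> / 2)\<^sup>2) / \<tau>) * ee (- (((1 + \<tau>) / 2)\<^sup>2) / \<tau>))"
      unfolding 1 2 3 by (simp only: mult_ac mult_minus_left mult_minus_right)
    ultimately have "C \<tau> ^ 3 * (- 2 * ee (- \<tau>)) = - (- 2 * ee (- \<sigma>)) * ee (\<sigma> / 2 - \<tau> / 2 - 1 / 2)"
      unfolding theta_half_periods(1)[OF \<tau>] theta_half_periods(1)[OF \<sigma>] e1 by (rule trans)
    also have "- (- 2 * ee (- \<sigma>)) * ee (\<sigma> / 2 - \<tau> / 2 - 1 / 2) = 2 * (ee (- \<sigma>) * ee (\<sigma> / 2 - \<tau> / 2 - 1 / 2))"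
      by simp
    also have "\<dots> = (\<i> * ee ((\<tau> - \<sigma>) / 2)) * (- 2 * ee (- \<tau>))" unfolding e2 e3 by simp
    finally have C3: "C \<tau> ^ 3 = \<i> * ee ((\<tau> - \<sigma>) / 2)"
      unfolding mult_cancel_right by simp
    have "ee ((\<tau> + 1 / \<tau>) / 6) ^ 3 = ee ((\<tau> - \<sigma>) / 2)"
      unfolding ee_power \<sigma>' by (rule arg_cong[where f = ee]) simp
    then show ?thesis using C3 by (simp add: D_def power_divide)
  qed
  have "continuous_on upper_half_plane D"
  proof -
    \<comment> \<open>As theta has no zero at \<open>1 / 2\<close>, the equation at this point
      exhibits \<open>D\<close> as a holomorphic function of \<tau>.\<close>
    let ?f = "\<lambda>\<tau>. theta (1 / 2 / \<tau>) (- 1 / \<tau>) * ee (- ((1 / 2)\<^sup>2) / \<tau>) / theta (1 / 2) \<tau> / ee ((\<tau> + 1 / \<tau>) / 6)"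
    have nz: "\<tau> \<noteq> 0" if "Im \<tau> > 0" for \<tau> using that by auto
    have "?f holomorphic_on upper_half_plane"
      by (intro holomorphic_intros theta_holomorphic open_upper_half_plane)
         (use nz theta_half_periods(2) Im_neg_inverse in auto)
    then have "D holomorphic_on upper_half_plane"
    proof (rule holomorphic_transform)
      fix \<tau> assume "\<tau> \<in> upper_half_plane"
      then have \<tau>: "Im \<tau> > 0" by simp
      show "?f \<tau> = D \<tau>"
        using C(1)[OF \<tau>, of "1 / 2"] theta_half_periods(2)[OF \<tau>] by (simp add: D_def)
    qed
    then show ?thesis by (rule holomorphic_on_imp_continuous_on)
  qed
  from power_constant_imp_constant[OF connected_upper_half_plane this, of 3 \<i>]
  obtain \<delta> where \<delta>: "\<delta> ^ 3 = \<i>" "\<And>\<tau>. Im \<tau> > 0 \<Longrightarrow> D \<tau> = \<delta>"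
  proof -
    have "upper_half_plane \<noteq> {}" by (auto intro!: exI[of _ \<i>])
    then show ?thesis
      using power_constant_imp_constant[OF connected_upper_half_plane \<open>continuous_on upper_half_plane D\<close>, of 3 \<i>] D3 that
      by auto
  qed
  have "norm \<delta> ^ 3 = 1" using arg_cong[OF \<delta>(1), of norm] by (simp add: norm_power)
  then have "norm \<delta> = 1" using power_eq_imp_eq_base[of "norm \<delta>" 3 1] by simp
  moreover have Ceq: "C \<tau> = \<delta> * ee ((\<tau> + 1 / \<tau>) / 6)" if "Im \<tau> > 0" for \<tau>
    using \<delta>(2)[OF that] unfolding D_def by (simp only: nonzero_divide_eq_eq[OF ee_nonzero])
  ultimately show ?thesis
    proof (intro exI[of _ \<delta>] conjI allI impI)
    fix \<tau> z :: complex assume \<tau>: "Im \<tau> > 0"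
    show "theta (z / \<tau>) (- 1 / \<tau>) * ee (- (z\<^sup>2) / \<tau>) = \<delta> * ee ((\<tau> + 1 / \<tau>) / 6) * theta z \<tau>"
      using C(1)[OF \<tau>, of z] unfolding Ceq[OF \<tau>] .
    show "(qpoch_inf (qexp (- 1 / \<tau>)) (qexp (- 1 / \<tau>)))\<^sup>2 / \<tau> = \<delta> * ee ((\<tau> + 1 / \<tau>) / 6) * (qpoch_inf (qexp \<tau>) (qexp \<tau>))\<^sup>2"
      using C(2)[OF \<tau>] unfolding Ceq[OF \<tau>] .
  qed
qed

text \<open>The Siegel function with characteristics \<open>(a, b)\<close>, up to sign. The leading
  exponent in \<open>q\<close> is half the second Bernoulli polynomial at \<open>a\<close>; with
  this power of \<open>q\<close> the function has weight 0 and the modular group acts through the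
  characteristics.\<close>

definition siegel :: "real \<Rightarrow> real \<Rightarrow> complex \<Rightarrow> complex" where
  "siegel a b \<tau> = ee (of_real a * (of_real a * \<tau> + of_real b)) * ee (\<tau> / 6) * theta (of_real a * \<tau> + of_real b) \<tau>"

text \<open>The square of Dedekind's eta function. Its weight is 1, so its transformation law
  involves no square root.\<close>

definition eta2 :: "complex \<Rightarrow> complex" where
  "eta2 \<tau> = ee (\<tau> / 6) * (qpoch_inf (qexp \<tau>) (qexp \<tau>))\<^sup>2"

lemma siegel_translate:
  "siegel a b (\<tau> + of_int n) = ee (of_int n / 6) * siegel a (b + of_int n * a) \<tau>"
proof -
  have z: "of_real a * (\<tau> + of_int n) + of_real b = of_real a * \<tau> + of_real (b + of_int n * a)"
    by (simp add: algebra_simps)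
  show ?thesis unfolding siegel_def z theta_tau_add_int by (simp add: add_divide_distrib ee_add)
qed

lemma eta2_translate: "eta2 (\<tau> + of_int n) = ee (of_int n / 6) * eta2 \<tau>"
proof -
  have "qexp (\<tau> + of_int n) = qexp \<tau>" unfolding qexp_add qexp_of_int by simp
  then show ?thesis unfolding eta2_def by (simp add: add_divide_distrib ee_add)
qed

lemma siegel_minus:
  assumes "Im \<tau> > 0"
  shows "siegel (- a) (- b) \<tau> = - siegel a b \<tau>"
proof -
  define z where "z = of_real a * \<tau> + of_real b"
  have zm: "of_real (- a) * \<tau> + of_real (- b) = - z" by (simp add: z_def)
  show ?thesis unfolding siegel_def zm z_def[symmetric] theta_minus[OF assms] by simp
qed

lemma siegel_shift_1:
  "siegel a (b + 1) \<tau> = - ee (of_real a) * siegel a b \<tau>"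
proof -
  have z: "of_real a * \<tau> + of_real (b + 1) = (of_real a * \<tau> + of_real b) + 1" by simp
  show ?thesis unfolding siegel_def z theta_add_1 by (simp add: distrib_left ee_add)
qed

lemma siegel_shift_2:
  assumes "Im \<tau> > 0"
  shows "siegel (a + 1) b \<tau> = - ee (- of_real b) * siegel a b \<tau>"
proof -
  define z where "z = of_real a * \<tau> + of_real b"
  have z: "of_real (a + 1) * \<tau> + of_real b = z + \<tau>" by (simp add: z_def algebra_simps)
  have "ee (of_real (a + 1) * (z + \<tau>)) * ee (- \<tau> - 2 * z) = ee (- of_real b) * ee (of_real a * z)"
    unfolding ee_add[symmetric] by (rule arg_cong[where f = ee]) (simp add: z_def algebra_simps)
  then show ?thesis unfolding siegel_def z theta_add_tau[OF assms] z_def[symmetric] by simp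
qed

lemma siegel_shift:
  "\<exists>u. norm u = 1 \<and> (\<forall>\<tau>. Im \<tau> > 0 \<longrightarrow> siegel (a + of_int m) (b + of_int n) \<tau> = u * siegel a b \<tau>)"
proof -
  have 1: "\<exists>u. norm u = 1 \<and> (\<forall>\<tau>. Im \<tau> > 0 \<longrightarrow> siegel a (b + of_int n) \<tau> = u * siegel a b \<tau>)" for a b n
  proof (induction n rule: int_induct[where k = 0])
    case base
    show ?case by (intro exI[of _ 1]) simp
  next
    case (step1 i)
    then obtain u where u: "norm u = 1" "\<And>\<tau>. Im \<tau> > 0 \<Longrightarrow> siegel a (b + of_int i) \<tau> = u * siegel a b \<tau>" by blast
    have "siegel a (b + of_int (i + 1)) \<tau> = (- ee (of_real a) * u) * siegel a b \<tau>" if "Im \<tau> > 0" for \<tau>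
      using siegel_shift_1[of a "b + of_int i" \<tau>] u(2)[OF that] by (simp add: add.assoc)
    then show ?case using u(1) by (intro exI[of _ "- ee (of_real a) * u"]) (simp add: norm_mult)
  next
    case (step2 i)
    then obtain u where u: "norm u = 1" "\<And>\<tau>. Im \<tau> > 0 \<Longrightarrow> siegel a (b + of_int i) \<tau> = u * siegel a b \<tau>" by blast
    have "siegel a (b + of_int (i - 1)) \<tau> = (- u / ee (of_real a)) * siegel a b \<tau>" if "Im \<tau> > 0" for \<tau>
      using siegel_shift_1[of a "b + of_int (i - 1)" \<tau>] u(2)[OF that] by (simp add: field_simps)
    then show ?case using u(1) by (intro exI[of _ "- u / ee (of_real a)"]) (simp add: norm_mult norm_divide)
  qed
  have 2: "\<exists>u. norm u = 1 \<and> (\<forall>\<tau>. Im \<tau> > 0 \<longrightarrow> siegel (a + of_int m) b \<tau> = u * siegel a b \<tau>)" for a b m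
  proof (induction m rule: int_induct[where k = 0])
    case base
    show ?case by (intro exI[of _ 1]) simp
  next
    case (step1 i)
    then obtain u where u: "norm u = 1" "\<And>\<tau>. Im \<tau> > 0 \<Longrightarrow> siegel (a + of_int i) b \<tau> = u * siegel a b \<tau>" by blast
    have "siegel (a + of_int (i + 1)) b \<tau> = (- ee (- of_real b) * u) * siegel a b \<tau>" if "Im \<tau> > 0" for \<tau>
      using siegel_shift_2[OF that, of "a + of_int i" b] u(2)[OF that] by (simp add: add.assoc)
    then show ?case using u(1) by (intro exI[of _ "- ee (- of_real b) * u"]) (simp add: norm_mult)
  next
    case (step2 i)
    then obtain u where u: "norm u = 1" "\<And>\<tau>. Im \<tau> > 0 \<Longrightarrow> siegel (a + of_int i) b \<tau> = u * siegel a b \<tau>" by blast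
    have "siegel (a + of_int (i - 1)) b \<tau> = (- u / ee (- of_real b)) * siegel a b \<tau>" if "Im \<tau> > 0" for \<tau>
      using siegel_shift_2[OF that, of "a + of_int (i - 1)" b] u(2)[OF that] by (simp add: field_simps)
    then show ?case using u(1) by (intro exI[of _ "- u / ee (- of_real b)"]) (simp add: norm_mult norm_divide)
  qed
  obtain u1 where u1: "norm u1 = 1" "\<And>\<tau>. Im \<tau> > 0 \<Longrightarrow> siegel (a + of_int m) (b + of_int n) \<tau> = u1 * siegel (a + of_int m) b \<tau>"
    using 1[of "a + of_int m" b n] by blast
  obtain u2 where u2: "norm u2 = 1" "\<And>\<tau>. Im \<tau> > 0 \<Longrightarrow> siegel (a + of_int m) b \<tau> = u2 * siegel a b \<tau>"
    using 2[of a m b] by blast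
  show ?thesis using u1 u2 by (intro exI[of _ "u1 * u2"]) (simp add: norm_mult)
qed

definition mob :: "int \<Rightarrow> int \<Rightarrow> int \<Rightarrow> int \<Rightarrow> complex \<Rightarrow> complex" where
  "mob a b c d \<tau> = (of_int a * \<tau> + of_int b) / (of_int c * \<tau> + of_int d)"

lemma mob_denom_nonzero:
  assumes "a * d - b * c = 1" "Im \<tau> > 0"
  shows "of_int c * \<tau> + of_int d \<noteq> (0 :: complex)"
proof
  assume h: "of_int c * \<tau> + of_int d = (0 :: complex)"
  then have "of_int c * Im \<tau> = 0" by (metis Im_complex_of_real add.right_neutral complex_Im_of_int mult_eq_0_iff plus_complex.sel(2) times_complex.sel(2) complex_Re_of_int mult_zero_left zero_complex.sel(2))
  then have "c = 0" using assms(2) by simp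
  with h have "d = 0" by simp
  with \<open>c = 0\<close> assms(1) show False by simp
qed

lemma Im_mob:
  assumes "a * d - b * c = 1" "Im \<tau> > 0"
  shows "Im (mob a b c d \<tau>) > 0"
proof -
  let ?D = "of_int c * \<tau> + of_int d :: complex"
  have D: "?D \<noteq> 0" by (rule mob_denom_nonzero[OF assms])
  have "Im (mob a b c d \<tau>) = Im ((of_int a * \<tau> + of_int b) * cnj ?D) / (norm ?D)\<^sup>2"
    unfolding mob_def by (subst complex_div_cnj) (simp add: Im_divide_of_real flip: of_real_power)
  also have "Im ((of_int a * \<tau> + of_int b) * cnj ?D) = of_int (a * d - b * c) * Im \<tau>"
    by (simp add: algebra_simps)
  finally show ?thesis using assms D by simp
qed

text \<open>Euclidean descent on the lower left entry: the matrix is a translation after an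
  inversion after a matrix whose lower left entry is, up to sign, \<open>a mod c\<close>. For
  \<open>c = 0\<close> only a translation, up to sign, remains. The characteristics change along the
  way, so the induction is for all of them.\<close>

theorem siegel_eta2_mob:
  assumes "a * d - b * c = (1 :: int)"
  shows "\<exists>u. norm u = 1 \<and> (\<forall>\<tau>. Im \<tau> > 0 \<longrightarrow> siegel x y (mob a b c d \<tau>) = u * siegel (x * a + y * c) (x * b + y * d) \<tau>)"
    and "\<exists>u. norm u = 1 \<and> (\<forall>\<tau>. Im \<tau> > 0 \<longrightarrow> eta2 (mob a b c d \<tau>) = u * (of_int c * \<tau> + of_int d) * eta2 \<tau>)"
proof -
  obtain \<delta> where \<delta>: "norm \<delta> = 1"
    "\<And>\<tau> z. Im \<tau> > 0 \<Longrightarrow> theta (z / \<tau>) (- 1 / \<tau>) * ee (- (z\<^sup>2) / \<tau>) = \<delta> * ee ((\<tau> + 1 / \<tau>) / 6) * theta z \<tau>"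
    "\<And>\<tau>. Im \<tau> > 0 \<Longrightarrow> (qpoch_inf (qexp (- 1 / \<tau>)) (qexp (- 1 / \<tau>)))\<^sup>2 / \<tau> = \<delta> * ee ((\<tau> + 1 / \<tau>) / 6) * (qpoch_inf (qexp \<tau>) (qexp \<tau>))\<^sup>2"
    using theta_inversion_constant by blast
  have siegel_S: "siegel x y (- 1 / \<tau>) = \<delta> * siegel y (- x) \<tau>" if \<tau>: "Im \<tau> > 0" for x y \<tau>
  proof -
    have \<tau>0: "\<tau> \<noteq> 0" using \<tau> by auto
    define z where "z = of_real y * \<tau> + of_real (- x)"
    have z: "of_real x * (- 1 / \<tau>) + of_real y = z / \<tau>" using \<tau>0 by (simp add: z_def field_simps)
    have "siegel x y (- 1 / \<tau>) = ee (of_real x * (z / \<tau>)) * ee (- 1 / \<tau> / 6) * theta (z / \<tau>) (- 1 / \<tau>)"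
      by (simp only: siegel_def z)
    also have "theta (z / \<tau>) (- 1 / \<tau>) = \<delta> * ee ((\<tau> + 1 / \<tau>) / 6) * theta z \<tau> * ee (z\<^sup>2 / \<tau>)"
      using \<delta>(2)[OF \<tau>, of z] ee_minus[of "z\<^sup>2 / \<tau>"] by (simp add: field_simps)
    also have "ee (of_real x * (z / \<tau>)) * ee (- 1 / \<tau> / 6) * (\<delta> * ee ((\<tau> + 1 / \<tau>) / 6) * theta z \<tau> * ee (z\<^sup>2 / \<tau>)) =
       \<delta> * (ee (of_real x * (z / \<tau>)) * ee (- 1 / \<tau> / 6) * ee ((\<tau> + 1 / \<tau>) / 6) * ee (z\<^sup>2 / \<tau>)) * theta z \<tau>"
      by (simp only: mult_ac)
    also have "ee (of_real x * (z / \<tau>)) * ee (- 1 / \<tau> / 6) * ee ((\<tau> + 1 / \<tau>) / 6) * ee (z\<^sup>2 / \<tau>) = ee (of_real y * z) * ee (\<tau> / 6)"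
      unfolding ee_add[symmetric] by (rule arg_cong[where f = ee]) (simp add: z_def field_simps power2_eq_square \<tau>0)
    finally show ?thesis by (simp add: siegel_def z_def mult_ac)
  qed
  have eta_S: "eta2 (- 1 / \<tau>) = \<delta> * \<tau> * eta2 \<tau>" if \<tau>: "Im \<tau> > 0" for \<tau>
  proof -
    have \<tau>0: "\<tau> \<noteq> 0" using \<tau> by auto
    have "(qpoch_inf (qexp (- 1 / \<tau>)) (qexp (- 1 / \<tau>)))\<^sup>2 = \<tau> * (\<delta> * ee ((\<tau> + 1 / \<tau>) / 6) * (qpoch_inf (qexp \<tau>) (qexp \<tau>))\<^sup>2)"
      using \<delta>(3)[OF \<tau>] \<tau>0 by (simp add: field_simps)
    moreover have "ee (- 1 / \<tau> / 6) * ee ((\<tau> + 1 / \<tau>) / 6) = ee (\<tau> / 6)"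
      unfolding ee_add[symmetric] by (rule arg_cong[where f = ee]) (simp add: field_simps \<tau>0)
    ultimately show ?thesis unfolding eta2_def by (simp add: mult_ac)
  qed
  have "(\<exists>u. norm u = 1 \<and> (\<forall>\<tau>. Im \<tau> > 0 \<longrightarrow> siegel x y (mob a b c d \<tau>) = u * siegel (x * a + y * c) (x * b + y * d) \<tau>)) \<and>
    (\<exists>u. norm u = 1 \<and> (\<forall>\<tau>. Im \<tau> > 0 \<longrightarrow> eta2 (mob a b c d \<tau>) = u * (of_int c * \<tau> + of_int d) * eta2 \<tau>))"
    using assms
  proof (induction "nat \<bar>c\<bar>" arbitrary: a b c d x y rule: less_induct)
    case less
    show ?case
    proof (cases "c = 0")
      case True
      then have "a * d = 1" using less.prems by simp
      then have "a = 1 \<and> d = 1 \<or> a = -1 \<and> d = -1" by (simp add: zmult_eq_1_iff)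
      then show ?thesis
      proof
        assume ad: "a = 1 \<and> d = 1"
        have m: "mob a b c d \<tau> = \<tau> + of_int b" for \<tau> using ad True by (simp add: mob_def)
        have y: "x * a + y * c = x" "x * b + y * d = y + of_int b * x" using ad True by (simp_all add: mult.commute)
        show ?thesis unfolding m y siegel_translate eta2_translate using ad True
          by (intro conjI exI[of _ "ee (of_int b / 6)"]) simp_all
      next
        \<comment> \<open>Minus the identity acts trivially on \<tau> but negates the
          characteristics and \<open>c * \<tau> + d\<close>. The Siegel function is odd in its
          characteristics, so both laws hold with the same constant.\<close>
        assume ad: "a = -1 \<and> d = -1"
        have m: "mob a b c d \<tau> = \<tau> + of_int (-b)" for \<tau> using ad True by (simp add: mob_def)
        have y: "x * a + y * c = - x" "x * b + y * d = - (y + of_int (-b) * x)" using ad True by (simp_all add: algebra_simps)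
        have e: "siegel x (y + of_int (-b) * x) \<tau> = - siegel (- x) (- (y + of_int (-b) * x)) \<tau>" if "Im \<tau> > 0" for \<tau>
          unfolding siegel_minus[OF that] by simp
        show ?thesis unfolding m y siegel_translate eta2_translate
        proof (intro conjI exI[of _ "- ee (of_int (-b) / 6)"] allI impI)
          fix \<tau> :: complex assume "Im \<tau> > 0"
          then show "ee (of_int (- b) / 6) * siegel x (y + of_int (-b) * x) \<tau> =
            - ee (of_int (- b) / 6) * siegel (- x) (- (y + of_int (-b) * x)) \<tau>"
            using e by (metis mult_minus_left mult_minus_right)
          show "ee (of_int (- b) / 6) * eta2 \<tau> = - ee (of_int (- b) / 6) * (of_int c * \<tau> + of_int d) * eta2 \<tau>"
            using ad True by simp
        qed simp_all
      qed
    next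
      case False
      \<comment> \<open>The Euclidean quotient: undoing the translation by \<open>n\<close> and an
        inversion leaves the matrix with rows \<open>(c, d)\<close> and
        \<open>(- a', - b')\<close>.\<close>
      define n where "n = a div c"
      define a' where "a' = a - n * c"
      define b' where "b' = b - n * d"
      have a': "a' = a mod c" by (simp add: a'_def n_def minus_div_mult_eq_mod)
      have lt: "nat \<bar>- a'\<bar> < nat \<bar>c\<bar>" using abs_mod_less[OF False, of a] False by (simp add: a')
      have det: "c * (- b') - d * (- a') = 1" using less.prems by (simp add: a'_def b'_def algebra_simps)
      from less.hyps[OF lt det]
      obtain u v where u: "norm u = 1" "\<And>\<tau>. Im \<tau> > 0 \<Longrightarrow> siegel (y + of_int n * x) (- x) (mob c d (- a') (- b') \<tau>) =
           u * siegel ((y + of_int n * x) * c + (- x) * of_int (- a')) ((y + of_int n * x) * d + (- x) * of_int (- b')) \<tau>"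
        and v: "norm v = 1" "\<And>\<tau>. Im \<tau> > 0 \<Longrightarrow> eta2 (mob c d (- a') (- b') \<tau>) = v * (of_int (- a') * \<tau> + of_int (- b')) * eta2 \<tau>"
        by metis
      have xy: "(y + of_int n * x) * c + (- x) * of_int (- a') = x * a + y * c"
        "(y + of_int n * x) * d + (- x) * of_int (- b') = x * b + y * d"
        by (simp_all add: a'_def b'_def algebra_simps)
      have key: "mob a b c d \<tau> = - 1 / mob c d (- a') (- b') \<tau> + of_int n" "Im (mob c d (- a') (- b') \<tau>) > 0"
        "of_int (- a') * \<tau> + of_int (- b') \<noteq> (0::complex)" "of_int c * \<tau> + of_int d \<noteq> (0::complex)"
        if \<tau>: "Im \<tau> > 0" for \<tau>
      proof -
        show nz1: "of_int (- a') * \<tau> + of_int (- b') \<noteq> (0::complex)" by (rule mob_denom_nonzero[OF det \<tau>])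
        show nz2: "of_int c * \<tau> + of_int d \<noteq> (0::complex)" by (rule mob_denom_nonzero[OF less.prems \<tau>])
        show "Im (mob c d (- a') (- b') \<tau>) > 0" by (rule Im_mob[OF det \<tau>])
        have "of_int a * \<tau> + of_int b = - (of_int (- a') * \<tau> + of_int (- b')) + of_int n * (of_int c * \<tau> + of_int d :: complex)"
          by (simp add: a'_def b'_def algebra_simps)
        then have "mob a b c d \<tau> = - (of_int (- a') * \<tau> + of_int (- b')) / (of_int c * \<tau> + of_int d) + of_int n"
          unfolding mob_def using nz2 by (simp add: add_divide_distrib)
        then show "mob a b c d \<tau> = - 1 / mob c d (- a') (- b') \<tau> + of_int n" by (simp add: mob_def)
      qed
      have "siegel x y (mob a b c d \<tau>) = (ee (of_int n / 6) * \<delta> * u) * siegel (x * a + y * c) (x * b + y * d) \<tau>"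
        if "Im \<tau> > 0" for \<tau>
        unfolding key(1)[OF that] siegel_translate siegel_S[OF key(2)[OF that]] u(2)[OF that] xy by simp
      moreover have "eta2 (mob a b c d \<tau>) = (ee (of_int n / 6) * \<delta> * v) * (of_int c * \<tau> + of_int d) * eta2 \<tau>"
        if "Im \<tau> > 0" for \<tau>
      proof -
        have "eta2 (mob a b c d \<tau>) = ee (of_int n / 6) * (\<delta> * mob c d (- a') (- b') \<tau> * (v * (of_int (- a') * \<tau> + of_int (- b')) * eta2 \<tau>))"
          unfolding key(1)[OF that] eta2_translate eta_S[OF key(2)[OF that]] v(2)[OF that] ..
        moreover have "mob c d (- a') (- b') \<tau> * (of_int (- a') * \<tau> + of_int (- b')) = of_int c * \<tau> + of_int d"
          unfolding mob_def using key(3)[OF that] by simp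
        ultimately show ?thesis by (simp add: mult_ac)
      qed
      moreover have "norm (ee (of_int n / 6) * \<delta> * u) = 1" "norm (ee (of_int n / 6) * \<delta> * v) = 1"
        using \<delta>(1) u(1) v(1) by (simp_all add: norm_mult)
      ultimately show ?thesis by blast
    qed
  qed
  then show "\<exists>u. norm u = 1 \<and> (\<forall>\<tau>. Im \<tau> > 0 \<longrightarrow> siegel x y (mob a b c d \<tau>) = u * siegel (x * a + y * c) (x * b + y * d) \<tau>)"
    "\<exists>u. norm u = 1 \<and> (\<forall>\<tau>. Im \<tau> > 0 \<longrightarrow> eta2 (mob a b c d \<tau>) = u * (of_int c * \<tau> + of_int d) * eta2 \<tau>)"
    by blast+
qed

section \<open>Eta--Siegel blocks of weight 1/2\<close>

definition eta :: "complex \<Rightarrow> complex" where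
  "eta \<tau> = ee (\<tau> / 12) * qpoch_inf (qexp \<tau>) (qexp \<tau>)"

lemma eta_square: "(eta \<tau>)\<^sup>2 = eta2 \<tau>"
  by (simp add: eta_def eta2_def power_mult_distrib ee_power)

lemma eta_nonzero: "Im \<tau> > 0 \<Longrightarrow> eta \<tau> \<noteq> 0"
  unfolding eta_def by (simp add: qpoch_inf_nonzero norm_qexp_less_1 del: norm_exp_eq_Re)

lemma siegel_nonzero:
  assumes "Im \<tau> > 0" "\<not> (a \<in> \<int> \<and> b \<in> \<int>)"
  shows "siegel a b \<tau> \<noteq> 0"
proof
  assume "siegel a b \<tau> = 0"
  then have "theta (of_real a * \<tau> + of_real b) \<tau> = 0" by (simp add: siegel_def)
  then obtain m n :: int where mn: "of_real a * \<tau> + of_real b = of_int m * \<tau> + of_int n"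
    using theta_eq_0D[OF assms(1)] by blast
  have "a * Im \<tau> = of_int m * Im \<tau>" using arg_cong[OF mn, of Im] by simp
  then have a: "a = of_int m" using assms(1) by simp
  with mn have "b = of_int n" by (simp add: a) (metis of_real_eq_iff of_real_of_int_eq)
  with a assms(2) show False by simp
qed

section \<open>Upper triangular integral matrices and the blocks built on them\<close>

definition aff :: "int \<Rightarrow> int \<Rightarrow> int \<Rightarrow> complex \<Rightarrow> complex" where
  "aff x y z \<tau> = (of_int x * \<tau> + of_int y) / of_int z"

lemma Im_aff:
  assumes "x > 0" "z > 0" "Im \<tau> > 0"
  shows "Im (aff x y z \<tau>) > 0"
proof -
  have "aff x y z \<tau> = (of_int x * \<tau> + of_int y) / of_real (real_of_int z)" by (simp add: aff_def)
  then have "Im (aff x y z \<tau>) = of_int x * Im \<tau> / of_int z" by (simp only: Im_divide_of_real) simp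
  then show ?thesis using assms by simp
qed

lemma aff_holomorphic [holomorphic_intros]: "aff x y z holomorphic_on S"
proof (cases "z = 0")
  case False
  then show ?thesis unfolding aff_def by (intro holomorphic_intros) auto
next
  case True
  then have "aff x y z = (\<lambda>_. 0)" by (auto simp: aff_def)
  then show ?thesis by simp
qed

text \<open>
  A triple \<open>(x, y, z)\<close> stands for the matrix with rows \<open>(x, y)\<close> and \<open>(0, z)\<close>, and \<open>(a, b, c, d)\<close> for the one with
  rows \<open>(a, b)\<close> and \<open>(c, d)\<close>; the relation is the matrix identity \<open>M Y = X M'\<close>.
\<close>

definition intertwines :: "int \<times> int \<times> int \<Rightarrow> int \<times> int \<times> int \<Rightarrow> int \<times> int \<times> int \<times> int \<Rightarrow> int \<times> int \<times> int \<times> int \<Rightarrow> bool" where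
  "intertwines M M' X Y \<longleftrightarrow> (case (M, M', X, Y) of ((x, y, z), (x', y', z'), (A, B, C, D), (a, b, c, d)) \<Rightarrow>
     x > 0 \<and> z > 0 \<and> x' > 0 \<and> z' > 0 \<and> A * D - B * C = 1 \<and> a * d - b * c = 1 \<and>
     x * a + y * c = A * x' \<and> x * b + y * d = A * y' + B * z' \<and> z * c = C * x' \<and> z * d = C * y' + D * z')"

lemma intertwines_iff:
  "intertwines (x, y, z) (x', y', z') (A, B, C, D) (a, b, c, d) \<longleftrightarrow>
     x > 0 \<and> z > 0 \<and> x' > 0 \<and> z' > 0 \<and> A * D - B * C = 1 \<and> a * d - b * c = 1 \<and>
     x * a + y * c = A * x' \<and> x * b + y * d = A * y' + B * z' \<and> z * c = C * x' \<and> z * d = C * y' + D * z'"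
  unfolding intertwines_def prod.case ..

text \<open>The matrix identity read as one of fractional linear maps. Upper triangular matrices
  have constant automorphy factors, which is why the other two differ by the constant
  \<open>z / z'\<close> only.\<close>

lemma intertwines_mob:
  assumes I: "intertwines (x, y, z) (x', y', z') (A, B, C, D) (a, b, c, d)" and \<tau>: "Im \<tau> > 0"
  shows "aff x y z (mob a b c d \<tau>) = mob A B C D (aff x' y' z' \<tau>)"
    "of_int C * aff x' y' z' \<tau> + of_int D = of_real (of_int z / of_int z') * (of_int c * \<tau> + of_int d :: complex)"
    "Im (aff x' y' z' \<tau>) > 0" "Im (mob a b c d \<tau>) > 0"
proof -
  have det: "a * d - b * c = 1" "A * D - B * C = 1"
    and e: "x * a + y * c = A * x'" "x * b + y * d = A * y' + B * z'" "z * c = C * x'" "z * d = C * y' + D * z'"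
    and pos: "x > 0" "z > 0" "x' > 0" "z' > 0"
    using I unfolding intertwines_iff by blast+
  have e': "of_int x * of_int a + of_int y * of_int c = (of_int A * of_int x' :: complex)"
    "of_int x * of_int b + of_int y * of_int d = (of_int A * of_int y' + of_int B * of_int z' :: complex)"
    "of_int z * of_int c = (of_int C * of_int x' :: complex)"
    "of_int z * of_int d = (of_int C * of_int y' + of_int D * of_int z' :: complex)"
    using e by (metis of_int_add of_int_mult)+
  have nz: "of_int c * \<tau> + of_int d \<noteq> (0 :: complex)" by (rule mob_denom_nonzero[OF det(1) \<tau>])
  have z: "of_int z \<noteq> (0::complex)" "of_int z' \<noteq> (0::complex)" using pos by auto
  have num: "of_int A * aff x' y' z' \<tau> + of_int B = (of_int x * (of_int a * \<tau> + of_int b) + of_int y * (of_int c * \<tau> + of_int d)) / of_int z'"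
  proof -
    have "of_int A * aff x' y' z' \<tau> + of_int B = ((of_int A * of_int x') * \<tau> + (of_int A * of_int y' + of_int B * of_int z')) / of_int z'"
      using z by (simp add: aff_def field_simps)
    then show ?thesis unfolding e'[symmetric] by (simp add: algebra_simps)
  qed
  have den: "of_int C * aff x' y' z' \<tau> + of_int D = of_int z * (of_int c * \<tau> + of_int d) / of_int z'"
  proof -
    have "of_int C * aff x' y' z' \<tau> + of_int D = ((of_int C * of_int x') * \<tau> + (of_int C * of_int y' + of_int D * of_int z')) / of_int z'"
      using z by (simp add: aff_def field_simps)
    then show ?thesis unfolding e'[symmetric] by (simp add: algebra_simps)
  qed
  show "of_int C * aff x' y' z' \<tau> + of_int D = of_real (of_int z / of_int z') * (of_int c * \<tau> + of_int d :: complex)"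
    unfolding den by simp
  show "aff x y z (mob a b c d \<tau>) = mob A B C D (aff x' y' z' \<tau>)"
  proof -
    have gen: "(X * (N / w) + Y) / Z = ((X * N + Y * w) / Z') / (Z * w / Z')"
      if "w \<noteq> 0" "Z \<noteq> 0" "Z' \<noteq> 0" for X N w Y Z Z' :: complex
      using that by (simp add: field_simps)
    show ?thesis unfolding mob_def[of A] num den unfolding aff_def mob_def by (rule gen[OF nz z])
  qed
  show "Im (aff x' y' z' \<tau>) > 0" by (rule Im_aff[OF pos(3,4) \<tau>])
  show "Im (mob a b c d \<tau>) > 0" by (rule Im_mob[OF det(1) \<tau>])
qed

text \<open>Hermite normal form: the first column of the product is \<open>g\<close> times a
  primitive vector \<open>(A, C)\<close>, and Bezout coefficients complete this vector to a
  unimodular matrix, whose inverse makes the product upper triangular. It gives access to the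
  expansions at all cusps.\<close>

lemma hermite_decomposition:
  assumes "a * d - b * c = (1 :: int)" "x > 0" "z > 0"
  shows "\<exists>x' y' z' A B C D. intertwines (x, y, z) (x', y', z') (A, B, C, D) (a, b, c, d)"
proof -
  define p where "p = x * a + y * c"
  define r where "r = z * c"
  define g where "g = gcd p r"
  have "\<not> (p = 0 \<and> r = 0)" using assms by (auto simp: p_def r_def)
  then have g: "g > 0" by (simp add: g_def)
  obtain u v where uv: "u * p + v * r = g" using bezout_int[of p r] by (auto simp: g_def)
  obtain A where A: "p = g * A" unfolding g_def by (meson dvdE gcd_dvd1)
  obtain C where C: "r = g * C" unfolding g_def by (meson dvdE gcd_dvd2)
  have "g * (A * u + C * v) = g * 1" using uv unfolding A C by (simp add: algebra_simps)
  then have det: "A * u - (- v) * C = 1" using g by (simp add: mult.commute)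
  define w1 where "w1 = x * b + y * d"
  define w2 where "w2 = z * d"
  define y' where "y' = u * w1 + v * w2"
  define z' where "z' = A * w2 - C * w1"
  have "g * z' = p * w2 - r * w1" unfolding z'_def A C by (simp add: algebra_simps)
  also have "\<dots> = x * z * (a * d - b * c)" by (simp add: p_def r_def w1_def w2_def algebra_simps)
  finally have "g * z' = x * z * (a * d - b * c)" .
  then have "g * z' = x * z" using assms by simp
  then have z': "z' > 0" using g assms by (metis mult_pos_pos zero_less_mult_pos)
  have 1: "w1 = A * y' + (- v) * z'" "w2 = C * y' + u * z'"
  proof -
    have "A * y' + (- v) * z' = (A * u - (- v) * C) * w1" "C * y' + u * z' = (A * u - (- v) * C) * w2"
      by (simp_all add: y'_def z'_def algebra_simps)
    then show "w1 = A * y' + (- v) * z'" "w2 = C * y' + u * z'" unfolding det by simp_all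
  qed
  have "intertwines (x, y, z) (g, y', z') (A, - v, C, u) (a, b, c, d)"
    unfolding intertwines_def using assms g z' det A C 1
    by (simp add: p_def r_def w1_def w2_def mult.commute)
  then show ?thesis by blast
qed

text \<open>The eta quotient is the shape of the fourth theta function, and the reciprocal Siegel
  function that of a Rogers--Ramanujan product. The weight is \<open>1 - 1 / 2 - 0\<close>; the
  three matrices carry the rescalings of \<tau>.\<close>

definition eta_block :: "int \<times> int \<times> int \<Rightarrow> int \<times> int \<times> int \<Rightarrow> int \<times> int \<times> int \<Rightarrow> real \<Rightarrow> real \<Rightarrow> complex \<Rightarrow> complex" where
  "eta_block M1 M2 M3 a b \<tau> = (case (M1, M2, M3) of ((x1, y1, z1), (x2, y2, z2), (x3, y3, z3)) \<Rightarrow>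
     (eta (aff x1 y1 z1 \<tau>))\<^sup>2 / (eta (aff x2 y2 z2 \<tau>) * siegel a b (aff x3 y3 z3 \<tau>)))"

definition upper_pos :: "int \<times> int \<times> int \<Rightarrow> bool" where
  "upper_pos M \<longleftrightarrow> (case M of (x, y, z) \<Rightarrow> x > 0 \<and> z > 0)"

lemma eta_holomorphic:
  assumes "open S" "f holomorphic_on S" "\<And>z. z \<in> S \<Longrightarrow> Im (f z) > 0"
  shows "(\<lambda>z. eta (f z)) holomorphic_on S"
  unfolding eta_def by (intro holomorphic_intros qpoch_inf_holomorphic assms norm_qexp_less_1) auto

lemma siegel_holomorphic:
  assumes "open S" "f holomorphic_on S" "\<And>z. z \<in> S \<Longrightarrow> Im (f z) > 0"
  shows "(\<lambda>z. siegel a b (f z)) holomorphic_on S"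
  unfolding siegel_def by (intro holomorphic_intros theta_holomorphic assms) auto

lemma eta_block_nonzero:
  assumes "upper_pos M1" "upper_pos M2" "upper_pos M3" "\<not> (a \<in> \<int> \<and> b \<in> \<int>)" "Im \<tau> > 0"
  shows "eta_block M1 M2 M3 a b \<tau> \<noteq> 0"
  using assms eta_nonzero siegel_nonzero Im_aff
  by (auto simp: eta_block_def upper_pos_def split: prod.splits)

lemma eta_block_holomorphic:
  assumes M: "upper_pos M1" "upper_pos M2" "upper_pos M3" and ab: "\<not> (a \<in> \<int> \<and> b \<in> \<int>)"
  shows "eta_block M1 M2 M3 a b holomorphic_on upper_half_plane"
proof -
  obtain x1 y1 z1 x2 y2 z2 x3 y3 z3 where MM: "M1 = (x1, y1, z1)" "M2 = (x2, y2, z2)" "M3 = (x3, y3, z3)"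
    by (metis prod.exhaust)
  have "(\<lambda>\<tau>. (eta (aff x1 y1 z1 \<tau>))\<^sup>2 / (eta (aff x2 y2 z2 \<tau>) * siegel a b (aff x3 y3 z3 \<tau>))) holomorphic_on upper_half_plane"
    using M unfolding MM upper_pos_def
    by (intro holomorphic_intros eta_holomorphic siegel_holomorphic open_upper_half_plane)
       (auto intro: Im_aff simp: eta_nonzero siegel_nonzero Im_aff ab)
  then show ?thesis unfolding eta_block_def MM by simp
qed

text \<open>For \<open>c \<noteq> 0\<close> the base has nonzero imaginary part and avoids the
  branch cut; for \<open>c = 0\<close> nothing varies.\<close>

lemma sqrt_automorphy_continuous:
  assumes "a * d - b * c = (1 :: int)"
  shows "continuous_on upper_half_plane (\<lambda>\<tau>. (of_int c * \<tau> + of_int d :: complex) powr (1 / 2))"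
proof (cases "c = 0")
  case False
  have "of_int c * \<tau> + of_int d \<notin> (\<real>\<^sub>\<le>\<^sub>0 :: complex set)" if "Im \<tau> > 0" for \<tau>
  proof
    assume "of_int c * \<tau> + of_int d \<in> (\<real>\<^sub>\<le>\<^sub>0 :: complex set)"
    then have "Im (of_int c * \<tau> + of_int d) = 0" by (auto simp: complex_nonpos_Reals_iff)
    then show False using False that by simp
  qed
  then show ?thesis
    by (intro holomorphic_on_imp_continuous_on holomorphic_intros) auto
qed simp

lemma powr_half_square: "((w :: complex) powr (1 / 2))\<^sup>2 = w"
  by (cases "w = 0") (simp_all add: powr_def power2_eq_square flip: exp_add)

text \<open>The squares of both sides transform by known laws, as these involve squared eta
  functions only. The quotient \<open>Q\<close> of the two sides is continuous with constant square,
  hence constant. Its modulus is determined by the ratios \<open>z / z'\<close> of the first two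
  matrices; the third enters through a function of weight 0 and contributes none.\<close>

lemma eta_block_transform:
  assumes I1: "intertwines M1 N1 (A1, B1, C1, D1) (a, b, c, d)"
    and I2: "intertwines M2 N2 (A2, B2, C2, D2) (a, b, c, d)"
    and I3: "intertwines M3 N3 (A3, B3, C3, D3) (a, b, c, d)"
    and \<alpha>\<beta>: "\<not> (\<alpha> \<in> \<int> \<and> \<beta> \<in> \<int>)"
  shows "\<exists>k. k \<noteq> 0 \<and> (snd (snd M1) = snd (snd N1) \<and> snd (snd M2) = snd (snd N2) \<longrightarrow> norm k = 1) \<and>
    (\<forall>\<tau>. Im \<tau> > 0 \<longrightarrow> eta_block M1 M2 M3 \<alpha> \<beta> (mob a b c d \<tau>) =
       k * (of_int c * \<tau> + of_int d) powr (1 / 2) * eta_block N1 N2 N3 (\<alpha> * A3 + \<beta> * C3) (\<alpha> * B3 + \<beta> * D3) \<tau>)"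
proof -
  obtain x1 y1 z1 x2 y2 z2 x3 y3 z3 where M: "M1 = (x1, y1, z1)" "M2 = (x2, y2, z2)" "M3 = (x3, y3, z3)"
    by (metis prod.exhaust)
  obtain x1' y1' z1' x2' y2' z2' x3' y3' z3' where N: "N1 = (x1', y1', z1')" "N2 = (x2', y2', z2')" "N3 = (x3', y3', z3')"
    by (metis prod.exhaust)
  let ?\<alpha> = "\<alpha> * A3 + \<beta> * C3" and ?\<beta> = "\<alpha> * B3 + \<beta> * D3"
  let ?m = "mob a b c d"
  have det: "a * d - b * c = 1" "A1 * D1 - B1 * C1 = 1" "A2 * D2 - B2 * C2 = 1" "A3 * D3 - B3 * C3 = 1"
    and pos: "z1 > 0" "z1' > 0" "z2 > 0" "z2' > 0" and pos': "x1 > 0" "x2 > 0" "x3 > 0" "x1' > 0" "x2' > 0" "x3' > 0" "z3 > 0" "z3' > 0"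
    using I1 I2 I3 unfolding M N intertwines_iff by blast+
  note i1 = intertwines_mob[OF I1[unfolded M N]] and i2 = intertwines_mob[OF I2[unfolded M N]]
    and i3 = intertwines_mob[OF I3[unfolded M N]]
  obtain u1 where u1: "norm u1 = 1" "\<And>\<tau>. Im \<tau> > 0 \<Longrightarrow> eta2 (mob A1 B1 C1 D1 \<tau>) = u1 * (of_int C1 * \<tau> + of_int D1) * eta2 \<tau>"
    using siegel_eta2_mob(2)[OF det(2)] by blast
  obtain u2 where u2: "norm u2 = 1" "\<And>\<tau>. Im \<tau> > 0 \<Longrightarrow> eta2 (mob A2 B2 C2 D2 \<tau>) = u2 * (of_int C2 * \<tau> + of_int D2) * eta2 \<tau>"
    using siegel_eta2_mob(2)[OF det(3)] by blast
  obtain u3 where u3: "norm u3 = 1" "\<And>\<tau>. Im \<tau> > 0 \<Longrightarrow> siegel \<alpha> \<beta> (mob A3 B3 C3 D3 \<tau>) = u3 * siegel ?\<alpha> ?\<beta> \<tau>"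
    using siegel_eta2_mob(1)[OF det(4)] by blast
  \<comment> \<open>The characteristics are transformed by a unimodular matrix, so they cannot
    become integral, and the denominator of the new block has no zeros.\<close>
  have nonint: "\<not> (?\<alpha> \<in> \<int> \<and> ?\<beta> \<in> \<int>)"
  proof
    assume h: "?\<alpha> \<in> \<int> \<and> ?\<beta> \<in> \<int>"
    have "\<alpha> = ?\<alpha> * D3 - ?\<beta> * C3" "\<beta> = ?\<beta> * A3 - ?\<alpha> * B3"
      using arg_cong[OF det(4), of "\<lambda>x. \<alpha> * real_of_int x"] arg_cong[OF det(4), of "\<lambda>x. \<beta> * real_of_int x"]
      by (simp_all add: algebra_simps)
    then have "\<alpha> \<in> \<int>" "\<beta> \<in> \<int>" using h by (metis Ints_diff Ints_mult Ints_of_int)+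
    then show False using \<alpha>\<beta> by blast
  qed
  have up: "upper_pos M1" "upper_pos M2" "upper_pos M3" "upper_pos N1" "upper_pos N2" "upper_pos N3"
    using pos pos' by (simp_all add: upper_pos_def M N)
  let ?J = "\<lambda>\<tau>. (of_int c * \<tau> + of_int d :: complex) powr (1 / 2)"
  define L where "L = eta_block M1 M2 M3 \<alpha> \<beta>"
  define R where "R = eta_block N1 N2 N3 ?\<alpha> ?\<beta>"
  define Q where "Q = (\<lambda>\<tau>. L (?m \<tau>) / (?J \<tau> * R \<tau>))"
  \<comment> \<open>The constants of the squared laws: the eta factor of the numerator occurs twice,
    the one of the denominator once, each with its ratio of automorphy factors.\<close>
  define K where "K = (u1 * of_real (of_int z1 / of_int z1'))\<^sup>2 / (u2 * of_real (of_int z2 / of_int z2') * u3\<^sup>2)"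
  have Jnz: "?J \<tau> \<noteq> 0" if "Im \<tau> > 0" for \<tau> using mob_denom_nonzero[OF det(1) that] by simp
  have Rnz: "R \<tau> \<noteq> 0" if "Im \<tau> > 0" for \<tau> unfolding R_def by (rule eta_block_nonzero[OF up(4,5,6) nonint that])
  have Qsq: "Q \<tau> ^ 2 = K" if "\<tau> \<in> upper_half_plane" for \<tau>
  proof -
    have \<tau>: "Im \<tau> > 0" using that by simp
    define w where "w = of_int c * \<tau> + of_int d"
    have w: "w \<noteq> 0" unfolding w_def by (rule mob_denom_nonzero[OF det(1) \<tau>])
    define e1 where "e1 = eta2 (aff x1' y1' z1' \<tau>)"
    define e2 where "e2 = eta2 (aff x2' y2' z2' \<tau>)"
    define s3 where "s3 = siegel ?\<alpha> ?\<beta> (aff x3' y3' z3' \<tau>)"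
    have nz: "e1 \<noteq> 0" "e2 \<noteq> 0" "s3 \<noteq> 0"
      unfolding e1_def e2_def s3_def eta_square[symmetric]
      using eta_nonzero[OF i1(3)[OF \<tau>]] eta_nonzero[OF i2(3)[OF \<tau>]] siegel_nonzero[OF i3(3)[OF \<tau>] nonint] by simp_all
    have "(L (?m \<tau>))\<^sup>2 = (eta2 (aff x1 y1 z1 (?m \<tau>)))\<^sup>2 / (eta2 (aff x2 y2 z2 (?m \<tau>)) * (siegel \<alpha> \<beta> (aff x3 y3 z3 (?m \<tau>)))\<^sup>2)"
      unfolding L_def eta_block_def M by (simp add: eta_square[symmetric] power_divide power_mult_distrib)
    also have "\<dots> = (u1 * (of_real (of_int z1 / of_int z1') * w) * e1)\<^sup>2 / (u2 * (of_real (of_int z2 / of_int z2') * w) * e2 * (u3 * s3)\<^sup>2)"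
      unfolding i1(1)[OF \<tau>] i2(1)[OF \<tau>] i3(1)[OF \<tau>] u1(2)[OF i1(3)[OF \<tau>]] u2(2)[OF i2(3)[OF \<tau>]] u3(2)[OF i3(3)[OF \<tau>]]
        i1(2)[OF \<tau>] i2(2)[OF \<tau>] e1_def e2_def s3_def w_def ..
    also have "\<dots> = K * w * (e1\<^sup>2 / (e2 * s3\<^sup>2))"
      unfolding K_def using w by (simp add: power2_eq_square field_simps)
    finally have LL: "(L (?m \<tau>))\<^sup>2 = K * w * (e1\<^sup>2 / (e2 * s3\<^sup>2))" .
    have rr_series: "(R \<tau>)\<^sup>2 = e1\<^sup>2 / (e2 * s3\<^sup>2)"
      unfolding R_def eta_block_def N e1_def e2_def s3_def by (simp add: eta_square[symmetric] power_divide power_mult_distrib)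
    have "Q \<tau> ^ 2 = (L (?m \<tau>))\<^sup>2 / (((w powr (1 / 2)))\<^sup>2 * (R \<tau>)\<^sup>2)"
      unfolding Q_def w_def[symmetric] by (simp add: power_divide power_mult_distrib)
    then show ?thesis unfolding LL rr_series powr_half_square using w nz by simp
  qed
  have Qc: "continuous_on upper_half_plane Q"
  proof -
    have mh: "?m holomorphic_on upper_half_plane"
      unfolding mob_def by (intro holomorphic_intros) (use mob_denom_nonzero[OF det(1)] in auto)
    have "continuous_on upper_half_plane (\<lambda>\<tau>. L (?m \<tau>))"
    proof (rule continuous_on_compose2[of upper_half_plane L])
      show "continuous_on upper_half_plane L"
        unfolding L_def by (intro holomorphic_on_imp_continuous_on eta_block_holomorphic up \<alpha>\<beta>)
      show "continuous_on upper_half_plane ?m" by (rule holomorphic_on_imp_continuous_on[OF mh])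
    qed (use Im_mob[OF det(1)] in auto)
    moreover have "continuous_on upper_half_plane R"
      unfolding R_def by (intro holomorphic_on_imp_continuous_on eta_block_holomorphic up nonint)
    ultimately show ?thesis unfolding Q_def
      by (intro continuous_intros sqrt_automorphy_continuous[OF det(1)]) (use Jnz Rnz in auto)
  qed
  have "\<exists>k. k ^ 2 = K \<and> (\<forall>\<tau>\<in>upper_half_plane. Q \<tau> = k) \<or> upper_half_plane = {}"
    by (rule power_constant_imp_constant[OF connected_upper_half_plane Qc _ Qsq]) simp_all
  moreover have "\<i> \<in> upper_half_plane" by simp
  ultimately obtain k where k: "k ^ 2 = K" "\<And>\<tau>. Im \<tau> > 0 \<Longrightarrow> Q \<tau> = k" by blast
  have u0: "u1 \<noteq> 0" "u2 \<noteq> 0" "u3 \<noteq> 0" using u1 u2 u3 by auto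
  have K0: "K \<noteq> 0" unfolding K_def using u0 pos by simp
  have "k \<noteq> 0"
  proof
    assume "k = 0"
    then have "K = 0" using k(1) by (simp only: zero_power2)
    then show False using K0 by blast
  qed
  moreover have "norm k = 1" if z: "snd (snd M1) = snd (snd N1) \<and> snd (snd M2) = snd (snd N2)"
  proof -
    have z': "z1' = z1" "z2' = z2" using z by (simp_all add: M N)
    have "norm K = 1" unfolding K_def z' using u1(1) u2(1) u3(1) pos
      by (simp add: norm_mult norm_divide norm_power)
    then have "norm k ^ 2 = 1 ^ 2" using arg_cong[OF k(1), of norm] by (simp add: norm_power)
    then show ?thesis using power_eq_imp_eq_base[of "norm k" 2 1] by simp
  qed
  moreover have "eta_block M1 M2 M3 \<alpha> \<beta> (mob a b c d \<tau>) = k * ?J \<tau> * eta_block N1 N2 N3 ?\<alpha> ?\<beta> \<tau>" if \<tau>: "Im \<tau> > 0" for \<tau>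
  proof -
    have "L (?m \<tau>) / (?J \<tau> * R \<tau>) = k" using k(2)[OF \<tau>] unfolding Q_def .
    then have "L (?m \<tau>) = k * (?J \<tau> * R \<tau>)"
      by (simp only: nonzero_divide_eq_eq[OF no_zero_divisors[OF Jnz[OF \<tau>] Rnz[OF \<tau>]]])
    then show ?thesis unfolding L_def R_def by (simp only: mult.assoc)
  qed
  ultimately show ?thesis by blast
qed

lemma eta_block_shift:
  assumes "upper_pos M3"
  shows "\<exists>u. norm u = 1 \<and> (\<forall>\<tau>. Im \<tau> > 0 \<longrightarrow> eta_block M1 M2 M3 (\<alpha> + of_int m) (\<beta> + of_int n) \<tau> = u * eta_block M1 M2 M3 \<alpha> \<beta> \<tau>)"
proof -
  obtain u where u: "norm u = 1" "\<And>\<tau>. Im \<tau> > 0 \<Longrightarrow> siegel (\<alpha> + of_int m) (\<beta> + of_int n) \<tau> = u * siegel \<alpha> \<beta> \<tau>"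
    using siegel_shift by blast
  obtain x1 y1 z1 x2 y2 z2 x3 y3 z3 where M: "M1 = (x1, y1, z1)" "M2 = (x2, y2, z2)" "M3 = (x3, y3, z3)"
    by (metis prod.exhaust)
  have "Im (aff x3 y3 z3 \<tau>) > 0" if "Im \<tau> > 0" for \<tau>
    using assms that by (simp add: M upper_pos_def Im_aff)
  then show ?thesis using u
    by (intro exI[of _ "1 / u"]) (auto simp: eta_block_def M norm_divide)
qed

section \<open>Meromorphy at infinity\<close>

text \<open>A Puiseux expansion in \<open>q\<close> with finite principal part. As the width
  \<open>h\<close> is arbitrary, it absorbs rational powers of \<open>q\<close>, and functions of
  different widths are combined at a common multiple.\<close>

definition cusp_mero :: "(complex \<Rightarrow> complex) \<Rightarrow> bool" where
  "cusp_mero f \<longleftrightarrow> (\<exists>(h::nat) F. h > 0 \<and> F meromorphic_on {0} \<and> (\<forall>\<tau>. Im \<tau> > 0 \<longrightarrow> f \<tau> = F (qexp (\<tau> / of_nat h))))"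

lemma qexp_divide_power:
  "h > 0 \<Longrightarrow> qexp (\<tau> / of_nat (h * m)) ^ m = (if m = 0 then 1 else qexp (\<tau> / of_nat h))"
  by (auto simp: exp_of_nat_mult[symmetric] field_simps)

lemma meromorphic_scale_power:
  assumes "F meromorphic_on {0}" "m > 0"
  shows "(\<lambda>X. F (c * X ^ m)) meromorphic_on {0 :: complex}"
  by (rule meromorphic_on_compose[OF assms(1)]) (use assms(2) in \<open>auto intro!: analytic_intros\<close>)

lemma cusp_mero_raise:
  assumes "h > 0" "m > 0" "F meromorphic_on {0}" "\<And>\<tau>. Im \<tau> > 0 \<Longrightarrow> f \<tau> = F (qexp (\<tau> / of_nat h))"
  shows "\<exists>G. G meromorphic_on {0} \<and> (\<forall>\<tau>. Im \<tau> > 0 \<longrightarrow> f \<tau> = G (qexp (\<tau> / of_nat (h * m))))"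
  using meromorphic_scale_power[OF assms(3,2), of 1] assms qexp_divide_power[OF assms(1), of _ m]
  by (intro exI[of _ "\<lambda>X. F (1 * X ^ m)"]) simp

lemma cusp_mero_combine:
  assumes f: "cusp_mero f" and g: "cusp_mero g"
    and op: "\<And>F G. F meromorphic_on {0} \<Longrightarrow> G meromorphic_on {0} \<Longrightarrow> (\<lambda>X. op (F X) (G X)) meromorphic_on {0 :: complex}"
  shows "cusp_mero (\<lambda>\<tau>. op (f \<tau>) (g \<tau>))"
proof -
  obtain h F where F: "h > 0" "F meromorphic_on {0}" "\<And>\<tau>. Im \<tau> > 0 \<Longrightarrow> f \<tau> = F (qexp (\<tau> / of_nat h))"
    using f unfolding cusp_mero_def by blast
  obtain k G where G: "k > 0" "G meromorphic_on {0}" "\<And>\<tau>. Im \<tau> > 0 \<Longrightarrow> g \<tau> = G (qexp (\<tau> / of_nat k))"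
    using g unfolding cusp_mero_def by blast
  obtain F' where F': "F' meromorphic_on {0}" "\<And>\<tau>. Im \<tau> > 0 \<Longrightarrow> f \<tau> = F' (qexp (\<tau> / of_nat (h * k)))"
    using cusp_mero_raise[OF F(1) G(1) F(2), of f] F(3) by blast
  obtain G' where G': "G' meromorphic_on {0}" "\<And>\<tau>. Im \<tau> > 0 \<Longrightarrow> g \<tau> = G' (qexp (\<tau> / of_nat (k * h)))"
    using cusp_mero_raise[OF G(1) F(1) G(2), of g] G(3) by blast
  show ?thesis unfolding cusp_mero_def
    using F(1) G(1) op[OF F'(1) G'(1)] F'(2) G'(2)
    by (intro exI[of _ "h * k"] exI[of _ "\<lambda>X. op (F' X) (G' X)"]) (simp add: mult.commute)
qed

lemma cusp_mero_mult: "cusp_mero f \<Longrightarrow> cusp_mero g \<Longrightarrow> cusp_mero (\<lambda>\<tau>. f \<tau> * g \<tau>)"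
  and cusp_mero_add: "cusp_mero f \<Longrightarrow> cusp_mero g \<Longrightarrow> cusp_mero (\<lambda>\<tau>. f \<tau> + g \<tau>)"
  and cusp_mero_diff: "cusp_mero f \<Longrightarrow> cusp_mero g \<Longrightarrow> cusp_mero (\<lambda>\<tau>. f \<tau> - g \<tau>)"
  and cusp_mero_divide: "cusp_mero f \<Longrightarrow> cusp_mero g \<Longrightarrow> cusp_mero (\<lambda>\<tau>. f \<tau> / g \<tau>)"
  by (rule cusp_mero_combine; (assumption | intro meromorphic_intros; assumption))+

lemma cusp_mero_const: "cusp_mero (\<lambda>_. c)"
  unfolding cusp_mero_def by (intro exI[of _ 1] exI[of _ "\<lambda>_. c"]) auto

lemma cusp_mero_cong: "cusp_mero f \<Longrightarrow> (\<And>\<tau>. Im \<tau> > 0 \<Longrightarrow> f \<tau> = g \<tau>) \<Longrightarrow> cusp_mero g"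
  unfolding cusp_mero_def by metis

lemma cusp_mero_prod: "finite I \<Longrightarrow> (\<And>i. i \<in> I \<Longrightarrow> cusp_mero (f i)) \<Longrightarrow> cusp_mero (\<lambda>\<tau>. \<Prod>i\<in>I. f i \<tau>)"
  by (induction I rule: finite_induct) (auto intro: cusp_mero_const cusp_mero_mult)

lemma cusp_mero_aff:
  assumes f: "cusp_mero f" and pos: "x > 0" "z > 0"
  shows "cusp_mero (\<lambda>\<tau>. f (aff x y z \<tau>))"
proof -
  obtain h F where F: "h > 0" "F meromorphic_on {0}" "\<And>\<tau>. Im \<tau> > 0 \<Longrightarrow> f \<tau> = F (qexp (\<tau> / of_nat h))"
    using f unfolding cusp_mero_def by blast
  define c where "c = qexp (of_int y / (of_int z * of_nat h))"
  have "f (aff x y z \<tau>) = F (c * qexp (\<tau> / of_nat (h * nat z)) ^ nat x)" if \<tau>: "Im \<tau> > 0" for \<tau>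
  proof -
    have "aff x y z \<tau> / of_nat h = of_int y / (of_int z * of_nat h) + of_nat (nat x) * (\<tau> / of_nat (h * nat z))"
      using pos F(1) by (simp add: aff_def field_simps)
    moreover have "qexp (of_nat (nat x) * (\<tau> / of_nat (h * nat z))) = qexp (\<tau> / of_nat (h * nat z)) ^ nat x"
      unfolding qexp_ee ee_power by (simp add: mult_ac)
    ultimately show ?thesis
      unfolding F(3)[OF Im_aff[OF pos \<tau>]] c_def by (simp only: qexp_add)
  qed
  then show ?thesis unfolding cusp_mero_def
    using meromorphic_scale_power[OF F(2), of "nat x" c] F(1) pos
    by (intro exI[of _ "h * nat z"] exI[of _ "\<lambda>X. F (c * X ^ nat x)"]) auto
qed

lemma cusp_mero_ee:
  assumes "r \<in> \<rat>"
  shows "cusp_mero (\<lambda>\<tau>. ee (of_real r * \<tau> + c))"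
proof -
  have "\<exists>m n :: int. n > 0 \<and> r = of_int m / of_int n"
    using assms by (elim Rats_cases') blast
  then obtain m n :: int where mn: "n > 0" "r = of_int m / of_int n" by blast
  have "ee (of_real r * \<tau> + c) = ee c * qexp (\<tau> / of_nat (nat (2 * n))) powi m" for \<tau>
  proof -
    have "qexp (\<tau> / of_nat (nat (2 * n))) powi m = ee (of_real r * \<tau>)"
      using mn(1) unfolding qexp_ee ee_def by (simp add: exp_power_int mn(2) field_simps)
    then show ?thesis by (simp add: ee_add mult.commute)
  qed
  moreover have "(\<lambda>X. ee c * X powi m) meromorphic_on {0}" by (intro meromorphic_intros)
  ultimately show ?thesis unfolding cusp_mero_def using mn(1)
    by (intro exI[of _ "nat (2 * n)"] exI[of _ "\<lambda>X. ee c * X powi m"]) simp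
qed

text \<open>For \<open>r = m / n \<ge> 0\<close> this is a product in the variable
  \<open>e(\<tau> / n)\<close> that is holomorphic at 0. For negative \<open>r\<close> finitely many
  factors, each a rational power of \<open>q\<close> subtracted from 1, are split off until the
  exponent is no longer negative.\<close>

lemma cusp_mero_qpoch:
  assumes r: "r \<in> \<rat>"
  shows "cusp_mero (\<lambda>\<tau>. qpoch_inf (qexp (of_real r * \<tau> + c)) (qexp \<tau>))"
proof -
  have pos: "cusp_mero (\<lambda>\<tau>. qpoch_inf (qexp (of_real r * \<tau> + c)) (qexp \<tau>))" if "r \<in> \<rat>" "r \<ge> 0" for r
  proof -
    have "\<exists>m n :: int. n > 0 \<and> r = of_int m / of_int n"
      using that(1) by (elim Rats_cases') blast
    then obtain m n :: int where mn: "n > 0" "r = of_int m / of_int n" by blast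
    then have m: "m \<ge> 0" using that(2) by (simp add: zero_le_divide_iff)
    let ?F = "\<lambda>X. qpoch_inf (qexp c * X ^ nat m) (X ^ nat n)"
    have "?F holomorphic_on ball 0 1"
      by (intro qpoch_inf_holomorphic holomorphic_intros) (use mn(1) in \<open>auto simp: norm_power power_less_one_iff\<close>)
    then have "?F meromorphic_on {0}"
      by (intro analytic_on_imp_meromorphic_on) (auto simp: analytic_at intro!: exI[of _ "ball 0 1"])
    moreover have "qpoch_inf (qexp (of_real r * \<tau> + c)) (qexp \<tau>) = ?F (qexp (\<tau> / of_nat (nat n)))" for \<tau>
    proof -
      have "qexp (of_real r * \<tau> + c) = qexp c * qexp (\<tau> / of_nat (nat n)) ^ nat m"
        unfolding qexp_ee ee_power ee_add[symmetric] by (rule arg_cong[where f = ee]) (use mn(1) m in \<open>simp add: mn(2) field_simps\<close>)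
      moreover have "qexp \<tau> = qexp (\<tau> / of_nat (nat n)) ^ nat n"
        using mn unfolding qexp_ee ee_power by simp
      ultimately show ?thesis by (simp only:)
    qed
    ultimately show ?thesis unfolding cusp_mero_def using mn(1)
      by (intro exI[of _ "nat n"] exI[of _ ?F]) auto
  qed
  define N where "N = nat \<lceil>- r\<rceil>"
  have N: "r + of_nat N \<ge> 0" unfolding N_def by linarith
  have pw: "qexp (of_real r * \<tau> + c) * qexp \<tau> ^ j = qexp (of_real (r + of_nat j) * \<tau> + c)" for \<tau> j
    unfolding qexp_ee ee_power ee_add[symmetric] by (rule arg_cong[where f = ee]) (simp add: algebra_simps)
  have "cusp_mero (\<lambda>\<tau>. (\<Prod>j<N. 1 - qexp (of_real (r + of_nat j) * \<tau> + c)) * qpoch_inf (qexp (of_real (r + of_nat N) * \<tau> + c)) (qexp \<tau>))"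
  proof (intro cusp_mero_mult cusp_mero_prod cusp_mero_diff cusp_mero_const)
    show "cusp_mero (\<lambda>\<tau>. qpoch_inf (qexp (of_real (r + of_nat N) * \<tau> + c)) (qexp \<tau>))"
      by (rule pos[OF _ N]) (use r in auto)
    fix j :: nat
    have "cusp_mero (\<lambda>\<tau>. ee (of_real (2 * (r + of_nat j)) * \<tau> + 2 * c))"
      by (rule cusp_mero_ee) (use r in auto)
    then show "cusp_mero (\<lambda>\<tau>. qexp (of_real (r + of_nat j) * \<tau> + c))"
      unfolding qexp_ee by (simp add: algebra_simps)
  qed auto
  then show ?thesis
  proof (rule cusp_mero_cong)
    fix \<tau> :: complex assume \<tau>: "Im \<tau> > 0"
    show "(\<Prod>j<N. 1 - qexp (of_real (r + of_nat j) * \<tau> + c)) * qpoch_inf (qexp (of_real (r + of_nat N) * \<tau> + c)) (qexp \<tau>) =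
      qpoch_inf (qexp (of_real r * \<tau> + c)) (qexp \<tau>)"
      unfolding qpoch_inf_shift[OF norm_qexp_less_1[OF \<tau>], of "qexp (of_real r * \<tau> + c)" N] qpoch_fin_def pw ..
  qed
qed

lemma cusp_mero_eta: "cusp_mero eta"
proof -
  have "cusp_mero (\<lambda>\<tau>. ee (of_real (1 / 12) * \<tau> + 0) * qpoch_inf (qexp (of_real 1 * \<tau> + 0)) (qexp \<tau>))"
    by (intro cusp_mero_mult cusp_mero_ee cusp_mero_qpoch) auto
  then show ?thesis by (rule cusp_mero_cong) (simp add: eta_def)
qed

lemma cusp_mero_siegel:
  assumes "a \<in> \<rat>"
  shows "cusp_mero (siegel a b)"
proof -
  have "cusp_mero (\<lambda>\<tau>. ee (of_real (a * a) * \<tau> + of_real (a * b)) * ee (of_real (1 / 6) * \<tau> + 0) *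
     (ee (of_real (- a) * \<tau> + of_real (- b)) * qpoch_inf (qexp (of_real a * \<tau> + of_real b)) (qexp \<tau>) *
      qpoch_inf (qexp (of_real (1 - a) * \<tau> + of_real (- b))) (qexp \<tau>)))"
    by (intro cusp_mero_mult cusp_mero_ee cusp_mero_qpoch) (use assms in auto)
  then show ?thesis
  proof (rule cusp_mero_cong)
    fix \<tau> :: complex
    have e: "of_real (a * a) * \<tau> + of_real (a * b) = of_real a * (of_real a * \<tau> + of_real b)"
      "of_real (1 / 6) * \<tau> + 0 = \<tau> / 6" "of_real (- a) * \<tau> + of_real (- b) = - (of_real a * \<tau> + of_real b)"
      "of_real (1 - a) * \<tau> + of_real (- b) = \<tau> - (of_real a * \<tau> + of_real b)"
      by (simp_all add: algebra_simps)
    show "ee (of_real (a * a) * \<tau> + of_real (a * b)) * ee (of_real (1 / 6) * \<tau> + 0) *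
     (ee (of_real (- a) * \<tau> + of_real (- b)) * qpoch_inf (qexp (of_real a * \<tau> + of_real b)) (qexp \<tau>) *
      qpoch_inf (qexp (of_real (1 - a) * \<tau> + of_real (- b))) (qexp \<tau>)) = siegel a b \<tau>"
      unfolding siegel_def theta_def e ..
  qed
qed

lemma cusp_mero_eta_block:
  assumes "upper_pos M1" "upper_pos M2" "upper_pos M3" "a \<in> \<rat>"
  shows "cusp_mero (eta_block M1 M2 M3 a b)"
proof -
  obtain x1 y1 z1 x2 y2 z2 x3 y3 z3 where M: "M1 = (x1, y1, z1)" "M2 = (x2, y2, z2)" "M3 = (x3, y3, z3)"
    by (metis prod.exhaust)
  have "cusp_mero (\<lambda>\<tau>. (eta (aff x1 y1 z1 \<tau>) * eta (aff x1 y1 z1 \<tau>)) / (eta (aff x2 y2 z2 \<tau>) * siegel a b (aff x3 y3 z3 \<tau>)))"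
    by (intro cusp_mero_divide cusp_mero_mult cusp_mero_aff cusp_mero_eta cusp_mero_siegel)
       (use assms in \<open>auto simp: M upper_pos_def\<close>)
  then show ?thesis unfolding eta_block_def M by (simp add: power2_eq_square)
qed

section \<open>Modularity of the bilateral series\<close>

text \<open>\<open>X(e(\<tau> / 2))\<close>, or \<open>X(- e(\<tau> / 2))\<close> if
  \<open>j\<close> holds, times the power of \<open>q\<close> that makes it an eta--Siegel block:
  that block begins with \<open>ee (- \<tau> / 60)\<close> for \<open>s = 0\<close> and with
  \<open>ee (11 * \<tau> / 60)\<close> for \<open>s = 1\<close>.\<close>

definition lift :: "nat \<Rightarrow> bool \<Rightarrow> complex \<Rightarrow> complex" where
  "lift s j \<tau> = ee (- of_real (if s = 0 then 1 / 60 else - 11 / 60) * \<tau>) * theta4_rr s (if j then - qexp (\<tau> / 2) else qexp (\<tau> / 2))"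

text \<open>With \<open>q = e(\<tau> / 2)\<close> this is half of
  \<open>theta2 q * rr_series (1 - s) (q ^ 4)\<close> up to a power of \<open>q\<close>, the third
  function in \<open>theta4_rr_relations\<close>.\<close>

definition companion :: "nat \<Rightarrow> complex \<Rightarrow> complex" where
  "companion s = eta_block (2, 0, 1) (1, 0, 1) (10, 0, 1) (real (2 - s) / 5) 0"

text \<open>The matrices with middle entry 1 or 5 evaluate at \<open>(\<tau> + 1) / 2\<close>
  instead of \<open>\<tau> / 2\<close>, which changes \<open>e(\<tau> / 2)\<close> to its
  negative.\<close>

definition lift_block :: "nat \<Rightarrow> bool \<Rightarrow> complex \<Rightarrow> complex" where
  "lift_block s j = (if j then eta_block (1, 1, 2) (1, 0, 1) (5, 5, 2) (real (s + 1) / 5) 0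
     else eta_block (1, 0, 2) (1, 0, 1) (5, 0, 2) (real (s + 1) / 5) 0)"

lemma eta_add_1: "eta (\<tau> + 1) = ee (1 / 12) * eta \<tau>"
proof -
  have "qexp (\<tau> + 1) = qexp \<tau>" unfolding qexp_add qexp_1 by simp
  then show ?thesis unfolding eta_def by (simp add: add_divide_distrib ee_add)
qed

text \<open>With \<open>a = (s + 1) / 5\<close> the Siegel function at \<open>5 * t\<close> starts
  with the exponent \<open>5 * a\<^sup>2 - 5 * a + 5 / 6\<close> in \<open>ee t\<close>, that is
  1/30 or -11/30. The eta quotient starts with exponent 0.\<close>

lemma eta_block_eq_theta4_rr:
  assumes s: "s \<le> 1" and t: "Im t > 0"
  shows "(eta t)\<^sup>2 / (eta (2 * t) * siegel (real (s + 1) / 5) 0 (5 * t)) =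
    ee (- of_real (if s = 0 then 1 / 30 else - 11 / 30) * t) * theta4_rr s (qexp t)"
proof -
  define q where "q = qexp t"
  have q: "norm q < 1" "q \<noteq> 0" unfolding q_def by (rule norm_qexp_less_1[OF t]) simp
  have q2: "qexp (2 * t) = q\<^sup>2" unfolding q_def qexp_ee ee_power by simp
  have q5: "qexp (5 * t) = q ^ 5" unfolding q_def qexp_ee ee_power by (simp add: mult_ac)
  define c where "c = (if s = 0 then 1 / 30 else - 11 / 30 :: real)"
  have z: "of_real (real (s + 1) / 5) * (5 * t) + of_real 0 = of_nat (s + 1) * t" by simp
  have w: "qexp (of_nat (s + 1) * t) = q ^ (s + 1)" unfolding q_def qexp_ee ee_power by (simp only: mult_ac)
  have w': "qexp (5 * t - of_nat (s + 1) * t) = q ^ (4 - s)"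
  proof -
    have "5 * t - of_nat (s + 1) * t = of_nat (4 - s) * t" using s by (simp add: of_nat_diff algebra_simps)
    then show ?thesis unfolding q_def qexp_ee ee_power by (simp only: mult_ac)
  qed
  have e: "ee (of_real (real (s + 1) / 5) * (of_nat (s + 1) * t)) * ee (5 * t / 6) * ee (- (of_nat (s + 1) * t)) = ee (of_real c * t)"
  proof -
    consider "s = 0" | "s = 1" using s by linarith
    then show ?thesis
      unfolding ee_add[symmetric]
      by cases (rule arg_cong[where f = ee], simp add: c_def field_simps)+
  qed
  have sg: "siegel (real (s + 1) / 5) 0 (5 * t) = ee (of_real c * t) * (qpoch_inf (q ^ (s + 1)) (q ^ 5) * qpoch_inf (q ^ (4 - s)) (q ^ 5))"
    unfolding siegel_def z theta_def w w' q5 e[symmetric] by (simp only: mult_ac)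
  have et: "(eta t)\<^sup>2 / eta (2 * t) = (qpoch_inf q q)\<^sup>2 / qpoch_inf (q\<^sup>2) (q\<^sup>2)"
  proof -
    have "(ee (t / 12))\<^sup>2 = ee (2 * t / 12)" unfolding ee_power by simp
    then show ?thesis unfolding eta_def q2 q_def[symmetric] by (simp add: power_mult_distrib)
  qed
  have "(eta t)\<^sup>2 / (eta (2 * t) * siegel (real (s + 1) / 5) 0 (5 * t)) = (eta t)\<^sup>2 / eta (2 * t) / siegel (real (s + 1) / 5) 0 (5 * t)"
    by simp
  also have "\<dots> = ee (- (of_real c * t)) * ((qpoch_inf q q)\<^sup>2 / qpoch_inf (q\<^sup>2) (q\<^sup>2) * rr_series s q)"
    unfolding et sg rr_series_prod[OF q s] ee_minus by (simp add: add.commute)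
  finally show ?thesis unfolding theta4_rr_def q_def c_def by simp
qed

text \<open>If \<open>j\<close> holds, the block keeps its middle eta function at \<tau> rather than
  at \<open>\<tau> + 1\<close>, and the power of \<open>q\<close> is taken at
  \<open>(\<tau> + 1) / 2\<close>; each costs a root of unity.\<close>

lemma lift_eq_lift_block:
  assumes s: "s \<le> 1"
  shows "\<exists>u. norm u = 1 \<and> (\<forall>\<tau>. Im \<tau> > 0 \<longrightarrow> lift_block s j \<tau> = u * lift s j \<tau>)"
proof (cases j)
  case False
  have "lift_block s j \<tau> = 1 * lift s j \<tau>" if "Im \<tau> > 0" for \<tau>
  proof -
    have a: "aff 1 0 2 \<tau> = \<tau> / 2" "aff 1 0 1 \<tau> = 2 * (\<tau> / 2)" "aff 5 0 2 \<tau> = 5 * (\<tau> / 2)" by (simp_all add: aff_def)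
    have t: "Im (\<tau> / 2) > 0" using that by simp
    have e: "ee (- of_real (if s = 0 then 1 / 30 else - 11 / 30) * (\<tau> / 2)) = ee (- of_real (if s = 0 then 1 / 60 else - 11 / 60) * \<tau>)"
      by (rule arg_cong[where f = ee]) simp
    have "lift_block s j \<tau> = ee (- of_real (if s = 0 then 1 / 60 else - 11 / 60) * \<tau>) * theta4_rr s (qexp (\<tau> / 2))"
      unfolding eta_block_eq_theta4_rr[OF s t, unfolded e, symmetric] lift_block_def using False by (simp only: if_False eta_block_def prod.case a)
    then show ?thesis using False unfolding lift_def by (simp only: if_False mult_1_left)
  qed
  then show ?thesis by (intro exI[of _ 1]) simp
next
  case True
  define c where "c = (if s = 0 then 1 / 30 else - 11 / 30 :: real)"
  have "lift_block s j \<tau> = (ee (1 / 12) * ee (- of_real c / 2)) * lift s j \<tau>" if \<tau>: "Im \<tau> > 0" for \<tau>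
  proof -
    let ?t = "(\<tau> + 1) / 2"
    have t: "Im ?t > 0" using \<tau> by simp
    have a: "aff 1 1 2 \<tau> = ?t" "aff 1 0 1 \<tau> = \<tau>" "aff 5 5 2 \<tau> = 5 * ?t" by (simp_all add: aff_def field_simps)
    have tt: "2 * ?t = \<tau> + 1" by simp
    have "eta (2 * ?t) = ee (1 / 12) * eta \<tau>" unfolding tt by (rule eta_add_1)
    then have "lift_block s j \<tau> = ee (1 / 12) * ((eta ?t)\<^sup>2 / (eta (2 * ?t) * siegel (real (s + 1) / 5) 0 (5 * ?t)))"
      using True unfolding lift_block_def eta_block_def prod.case a by (simp only: if_True) (simp add: a)
    also have "\<dots> = ee (1 / 12) * (ee (- of_real c * ?t) * theta4_rr s (qexp ?t))"
      unfolding eta_block_eq_theta4_rr[OF s t] c_def ..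
    also have "ee (- of_real c * ?t) = ee (- of_real c / 2) * ee (- of_real (c / 2) * \<tau>)"
      unfolding ee_add[symmetric] by (rule arg_cong[where f = ee]) (simp add: field_simps)
    also have "qexp ?t = - qexp (\<tau> / 2)"
    proof -
      have "qexp ?t = ee \<tau> * ee 1" unfolding qexp_ee ee_add[symmetric] by (rule arg_cong[where f = ee]) (simp add: field_simps)
      also have "\<dots> = - qexp (\<tau> / 2)" unfolding qexp_ee by simp
      finally show ?thesis .
    qed
    finally show ?thesis using True by (simp add: lift_def c_def)
  qed
  then show ?thesis by (intro exI[of _ "ee (1 / 12) * ee (- of_real c / 2)"]) (simp add: norm_mult)
qed

section \<open>Transformation of the lifts under \<open>Gamma1 10\<close>\<close>

lemma lift_block_nonzero_holomorphic:
  assumes s: "s \<le> 1"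
  shows "Im \<tau> > 0 \<Longrightarrow> lift_block s j \<tau> \<noteq> 0" "Im \<tau> > 0 \<Longrightarrow> companion s \<tau> \<noteq> 0" "lift_block s j holomorphic_on upper_half_plane"
proof -
  have i: "real k / 5 \<notin> \<int>" if "k > 0" "k < 5" for k :: nat
  proof
    assume "real k / 5 \<in> \<int>"
    then obtain n :: int where "real k / 5 = of_int n" by (auto elim: Ints_cases)
    then have "real_of_int (int k) = real_of_int (5 * n)" by simp
    then have "int k = 5 * n" by (simp only: of_int_eq_iff)
    then show False using that by presburger
  qed
  have i1: "\<not> (real (s + 1) / 5 \<in> \<int> \<and> (0::real) \<in> \<int>)" using i[of "s + 1"] s by simp
  have i2: "\<not> (real (2 - s) / 5 \<in> \<int> \<and> (0::real) \<in> \<int>)" using i[of "2 - s"] s by simp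
  show "Im \<tau> > 0 \<Longrightarrow> lift_block s j \<tau> \<noteq> 0"
    unfolding lift_block_def using i1 by (cases j) (simp_all add: upper_pos_def eta_block_nonzero)
  show "Im \<tau> > 0 \<Longrightarrow> companion s \<tau> \<noteq> 0"
    unfolding companion_def using i2 by (simp add: upper_pos_def eta_block_nonzero)
  show "lift_block s j holomorphic_on upper_half_plane"
    unfolding lift_block_def using i1 by (cases j) (simp_all add: upper_pos_def eta_block_holomorphic)
qed

lemma lift_nonzero_holomorphic:
  assumes s: "s \<le> 1"
  shows "Im \<tau> > 0 \<Longrightarrow> lift s j \<tau> \<noteq> 0" "lift s j holomorphic_on upper_half_plane"
proof -
  obtain u where u: "norm u = 1" "\<And>\<tau>. Im \<tau> > 0 \<Longrightarrow> lift_block s j \<tau> = u * lift s j \<tau>" using lift_eq_lift_block[OF s] by blast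
  then have u0: "u \<noteq> 0" by auto
  show "Im \<tau> > 0 \<Longrightarrow> lift s j \<tau> \<noteq> 0" using u(2) lift_block_nonzero_holomorphic(1)[OF s] by fastforce
  have "(\<lambda>\<tau>. lift_block s j \<tau> / u) holomorphic_on upper_half_plane"
    using lift_block_nonzero_holomorphic(3)[OF s] u0 by (intro holomorphic_intros) auto
  then show "lift s j holomorphic_on upper_half_plane"
    by (rule holomorphic_transform) (use u u0 in auto)
qed

text \<open>This is \<open>theta4_rr_relations\<close> in modular normalisation; the work lies in
  checking that the powers of \<open>q\<close> of the three blocks match.\<close>

lemma lift_companion_relation:
  assumes s: "s \<le> 1" and \<tau>: "Im \<tau> > 0"
  shows "lift s True \<tau> + (if s = 0 then - 1 else 1) * lift s False \<tau> = 2 * companion s \<tau>"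
proof -
  define t where "t = \<tau> / 2"
  define q where "q = qexp t"
  have t: "Im t > 0" using \<tau> by (simp add: t_def)
  have q: "norm q < 1" "q \<noteq> 0" unfolding q_def by (rule norm_qexp_less_1[OF t]) simp
  have q4: "norm (q ^ 4) < 1" "q ^ 4 \<noteq> 0" using norm_power4_less_1[OF q(1)] q(2) by simp_all
  have s': "1 - s \<le> 1" "real (1 - s + 1) / 5 = real (2 - s) / 5" using s by auto
  have t4: "Im (4 * t) > 0" using t by simp
  define c where "c = (if s = 0 then 1 / 60 else - 11 / 60 :: real)"
  have "2 * t * 2 = 4 * t" by simp
  have a: "aff 2 0 1 \<tau> = 4 * t" "aff 1 0 1 \<tau> = 2 * t" "aff 10 0 1 \<tau> = 5 * (4 * t)" by (simp_all add: aff_def t_def)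
  have "companion s \<tau> = (eta (4 * t))\<^sup>2 / (eta (2 * t) * siegel (real (2 - s) / 5) 0 (5 * (4 * t)))"
    unfolding companion_def eta_block_def prod.case a ..
  \<comment> \<open>Solving \<open>eta_block_eq_theta4_rr\<close> at \<open>4 * t\<close> for the
    Siegel function brings in \<open>rr_series (1 - s)\<close> at \<open>q ^ 4\<close>.\<close>
  also have "siegel (real (2 - s) / 5) 0 (5 * (4 * t)) =
     (eta (4 * t))\<^sup>2 / (eta (2 * (4 * t)) * (ee (- of_real (if 1 - s = 0 then 1 / 30 else - 11 / 30) * (4 * t)) * theta4_rr (1 - s) (qexp (4 * t))))"
  proof -
    have S: "siegel (real (2 - s) / 5) 0 (5 * (4 * t)) \<noteq> 0"
    proof (rule siegel_nonzero)
      show "Im (5 * (4 * t)) > 0" using t by simp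
      show "\<not> (real (2 - s) / 5 \<in> \<int> \<and> (0::real) \<in> \<int>)"
      proof
        assume "real (2 - s) / 5 \<in> \<int> \<and> (0::real) \<in> \<int>"
        then obtain n :: int where "real (2 - s) / 5 = of_int n" by (auto elim: Ints_cases)
        then have "real_of_int (int (2 - s)) = real_of_int (5 * n)" by simp
        then have "int (2 - s) = 5 * n" by (simp only: of_int_eq_iff)
        then show False using s by presburger
      qed
    qed
    have gen: "S = E1 / (E2 * Y)" if "E1 / (E2 * S) = Y" "E1 \<noteq> 0" "E2 \<noteq> 0" "S \<noteq> 0" for S E1 E2 Y :: complex
      using that by auto
    have "(eta (4 * t))\<^sup>2 \<noteq> 0" "eta (2 * (4 * t)) \<noteq> 0" using t by (simp_all add: eta_nonzero)
    then show ?thesis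
      using gen[OF eta_block_eq_theta4_rr[OF s'(1) t4]] S unfolding s'(2) by blast
  qed
  finally have W1: "companion s \<tau> = eta (2 * (4 * t)) / eta (2 * t) * (ee (- of_real (if 1 - s = 0 then 1 / 30 else - 11 / 30) * (4 * t)) * theta4_rr (1 - s) (qexp (4 * t)))"
    using eta_nonzero[OF t4] by simp
  have qq: "qexp (2 * t) = q\<^sup>2" "qexp (4 * t) = q ^ 4" "qexp (2 * (4 * t)) = (q ^ 4)\<^sup>2"
    unfolding q_def qexp_ee ee_power by (simp_all add: mult_ac)
  have P: "qpoch_inf ((q ^ 4)\<^sup>2) ((q ^ 4)\<^sup>2) \<noteq> 0"
    using norm_square_less_1[OF q4(1)] by (intro qpoch_inf_nonzero)
  have f0: "eta (2 * (4 * t)) / eta (2 * t) * theta4_rr (1 - s) (qexp (4 * t)) =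
      ee (t / 2) * ((qpoch_inf (q ^ 4) (q ^ 4))\<^sup>2 / qpoch_inf (q\<^sup>2) (q\<^sup>2)) * rr_series (1 - s) (q ^ 4)"
  proof -
    have "ee (2 * (4 * t) / 12) / ee (2 * t / 12) = ee (t / 2)"
      unfolding ee_diff[symmetric] by (rule arg_cong[where f = ee]) (simp add: field_simps)
    then show ?thesis unfolding eta_def qq theta4_rr_def using P by (simp add: divide_simps)
  qed
  define E where "E = ee (- of_real (if 1 - s = 0 then 1 / 30 else - 11 / 30) * (4 * t))"
  have "companion s \<tau> = E * (eta (2 * (4 * t)) / eta (2 * t) * theta4_rr (1 - s) (qexp (4 * t)))"
    unfolding W1 E_def[symmetric] by (simp only: mult_ac)
  also have "\<dots> = ee (t / 2) * E * (theta2 q / 2 * rr_series (1 - s) (q ^ 4))"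
    unfolding f0 theta2_prod[OF q] by simp
  finally have w1: "companion s \<tau> = ee (t / 2) * ee (- of_real (if 1 - s = 0 then 1 / 30 else - 11 / 30) * (4 * t)) * (theta2 q / 2 * rr_series (1 - s) (q ^ 4))"
    unfolding E_def .
  \<comment> \<open>The exponents agree except for one factor \<open>q\<close> if
    \<open>s = 0\<close>, which is the factor in front of \<open>theta2 q\<close> in the first
    relation.\<close>
  have w2: "ee (t / 2) * ee (- of_real (if 1 - s = 0 then 1 / 30 else - 11 / 30) * (4 * t)) = ee (- of_real c * \<tau>) * (if s = 0 then q else 1)"
  proof -
    have qe: "q = ee (2 * t)" by (simp add: q_def qexp_ee)
    define c' where "c' = (if 1 - s = 0 then 1 / 30 else - 11 / 30 :: real)"
    show ?thesis
    proof (cases "s = 0")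
      case True
      have c: "c' = - 11 / 30" "c = 1 / 60" using True by (simp_all add: c'_def c_def)
      have "ee (t / 2) * ee (- of_real c' * (4 * t)) = ee (- of_real c * \<tau>) * q"
        unfolding qe c ee_add[symmetric] by (rule arg_cong[where f = ee]) (simp add: t_def field_simps)
      then show ?thesis unfolding c'_def if_P[OF True] .
    next
      case False
      then have c: "c' = 1 / 30" "c = - 11 / 60" using s by (simp_all add: c'_def c_def)
      have "ee (t / 2) * ee (- of_real c' * (4 * t)) = ee (- of_real c * \<tau>)"
        unfolding c ee_add[symmetric] by (rule arg_cong[where f = ee]) (simp add: t_def field_simps)
      then show ?thesis unfolding c'_def if_not_P[OF False] mult_1_right .
    qed
  qed
  have gen: "2 * (A * (x / 2 * y)) = A * (x * y)" for A x y :: complex by simp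
  have W2: "2 * companion s \<tau> = ee (- of_real c * \<tau>) * ((if s = 0 then q else 1) * theta2 q * rr_series (1 - s) (q ^ 4))"
    unfolding w1 gen w2 by (simp only: mult_ac)
  have Vs: "lift s True \<tau> = ee (- of_real c * \<tau>) * theta4_rr s (- q)" "lift s False \<tau> = ee (- of_real c * \<tau>) * theta4_rr s q"
    by (simp_all add: lift_def c_def q_def t_def)
  consider "s = 0" | "s = 1" using s by linarith
  then show ?thesis
  proof cases
    case 1
    define E where "E = ee (- of_real c * \<tau>)"
    have x: "theta4_rr 0 (- q) = theta4_rr 0 q + q * theta2 q * rr_series 1 (q ^ 4)" using theta4_rr_relations(1)[OF q] by simp
    show ?thesis unfolding Vs W2 unfolding E_def[symmetric] 1 x by (simp add: algebra_simps)
  next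
    case 2
    define E where "E = ee (- of_real c * \<tau>)"
    have x: "theta4_rr 1 (- q) = theta2 q * rr_series 0 (q ^ 4) - theta4_rr 1 q" using theta4_rr_relations(2)[OF q] by simp
    show ?thesis unfolding Vs W2 unfolding E_def[symmetric] 2 x by (simp add: algebra_simps)
  qed
qed

text \<open>Divisibility of \<open>c\<close> by 10 makes the intertwining matrices integral, and
  \<open>a\<close> being 1 modulo 5 means that the characteristics move by integers only, which
  \<open>eta_block_shift\<close> absorbs. The lower right entries of the triangular matrices are
  preserved, so the constants have modulus one.\<close>

lemma lift_block_companion_transform:
  fixes a b c d :: int
  assumes s: "s \<le> 1" and det: "a * d - b * c = 1" and a: "[a = 1] (mod 10)" and d: "[d = 1] (mod 10)" and c: "[c = 0] (mod 10)"
  shows "\<exists>k. norm k = 1 \<and> (\<forall>\<tau>. Im \<tau> > 0 \<longrightarrow> lift_block s j (mob a b c d \<tau>) = k * (of_int c * \<tau> + of_int d) powr (1 / 2) * lift_block s (j \<noteq> odd b) \<tau>)"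
    and "\<exists>k. norm k = 1 \<and> (\<forall>\<tau>. Im \<tau> > 0 \<longrightarrow> companion s (mob a b c d \<tau>) = k * (of_int c * \<tau> + of_int d) powr (1 / 2) * companion s \<tau>)"
proof -
  obtain e where e: "c = 10 * e" using c by (auto simp: cong_0_iff)
  obtain a0 where a0: "a = 1 + 10 * a0" using a by (metis cong_iff_lin cong_sym)
  obtain d0 where d0: "d = 1 + 10 * d0" using d by (metis cong_iff_lin cong_sym)
  have ni: "real k / 5 \<notin> \<int>" if "k > 0" "k < 5" for k :: nat
  proof
    assume "real k / 5 \<in> \<int>"
    then obtain n :: int where "real k / 5 = of_int n" by (auto elim: Ints_cases)
    then have "real_of_int (int k) = real_of_int (5 * n)" by simp
    then have "int k = 5 * n" by (simp only: of_int_eq_iff)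
    then show False using that by presburger
  qed
  have I0: "intertwines (1, 0, 1) (1, 0, 1) (a, b, c, d) (a, b, c, d)"
    unfolding intertwines_iff using det by simp
  show "\<exists>k. norm k = 1 \<and> (\<forall>\<tau>. Im \<tau> > 0 \<longrightarrow> companion s (mob a b c d \<tau>) = k * (of_int c * \<tau> + of_int d) powr (1 / 2) * companion s \<tau>)"
  proof -
    let ?x = "real (2 - s) / 5"
    have I1: "intertwines (2, 0, 1) (2, 0, 1) (a, 2 * b, 5 * e, d) (a, b, c, d)"
      unfolding intertwines_iff using det by (simp add: e)
    have I3: "intertwines (10, 0, 1) (10, 0, 1) (a, 10 * b, e, d) (a, b, c, d)"
      unfolding intertwines_iff using det by (simp add: e)
    have nn: "\<not> (?x \<in> \<int> \<and> (0::real) \<in> \<int>)" using ni[of "2 - s"] s by simp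
    obtain k where k: "norm k = 1" "\<And>\<tau>. Im \<tau> > 0 \<Longrightarrow> companion s (mob a b c d \<tau>) =
       k * (of_int c * \<tau> + of_int d) powr (1 / 2) * eta_block (2, 0, 1) (1, 0, 1) (10, 0, 1) (?x * of_int a + 0 * of_int e) (?x * of_int (10 * b) + 0 * of_int d) \<tau>"
      using eta_block_transform[OF I1 I0 I3 nn] unfolding companion_def snd_conv by blast
    obtain u where u: "norm u = 1" "\<And>\<tau>. Im \<tau> > 0 \<Longrightarrow> eta_block (2, 0, 1) (1, 0, 1) (10, 0, 1) (?x + of_int (2 * int (2 - s) * a0)) (0 + of_int (2 * int (2 - s) * b)) \<tau> = u * companion s \<tau>"
      using eta_block_shift[of "(10, 0, 1)" "(2, 0, 1)" "(1, 0, 1)" ?x "2 * int (2 - s) * a0" 0 "2 * int (2 - s) * b"] unfolding companion_def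
      by (auto simp: upper_pos_def)
    have ea: "?x * of_int a + 0 * of_int e = ?x + of_int (2 * int (2 - s) * a0)" and eb: "?x * of_int (10 * b) + 0 * of_int d = 0 + of_int (2 * int (2 - s) * b)"
      by (simp_all add: a0 field_simps)
    have "companion s (mob a b c d \<tau>) = (k * u) * (of_int c * \<tau> + of_int d) powr (1 / 2) * companion s \<tau>" if "Im \<tau> > 0" for \<tau>
      using k(2)[OF that] unfolding ea eb u(2)[OF that] by (simp only: mult_ac)
    then show ?thesis using k(1) u(1) by (intro exI[of _ "k * u"]) (simp add: norm_mult)
  qed
  show "\<exists>k. norm k = 1 \<and> (\<forall>\<tau>. Im \<tau> > 0 \<longrightarrow> lift_block s j (mob a b c d \<tau>) = k * (of_int c * \<tau> + of_int d) powr (1 / 2) * lift_block s (j \<noteq> odd b) \<tau>)"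
  proof -
    let ?x = "real (s + 1) / 5"
    define n where "n = (of_bool j :: int)"
    \<comment> \<open>Since \<open>a\<close> and \<open>d\<close> are odd and \<open>c\<close> is
      even, this is the parity for which \<open>b + n * d - p * m\<close> is even, that is, for
      which the upper right entry \<open>h\<close> of the intertwining matrix is integral.\<close>
    define m where "m = (of_bool (j \<noteq> odd b) :: int)"
    define p where "p = a + n * c"
    have "even (b + n * d - p * m)"
      unfolding p_def n_def m_def a0 d0 e by (cases j; cases "odd b") auto
    then obtain h where h: "b + n * d - p * m = 2 * h" by (rule evenE)
    have h': "b = 2 * h + p * m - n * d" using h by simp
    have det': "p * (d - c * m) - h * (2 * c) = 1"
      using det unfolding h' p_def by (simp add: algebra_simps)
    have U: "lift_block s j = eta_block (1, n, 2) (1, 0, 1) (5, 5 * n, 2) ?x 0" "lift_block s (j \<noteq> odd b) = eta_block (1, m, 2) (1, 0, 1) (5, 5 * m, 2) ?x 0"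
      by (auto simp: lift_block_def n_def m_def)
    have I1: "intertwines (1, n, 2) (1, m, 2) (p, h, 2 * c, d - c * m) (a, b, c, d)"
      unfolding intertwines_iff using det det' h by (simp add: p_def algebra_simps)
    have I3: "intertwines (5, 5 * n, 2) (5, 5 * m, 2) (p, 5 * h, 4 * e, d - c * m) (a, b, c, d)"
      unfolding intertwines_iff using det det' h by (simp add: p_def e algebra_simps)
    have nn: "\<not> (?x \<in> \<int> \<and> (0::real) \<in> \<int>)" using ni[of "s + 1"] s by simp
    obtain k where k: "norm k = 1" "\<And>\<tau>. Im \<tau> > 0 \<Longrightarrow> eta_block (1, n, 2) (1, 0, 1) (5, 5 * n, 2) ?x 0 (mob a b c d \<tau>) =
       k * (of_int c * \<tau> + of_int d) powr (1 / 2) * eta_block (1, m, 2) (1, 0, 1) (5, 5 * m, 2) (?x * of_int p + 0 * of_int (4 * e)) (?x * of_int (5 * h) + 0 * of_int (d - c * m)) \<tau>"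
      using eta_block_transform[OF I1 I0 I3 nn] unfolding snd_conv by blast
    obtain u where u: "norm u = 1" "\<And>\<tau>. Im \<tau> > 0 \<Longrightarrow> eta_block (1, m, 2) (1, 0, 1) (5, 5 * m, 2) (?x + of_int (int (s + 1) * 2 * (a0 + n * e))) (0 + of_int (int (s + 1) * h)) \<tau> =
        u * eta_block (1, m, 2) (1, 0, 1) (5, 5 * m, 2) ?x 0 \<tau>"
      using eta_block_shift[of "(5, 5 * m, 2)" "(1, m, 2)" "(1, 0, 1)" ?x "int (s + 1) * 2 * (a0 + n * e)" 0 "int (s + 1) * h"]
      by (auto simp: upper_pos_def)
    have ea: "?x * of_int p + 0 * of_int (4 * e) = ?x + of_int (int (s + 1) * 2 * (a0 + n * e))" and eb: "?x * of_int (5 * h) + 0 * of_int (d - c * m) = 0 + of_int (int (s + 1) * h)"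
      by (simp_all add: p_def a0 e field_simps)
    have "eta_block (1, n, 2) (1, 0, 1) (5, 5 * n, 2) ?x 0 (mob a b c d \<tau>) =
        (k * u) * (of_int c * \<tau> + of_int d) powr (1 / 2) * eta_block (1, m, 2) (1, 0, 1) (5, 5 * m, 2) ?x 0 \<tau>" if "Im \<tau> > 0" for \<tau>
      using k(2)[OF that] unfolding ea eb u(2)[OF that] by (simp only: mult_ac)
    then show ?thesis unfolding U using k(1) u(1) by (intro exI[of _ "k * u"]) (simp add: norm_mult)
  qed
qed

text \<open>The constants \<kappa> of the two lifts are compared by means of the companion, which
  has a constant \<open>w\<close> of its own. If the lifts are linearly independent, comparing
  coefficients in the transformed relation equates all constants up to the sign \<sigma>. If they
  are proportional, that relation says too little, and the exchange of the two under
  \<open>\<tau> + 1\<close> is used instead.\<close>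

lemma lift_transform:
  fixes a b c d :: int
  assumes s: "s \<le> 1" and det: "a * d - b * c = 1" and a: "[a = 1] (mod 10)" and d: "[d = 1] (mod 10)" and c: "[c = 0] (mod 10)"
  shows "\<exists>k. norm k = 1 \<and> (\<forall>\<tau> j. Im \<tau> > 0 \<longrightarrow> lift s j (mob a b c d \<tau>) = k * (of_int c * \<tau> + of_int d) powr (1 / 2) * lift s (j \<noteq> odd b) \<tau>)"
proof -
  define J where "J = (\<lambda>\<tau>. (of_int c * \<tau> + of_int d :: complex) powr (1 / 2))"
  define \<sigma> where "\<sigma> = (if s = 0 then - 1 else 1 :: complex)"
  let ?m = "mob a b c d"
  have \<sigma>: "\<sigma> * \<sigma> = 1" by (simp add: \<sigma>_def)
  have Jnz: "J \<tau> \<noteq> 0" if "Im \<tau> > 0" for \<tau> using mob_denom_nonzero[OF det that] by (simp add: J_def)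
  have "\<exists>k. norm k = 1 \<and> (\<forall>\<tau>. Im \<tau> > 0 \<longrightarrow> lift s j (?m \<tau>) = k * J \<tau> * lift s (j \<noteq> odd b) \<tau>)" for j
  proof -
    obtain u where u: "norm u = 1" "\<And>\<tau>. Im \<tau> > 0 \<Longrightarrow> lift_block s j \<tau> = u * lift s j \<tau>" using lift_eq_lift_block[OF s] by blast
    obtain u' where u': "norm u' = 1" "\<And>\<tau>. Im \<tau> > 0 \<Longrightarrow> lift_block s (j \<noteq> odd b) \<tau> = u' * lift s (j \<noteq> odd b) \<tau>" using lift_eq_lift_block[OF s] by blast
    obtain k where k: "norm k = 1" "\<And>\<tau>. Im \<tau> > 0 \<Longrightarrow> lift_block s j (?m \<tau>) = k * J \<tau> * lift_block s (j \<noteq> odd b) \<tau>"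
      using lift_block_companion_transform(1)[OF s det a d c] unfolding J_def by blast
    have u0: "u \<noteq> 0" using u(1) by auto
    have "lift s j (?m \<tau>) = (k * u' / u) * J \<tau> * lift s (j \<noteq> odd b) \<tau>" if \<tau>: "Im \<tau> > 0" for \<tau>
    proof -
      have "u * lift s j (?m \<tau>) = k * J \<tau> * (u' * lift s (j \<noteq> odd b) \<tau>)"
        using k(2)[OF \<tau>] u(2)[OF Im_mob[OF det \<tau>]] u'(2)[OF \<tau>] by simp
      then show ?thesis using u0 by (simp add: field_simps)
    qed
    then show ?thesis using u(1) u'(1) k(1) by (intro exI[of _ "k * u' / u"]) (simp add: norm_mult norm_divide)
  qed
  then obtain \<kappa> where \<kappa>: "\<And>j. norm (\<kappa> j) = 1" "\<And>j \<tau>. Im \<tau> > 0 \<Longrightarrow> lift s j (?m \<tau>) = \<kappa> j * J \<tau> * lift s (j \<noteq> odd b) \<tau>"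
    by metis
  obtain w where w: "\<And>\<tau>. Im \<tau> > 0 \<Longrightarrow> companion s (?m \<tau>) = w * J \<tau> * companion s \<tau>"
    using lift_block_companion_transform(2)[OF s det a d c] unfolding J_def by blast
  have rel: "\<kappa> True * lift s (\<not> odd b) \<tau> + \<sigma> * \<kappa> False * lift s (odd b) \<tau> = w * (lift s True \<tau> + \<sigma> * lift s False \<tau>)" if \<tau>: "Im \<tau> > 0" for \<tau>
  proof -
    have "lift s True (?m \<tau>) + \<sigma> * lift s False (?m \<tau>) = 2 * companion s (?m \<tau>)"
      using lift_companion_relation[OF s Im_mob[OF det \<tau>]] by (simp add: \<sigma>_def)
    then have "J \<tau> * (\<kappa> True * lift s (\<not> odd b) \<tau> + \<sigma> * \<kappa> False * lift s (odd b) \<tau>) = J \<tau> * (w * (lift s True \<tau> + \<sigma> * lift s False \<tau>))"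
      using lift_companion_relation[OF s \<tau>] \<kappa>(2)[OF \<tau>, of True] \<kappa>(2)[OF \<tau>, of False] w[OF \<tau>] by (simp add: \<sigma>_def algebra_simps)
    then show ?thesis using Jnz[OF \<tau>] by simp
  qed
  have "\<kappa> True = \<kappa> False"
  proof (cases "\<exists>l. \<forall>\<tau>. Im \<tau> > 0 \<longrightarrow> lift s True \<tau> = l * lift s False \<tau>")
    case True
    then obtain l where l: "\<And>\<tau>. Im \<tau> > 0 \<Longrightarrow> lift s True \<tau> = l * lift s False \<tau>" by blast
    have I: "Im \<i> > 0" by simp
    \<comment> \<open>Translation by 1 exchanges \<open>X(q)\<close> and \<open>X(-q)\<close>;
      applied at two points it shows that the factor of proportionality has square one.\<close>
    have X1: "theta4_rr s (- qexp (\<tau> / 2)) = l * theta4_rr s (qexp (\<tau> / 2))" if "Im \<tau> > 0" for \<tau>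
      using l[OF that] by (simp add: lift_def)
    have qh: "qexp ((\<tau> + 1) / 2) = - qexp (\<tau> / 2)" for \<tau>
    proof -
      have "qexp ((\<tau> + 1) / 2) = ee \<tau> * ee 1" unfolding qexp_ee ee_add[symmetric] by (rule arg_cong[where f = ee]) (simp add: field_simps)
      also have "\<dots> = - qexp (\<tau> / 2)" unfolding qexp_ee by simp
      finally show ?thesis .
    qed
    have "theta4_rr s (qexp (\<i> / 2)) = l * theta4_rr s (- qexp (\<i> / 2))"
      using X1[of "\<i> + 1"] unfolding qh by simp
    also have "\<dots> = l * l * theta4_rr s (qexp (\<i> / 2))" using X1[OF I] by simp
    finally have "l * l = 1 \<or> theta4_rr s (qexp (\<i> / 2)) = 0" by auto
    moreover have "theta4_rr s (qexp (\<i> / 2)) \<noteq> 0" using lift_nonzero_holomorphic(1)[OF s I, of False] by (simp add: lift_def)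
    ultimately have ll: "l * l = 1" by simp
    have e: "\<kappa> True * J \<i> * lift s (\<not> odd b) \<i> = l * (\<kappa> False * J \<i> * lift s (odd b) \<i>)"
      using l[OF Im_mob[OF det I]] \<kappa>(2)[OF I, of True] \<kappa>(2)[OF I, of False] by simp
    have nz: "J \<i> \<noteq> 0" "lift s False \<i> \<noteq> 0" using Jnz[OF I] lift_nonzero_holomorphic(1)[OF s I] by auto
    have "l \<noteq> 0" using ll by auto
    show ?thesis
    proof (cases "odd b")
      case True
      then have "\<kappa> True * (J \<i> * lift s False \<i>) = (l * l) * \<kappa> False * (J \<i> * lift s False \<i>)"
        using e l[OF I] by (simp add: mult_ac)
      then show ?thesis unfolding ll using nz by simp
    next
      case False
      then have "\<kappa> True * (J \<i> * lift s False \<i> * l) = \<kappa> False * (J \<i> * lift s False \<i> * l)"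
        using e l[OF I] by (simp add: mult_ac)
      then show ?thesis using nz \<open>l \<noteq> 0\<close> by simp
    qed
  next
    case False
    \<comment> \<open>Linear independence in the form needed for comparing coefficients.\<close>
    have no: "x = 0 \<and> y = 0" if xy: "\<And>\<tau>. Im \<tau> > 0 \<Longrightarrow> x * lift s True \<tau> = y * lift s False \<tau>" for x y
    proof -
      have "x = 0"
      proof (rule ccontr)
        assume "x \<noteq> 0"
        then have "lift s True \<tau> = y / x * lift s False \<tau>" if "Im \<tau> > 0" for \<tau> using xy[OF that] by (simp add: field_simps)
        then show False using False by blast
      qed
      then show ?thesis using xy[of \<i>] lift_nonzero_holomorphic(1)[OF s, of \<i> False] by simp
    qed
    show ?thesis
    proof (cases "odd b")
      case True
      have "(\<sigma> * \<kappa> False - w) * lift s True \<tau> = (w * \<sigma> - \<kappa> True) * lift s False \<tau>" if "Im \<tau> > 0" for \<tau>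
        using rel[OF that] True by (simp add: algebra_simps)
      from no[OF this] have "w = \<sigma> * \<kappa> False" "\<kappa> True = w * \<sigma>" by simp_all
      then show ?thesis using \<sigma> by (simp add: mult_ac)
    next
      case False
      have "(\<kappa> True - w) * lift s True \<tau> = (w * \<sigma> - \<sigma> * \<kappa> False) * lift s False \<tau>" if "Im \<tau> > 0" for \<tau>
        using rel[OF that] False by (simp add: algebra_simps)
      from no[OF this] have "\<kappa> True = w" "w * \<sigma> = \<sigma> * \<kappa> False" by simp_all
      then show ?thesis using \<sigma> by (auto simp: mult.commute)
    qed
  qed
  then have "lift s j (?m \<tau>) = \<kappa> False * J \<tau> * lift s (j \<noteq> odd b) \<tau>" if "Im \<tau> > 0" for j \<tau>
    using \<kappa>(2)[OF that, of j] by (cases j) simp_all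
  then show ?thesis using \<kappa>(1) unfolding J_def by blast
qed

text \<open>Hermite normal forms for the three matrices of the block turn its translate by any
  element of the modular group into another block, with rational characteristics, whose expansion at
  infinity is known.\<close>

lemma lift_cusp:
  fixes a b c d :: int
  assumes s: "s \<le> 1" and det: "a * d - b * c = 1"
  shows "cusp_mero (\<lambda>\<tau>. lift s j (mob a b c d \<tau>) / (of_int c * \<tau> + of_int d) powr (1 / 2))"
proof -
  let ?x = "real (s + 1) / 5"
  obtain u where u: "norm u = 1" "\<And>\<tau>. Im \<tau> > 0 \<Longrightarrow> lift_block s j \<tau> = u * lift s j \<tau>" using lift_eq_lift_block[OF s] by blast
  have u0: "u \<noteq> 0" using u(1) by auto
  define n where "n = (of_bool j :: int)"
  have U: "lift_block s j = eta_block (1, n, 2) (1, 0, 1) (5, 5 * n, 2) ?x 0"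
    by (auto simp: lift_block_def n_def)
  obtain x1 y1 z1 A1 B1 C1 D1 where I1: "intertwines (1, n, 2) (x1, y1, z1) (A1, B1, C1, D1) (a, b, c, d)"
    using hermite_decomposition[OF det, of 1 2 n] by fastforce
  obtain x2 y2 z2 A2 B2 C2 D2 where I2: "intertwines (1, 0, 1) (x2, y2, z2) (A2, B2, C2, D2) (a, b, c, d)"
    using hermite_decomposition[OF det, of 1 1 0] by fastforce
  obtain x3 y3 z3 A3 B3 C3 D3 where I3: "intertwines (5, 5 * n, 2) (x3, y3, z3) (A3, B3, C3, D3) (a, b, c, d)"
    using hermite_decomposition[OF det, of 5 2 "5 * n"] by fastforce
  have up: "upper_pos (x1, y1, z1)" "upper_pos (x2, y2, z2)" "upper_pos (x3, y3, z3)"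
    using I1 I2 I3 unfolding intertwines_iff upper_pos_def prod.case by blast+
  have nn: "\<not> (?x \<in> \<int> \<and> (0::real) \<in> \<int>)"
  proof
    assume "?x \<in> \<int> \<and> (0::real) \<in> \<int>"
    then obtain n :: int where "?x = of_int n" by (auto elim: Ints_cases)
    then have "real_of_int (int (s + 1)) = real_of_int (5 * n)" by simp
    then have "int (s + 1) = 5 * n" by (simp only: of_int_eq_iff)
    then show False using s by presburger
  qed
  define \<alpha> where "\<alpha> = ?x * real_of_int A3 + 0 * real_of_int C3"
  define \<beta> where "\<beta> = ?x * real_of_int B3 + 0 * real_of_int D3"
  obtain k where k: "\<And>\<tau>. Im \<tau> > 0 \<Longrightarrow> eta_block (1, n, 2) (1, 0, 1) (5, 5 * n, 2) ?x 0 (mob a b c d \<tau>) =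
       k * (of_int c * \<tau> + of_int d) powr (1 / 2) * eta_block (x1, y1, z1) (x2, y2, z2) (x3, y3, z3) \<alpha> \<beta> \<tau>"
    using eta_block_transform[OF I1 I2 I3 nn] unfolding \<alpha>_def \<beta>_def by blast
  have "\<alpha> \<in> \<rat>" unfolding \<alpha>_def by simp
  then have "cusp_mero (\<lambda>\<tau>. (k / u) * eta_block (x1, y1, z1) (x2, y2, z2) (x3, y3, z3) \<alpha> \<beta> \<tau>)"
    by (intro cusp_mero_mult cusp_mero_const cusp_mero_eta_block up)
  then show ?thesis
  proof (rule cusp_mero_cong)
    fix \<tau> :: complex assume \<tau>: "Im \<tau> > 0"
    have "(of_int c * \<tau> + of_int d :: complex) powr (1 / 2) \<noteq> 0" using mob_denom_nonzero[OF det \<tau>] by simp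
    moreover have "u * lift s j (mob a b c d \<tau>) = k * (of_int c * \<tau> + of_int d) powr (1 / 2) * eta_block (x1, y1, z1) (x2, y2, z2) (x3, y3, z3) \<alpha> \<beta> \<tau>"
      using k[OF \<tau>] u(2)[OF Im_mob[OF det \<tau>]] unfolding U by simp
    ultimately show "(k / u) * eta_block (x1, y1, z1) (x2, y2, z2) (x3, y3, z3) \<alpha> \<beta> \<tau> = lift s j (mob a b c d \<tau>) / (of_int c * \<tau> + of_int d) powr (1 / 2)"
      using u0 by (simp add: field_simps)
  qed
qed


section \<open>Matrices, multiplier systems and conjugation\<close>

lemma matrix_mult_nth: "(A ** B) $ i $ j = A $ i $ 1 * B $ 1 $ j + A $ i $ 2 * (B $ 2 $ j :: int)"
  for A B :: "int ^ 2 ^ 2"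
  by (simp add: matrix_matrix_mult_def sum_2)

lemma mat2_eqI:
  fixes A B :: "int ^ 2 ^ 2"
  assumes "A $ 1 $ 1 = B $ 1 $ 1" "A $ 1 $ 2 = B $ 1 $ 2" "A $ 2 $ 1 = B $ 2 $ 1" "A $ 2 $ 2 = B $ 2 $ 2"
  shows "A = B"
  using assms by (simp add: vec_eq_iff forall_2)

definition mat2 :: "int \<Rightarrow> int \<Rightarrow> int \<Rightarrow> int \<Rightarrow> int ^ 2 ^ 2" where
  "mat2 a b c d = (\<chi> i j. if i = 1 then (if j = 1 then a else b) else (if j = 1 then c else d))"

lemma mat2_nth [simp]: "mat2 a b c d $ 1 $ 1 = a" "mat2 a b c d $ 1 $ 2 = b" "mat2 a b c d $ 2 $ 1 = c" "mat2 a b c d $ 2 $ 2 = d"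
  by (simp_all add: mat2_def)

lemma SL2Z_iff: "A \<in> SL2Z \<longleftrightarrow> A $ 1 $ 1 * A $ 2 $ 2 - A $ 1 $ 2 * A $ 2 $ 1 = 1"
  by (simp add: SL2Z_def det_2)

lemma moebius_mob: "moebius A \<tau> = mob (A $ 1 $ 1) (A $ 1 $ 2) (A $ 2 $ 1) (A $ 2 $ 2) \<tau>"
  by (simp add: moebius_def mob_def)

lemma SL2Z_mult: "A \<in> SL2Z \<Longrightarrow> B \<in> SL2Z \<Longrightarrow> A ** B \<in> SL2Z"
  by (simp add: SL2Z_def det_mul)

lemma Im_moebius: "A \<in> SL2Z \<Longrightarrow> Im \<tau> > 0 \<Longrightarrow> Im (moebius A \<tau>) > 0"
  unfolding moebius_mob SL2Z_iff by (rule Im_mob)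

lemma denom_nonzero: "A \<in> SL2Z \<Longrightarrow> Im \<tau> > 0 \<Longrightarrow> of_int (A $ 2 $ 1) * \<tau> + of_int (A $ 2 $ 2) \<noteq> (0 :: complex)"
  unfolding SL2Z_iff by (rule mob_denom_nonzero)

lemma moebius_mult:
  assumes B: "B \<in> SL2Z" and \<tau>: "Im \<tau> > 0"
  shows "moebius (A ** B) \<tau> = moebius A (moebius B \<tau>)"
proof -
  define w where "w = of_int (B $ 2 $ 1) * \<tau> + (of_int (B $ 2 $ 2) :: complex)"
  define n where "n = of_int (B $ 1 $ 1) * \<tau> + (of_int (B $ 1 $ 2) :: complex)"
  have w: "w \<noteq> 0" unfolding w_def by (rule denom_nonzero[OF B \<tau>])
  have "moebius (A ** B) \<tau> = (of_int (A $ 1 $ 1) * n + of_int (A $ 1 $ 2) * w) / (of_int (A $ 2 $ 1) * n + of_int (A $ 2 $ 2) * w)"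
    unfolding moebius_def matrix_mult_nth w_def n_def by (simp add: algebra_simps)
  also have "\<dots> = (of_int (A $ 1 $ 1) * (n / w) + of_int (A $ 1 $ 2)) / (of_int (A $ 2 $ 1) * (n / w) + of_int (A $ 2 $ 2))"
  proof -
    have "a * n + b * w = (a * (n / w) + b) * w" for a b :: complex using w by (simp add: field_simps)
    then show ?thesis using w by simp
  qed
  finally show ?thesis by (simp add: moebius_def w_def n_def)
qed

lemma Gamma1_subset_SL2Z: "Gamma1 N \<subseteq> SL2Z"
  by (auto simp: Gamma1_def)

lemma Gamma1_mult: "A \<in> Gamma1 N \<Longrightarrow> B \<in> Gamma1 N \<Longrightarrow> A ** B \<in> Gamma1 N"
proof -
  assume A: "A \<in> Gamma1 N" and B: "B \<in> Gamma1 N"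
  have 1: "[A $ 1 $ 1 * B $ 1 $ 1 + A $ 1 $ 2 * B $ 2 $ 1 = 1 * 1 + A $ 1 $ 2 * 0] (mod int N)"
    using A B by (intro cong_add cong_mult cong_refl) (auto simp: Gamma1_def)
  have 2: "[A $ 2 $ 1 * B $ 1 $ 2 + A $ 2 $ 2 * B $ 2 $ 2 = 0 * B $ 1 $ 2 + 1 * 1] (mod int N)"
    using A B by (intro cong_add cong_mult cong_refl) (auto simp: Gamma1_def)
  have 3: "[A $ 2 $ 1 * B $ 1 $ 1 + A $ 2 $ 2 * B $ 2 $ 1 = 0 * 1 + 1 * 0] (mod int N)"
    using A B by (intro cong_add cong_mult cong_refl) (auto simp: Gamma1_def)
  show ?thesis using 1 2 3 A B SL2Z_mult by (simp add: Gamma1_def matrix_mult_nth)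
qed

lemma modular_form_cong:
  assumes f: "modular_form G k v f" and G: "G \<subseteq> SL2Z" and eq: "\<And>\<tau>. Im \<tau> > 0 \<Longrightarrow> f \<tau> = g \<tau>"
  shows "modular_form G k v g"
  unfolding modular_form_def
proof (intro conjI ballI)
  show "g holomorphic_on upper_half_plane"
    using f eq unfolding modular_form_def by (auto intro: holomorphic_transform)
  show "g (moebius A \<tau>) = v A * autom_factor k A \<tau> * g \<tau>" if "A \<in> G" "\<tau> \<in> upper_half_plane" for A \<tau>
    using that f G eq[of \<tau>] eq[OF Im_moebius[of A \<tau>]] unfolding modular_form_def by auto
  show "meromorphic_at_cusp k g A" if A: "A \<in> SL2Z" for A
  proof -
    have "meromorphic_at_cusp k f A" using f A by (simp add: modular_form_def)
    then show ?thesis unfolding meromorphic_at_cusp_def using eq[OF Im_moebius[OF A]] by auto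
  qed
qed

lemma modular_form_scale:
  assumes f: "modular_form G k v f"
  shows "modular_form G k v (\<lambda>\<tau>. c * f \<tau>)"
  unfolding modular_form_def
proof (intro conjI ballI)
  show "(\<lambda>\<tau>. c * f \<tau>) holomorphic_on upper_half_plane"
    using f unfolding modular_form_def by (intro holomorphic_intros) auto
  show "c * f (moebius A \<tau>) = v A * autom_factor k A \<tau> * (c * f \<tau>)" if "A \<in> G" "\<tau> \<in> upper_half_plane" for A \<tau>
    using that f unfolding modular_form_def by simp
  show "meromorphic_at_cusp k (\<lambda>\<tau>. c * f \<tau>) A" if A: "A \<in> SL2Z" for A
  proof -
    obtain h \<kappa> F where F: "(h::nat) > 0" "F meromorphic_on {0}" "\<And>\<tau>. \<tau> \<in> upper_half_plane \<Longrightarrow>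
       f (moebius A \<tau>) / autom_factor k A \<tau> = qexp (of_real \<kappa> * \<tau> / of_nat h) * F (qexp (\<tau> / of_nat h))"
      using f A unfolding modular_form_def meromorphic_at_cusp_def by blast
    have "(\<lambda>X. c * F X) meromorphic_on {0}" by (intro meromorphic_intros F)
    moreover have "c * f (moebius A \<tau>) / autom_factor k A \<tau> = qexp (of_real \<kappa> * \<tau> / of_nat h) * (c * F (qexp (\<tau> / of_nat h)))"
      if "\<tau> \<in> upper_half_plane" for \<tau>
      using F(3)[OF that] by (simp only: times_divide_eq_right[symmetric] mult.left_commute)
    ultimately show ?thesis unfolding meromorphic_at_cusp_def using F(1) by blast
  qed
qed

text \<open>The exponent \<kappa> can be 0, because the width already accounts for rational powers
  of \<open>q\<close>.\<close>

lemma cusp_meroD: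
  assumes "cusp_mero (\<lambda>\<tau>. f (moebius A \<tau>) / autom_factor k A \<tau>)"
  shows "meromorphic_at_cusp k f A"
proof -
  obtain h F where F: "(h::nat) > 0" "F meromorphic_on {0}" "\<And>\<tau>. Im \<tau> > 0 \<Longrightarrow> f (moebius A \<tau>) / autom_factor k A \<tau> = F (qexp (\<tau> / of_nat h))"
    using assms unfolding cusp_mero_def by blast
  have "f (moebius A \<tau>) / autom_factor k A \<tau> = qexp (of_real 0 * \<tau> / of_nat h) * F (qexp (\<tau> / of_nat h))" if "\<tau> \<in> upper_half_plane" for \<tau>
    using F(3)[of \<tau>] that by simp
  then show ?thesis unfolding meromorphic_at_cusp_def using F(1,2) by blast
qed

text \<open>The matrices of \<open>Gamma1 10\<close> that fix both lifts up to a factor instead of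
  exchanging them.\<close>

definition Gamma1_10_even :: "(int ^ 2 ^ 2) set" where
  "Gamma1_10_even = {A \<in> Gamma1 10. even (A $ 1 $ 2)}"

text \<open>The cocycle law follows from transforming one function by \<open>A ** B\<close> at once
  and in two steps, then cancelling the function, which has no zeros. The indices \<open>j\<close>
  agree on both routes because the parity of the upper right entry is additive on
  \<open>Gamma1 10\<close>.\<close>

lemma lift_multiplier:
  assumes s: "s \<le> 1"
  shows "\<exists>v. multiplier_system (Gamma1 10) (1 / 2) v \<and>
     (\<forall>A\<in>Gamma1 10. \<forall>\<tau>\<in>upper_half_plane. \<forall>j. lift s j (moebius A \<tau>) = v A * autom_factor (1 / 2) A \<tau> * lift s (j \<noteq> odd (A $ 1 $ 2)) \<tau>)"
proof -
  have "\<exists>k. norm k = 1 \<and> (\<forall>\<tau> j. Im \<tau> > 0 \<longrightarrow> lift s j (moebius A \<tau>) = k * autom_factor (1 / 2) A \<tau> * lift s (j \<noteq> odd (A $ 1 $ 2)) \<tau>)"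
    if A: "A \<in> Gamma1 10" for A
  proof -
    have "[A $ 1 $ 1 = 1] (mod 10)" "[A $ 2 $ 2 = 1] (mod 10)" "[A $ 2 $ 1 = 0] (mod 10)" "A $ 1 $ 1 * A $ 2 $ 2 - A $ 1 $ 2 * A $ 2 $ 1 = 1"
      using A by (auto simp: Gamma1_def SL2Z_iff)
    from lift_transform[OF s this(4,1,2,3)] show ?thesis
      unfolding moebius_mob autom_factor_def by simp
  qed
  then obtain v where v: "\<And>A. A \<in> Gamma1 10 \<Longrightarrow> norm (v A) = 1"
    "\<And>A \<tau> j. A \<in> Gamma1 10 \<Longrightarrow> Im \<tau> > 0 \<Longrightarrow> lift s j (moebius A \<tau>) = v A * autom_factor (1 / 2) A \<tau> * lift s (j \<noteq> odd (A $ 1 $ 2)) \<tau>"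
    by metis
  have "v (A ** B) * autom_factor (1 / 2) (A ** B) \<tau> =
        (v A * autom_factor (1 / 2) A (moebius B \<tau>)) * (v B * autom_factor (1 / 2) B \<tau>)"
    if A: "A \<in> Gamma1 10" and B: "B \<in> Gamma1 10" and \<tau>: "Im \<tau> > 0" for A B \<tau>
  proof -
    have B': "B \<in> SL2Z" using B Gamma1_subset_SL2Z by blast
    have par: "odd ((A ** B) $ 1 $ 2) = (odd (A $ 1 $ 2) \<noteq> odd (B $ 1 $ 2))"
    proof -
      have o: "odd (A $ 1 $ 1)" "odd (B $ 2 $ 2)"
      proof -
        have "[A $ 1 $ 1 = 1] (mod 10)" "[B $ 2 $ 2 = 1] (mod 10)" using A B by (auto simp: Gamma1_def)
        then have "[A $ 1 $ 1 = 1] (mod 2)" "[B $ 2 $ 2 = 1] (mod 2)" by (auto intro: cong_dvd_modulus)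
        then show "odd (A $ 1 $ 1)" "odd (B $ 2 $ 2)" by (simp_all add: cong_def odd_iff_mod_2_eq_one)
      qed
      then show ?thesis unfolding matrix_mult_nth by auto
    qed
    \<comment> \<open>With this choice both routes end at \<open>lift s False\<close>.\<close>
    let ?j = "odd ((A ** B) $ 1 $ 2)"
    have "lift s ?j (moebius (A ** B) \<tau>) = v (A ** B) * autom_factor (1 / 2) (A ** B) \<tau> * lift s False \<tau>"
      using v(2)[OF Gamma1_mult[OF A B] \<tau>, of ?j] by simp
    moreover have "((?j \<noteq> odd (A $ 1 $ 2)) \<noteq> odd (B $ 1 $ 2)) = False" unfolding par by blast
    then have "lift s ?j (moebius A (moebius B \<tau>)) = v A * autom_factor (1 / 2) A (moebius B \<tau>) * (v B * autom_factor (1 / 2) B \<tau> * lift s False \<tau>)"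
      using v(2)[OF A Im_moebius[OF B' \<tau>], of ?j] v(2)[OF B \<tau>, of "?j \<noteq> odd (A $ 1 $ 2)"] by (simp only:)
    ultimately have "(v (A ** B) * autom_factor (1 / 2) (A ** B) \<tau>) * lift s False \<tau> =
        ((v A * autom_factor (1 / 2) A (moebius B \<tau>)) * (v B * autom_factor (1 / 2) B \<tau>)) * lift s False \<tau>"
      unfolding moebius_mult[OF B' \<tau>] by (simp only: mult.assoc)
    then show ?thesis using lift_nonzero_holomorphic(1)[OF s \<tau>, of False] by simp
  qed
  then show ?thesis using v unfolding multiplier_system_def by (intro exI[of _ v]) auto
qed

lemma lift_combination_cusp:
  assumes s: "s \<le> 1" and A: "A \<in> SL2Z"
  shows "meromorphic_at_cusp (1 / 2) (\<lambda>\<tau>. lift s True \<tau> + c * lift s False \<tau>) A"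
proof (rule cusp_meroD)
  have det: "A $ 1 $ 1 * A $ 2 $ 2 - A $ 1 $ 2 * A $ 2 $ 1 = 1" using A by (simp add: SL2Z_iff)
  have "cusp_mero (\<lambda>\<tau>. lift s True (moebius A \<tau>) / autom_factor (1 / 2) A \<tau> + c * (lift s False (moebius A \<tau>) / autom_factor (1 / 2) A \<tau>))"
    using lift_cusp[OF s det] unfolding moebius_mob autom_factor_def
    by (intro cusp_mero_add cusp_mero_mult cusp_mero_const) simp_all
  then show "cusp_mero (\<lambda>\<tau>. (lift s True (moebius A \<tau>) + c * lift s False (moebius A \<tau>)) / autom_factor (1 / 2) A \<tau>)"
    by (rule cusp_mero_cong) (simp add: add_divide_distrib)
qed

lemma lift_combination_holomorphic:
  assumes s: "s \<le> 1"
  shows "(\<lambda>\<tau>. lift s True \<tau> + c * lift s False \<tau>) holomorphic_on upper_half_plane"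
  by (intro holomorphic_intros lift_nonzero_holomorphic(2) s)

text \<open>The combination is an eigenvector of the exchange with eigenvalue \<sigma>. Matrices
  with odd upper right entry therefore contribute a further factor \<sigma>, a character by
  additivity of that parity.\<close>

lemma lift_sum_modular:
  assumes s: "s \<le> 1" and \<sigma>: "\<sigma> = 1 \<or> \<sigma> = (-1 :: complex)"
  shows "\<exists>v. multiplier_system (Gamma1 10) (1 / 2) v \<and> modular_form (Gamma1 10) (1 / 2) v (\<lambda>\<tau>. lift s True \<tau> + \<sigma> * lift s False \<tau>)"
proof -
  obtain v where v: "multiplier_system (Gamma1 10) (1 / 2) v"
    "\<And>A \<tau> j. A \<in> Gamma1 10 \<Longrightarrow> \<tau> \<in> upper_half_plane \<Longrightarrow> lift s j (moebius A \<tau>) = v A * autom_factor (1 / 2) A \<tau> * lift s (j \<noteq> odd (A $ 1 $ 2)) \<tau>"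
    using lift_multiplier[OF s] by blast
  define sg where "sg = (\<lambda>A :: int ^ 2 ^ 2. if odd (A $ 1 $ 2) then \<sigma> else 1)"
  have sg1: "norm (sg A) = 1" for A using \<sigma> by (auto simp: sg_def)
  have sg2: "sg (A ** B) = sg A * sg B" if A: "A \<in> Gamma1 10" and B: "B \<in> Gamma1 10" for A B
  proof -
    have "[A $ 1 $ 1 = 1] (mod 10)" "[B $ 2 $ 2 = 1] (mod 10)" using A B by (auto simp: Gamma1_def)
    then have "[A $ 1 $ 1 = 1] (mod 2)" "[B $ 2 $ 2 = 1] (mod 2)" by (auto intro: cong_dvd_modulus)
    then have "odd (A $ 1 $ 1)" "odd (B $ 2 $ 2)" by (simp_all add: cong_def odd_iff_mod_2_eq_one)
    then show ?thesis using \<sigma> unfolding sg_def matrix_mult_nth by auto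
  qed
  have "multiplier_system (Gamma1 10) (1 / 2) (\<lambda>A. sg A * v A)"
    using v(1) sg1 sg2 unfolding multiplier_system_def by (simp add: norm_mult mult_ac)
  moreover have "modular_form (Gamma1 10) (1 / 2) (\<lambda>A. sg A * v A) (\<lambda>\<tau>. lift s True \<tau> + \<sigma> * lift s False \<tau>)"
    unfolding modular_form_def
  proof (intro conjI ballI)
    fix A \<tau> assume A: "A \<in> Gamma1 10" and \<tau>: "\<tau> \<in> upper_half_plane"
    show "lift s True (moebius A \<tau>) + \<sigma> * lift s False (moebius A \<tau>) =
           sg A * v A * autom_factor (1 / 2) A \<tau> * (lift s True \<tau> + \<sigma> * lift s False \<tau>)"
      unfolding v(2)[OF A \<tau>] using \<sigma> by (cases "odd (A $ 1 $ 2)") (auto simp: sg_def algebra_simps)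
  qed (use lift_combination_cusp[OF s] lift_combination_holomorphic[OF s] in auto)
  ultimately show ?thesis by blast
qed

text \<open>Where no exchange takes place, every combination is modular. The psi series need this,
  since their coefficients 1 and -1/2 or 1/2 do not form an eigenvector.\<close>

lemma lift_even_modular:
  assumes s: "s \<le> 1"
  shows "\<exists>v. multiplier_system Gamma1_10_even (1 / 2) v \<and> modular_form Gamma1_10_even (1 / 2) v (\<lambda>\<tau>. lift s True \<tau> + c * lift s False \<tau>)"
proof -
  obtain v where v: "multiplier_system (Gamma1 10) (1 / 2) v"
    "\<And>A \<tau> j. A \<in> Gamma1 10 \<Longrightarrow> \<tau> \<in> upper_half_plane \<Longrightarrow> lift s j (moebius A \<tau>) = v A * autom_factor (1 / 2) A \<tau> * lift s (j \<noteq> odd (A $ 1 $ 2)) \<tau>"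
    using lift_multiplier[OF s] by blast
  have "multiplier_system Gamma1_10_even (1 / 2) v"
    using v(1) unfolding multiplier_system_def Gamma1_10_even_def by auto
  moreover have "modular_form Gamma1_10_even (1 / 2) v (\<lambda>\<tau>. lift s True \<tau> + c * lift s False \<tau>)"
    unfolding modular_form_def
  proof (intro conjI ballI)
    fix A \<tau> assume A: "A \<in> Gamma1_10_even" and \<tau>: "\<tau> \<in> upper_half_plane"
    then have A': "A \<in> Gamma1 10" "even (A $ 1 $ 2)" by (auto simp: Gamma1_10_even_def)
    show "lift s True (moebius A \<tau>) + c * lift s False (moebius A \<tau>) =
           v A * autom_factor (1 / 2) A \<tau> * (lift s True \<tau> + c * lift s False \<tau>)"
      unfolding v(2)[OF A'(1) \<tau>] using A'(2) by (simp add: algebra_simps)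
  qed (use lift_combination_cusp[OF s] lift_combination_holomorphic[OF s] in auto)
  ultimately show ?thesis by blast
qed

text \<open>Conjugation by the integral matrix with rows \<open>(x, y)\<close> and \<open>(0, z)\<close>, which acts as \<open>aff x y z\<close>.\<close>

lemma modular_form_conjugate:
  assumes v: "multiplier_system G k v" and f: "modular_form G k v f"
    and pos: "x > 0" "z > 0" and G: "G \<subseteq> SL2Z" and G': "G' \<subseteq> SL2Z"
    and conj: "\<And>A. A \<in> G' \<Longrightarrow> \<phi> A \<in> G \<and> mat2 x y 0 z ** A = \<phi> A ** mat2 x y 0 z"
    and closed: "\<And>A B. A \<in> G' \<Longrightarrow> B \<in> G' \<Longrightarrow> A ** B \<in> G'"
  shows "multiplier_system G' k (v \<circ> \<phi>)" "modular_form G' k (v \<circ> \<phi>) (\<lambda>\<tau>. f (aff x y z \<tau>))"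
proof -
  let ?M = "mat2 x y 0 z"
  have I: "aff x y z (moebius A \<tau>) = moebius (\<phi> A) (aff x y z \<tau>)"
    "autom_factor k (\<phi> A) (aff x y z \<tau>) = autom_factor k A \<tau>" if A: "A \<in> G'" and \<tau>: "Im \<tau> > 0" for A \<tau>
  proof -
    have m: "?M ** A = \<phi> A ** ?M" and sA: "A \<in> SL2Z" and s\<phi>: "\<phi> A \<in> SL2Z" using conj[OF A] A G G' by auto
    have m': "(?M ** A) $ i $ j = (\<phi> A ** ?M) $ i $ j" for i j by (simp only: m)
    have "intertwines (x, y, z) (x, y, z) (\<phi> A $ 1 $ 1, \<phi> A $ 1 $ 2, \<phi> A $ 2 $ 1, \<phi> A $ 2 $ 2) (A $ 1 $ 1, A $ 1 $ 2, A $ 2 $ 1, A $ 2 $ 2)"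
      using m'[of 1 1] m'[of 1 2] m'[of 2 1] m'[of 2 2] pos sA s\<phi>
      unfolding intertwines_iff matrix_mult_nth mat2_nth SL2Z_iff mult_zero_left mult_zero_right add_0_left add_0_right by blast
    from intertwines_mob[OF this \<tau>] show "aff x y z (moebius A \<tau>) = moebius (\<phi> A) (aff x y z \<tau>)"
      "autom_factor k (\<phi> A) (aff x y z \<tau>) = autom_factor k A \<tau>"
      using pos by (simp_all add: moebius_mob autom_factor_def)
  qed
  \<comment> \<open>The triangular matrix has nonzero determinant and can be cancelled, so the
    relation that characterises \<phi> also makes it multiplicative.\<close>
  have hom: "\<phi> (A ** B) = \<phi> A ** \<phi> B" if A: "A \<in> G'" and B: "B \<in> G'" for A B
  proof -
    have "\<phi> (A ** B) ** ?M = (\<phi> A ** \<phi> B) ** ?M"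
      using conj[OF A] conj[OF B] conj[OF closed[OF A B]] by (metis matrix_mul_assoc)
    then have e: "(\<phi> (A ** B) ** ?M) $ i $ j = ((\<phi> A ** \<phi> B) ** ?M) $ i $ j" for i j by simp
    have 1: "\<phi> (A ** B) $ i $ 1 = (\<phi> A ** \<phi> B) $ i $ 1" for i
      using e[of i 1] pos unfolding matrix_mult_nth[of _ ?M] by simp
    have 2: "\<phi> (A ** B) $ i $ 2 = (\<phi> A ** \<phi> B) $ i $ 2" for i
      using e[of i 2] 1[of i] pos unfolding matrix_mult_nth[of _ ?M] by simp
    show ?thesis using 1 2 by (intro mat2_eqI) auto
  qed
  have up: "Im (aff x y z \<tau>) > 0" if "Im \<tau> > 0" for \<tau> by (rule Im_aff[OF pos that])
  show "multiplier_system G' k (v \<circ> \<phi>)"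
    unfolding multiplier_system_def
  proof (intro conjI ballI)
    show "norm ((v \<circ> \<phi>) A) = 1" if "A \<in> G'" for A using v conj[OF that] by (simp add: multiplier_system_def)
    fix A B \<tau> assume A: "A \<in> G'" and B: "B \<in> G'" and "\<tau> \<in> upper_half_plane"
    then have \<tau>: "Im \<tau> > 0" by simp
    have "v (\<phi> A ** \<phi> B) * autom_factor k (\<phi> A ** \<phi> B) (aff x y z \<tau>) =
      v (\<phi> A) * autom_factor k (\<phi> A) (moebius (\<phi> B) (aff x y z \<tau>)) * (v (\<phi> B) * autom_factor k (\<phi> B) (aff x y z \<tau>))"
      using v conj[OF A] conj[OF B] up[OF \<tau>] unfolding multiplier_system_def by simp
    moreover have "autom_factor k (\<phi> A ** \<phi> B) (aff x y z \<tau>) = autom_factor k (A ** B) \<tau>"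
      using I(2)[OF closed[OF A B] \<tau>] by (simp add: hom[OF A B])
    moreover have "autom_factor k (\<phi> A) (moebius (\<phi> B) (aff x y z \<tau>)) = autom_factor k A (moebius B \<tau>)"
      unfolding I(1)[OF B \<tau>, symmetric] by (rule I(2)[OF A Im_moebius]) (use B G' \<tau> in auto)
    ultimately show "(v \<circ> \<phi>) (A ** B) * autom_factor k (A ** B) \<tau> = (v \<circ> \<phi>) A * autom_factor k A (moebius B \<tau>) * ((v \<circ> \<phi>) B * autom_factor k B \<tau>)"
      using I(2)[OF B \<tau>] by (simp add: hom[OF A B])
  qed
  show "modular_form G' k (v \<circ> \<phi>) (\<lambda>\<tau>. f (aff x y z \<tau>))"
    unfolding modular_form_def
  proof (intro conjI ballI)
    have "f holomorphic_on upper_half_plane" using f unfolding modular_form_def by blast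
    moreover have "aff x y z ` upper_half_plane \<subseteq> upper_half_plane"
    proof (rule image_subsetI)
      show "aff x y z \<tau> \<in> upper_half_plane" if "\<tau> \<in> upper_half_plane" for \<tau>
        using up[of \<tau>] that by blast
    qed
    ultimately have "(f \<circ> aff x y z) holomorphic_on upper_half_plane"
      by (rule holomorphic_on_compose_gen[OF aff_holomorphic])
    then show "(\<lambda>\<tau>. f (aff x y z \<tau>)) holomorphic_on upper_half_plane" by (simp add: o_def)
    show "f (aff x y z (moebius A \<tau>)) = (v \<circ> \<phi>) A * autom_factor k A \<tau> * f (aff x y z \<tau>)"
      if A: "A \<in> G'" and "\<tau> \<in> upper_half_plane" for A \<tau>
    proof -
      have \<tau>: "Im \<tau> > 0" using that by simp
      show ?thesis unfolding I(1)[OF A \<tau>]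
        using f conj[OF A] up[OF \<tau>] I(2)[OF A \<tau>] by (simp add: modular_form_def)
    qed
    fix A assume A: "A \<in> SL2Z"
    \<comment> \<open>Hermite normal form carries the rescaling past \<open>A\<close>: the expansion
      at the cusp of \<open>A\<close> is that of \<open>f\<close> at the cusp of
      \<open>mat2 a b c d\<close>, with variable rescaled by the triangular matrix
      \<open>(x', y', z')\<close>.\<close>
    obtain x' y' z' a b c d where I': "intertwines (x, y, z) (x', y', z') (a, b, c, d) (A $ 1 $ 1, A $ 1 $ 2, A $ 2 $ 1, A $ 2 $ 2)"
      using hermite_decomposition[of "A $ 1 $ 1" "A $ 2 $ 2" "A $ 1 $ 2" "A $ 2 $ 1" x z y] A pos by (auto simp: SL2Z_iff)
    have pos': "x' > 0" "z' > 0" and sB: "mat2 a b c d \<in> SL2Z"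
      using I' unfolding intertwines_iff by (simp_all add: SL2Z_iff)
    obtain h \<kappa> F where F: "(h::nat) > 0" "F meromorphic_on {0}" "\<And>\<tau>. \<tau> \<in> upper_half_plane \<Longrightarrow>
       f (moebius (mat2 a b c d) \<tau>) / autom_factor k (mat2 a b c d) \<tau> = qexp (of_real \<kappa> * \<tau> / of_nat h) * F (qexp (\<tau> / of_nat h))"
      using f sB unfolding modular_form_def meromorphic_at_cusp_def by blast
    define h' where "h' = h * nat z'"
    define \<kappa>' where "\<kappa>' = \<kappa> * of_int x'"
    define C where "C = complex_of_real (of_int z / of_int z') powr of_real k * qexp (of_real \<kappa> * of_int y' / (of_int z' * of_nat h))"
    define c' where "c' = qexp (of_int y' / (of_int z' * of_nat h))"
    have "h' > 0" using F(1) pos' by (simp add: h'_def)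
    moreover have "(\<lambda>X. C * F (c' * X ^ nat x')) meromorphic_on {0}"
      using meromorphic_scale_power[OF F(2), of "nat x'" c'] pos' by (intro meromorphic_intros) auto
    moreover have "f (aff x y z (moebius A \<tau>)) / autom_factor k A \<tau> = qexp (of_real \<kappa>' * \<tau> / of_nat h') * (C * F (c' * qexp (\<tau> / of_nat h') ^ nat x'))"
      if "\<tau> \<in> upper_half_plane" for \<tau>
    proof -
      have \<tau>: "Im \<tau> > 0" using that by simp
      define w where "w = aff x' y' z' \<tau>"
      note i = intertwines_mob[OF I' \<tau>]
      have w: "w \<in> upper_half_plane" using i(3) by (simp add: w_def)
      have 1: "aff x y z (moebius A \<tau>) = moebius (mat2 a b c d) w" using i(1) by (simp add: moebius_mob w_def)
      have 2: "autom_factor k (mat2 a b c d) w = complex_of_real (of_int z / of_int z') powr of_real k * autom_factor k A \<tau>"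
      proof -
        \<comment> \<open>A positive real factor may be pulled out of a power taken with the
          principal branch.\<close>
        have "complex_of_real (of_int z / of_int z') \<in> \<real>" "Re (complex_of_real (of_int z / of_int z')) \<ge> 0"
          using pos pos' by (simp_all only: Reals_of_real Re_complex_of_real) simp
        then show ?thesis
          unfolding autom_factor_def mat2_nth w_def i(2) by (rule powr_times_real_left)
      qed
      have "complex_of_real (of_int z / of_int z') powr of_real k \<noteq> 0" using pos pos' by simp
      then have "f (aff x y z (moebius A \<tau>)) / autom_factor k A \<tau> =
        complex_of_real (of_int z / of_int z') powr of_real k * (f (moebius (mat2 a b c d) w) / autom_factor k (mat2 a b c d) w)"
        unfolding 1 2 by simp
      also have "f (moebius (mat2 a b c d) w) / autom_factor k (mat2 a b c d) w = qexp (of_real \<kappa> * w / of_nat h) * F (qexp (w / of_nat h))"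
        by (rule F(3)[OF w])
      also have "qexp (of_real \<kappa> * w / of_nat h) = qexp (of_real \<kappa>' * \<tau> / of_nat h') * qexp (of_real \<kappa> * of_int y' / (of_int z' * of_nat h))"
        unfolding qexp_ee ee_add[symmetric] 
        by (rule arg_cong[where f = ee]) (use pos' F(1) in \<open>simp add: w_def aff_def \<kappa>'_def h'_def field_simps\<close>)
      also have "qexp (w / of_nat h) = c' * qexp (\<tau> / of_nat h') ^ nat x'"
      proof -
        have "qexp (w / of_nat h) = qexp (of_int y' / (of_int z' * of_nat h)) * qexp (of_nat (nat x') * (\<tau> / of_nat h'))"
          unfolding qexp_ee ee_add[symmetric] 
          by (rule arg_cong[where f = ee]) (use pos' F(1) in \<open>simp add: w_def aff_def h'_def field_simps\<close>)
        also have "qexp (of_nat (nat x') * (\<tau> / of_nat h')) = qexp (\<tau> / of_nat h') ^ nat x'"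
          unfolding qexp_ee ee_power by (simp add: mult_ac)
        finally show ?thesis by (simp only: c'_def)
      qed
      finally show ?thesis unfolding C_def by (simp only: mult_ac)
    qed
    ultimately show "meromorphic_at_cusp k (\<lambda>\<tau>. f (aff x y z \<tau>)) A"
      unfolding meromorphic_at_cusp_def by blast
  qed
qed

text \<open>The translation \<open>\<tau> -> \<tau> + 1 / 2\<close> changes the sign of
  \<open>q\<close>. As an integral matrix it has rows \<open>(2, 1)\<close> and
  \<open>(0, 2)\<close>, and conjugation by it maps \<open>Gamma1 20\<close> into
  \<open>Gamma1 10\<close>: the divisions by 2 and 4 in \<phi> are exact because 20 divides
  \<open>c\<close> and \<open>d - a\<close>.\<close>

lemma modular_in_q_minus:
  assumes "modular_in_q (Gamma1 10) k (\<lambda>q. F (- q))"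
  shows "modular_in_q (Gamma1 20) k F"
proof -
  obtain r v where r: "r \<in> \<rat>" and v: "multiplier_system (Gamma1 10) k v"
    and f: "modular_form (Gamma1 10) k v (\<lambda>\<tau>. qexp (of_real r * \<tau>) * F (- qexp \<tau>))"
    using assms unfolding modular_in_q_def by blast
  define \<phi> where "\<phi> = (\<lambda>A :: int ^ 2 ^ 2. mat2 (A $ 1 $ 1 + A $ 2 $ 1 div 2) (A $ 1 $ 2 + (A $ 2 $ 2 - A $ 1 $ 1) div 2 - A $ 2 $ 1 div 4) (A $ 2 $ 1) (A $ 2 $ 2 - A $ 2 $ 1 div 2))"
  have \<phi>: "\<phi> A \<in> Gamma1 10 \<and> mat2 2 1 0 2 ** A = \<phi> A ** mat2 2 1 0 2" if A: "A \<in> Gamma1 20" for A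
  proof -
    have c: "[A $ 1 $ 1 = 1] (mod 20)" "[A $ 2 $ 2 = 1] (mod 20)" "[A $ 2 $ 1 = 0] (mod 20)" and det: "A $ 1 $ 1 * A $ 2 $ 2 - A $ 1 $ 2 * A $ 2 $ 1 = 1"
      using A by (auto simp: Gamma1_def SL2Z_iff)
    obtain a0 where a0: "A $ 1 $ 1 = 1 + 20 * a0" using c(1) by (metis cong_iff_lin cong_sym)
    obtain d0 where d0: "A $ 2 $ 2 = 1 + 20 * d0" using c(2) by (metis cong_iff_lin cong_sym)
    obtain e where e: "A $ 2 $ 1 = 20 * e" using c(3) by (auto simp: cong_0_iff)
    define b where "b = A $ 1 $ 2"
    have \<phi>A: "\<phi> A = mat2 (1 + 20 * a0 + 10 * e) (b + 10 * (d0 - a0) - 5 * e) (20 * e) (1 + 20 * d0 - 10 * e)"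
    proof -
      have "20 * e div 2 = 10 * e" "20 * e div 4 = 5 * e" "(1 + 20 * d0 - (1 + 20 * a0)) div 2 = 10 * (d0 - a0)" by presburger+
      then show ?thesis unfolding \<phi>_def a0 d0 e b_def by (simp only: add_ac diff_conv_add_uminus)
    qed
    have "(1 + 20 * a0) * (1 + 20 * d0) - b * (20 * e) = 1" using det unfolding a0 d0 e b_def .
    then have "\<phi> A \<in> SL2Z" unfolding \<phi>A SL2Z_iff by (simp add: algebra_simps)
    moreover have "[1 + 20 * a0 + 10 * e = 1] (mod 10)" "[1 + 20 * d0 - 10 * e = 1] (mod 10)" "[20 * e = 0] (mod 10)"
    proof -
      have "(1 + 20 * a0 + 10 * e) - 1 = 10 * (2 * a0 + e)" "(1 + 20 * d0 - 10 * e) - 1 = 10 * (2 * d0 - e)" by simp_all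
      then show "[1 + 20 * a0 + 10 * e = 1] (mod 10)" "[1 + 20 * d0 - 10 * e = 1] (mod 10)"
        unfolding cong_iff_dvd_diff by (metis dvd_triv_left)+
      show "[20 * e = 0] (mod 10)" by (simp add: cong_0_iff)
    qed
    ultimately have "\<phi> A \<in> Gamma1 10" unfolding Gamma1_def by (simp add: \<phi>A)
    moreover have "mat2 2 1 0 2 ** A = \<phi> A ** mat2 2 1 0 2"
      by (rule mat2_eqI) (simp_all add: matrix_mult_nth \<phi>A a0 d0 e b_def[symmetric])
    ultimately show ?thesis by blast
  qed
  note C = modular_form_conjugate[OF v f, of 2 2 "Gamma1 20" \<phi> 1, OF _ _ Gamma1_subset_SL2Z Gamma1_subset_SL2Z \<phi> Gamma1_mult]
  have m: "multiplier_system (Gamma1 20) k (v \<circ> \<phi>)" by (rule C(1)) auto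
  have "modular_form (Gamma1 20) k (v \<circ> \<phi>) (\<lambda>\<tau>. qexp (of_real r * aff 2 1 2 \<tau>) * F (- qexp (aff 2 1 2 \<tau>)))"
    by (rule C(2)) auto
  \<comment> \<open>Under the translation the power of \<open>q\<close> acquires the constant
    \<open>qexp (r / 2)\<close>, which is divided out.\<close>
  note sc = modular_form_scale[OF this, of "1 / qexp (of_real r / 2)"]
  have "modular_form (Gamma1 20) k (v \<circ> \<phi>) (\<lambda>\<tau>. qexp (of_real r * \<tau>) * F (qexp \<tau>))"
  proof (rule modular_form_cong[OF sc Gamma1_subset_SL2Z])
    fix \<tau> :: complex
    have a: "aff 2 1 2 \<tau> = \<tau> + 1 / 2" by (simp add: aff_def field_simps)
    have 1: "qexp (of_real r * (\<tau> + 1 / 2)) = qexp (of_real r * \<tau>) * qexp (of_real r / 2)"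
      unfolding qexp_ee ee_add[symmetric] by (rule arg_cong[where f = ee]) (simp add: field_simps)
    have 2: "qexp (\<tau> + 1 / 2) = - qexp \<tau>"
    proof -
      have "qexp (\<tau> + 1 / 2) = ee (2 * \<tau>) * ee 1" unfolding qexp_ee ee_add[symmetric] by (rule arg_cong[where f = ee]) (simp add: field_simps)
      then show ?thesis by (simp add: qexp_ee)
    qed
    show "1 / qexp (of_real r / 2) * (qexp (of_real r * aff 2 1 2 \<tau>) * F (- qexp (aff 2 1 2 \<tau>))) = qexp (of_real r * \<tau>) * F (qexp \<tau>)"
      unfolding a 1 2 by simp
  qed
  with m r show ?thesis unfolding modular_in_q_def by blast
qed

text \<open>With \<open>q = e(\<tau> / 2)\<close> the argument \<open>- (q\<^sup>2)\<close> of
  \<open>bilateral_phi\<close> is \<open>- e(\<tau>)\<close>, and the even and odd parts found there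
  are the eigenvectors of the exchange with \<sigma> = 1 and \<sigma> = -1.\<close>

lemma modular_in_q_phi:
  "modular_in_q (Gamma1 10) (1 / 2) (\<lambda>q. bilateral phi0_term (- q))"
  "modular_in_q (Gamma1 10) (1 / 2) (\<lambda>q. bilateral phi1_term (- q))"
proof -
  have half: "qexp \<tau> = (qexp (\<tau> / 2))\<^sup>2" "norm (qexp (\<tau> / 2)) < 1" "qexp (\<tau> / 2) \<noteq> 0" if "Im \<tau> > 0" for \<tau>
    using that unfolding qexp_ee ee_power by (simp_all add: norm_ee)
  have lift: "lift s True \<tau> = ee (- of_real (if s = 0 then 1 / 60 else - 11 / 60) * \<tau>) * theta4_rr s (- qexp (\<tau> / 2))"
    "lift s False \<tau> = ee (- of_real (if s = 0 then 1 / 60 else - 11 / 60) * \<tau>) * theta4_rr s (qexp (\<tau> / 2))" for s \<tau>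
    by (simp_all add: lift_def)
  obtain v where v: "multiplier_system (Gamma1 10) (1 / 2) v" "modular_form (Gamma1 10) (1 / 2) v (\<lambda>\<tau>. lift 0 True \<tau> + 1 * lift 0 False \<tau>)"
    using lift_sum_modular[of 0 1] by auto
  have "modular_form (Gamma1 10) (1 / 2) v (\<lambda>\<tau>. qexp (of_real (- 1 / 120) * \<tau>) * bilateral phi0_term (- qexp \<tau>))"
  proof (rule modular_form_cong[OF modular_form_scale[OF v(2), of "1 / 2"] Gamma1_subset_SL2Z])
    fix \<tau> :: complex assume \<tau>: "Im \<tau> > 0"
    have e: "ee (- of_real (if (0::nat) = 0 then 1 / 60 else - 11 / 60) * \<tau>) = qexp (of_real (- 1 / 120) * \<tau>)"
      unfolding qexp_ee by (rule arg_cong[where f = ee]) (simp add: field_simps)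
    show "1 / 2 * (lift 0 True \<tau> + 1 * lift 0 False \<tau>) = qexp (of_real (- 1 / 120) * \<tau>) * bilateral phi0_term (- qexp \<tau>)"
      unfolding lift e half(1)[OF \<tau>] bilateral_phi(1)[OF half(2,3)[OF \<tau>]] by (simp add: algebra_simps)
  qed
  with v(1) show "modular_in_q (Gamma1 10) (1 / 2) (\<lambda>q. bilateral phi0_term (- q))"
    unfolding modular_in_q_def by (intro bexI[of _ "- 1 / 120"] exI[of _ v] conjI) auto
  obtain v where v: "multiplier_system (Gamma1 10) (1 / 2) v" "modular_form (Gamma1 10) (1 / 2) v (\<lambda>\<tau>. lift 1 True \<tau> + (-1) * lift 1 False \<tau>)"
    using lift_sum_modular[of 1 "-1"] by auto
  \<comment> \<open>The factor \<open>q = e(\<tau> / 2)\<close> in \<open>bilateral_phi\<close> for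
    the second series lowers the exponent 11/120 by 1/2.\<close>
  have "modular_form (Gamma1 10) (1 / 2) v (\<lambda>\<tau>. qexp (of_real (11 / 120 - 1 / 2) * \<tau>) * bilateral phi1_term (- qexp \<tau>))"
  proof (rule modular_form_cong[OF modular_form_scale[OF v(2), of "- 1 / 2"] Gamma1_subset_SL2Z])
    fix \<tau> :: complex assume \<tau>: "Im \<tau> > 0"
    have e: "ee (- of_real (if (1::nat) = 0 then 1 / 60 else - 11 / 60) * \<tau>) = qexp (of_real (11 / 120 - 1 / 2) * \<tau>) * qexp (\<tau> / 2)"
      unfolding qexp_ee ee_add[symmetric] by (rule arg_cong[where f = ee]) (simp add: field_simps)
    show "- 1 / 2 * (lift 1 True \<tau> + (-1) * lift 1 False \<tau>) = qexp (of_real (11 / 120 - 1 / 2) * \<tau>) * bilateral phi1_term (- qexp \<tau>)"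
      unfolding lift e half(1)[OF \<tau>] bilateral_phi(2)[OF half(2,3)[OF \<tau>]] by (simp add: algebra_simps)
  qed
  with v(1) show "modular_in_q (Gamma1 10) (1 / 2) (\<lambda>q. bilateral phi1_term (- q))"
    unfolding modular_in_q_def by (intro bexI[of _ "11 / 120 - 1 / 2"] exI[of _ v] conjI) auto
qed

text \<open>Replacing \<tau> by \<open>2 * \<tau>\<close> turns \<open>e(\<tau> / 2)\<close> into
  \<open>e(\<tau>)\<close>. The corresponding conjugation doubles the upper right entry and halves
  the lower left one, and so maps \<open>Gamma1 20\<close> into
  \<open>Gamma1_10_even\<close>.\<close>

lemma modular_in_q_psi_aux:
  assumes s: "s \<le> 1" and F: "\<And>q. norm q < 1 \<Longrightarrow> q \<noteq> 0 \<Longrightarrow> F q = theta4_rr s (- q) + c * theta4_rr s q"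
  shows "modular_in_q (Gamma1 20) (1 / 2) F"
proof -
  obtain v where v: "multiplier_system Gamma1_10_even (1 / 2) v" "modular_form Gamma1_10_even (1 / 2) v (\<lambda>\<tau>. lift s True \<tau> + c * lift s False \<tau>)"
    using lift_even_modular[OF s] by blast
  have sub: "Gamma1_10_even \<subseteq> SL2Z" using Gamma1_subset_SL2Z by (auto simp: Gamma1_10_even_def)
  define \<phi> where "\<phi> = (\<lambda>A :: int ^ 2 ^ 2. mat2 (A $ 1 $ 1) (2 * A $ 1 $ 2) (A $ 2 $ 1 div 2) (A $ 2 $ 2))"
  have \<phi>: "\<phi> A \<in> Gamma1_10_even \<and> mat2 2 0 0 1 ** A = \<phi> A ** mat2 2 0 0 1" if A: "A \<in> Gamma1 20" for A
  proof -
    have c: "[A $ 1 $ 1 = 1] (mod 20)" "[A $ 2 $ 2 = 1] (mod 20)" "[A $ 2 $ 1 = 0] (mod 20)" and det: "A $ 1 $ 1 * A $ 2 $ 2 - A $ 1 $ 2 * A $ 2 $ 1 = 1"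
      using A by (auto simp: Gamma1_def SL2Z_iff)
    obtain e where e: "A $ 2 $ 1 = 20 * e" using c(3) by (auto simp: cong_0_iff)
    have \<phi>A: "\<phi> A = mat2 (A $ 1 $ 1) (2 * A $ 1 $ 2) (10 * e) (A $ 2 $ 2)" by (simp add: \<phi>_def e)
    have "[A $ 1 $ 1 = 1] (mod 10)" "[A $ 2 $ 2 = 1] (mod 10)"
      by (rule cong_dvd_modulus[OF c(1)], simp) (rule cong_dvd_modulus[OF c(2)], simp)
    then have "\<phi> A \<in> Gamma1_10_even" using det
      unfolding Gamma1_10_even_def Gamma1_def SL2Z_iff by (simp add: \<phi>A e cong_0_iff)
    moreover have "mat2 2 0 0 1 ** A = \<phi> A ** mat2 2 0 0 1"
      by (rule mat2_eqI) (simp_all add: matrix_mult_nth \<phi>A e)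
    ultimately show ?thesis by blast
  qed
  note C = modular_form_conjugate[OF v, of 2 1 "Gamma1 20" \<phi> 0, OF _ _ sub Gamma1_subset_SL2Z \<phi> Gamma1_mult]
  have m: "multiplier_system (Gamma1 20) (1 / 2) (v \<circ> \<phi>)" by (rule C(1)) auto
  have "modular_form (Gamma1 20) (1 / 2) (v \<circ> \<phi>) (\<lambda>\<tau>. lift s True (aff 2 0 1 \<tau>) + c * lift s False (aff 2 0 1 \<tau>))"
    by (rule C(2)) auto
  note sc = this
  have "modular_form (Gamma1 20) (1 / 2) (v \<circ> \<phi>) (\<lambda>\<tau>. qexp (of_real (- (if s = 0 then 1 / 60 else - 11 / 60)) * \<tau>) * F (qexp \<tau>))"
  proof (rule modular_form_cong[OF sc Gamma1_subset_SL2Z])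
    fix \<tau> :: complex assume \<tau>: "Im \<tau> > 0"
    define x where "x = (if s = 0 then 1 / 60 else - 11 / 60 :: real)"
    have a: "aff 2 0 1 \<tau> = 2 * \<tau>" "2 * \<tau> / 2 = \<tau>" by (simp_all add: aff_def)
    have e: "ee (- of_real x * (2 * \<tau>)) = qexp (of_real (- x) * \<tau>)"
      unfolding qexp_ee by (rule arg_cong[where f = ee]) simp
    have lift: "lift s True (2 * \<tau>) = ee (- of_real x * (2 * \<tau>)) * theta4_rr s (- qexp \<tau>)"
      "lift s False (2 * \<tau>) = ee (- of_real x * (2 * \<tau>)) * theta4_rr s (qexp \<tau>)"
      unfolding lift_def a x_def by (simp_all only: if_True if_False)
    have "F (qexp \<tau>) = theta4_rr s (- qexp \<tau>) + c * theta4_rr s (qexp \<tau>)"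
      by (rule F[OF norm_qexp_less_1[OF \<tau>]]) simp
    then show "lift s True (aff 2 0 1 \<tau>) + c * lift s False (aff 2 0 1 \<tau>) = qexp (of_real (- (if s = 0 then 1 / 60 else - 11 / 60)) * \<tau>) * F (qexp \<tau>)"
      unfolding a lift e x_def[symmetric] by (simp add: algebra_simps)
  qed
  with m show ?thesis unfolding modular_in_q_def
    by (intro bexI[of _ "- (if s = 0 then 1 / 60 else - 11 / 60)"] exI[of _ "v \<circ> \<phi>"] conjI) auto
qed

lemma modular_in_q_psi:
  "modular_in_q (Gamma1 20) (1 / 2) (bilateral psi0_term)"
  "modular_in_q (Gamma1 20) (1 / 2) (bilateral psi1_term)"
proof -
  show "modular_in_q (Gamma1 20) (1 / 2) (bilateral psi0_term)"
    by (rule modular_in_q_psi_aux[of 0 _ "- 1 / 2"]) (simp_all add: bilateral_psi)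
  show "modular_in_q (Gamma1 20) (1 / 2) (bilateral psi1_term)"
    by (rule modular_in_q_psi_aux[of 1 _ "1 / 2"]) (simp_all add: bilateral_psi)
qed

section \<open>Radial limits\<close>

lemma primitive_root_power_inj:
  assumes "primitive_root_of_unity M \<omega>" "i < M" "j < M" "\<omega> ^ i = \<omega> ^ j"
  shows "i = j"
proof -
  have w: "\<omega> \<noteq> 0" using assms(1) by (auto simp: primitive_root_of_unity_def power_0_left split: if_splits)
  have *: "\<not> (i < j)" if "i < M" "j < M" "\<omega> ^ i = \<omega> ^ j" for i j
  proof
    assume ij: "i < j"
    have "\<omega> ^ j = \<omega> ^ i * \<omega> ^ (j - i)" using ij by (simp add: power_add[symmetric])
    then have "\<omega> ^ (j - i) = 1" using that w by simp
    then show False using assms(1) ij that by (auto simp: primitive_root_of_unity_def)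
  qed
  show ?thesis using *[of i j] *[of j i] assms by (cases i j rule: linorder_cases) auto
qed

text \<open>Both sides are polynomials in \<open>z\<close> of degree at most \<open>M\<close>, and
  they agree at the \<open>M + 1\<close> points consisting of 0 and the powers of \<omega>.\<close>

lemma prod_primitive_root:
  assumes \<omega>: "primitive_root_of_unity M \<omega>"
  shows "(\<Prod>i<M. 1 - z * \<omega> ^ i) = 1 - z ^ M"
proof -
  have M: "M > 0" "\<omega> ^ M = 1" using \<omega> by (auto simp: primitive_root_of_unity_def)
  have w: "\<omega> \<noteq> 0" using M by (auto simp: power_0_left)
  define P where "P = (\<Prod>i<M. [:1, - (\<omega> ^ i):])"
  define Q where "Q = 1 - monom (1 :: complex) M"
  define A where "A = insert 0 ((\<lambda>j. \<omega> ^ j) ` {..<M})"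
  have "card ((\<lambda>j. \<omega> ^ j) ` {..<M}) = M"
    using card_image[of "\<lambda>j. \<omega> ^ j" "{..<M}"] primitive_root_power_inj[OF \<omega>] by (auto simp: inj_on_def)
  moreover have "0 \<notin> (\<lambda>j. \<omega> ^ j) ` {..<M}" using w by auto
  ultimately have card: "card A = M + 1" by (simp add: A_def)
  have dP: "degree P \<le> M"
  proof -
    have "degree P \<le> (\<Sum>i<M. degree [:1, - (\<omega> ^ i):])" unfolding P_def using degree_prod_sum_le[of "{..<M}" "\<lambda>i. [:1, - (\<omega> ^ i):]"] by (simp add: o_def)
    also have "\<dots> \<le> (\<Sum>i<M. 1)" by (rule sum_mono) simp
    finally show ?thesis by simp
  qed
  have dQ: "degree Q \<le> M" unfolding Q_def
    by (rule order_trans[OF degree_diff_le_max]) (simp add: degree_monom_le)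
  have "P = Q"
  proof (rule poly_eqI_degree[of A])
    fix x assume x: "x \<in> A"
    show "poly P x = poly Q x"
    proof (cases "x = 0")
      case True
      then show ?thesis using M by (simp add: P_def Q_def poly_prod poly_monom power_0_left)
    next
      case False
      then obtain j where j: "j < M" "x = \<omega> ^ j" using x by (auto simp: A_def)
      have "\<exists>i<M. x * \<omega> ^ i = 1"
      proof (cases "j = 0")
        case True
        then show ?thesis using M j by auto
      next
        case False
        then have "M - j < M" "x * \<omega> ^ (M - j) = 1" using j M by (simp_all add: power_add[symmetric])
        then show ?thesis by blast
      qed
      then have "(\<Prod>i<M. poly [:1, - (\<omega> ^ i):] x) = 0" by (auto simp: prod_zero_iff)
      moreover have "x ^ M = 1" using M(2) j by (metis mult.commute power_mult power_one)
      ultimately show ?thesis by (simp add: P_def Q_def poly_prod poly_monom)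
    qed
  qed (use dP dQ card in auto)
  then have "poly P z = poly Q z" by simp
  then show ?thesis by (simp add: P_def Q_def poly_prod poly_monom)
qed

lemma infsum_eq_suminf:
  fixes f :: "nat \<Rightarrow> 'a :: banach"
  assumes "summable (\<lambda>n. norm (f n))"
  shows "infsum f UNIV = suminf f" 
  using norm_summable_imp_has_sum[OF assms summable_sums[OF summable_norm_cancel[OF assms]]] by (rule infsumI)

lemma unilateral_minus_bilateral:
  fixes c :: "int \<Rightarrow> complex \<Rightarrow> complex"
  assumes "(\<lambda>n. c n q) summable_on UNIV"
  shows "unilateral c q - bilateral c q = - (\<Sum>\<^sub>\<infinity>n. c (- int n - 1) q)"
    "summable (\<lambda>n. norm (c (- int n - 1) q))"
proof -
  have s: "(\<lambda>n. norm (c n q)) summable_on UNIV"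
    using assms by (simp add: summable_on_iff_abs_summable_on_complex)
  have r: "summable (\<lambda>n. norm (c (h n) q))" if "inj h" for h :: "nat \<Rightarrow> int"
  proof -
    have "(\<lambda>n. norm (c n q)) summable_on (h ` UNIV)"
      by (rule summable_on_subset_banach[OF s]) simp
    then have "((\<lambda>n. norm (c n q)) \<circ> h) summable_on UNIV"
      using summable_on_reindex[OF that] by blast
    then show ?thesis by (simp add: o_def summable_on_UNIV_nonneg_real_iff)
  qed
  have s1: "summable (\<lambda>n. norm (c (int n) q))" by (rule r) simp
  have s2: "summable (\<lambda>n. norm (c (- int n - 1) q))" by (rule r) (simp add: inj_def)
  show "unilateral c q - bilateral c q = - (\<Sum>\<^sub>\<infinity>n. c (- int n - 1) q)"
    unfolding unilateral_def bilateral_def int_abs_summableI(2)[OF s1 s2] infsum_eq_suminf[OF s2] by simp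
  show "summable (\<lambda>n. norm (c (- int n - 1) q))" by (rule s2)
qed

text \<open>Halving every factor brings it into the unit disk, where the difference of two products
  is at most the sum of the differences of the factors; the power of 2 undoes the halving.\<close>

lemma prod_perturbation:
  fixes a b :: "nat \<Rightarrow> complex"
  assumes "\<And>i. i < M \<Longrightarrow> norm (a i) \<le> 1" "\<And>i. i < M \<Longrightarrow> norm (b i) \<le> 1" "\<And>i. i < M \<Longrightarrow> norm (a i - b i) \<le> e"
  shows "norm ((\<Prod>i<M. 1 - a i) - (\<Prod>i<M. 1 - b i)) \<le> 2 ^ M * (real M * e)"
proof -
  have h: "norm ((1 - x) / 2) \<le> 1" if "norm x \<le> 1" for x :: complex
    using norm_triangle_ineq4[of 1 x] that by (simp add: norm_divide)
  have "norm ((\<Prod>i<M. (1 - a i) / 2) - (\<Prod>i<M. (1 - b i) / 2)) \<le> (\<Sum>i<M. norm ((1 - a i) / 2 - (1 - b i) / 2))"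
    by (rule norm_prod_diff) (use h assms in auto)
  also have "\<dots> \<le> (\<Sum>i<M. e)"
  proof (rule sum_mono)
    fix i assume i: "i \<in> {..<M}"
    have "(1 - a i) / 2 - (1 - b i) / 2 = - ((a i - b i) / 2)" by (simp add: field_simps)
    then have "norm ((1 - a i) / 2 - (1 - b i) / 2) = norm (a i - b i) / 2" by (simp only: norm_minus_cancel norm_divide) simp
    also have "\<dots> \<le> e" using assms(3)[of i] i norm_ge_zero[of "a i - b i"] by (simp del: norm_ge_zero)
    finally show "norm ((1 - a i) / 2 - (1 - b i) / 2) \<le> e" .
  qed
  finally have 1: "norm ((\<Prod>i<M. (1 - a i) / 2) - (\<Prod>i<M. (1 - b i) / 2)) \<le> real M * e" by simp
  have "(\<Prod>i<M. 1 - a i) - (\<Prod>i<M. 1 - b i) = 2 ^ M * ((\<Prod>i<M. (1 - a i) / 2) - (\<Prod>i<M. (1 - b i) / 2))"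
    by (simp add: prod_dividef algebra_simps)
  then have "norm ((\<Prod>i<M. 1 - a i) - (\<Prod>i<M. 1 - b i)) = 2 ^ M * norm ((\<Prod>i<M. (1 - a i) / 2) - (\<Prod>i<M. (1 - b i) / 2))"
    by (simp add: norm_mult norm_power)
  then show ?thesis using mult_left_mono[OF 1, of "2 ^ M"] by simp
qed

text \<open>
  A block of \<open>M\<close> consecutive factors of the denominators is close to \<open>1 + x ^ M\<close> with
  \<open>x = r ^ (p n + 1)\<close>, while the numerator gains at least \<open>x ^ M\<close>, and \<open>x ^ M / (1 / 2 + x ^ M) \<le> 2 / 3\<close>.
  This gives a geometric majorant that is uniform in \<open>r\<close>.
\<close>

lemma radial_sum:
  fixes \<zeta> :: complex and e :: "nat \<Rightarrow> nat"
  assumes \<omega>: "primitive_root_of_unity M (\<zeta> ^ p)" and z: "(- \<zeta>) ^ M = - 1" and p: "p > 0"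
    and per: "\<And>n. n \<ge> 1 \<Longrightarrow> \<zeta> ^ e (n + M) = \<zeta> ^ e n"
    and e: "\<And>n. n \<ge> 1 \<Longrightarrow> e n + (p * n + 1) * M \<le> e (n + M)"
  defines "t \<equiv> (\<lambda>q n. q ^ e n / qpoch_fin (- q) (q ^ p) n)"
  shows "((\<lambda>r. \<Sum>\<^sub>\<infinity>n. t (of_real r * \<zeta>) (Suc n)) \<longlongrightarrow> 2 * (\<Sum>n=1..M. t \<zeta> n)) (at_left 1)"
proof -
  have M: "M > 0" "(\<zeta> ^ p) ^ M = 1" using \<omega> by (auto simp: primitive_root_of_unity_def)
  have "\<zeta> ^ (p * M) = 1" using M(2) by (simp add: power_mult)
  then have "norm \<zeta> ^ (p * M) = 1 ^ (p * M)" unfolding norm_power[symmetric] by simp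
  then have nz: "norm \<zeta> = 1" by (rule power_eq_imp_eq_base) (use p M(1) in auto)
  define block where "block = (\<lambda>q n. qpoch_fin (- q * (q ^ p) ^ n) (q ^ p) M)"
  have tM: "t q (n + M) = t q n * (q ^ (e (n + M) - e n) / block q n)" if n: "n \<ge> 1" for q n
  proof -
    have "q ^ e (n + M) = q ^ e n * q ^ (e (n + M) - e n)"
      unfolding power_add[symmetric] using e[OF n] by simp
    then show ?thesis unfolding t_def block_def qpoch_fin_add by simp
  qed
  have zM: "(\<zeta> ^ (p * n + 1)) ^ M * (- 1) ^ M = - 1" for n
  proof -
    have "(\<zeta> ^ (p * n + 1)) ^ M = ((\<zeta> ^ p) ^ M) ^ n * \<zeta> ^ M"
      by (simp add: power_add power_mult power_mult_distrib) (simp flip: power_mult add: mult_ac)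
    then have "(\<zeta> ^ (p * n + 1)) ^ M * (- 1) ^ M = (- \<zeta>) ^ M" using M(2) by (simp add: power_minus[of \<zeta>] mult_ac)
    then show ?thesis using z by simp
  qed
  \<comment> \<open>If all factors of a block had the same modulus \<open>x\<close>, the block would
    be \<open>1 + x ^ M\<close>; the plus sign is due to the assumption on
    \<open>(- \<zeta>) ^ M\<close>.\<close>
  have P: "(\<Prod>i<M. 1 - (- (of_real x * \<zeta> ^ (p * n + 1) * (\<zeta> ^ p) ^ i))) = 1 + of_real x ^ M" for x :: real and n
  proof -
    have "(\<Prod>i<M. 1 - (- (of_real x * \<zeta> ^ (p * n + 1) * (\<zeta> ^ p) ^ i))) = (\<Prod>i<M. 1 - (- (of_real x * \<zeta> ^ (p * n + 1))) * (\<zeta> ^ p) ^ i)"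
      by simp
    also have "\<dots> = 1 - (- (of_real x * \<zeta> ^ (p * n + 1))) ^ M" by (rule prod_primitive_root[OF \<omega>])
    also have "(- (of_real x * \<zeta> ^ (p * n + 1))) ^ M = of_real x ^ M * ((\<zeta> ^ (p * n + 1)) ^ M * (- 1) ^ M)"
      by (subst power_minus) (simp add: power_mult_distrib mult_ac)
    finally show ?thesis unfolding zM by simp
  qed
  have block_factor: "block q n = (\<Prod>i<M. 1 - (- (q ^ (p * n + 1) * (q ^ p) ^ i)))" for q n
    unfolding block_def qpoch_fin_def by (simp add: power_mult)
  have block_1: "block \<zeta> n = 2" for n
    using P[of 1 n] unfolding block_factor by simp
  \<comment> \<open>Every factor of the denominator is the first of some block, and at \<zeta> all
    blocks have the value 2.\<close>
  have den: "qpoch_fin (- \<zeta>) (\<zeta> ^ p) n \<noteq> 0" for n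
  proof
    assume "qpoch_fin (- \<zeta>) (\<zeta> ^ p) n = 0"
    then obtain j where j: "1 - (- \<zeta>) * (\<zeta> ^ p) ^ j = 0"
      by (auto simp: qpoch_fin_def prod_zero_iff)
    have "block \<zeta> j = 0" unfolding block_def qpoch_fin_def using j M(1) by (intro prod_zero) (auto intro!: bexI[of _ 0])
    then show False by (simp add: block_1)
  qed
  define N where "N = 2 ^ M * (real M * 1)"
  have ev0: "eventually (\<lambda>r. 0 < r \<and> r < 1) (at_left (1::real))"
    using eventually_at_left_real[of 0 1] by (simp add: eventually_mono)
  have ev1: "eventually (\<lambda>r. 2 ^ M * (real M * (1 - r ^ (p * M))) < 1 / 2) (at_left (1::real))"
  proof -
    have "((\<lambda>r::real. 2 ^ M * (real M * (1 - r ^ (p * M)))) \<longlongrightarrow> 2 ^ M * (real M * (1 - 1 ^ (p * M)))) (at_left 1)"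
      by (intro tendsto_intros)
    then show ?thesis by (rule order_tendstoD) simp
  qed
  have block_ge: "norm (block (of_real r * \<zeta>) n) \<ge> 1 / 2 + r ^ ((p * n + 1) * M)"
    if r: "0 < r" "r < 1" "2 ^ M * (real M * (1 - r ^ (p * M))) < 1 / 2" for r n
  proof -
    define x where "x = r ^ (p * n + 1)"
    have x: "0 \<le> x" "x \<le> 1" unfolding x_def using r power_le_one[of r "p * n + 1"] by auto
    \<comment> \<open>Here \<open>?b\<close> has the constant modulus \<open>x\<close>, so its block
      is known exactly, whereas \<open>?a\<close> is the actual factor, whose modulus decreases
      within the block. Near \<open>r = 1\<close> the perturbation is below 1/2.\<close>
    let ?b = "\<lambda>i. - (of_real x * \<zeta> ^ (p * n + 1) * (\<zeta> ^ p) ^ i)"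
    let ?a = "\<lambda>i. of_real (r ^ (p * i)) * ?b i"
    have ba: "block (of_real r * \<zeta>) n = (\<Prod>i<M. 1 - ?a i)"
      unfolding block_factor
    proof (rule prod.cong[OF refl])
      fix i
      have "(of_real r * \<zeta>) ^ (p * n + 1) = of_real x * \<zeta> ^ (p * n + 1)" unfolding x_def power_mult_distrib of_real_power ..
      moreover have "((of_real r * \<zeta>) ^ p) ^ i = of_real (r ^ (p * i)) * (\<zeta> ^ p) ^ i"
        unfolding power_mult_distrib of_real_power power_mult ..
      ultimately show "1 - - ((of_real r * \<zeta>) ^ (p * n + 1) * ((of_real r * \<zeta>) ^ p) ^ i) = 1 - ?a i" by (simp only: mult_minus_right mult_ac)
    qed
    have nb: "norm (?b i) = x" for i using x nz by (simp add: norm_mult norm_power)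
    have rp: "0 \<le> r ^ (p * i)" "r ^ (p * i) \<le> 1" for i using r by (auto simp: power_le_one)
    have "norm ((\<Prod>i<M. 1 - ?a i) - (\<Prod>i<M. 1 - ?b i)) \<le> 2 ^ M * (real M * (1 - r ^ (p * M)))"
    proof (rule prod_perturbation)
      fix i assume i: "i < M"
      show "norm (?b i) \<le> 1" using nb x by simp
      show "norm (?a i) \<le> 1" unfolding norm_mult[of "of_real _" "?b i"] nb norm_of_real using x rp[of i] by (simp only: abs_of_nonneg mult_le_one)
      have "?a i - ?b i = of_real (r ^ (p * i) - 1) * ?b i" by (simp add: algebra_simps)
      then have "norm (?a i - ?b i) = (1 - r ^ (p * i)) * x"
        using rp[of i] by (simp only: norm_mult[of "of_real _" "?b i"] nb norm_of_real) simp
      also have "\<dots> \<le> (1 - r ^ (p * i)) * 1" using x rp by (intro mult_left_mono) auto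
      also have "\<dots> \<le> 1 - r ^ (p * M)" using r i by (simp add: power_decreasing)
      finally show "norm (?a i - ?b i) \<le> 1 - r ^ (p * M)" .
    qed
    then have "norm (block (of_real r * \<zeta>) n - (1 + of_real x ^ M)) < 1 / 2" unfolding ba P using r(3) by linarith
    moreover have "norm (1 + complex_of_real x ^ M) = 1 + x ^ M"
    proof -
      have "1 + complex_of_real x ^ M = of_real (1 + x ^ M)" by simp
      then show ?thesis using x by (simp only: norm_of_real) simp
    qed
    moreover have "x ^ M = r ^ ((p * n + 1) * M)" by (simp only: x_def power_mult[symmetric])
    ultimately show ?thesis
      using norm_triangle_ineq2[of "1 + complex_of_real x ^ M" "block (of_real r * \<zeta>) n"] by (simp add: norm_minus_commute)
  qed
  have step: "norm (t (of_real r * \<zeta>) (n + M)) \<le> 2 / 3 * norm (t (of_real r * \<zeta>) n)"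
    if r: "0 < r" "r < 1" "2 ^ M * (real M * (1 - r ^ (p * M))) < 1 / 2" and n: "n \<ge> 1" for r n
  proof -
    define y where "y = r ^ ((p * n + 1) * M)"
    have y: "0 \<le> y" "y \<le> 1" using r by (auto simp: y_def power_le_one)
    have "(p * n + 1) * M \<le> e (n + M) - e n" using e[OF n] by simp
    then have "r ^ (e (n + M) - e n) \<le> y" unfolding y_def using r by (intro power_decreasing) auto
    then have "r ^ (e (n + M) - e n) / norm (block (of_real r * \<zeta>) n) \<le> y / (1 / 2 + y)"
      using block_ge[OF r, of n] y r unfolding y_def[symmetric] by (intro frac_le) auto
    also have "\<dots> \<le> 2 / 3" using y by (simp add: field_simps)
    finally have "norm ((of_real r * \<zeta>) ^ (e (n + M) - e n) / block (of_real r * \<zeta>) n) \<le> 2 / 3"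
      using r nz by (simp add: norm_divide norm_power norm_mult)
    then show ?thesis unfolding tM[OF n] norm_mult
      using mult_left_mono[OF _ norm_ge_zero[of "t (of_real r * \<zeta>) n"]] by (metis mult.commute)
  qed
  have lim: "((\<lambda>r. t (of_real r * \<zeta>) n) \<longlongrightarrow> t \<zeta> n) (at_left (1::real))" for n
  proof -
    have 1: "((\<lambda>r. complex_of_real r * \<zeta>) \<longlongrightarrow> of_real 1 * \<zeta>) (at_left 1)"
      by (intro tendsto_intros)
    have "((\<lambda>r. t (of_real r * \<zeta>) n) \<longlongrightarrow> t (of_real 1 * \<zeta>) n) (at_left 1)"
      unfolding t_def qpoch_fin_def
      by (intro tendsto_divide tendsto_power tendsto_prod tendsto_diff tendsto_mult tendsto_minus tendsto_const 1)
        (use den[of n] in \<open>simp add: qpoch_fin_def\<close>)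
    then show ?thesis by simp
  qed
  \<comment> \<open>A bound for the terms of the first period, valid for all \<open>r\<close> near
    1; later periods are then controlled by \<open>step\<close>.\<close>
  define B where "B = (\<Sum>n\<le>M. norm (t \<zeta> n) + 1)"
  have evB: "eventually (\<lambda>r. \<forall>n\<in>{..M}. norm (t (of_real r * \<zeta>) n) < norm (t \<zeta> n) + 1) (at_left (1::real))"
    by (rule eventually_ball_finite) (auto intro: order_tendstoD(2)[OF tendsto_norm[OF lim]])
  \<comment> \<open>The \<open>M\<close>-th root spreads the contraction by 2/3 per period evenly
    over its terms, so that the majorant is geometric in \<open>n\<close>.\<close>
  define s where "s = root M (2 / 3)"
  have s: "0 < s" "s < 1" "s ^ M = 2 / 3" using M(1) by (simp_all add: s_def)
  define Y where "Y = {r::real. 0 < r \<and> r < 1 \<and> 2 ^ M * (real M * (1 - r ^ (p * M))) < 1 / 2 \<and> (\<forall>n\<in>{..M}. norm (t (of_real r * \<zeta>) n) < norm (t \<zeta> n) + 1)}"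
  have evY: "eventually (\<lambda>r. r \<in> Y) (at_left 1)"
    using ev0 ev1 evB by eventually_elim (simp add: Y_def)
  have sB: "B \<le> B / s ^ M * s ^ n" if n: "n < M" for n
  proof -
    have "0 \<le> B" unfolding B_def by (intro sum_nonneg) simp
    then have B: "0 \<le> B / s ^ M" using s(1) by simp
    have "s ^ M \<le> s ^ n" by (rule power_decreasing) (use s(1,2) n in simp_all)
    from mult_left_mono[OF this B] show ?thesis using s(1) by simp
  qed
  have bound: "norm (t (of_real r * \<zeta>) (Suc n)) \<le> B / s ^ M * s ^ n" if r: "r \<in> Y" for r n
  proof (induction n rule: less_induct)
    case (less n)
    have r': "0 < r" "r < 1" "2 ^ M * (real M * (1 - r ^ (p * M))) < 1 / 2" using r by (auto simp: Y_def)
    show ?case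
    proof (cases "n < M")
      case True
      then have "norm (t (of_real r * \<zeta>) (Suc n)) < norm (t \<zeta> (Suc n)) + 1" using r by (auto simp: Y_def)
      also have "\<dots> \<le> B" unfolding B_def by (rule member_le_sum) (use True in auto)
      also have "B \<le> B / s ^ M * s ^ n" by (rule sB[OF True])
      finally show ?thesis by simp
    next
      case False
      then obtain m where m: "n = m + M" by (metis add.commute le_Suc_ex not_less)
      have "norm (t (of_real r * \<zeta>) (Suc m + M)) \<le> 2 / 3 * norm (t (of_real r * \<zeta>) (Suc m))"
        by (rule step[OF r']) simp
      also have "\<dots> \<le> 2 / 3 * (B / s ^ M * s ^ m)" using less.IH[of m] m M(1) by (intro mult_left_mono) auto
      also have "\<dots> = B / s ^ M * s ^ n" unfolding m power_add s(3) by simp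
      finally show ?thesis by (simp add: m)
    qed
  qed
  have Ms: "(\<lambda>n. B / s ^ M * s ^ n) summable_on UNIV"
    by (rule norm_summable_imp_summable_on) (use s in \<open>auto simp: abs_mult power_abs intro!: summable_mult summable_geometric\<close>)
  note T = infsum_tannery[of UNIV "\<lambda>n r. t (of_real r * \<zeta>) (Suc n)" "\<lambda>n. t \<zeta> (Suc n)" "at_left 1" Y "\<lambda>n. B / s ^ M * s ^ n",
      OF lim bound evY Ms]
  have T1: "((\<lambda>r. \<Sum>\<^sub>\<infinity>n. t (of_real r * \<zeta>) (Suc n)) \<longlongrightarrow> (\<Sum>\<^sub>\<infinity>n. t \<zeta> (Suc n))) (at_left 1)"
    and T2: "(\<lambda>n. t \<zeta> (Suc n)) summable_on UNIV"
    using T by (auto simp: trivial_limit_at_left_real)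
  have ns: "summable (\<lambda>n. norm (t \<zeta> (Suc n)))"
    using T2 by (simp add: summable_on_iff_abs_summable_on_complex summable_on_UNIV_nonneg_real_iff)
  have half: "t \<zeta> (Suc n + M) = t \<zeta> (Suc n) / 2" for n
  proof -
    have "\<zeta> ^ e (Suc n + M) = \<zeta> ^ e (Suc n) * \<zeta> ^ (e (Suc n + M) - e (Suc n))"
      unfolding power_add[symmetric] using e[of "Suc n"] by simp
    moreover have "\<zeta> \<noteq> 0" using nz by auto
    ultimately have "\<zeta> ^ (e (Suc n + M) - e (Suc n)) = 1" using per[of "Suc n"] by simp
    then show ?thesis using tM[of "Suc n" \<zeta>] by (simp add: block_1)
  qed
  have sm: "summable (\<lambda>n. t \<zeta> (Suc n))" using ns by (rule summable_norm_cancel)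
  \<comment> \<open>The sum is found by splitting off one period and solving the resulting linear
    equation.\<close>
  have "(\<Sum>n. t \<zeta> (Suc n)) = (\<Sum>n. t \<zeta> (Suc (n + M))) + (\<Sum>n<M. t \<zeta> (Suc n))"
    by (rule suminf_split_initial_segment[OF sm])
  also have "(\<Sum>n. t \<zeta> (Suc (n + M))) = (\<Sum>n. t \<zeta> (Suc n)) / 2"
    using half suminf_divide[OF sm, of 2] by (simp only: add_Suc)
  also have "(\<Sum>n<M. t \<zeta> (Suc n)) = (\<Sum>n=1..M. t \<zeta> n)"
    by (rule sum.reindex_bij_witness[of _ "\<lambda>n. n - 1" Suc]) auto
  finally have "(\<Sum>n. t \<zeta> (Suc n)) = 2 * (\<Sum>n=1..M. t \<zeta> n)" by (simp add: field_simps)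
  then show ?thesis using T1 unfolding infsum_eq_suminf[OF ns] by simp
qed

section \<open>The terms with negative index\<close>

lemma qpoch_ratio:
  assumes "norm q < 1" "norm Q < 1"
  shows "qpoch_inf (- q * Q powi int n) Q / qpoch_inf (- q) Q = 1 / qpoch_fin (- q) Q n"
proof -
  have "qpoch_inf (- q) Q = qpoch_fin (- q) Q n * qpoch_inf (- q * Q ^ n) Q" by (rule qpoch_inf_shift) fact
  moreover have "qpoch_inf (- q) Q \<noteq> 0" by (rule qpoch_inf_nonzero) (use assms in auto)
  ultimately show ?thesis by (auto simp: field_simps)
qed

text \<open>At natural arguments the reflected forms have finite products as denominators. The psi
  terms keep the factor 1/2 and start at \<open>n = 0\<close>, the phi terms start at
  \<open>n = 1\<close>; this is why two versions of the limit follow.\<close>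

lemma negative_terms:
  assumes q: "norm q < 1" and q0: "q \<noteq> 0"
  shows "psi0_term (- int n - 1) q = q ^ (n\<^sup>2) / qpoch_fin (- q) (q ^ 1) n / 2"
    "psi1_term (- int n - 1) q = q ^ (n * (n + 1)) / qpoch_fin (- q) (q ^ 1) n / 2"
    "phi0_term (- int (Suc n) ) q = q ^ (2 * (Suc n)\<^sup>2) / qpoch_fin (- q) (q\<^sup>2) (Suc n)"
    "phi1_term (- int (Suc n) ) q = q ^ (2 * Suc n * (Suc n - 1) + 1) / qpoch_fin (- q) (q\<^sup>2) (Suc n)"
proof -
  have q2: "norm (q\<^sup>2) < 1" by (rule norm_square_less_1[OF q])
  have A: "X * Y / (2 * Z) = X * (Y / Z) / 2" "X * Y / Z = X * (Y / Z)" "q * (X * Y) / Z = q * X * (Y / Z)" for X Y Z :: complex by simp_all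
  have e: "(int n)\<^sup>2 = int (n\<^sup>2)" "(int n)\<^sup>2 + int n = int (n * (n + 1))" "(int (Suc n))\<^sup>2 = int ((Suc n)\<^sup>2)"
    "(int (Suc n))\<^sup>2 - int (Suc n) = int (Suc n * (Suc n - 1))"
    by (simp_all add: power2_eq_square algebra_simps)
  show "psi0_term (- int n - 1) q = q ^ (n\<^sup>2) / qpoch_fin (- q) (q ^ 1) n / 2"
    unfolding psi_term_eq(1)[OF q q0] A(1) qpoch_ratio[OF q q] unfolding e(1) power_int_of_nat by simp
  show "psi1_term (- int n - 1) q = q ^ (n * (n + 1)) / qpoch_fin (- q) (q ^ 1) n / 2"
    unfolding psi_term_eq(2)[OF q q0] A(1) qpoch_ratio[OF q q] unfolding e(2) power_int_of_nat by simp
  show "phi0_term (- int (Suc n)) q = q ^ (2 * (Suc n)\<^sup>2) / qpoch_fin (- q) (q\<^sup>2) (Suc n)"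
    unfolding phi_term_eq(1)[OF q q0] A(2) qpoch_ratio[OF q q2] unfolding e(3) power_int_of_nat power_mult[symmetric] by simp
  show "phi1_term (- int (Suc n)) q = q ^ (2 * Suc n * (Suc n - 1) + 1) / qpoch_fin (- q) (q\<^sup>2) (Suc n)"
    unfolding phi_term_eq(2)[OF q q0] A(3) qpoch_ratio[OF q q2] unfolding e(4) power_int_of_nat power_mult[symmetric] by (simp add: power_add mult_ac)
qed


lemma radial_limit_shifted:
  fixes \<zeta> :: complex
  assumes lim: "((\<lambda>r. \<Sum>\<^sub>\<infinity>n. t (of_real r * \<zeta>) (Suc n)) \<longlongrightarrow> L) (at_left 1)" and \<zeta>: "norm \<zeta> = 1"
    and summable: "\<And>q. norm q < 1 \<Longrightarrow> q \<noteq> 0 \<Longrightarrow> (\<lambda>n. c n q) summable_on UNIV"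
    and neg: "\<And>q n. norm q < 1 \<Longrightarrow> q \<noteq> 0 \<Longrightarrow> c (- int n - 1) q = t q (Suc n)"
  shows "radial_limit (\<lambda>q. unilateral c q - bilateral c q) \<zeta> (- L)"
  unfolding radial_limit_def
proof (rule Lim_transform_eventually[OF tendsto_minus[OF lim]])
  have "eventually (\<lambda>r. r \<in> {0<..<1}) (at_left (1::real))" by (rule eventually_at_left_real) simp
  then show "eventually (\<lambda>r. - (\<Sum>\<^sub>\<infinity>n. t (of_real r * \<zeta>) (Suc n)) = unilateral c (of_real r * \<zeta>) - bilateral c (of_real r * \<zeta>)) (at_left (1::real))"
  proof eventually_elim
    case (elim r)
    then have q: "norm (of_real r * \<zeta>) < 1" "of_real r * \<zeta> \<noteq> 0" using \<zeta> by (auto simp: norm_mult)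
    show ?case unfolding unilateral_minus_bilateral(1)[of c, OF summable[OF q]] neg[OF q] ..
  qed
qed

text \<open>The term \<open>t q 0 = 1\<close> precedes the sum from index 1 whose limit is
  \<open>L\<close>. Halved, it is the origin of the summand -1/2 in the limits of the psi
  series.\<close>

lemma radial_limit_unshifted:
  fixes \<zeta> :: complex
  assumes lim: "((\<lambda>r. \<Sum>\<^sub>\<infinity>n. t (of_real r * \<zeta>) (Suc n)) \<longlongrightarrow> L) (at_left 1)" and \<zeta>: "norm \<zeta> = 1"
    and summable: "\<And>q. norm q < 1 \<Longrightarrow> q \<noteq> 0 \<Longrightarrow> (\<lambda>n. c n q) summable_on UNIV"
    and neg: "\<And>q n. norm q < 1 \<Longrightarrow> q \<noteq> 0 \<Longrightarrow> c (- int n - 1) q = t q n / 2" and t0: "\<And>q. t q 0 = 1"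
  shows "radial_limit (\<lambda>q. unilateral c q - bilateral c q) \<zeta> (- ((1 + L) / 2))"
  unfolding radial_limit_def
proof (rule Lim_transform_eventually)
  show "((\<lambda>r. - ((1 + (\<Sum>\<^sub>\<infinity>n. t (of_real r * \<zeta>) (Suc n))) / 2)) \<longlongrightarrow> - ((1 + L) / 2)) (at_left (1::real))"
    by (intro tendsto_intros lim) simp
  have "eventually (\<lambda>r. r \<in> {0<..<1}) (at_left (1::real))" by (rule eventually_at_left_real) simp
  then show "eventually (\<lambda>r. - ((1 + (\<Sum>\<^sub>\<infinity>n. t (of_real r * \<zeta>) (Suc n))) / 2) =
      unilateral c (of_real r * \<zeta>) - bilateral c (of_real r * \<zeta>)) (at_left (1::real))"
  proof eventually_elim
    case (elim r)
    define q where "q = of_real r * \<zeta>"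
    have q: "norm q < 1" "q \<noteq> 0" using \<zeta> elim by (auto simp: q_def norm_mult)
    have "summable (\<lambda>n. norm (t q n / 2))"
      using unilateral_minus_bilateral(2)[of c, OF summable[OF q]] unfolding neg[OF q] .
    then have "summable (\<lambda>n. norm (t q n / 2) * 2)" by (rule summable_mult2)
    then have s: "summable (\<lambda>n. norm (t q n))" by (simp add: norm_divide)
    have s': "summable (\<lambda>n. norm (t q (Suc n)))" using s by (subst summable_Suc_iff)
    have "(\<Sum>\<^sub>\<infinity>n. t q n / 2) = (\<Sum>n. t q n) / 2"
      using \<open>summable (\<lambda>n. norm (t q n / 2))\<close> suminf_divide[OF summable_norm_cancel[OF s], of 2]
      by (simp add: infsum_eq_suminf)
    also have "(\<Sum>n. t q n) = 1 + (\<Sum>n. t q (Suc n))"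
      using suminf_split_head[OF summable_norm_cancel[OF s]] t0[of q] by simp
    finally show ?case
      unfolding unilateral_minus_bilateral(1)[of c, OF summable[OF q], unfolded neg[OF q], unfolded q_def] q_def
      using s' by (simp add: infsum_eq_suminf q_def)
  qed
qed

lemma primitive_root_square:
  assumes "primitive_root_of_unity m \<zeta>" "odd m"
  shows "primitive_root_of_unity m (\<zeta>\<^sup>2)"
  unfolding primitive_root_of_unity_def
proof (intro conjI allI impI)
  have m: "m > 0" "\<zeta> ^ m = 1" "\<And>j. 0 < j \<Longrightarrow> j < m \<Longrightarrow> \<zeta> ^ j \<noteq> 1" using assms by (auto simp: primitive_root_of_unity_def)
  show "m > 0" by fact
  show "(\<zeta>\<^sup>2) ^ m = 1" using m(2) by (metis mult.commute power_mult power_one)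
  show "(\<zeta>\<^sup>2) ^ j \<noteq> 1" if j: "0 < j \<and> j < m" for j
  proof
    assume "(\<zeta>\<^sup>2) ^ j = 1"
    then have a: "\<zeta> ^ (2 * j) = 1" by (simp add: power_mult)
    show False
    proof (cases "2 * j < m")
      case True
      then show False using a m(3)[of "2 * j"] j by simp
    next
      case False
      then have "\<zeta> ^ (2 * j) = \<zeta> ^ m * \<zeta> ^ (2 * j - m)" by (simp add: power_add[symmetric])
      then have "\<zeta> ^ (2 * j - m) = 1" using a m(2) by simp
      moreover have "2 * j \<noteq> m" using assms(2) by auto
      moreover have "2 * j - m < m" using j m(1) by arith
      ultimately show False using m(3)[of "2 * j - m"] False by simp
    qed
  qed
qed

lemma primitive_root_square_even:
  assumes "primitive_root_of_unity (2 * m) \<zeta>"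
  shows "primitive_root_of_unity m (\<zeta>\<^sup>2)" "\<zeta> ^ m = - 1"
proof -
  have m: "m > 0" "\<zeta> ^ (2 * m) = 1" "\<And>j. 0 < j \<Longrightarrow> j < 2 * m \<Longrightarrow> \<zeta> ^ j \<noteq> 1" using assms by (auto simp: primitive_root_of_unity_def)
  show "primitive_root_of_unity m (\<zeta>\<^sup>2)"
    unfolding primitive_root_of_unity_def power_mult[symmetric] using m by auto
  have "(\<zeta> ^ m)\<^sup>2 = 1" using m(2) by (simp add: power_mult[symmetric] mult.commute)
  moreover have "\<zeta> ^ m \<noteq> 1" using m(3)[of m] m(1) by simp
  ultimately show "\<zeta> ^ m = - 1" by (simp add: power2_eq_1_iff)
qed

lemma power_periodic: "\<zeta> ^ m = (1 :: complex) \<Longrightarrow> a + m * b = a' \<Longrightarrow> \<zeta> ^ a' = \<zeta> ^ a"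
  by (auto simp: power_add power_mult)

lemma norm_root_of_unity:
  assumes "(x :: complex) ^ n = 1" "n > 0"
  shows "norm x = 1"
proof -
  have "norm x ^ n = 1 ^ n" using assms(1) by (simp flip: norm_power)
  then show ?thesis by (rule power_eq_imp_eq_base) (use assms in auto)
qed

text \<open>The block length is the order of \<zeta> itself, with \<open>p = 1\<close>. Oddness of
  the order gives \<open>(- \<zeta>) ^ m = - 1\<close>, without which factors of the denominators
  could vanish.\<close>

lemma psi_radial_limits:
  assumes \<zeta>: "primitive_root_of_unity m \<zeta>" and m: "odd m"
  shows "radial_limit (\<lambda>q. unilateral psi0_term q - bilateral psi0_term q) \<zeta>
          (- 1 / 2 - (\<Sum>n=1..m. \<zeta> ^ (n\<^sup>2) / qpoch_fin (-\<zeta>) \<zeta> n))"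
    "radial_limit (\<lambda>q. unilateral psi1_term q - bilateral psi1_term q) \<zeta>
          (- 1 / 2 - (\<Sum>n=1..m. \<zeta> ^ (n * (n + 1)) / qpoch_fin (-\<zeta>) \<zeta> n))"
proof -
  have M: "m > 0" "\<zeta> ^ m = 1" using \<zeta> by (auto simp: primitive_root_of_unity_def)
  have nz: "norm \<zeta> = 1" by (rule norm_root_of_unity[OF M(2,1)])
  have z: "(- \<zeta>) ^ m = - 1" using m M by (simp add: power_minus_odd)
  have \<zeta>1: "primitive_root_of_unity m (\<zeta> ^ 1)" using \<zeta> by simp
  have "((\<lambda>r. \<Sum>\<^sub>\<infinity>n. (of_real r * \<zeta>) ^ ((Suc n)\<^sup>2) / qpoch_fin (- (of_real r * \<zeta>)) ((of_real r * \<zeta>) ^ 1) (Suc n)) \<longlongrightarrow>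
      2 * (\<Sum>n=1..m. \<zeta> ^ (n\<^sup>2) / qpoch_fin (- \<zeta>) (\<zeta> ^ 1) n)) (at_left 1)"
  proof (rule radial_sum[OF \<zeta>1 z, of "\<lambda>n. n\<^sup>2"])
    fix n :: nat assume n: "n \<ge> 1"
    show "\<zeta> ^ ((n + m)\<^sup>2) = \<zeta> ^ (n\<^sup>2)"
      by (rule power_periodic[OF M(2), of _ "2 * n + m"]) (simp add: power2_eq_square algebra_simps)
    have "m * 1 \<le> m * (n + m)" using M(1) by (intro mult_left_mono) auto
    then show "n\<^sup>2 + (1 * n + 1) * m \<le> (n + m)\<^sup>2" by (simp add: power2_eq_square algebra_simps)
  qed simp
  from radial_limit_unshifted[OF this nz bilateral_terms_summable(1) negative_terms(1)]
  show "radial_limit (\<lambda>q. unilateral psi0_term q - bilateral psi0_term q) \<zeta>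
          (- 1 / 2 - (\<Sum>n=1..m. \<zeta> ^ (n\<^sup>2) / qpoch_fin (-\<zeta>) \<zeta> n))"
    by (simp add: qpoch_fin_def add_divide_distrib)
  have "((\<lambda>r. \<Sum>\<^sub>\<infinity>n. (of_real r * \<zeta>) ^ (Suc n * (Suc n + 1)) / qpoch_fin (- (of_real r * \<zeta>)) ((of_real r * \<zeta>) ^ 1) (Suc n)) \<longlongrightarrow>
      2 * (\<Sum>n=1..m. \<zeta> ^ (n * (n + 1)) / qpoch_fin (- \<zeta>) (\<zeta> ^ 1) n)) (at_left 1)"
  proof (rule radial_sum[OF \<zeta>1 z, of "\<lambda>n. n * (n + 1)"])
    fix n :: nat assume n: "n \<ge> 1"
    show "\<zeta> ^ ((n + m) * (n + m + 1)) = \<zeta> ^ (n * (n + 1))"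
      by (rule power_periodic[OF M(2), of _ "2 * n + m + 1"]) (simp add: algebra_simps)
    show "n * (n + 1) + (1 * n + 1) * m \<le> (n + m) * (n + m + 1)" by (simp add: algebra_simps)
  qed simp
  from radial_limit_unshifted[OF this nz bilateral_terms_summable(2) negative_terms(2)]
  show "radial_limit (\<lambda>q. unilateral psi1_term q - bilateral psi1_term q) \<zeta>
          (- 1 / 2 - (\<Sum>n=1..m. \<zeta> ^ (n * (n + 1)) / qpoch_fin (-\<zeta>) \<zeta> n))"
    by (simp add: qpoch_fin_def add_divide_distrib)
qed

text \<open>Both cases of the phi statements at once: only the order \<open>M\<close> of the square
  of \<zeta> and the sign of \<open>(- \<zeta>) ^ M\<close> matter.\<close>

lemma phi_radial_limits:
  assumes \<omega>: "primitive_root_of_unity M (\<zeta>\<^sup>2)" and z: "(- \<zeta>) ^ M = - 1"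
  shows "radial_limit (\<lambda>q. unilateral phi0_term q - bilateral phi0_term q) \<zeta>
          (- 2 * (\<Sum>n=1..M. \<zeta> ^ (2 * n\<^sup>2) / qpoch_fin (-\<zeta>) (\<zeta>\<^sup>2) n))"
    "radial_limit (\<lambda>q. unilateral phi1_term q - bilateral phi1_term q) \<zeta>
          (- 2 * \<zeta> * (\<Sum>n=1..M. \<zeta> ^ (2 * n * (n - 1)) / qpoch_fin (-\<zeta>) (\<zeta>\<^sup>2) n))"
proof -
  have M: "M > 0" "\<zeta> ^ (2 * M) = 1" using \<omega> by (auto simp: primitive_root_of_unity_def power_mult)
  have nz: "norm \<zeta> = 1" by (rule norm_root_of_unity[OF M(2)]) (use M in simp)
  have Suc: "- int n - 1 = - int (Suc n)" for n by simp
  have "((\<lambda>r. \<Sum>\<^sub>\<infinity>n. (of_real r * \<zeta>) ^ (2 * (Suc n)\<^sup>2) / qpoch_fin (- (of_real r * \<zeta>)) ((of_real r * \<zeta>)\<^sup>2) (Suc n)) \<longlongrightarrow>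
      2 * (\<Sum>n=1..M. \<zeta> ^ (2 * n\<^sup>2) / qpoch_fin (- \<zeta>) (\<zeta>\<^sup>2) n)) (at_left 1)"
  proof (rule radial_sum[OF \<omega> z, of "\<lambda>n. 2 * n\<^sup>2"])
    fix n :: nat assume n: "n \<ge> 1"
    show "\<zeta> ^ (2 * (n + M)\<^sup>2) = \<zeta> ^ (2 * n\<^sup>2)"
      by (rule power_periodic[OF M(2), of _ "2 * n + M"]) (simp add: power2_eq_square algebra_simps)
    have "M * 1 \<le> M * (2 * n + 2 * M)" using M(1) by (intro mult_left_mono) auto
    then show "2 * n\<^sup>2 + (2 * n + 1) * M \<le> 2 * (n + M)\<^sup>2" by (simp add: power2_eq_square algebra_simps)
  qed simp
  from radial_limit_shifted[OF this nz bilateral_terms_summable(3), unfolded Suc, OF _ _ negative_terms(3)]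
  show "radial_limit (\<lambda>q. unilateral phi0_term q - bilateral phi0_term q) \<zeta>
          (- 2 * (\<Sum>n=1..M. \<zeta> ^ (2 * n\<^sup>2) / qpoch_fin (-\<zeta>) (\<zeta>\<^sup>2) n))"
    by simp
  have "((\<lambda>r. \<Sum>\<^sub>\<infinity>n. (of_real r * \<zeta>) ^ (2 * Suc n * (Suc n - 1) + 1) / qpoch_fin (- (of_real r * \<zeta>)) ((of_real r * \<zeta>)\<^sup>2) (Suc n)) \<longlongrightarrow>
      2 * (\<Sum>n=1..M. \<zeta> ^ (2 * n * (n - 1) + 1) / qpoch_fin (- \<zeta>) (\<zeta>\<^sup>2) n)) (at_left 1)"
  proof (rule radial_sum[OF \<omega> z, of "\<lambda>n. 2 * n * (n - 1) + 1"])
    fix n :: nat assume "n \<ge> 1"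
    then obtain k where n: "n = Suc k" by (cases n) auto
    show "\<zeta> ^ (2 * (n + M) * (n + M - 1) + 1) = \<zeta> ^ (2 * n * (n - 1) + 1)"
      by (rule power_periodic[OF M(2), of _ "2 * k + 1 + M"]) (simp add: n algebra_simps)
    have "M * 1 \<le> M * (2 * k + 2 * M)" using M(1) by (intro mult_left_mono) auto
    then show "2 * n * (n - 1) + 1 + (2 * n + 1) * M \<le> 2 * (n + M) * (n + M - 1) + 1" by (simp add: n algebra_simps)
  qed simp
  from radial_limit_shifted[OF this nz bilateral_terms_summable(4), unfolded Suc, OF _ _ negative_terms(4)]
  show "radial_limit (\<lambda>q. unilateral phi1_term q - bilateral phi1_term q) \<zeta>
          (- 2 * \<zeta> * (\<Sum>n=1..M. \<zeta> ^ (2 * n * (n - 1)) / qpoch_fin (-\<zeta>) (\<zeta>\<^sup>2) n))"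
    by (simp add: sum_distrib_left sum_negf mult_ac)
qed

theorem theorem1p2:
  fixes \<zeta> :: complex and k :: nat
  assumes "k \<ge> 1"
  shows
    "(primitive_root_of_unity (2 * k - 1) \<zeta> \<longrightarrow>
        radial_limit (\<lambda>q. unilateral psi0_term q - bilateral psi0_term q) \<zeta>
          (- 1 / 2 - (\<Sum>n=1..2*k-1. \<zeta> ^ (n\<^sup>2) / qpoch_fin (-\<zeta>) \<zeta> n)) \<and>
        radial_limit (\<lambda>q. unilateral psi1_term q - bilateral psi1_term q) \<zeta>
          (- 1 / 2 - (\<Sum>n=1..2*k-1. \<zeta> ^ (n * (n + 1)) / qpoch_fin (-\<zeta>) \<zeta> n))) \<and>
     modular_in_q (Gamma1 20) (1 / 2) (bilateral psi0_term) \<and>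
     modular_in_q (Gamma1 20) (1 / 2) (bilateral psi1_term) \<and>
     (primitive_root_of_unity (2 * k - 1) \<zeta> \<longrightarrow>
        radial_limit (\<lambda>q. unilateral phi0_term q - bilateral phi0_term q) \<zeta>
          (- 2 * (\<Sum>n=1..2*k-1. \<zeta> ^ (2 * n\<^sup>2) / qpoch_fin (-\<zeta>) (\<zeta>\<^sup>2) n)) \<and>
        radial_limit (\<lambda>q. unilateral phi1_term q - bilateral phi1_term q) \<zeta>
          (- 2 * \<zeta> * (\<Sum>n=1..2*k-1. \<zeta> ^ (2 * n * (n - 1)) / qpoch_fin (-\<zeta>) (\<zeta>\<^sup>2) n))) \<and>
     (primitive_root_of_unity (4 * k) \<zeta> \<longrightarrow>
        radial_limit (\<lambda>q. unilateral phi0_term q - bilateral phi0_term q) \<zeta>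
          (- 2 * (\<Sum>n=1..2*k. \<zeta> ^ (2 * n\<^sup>2) / qpoch_fin (-\<zeta>) (\<zeta>\<^sup>2) n)) \<and>
        radial_limit (\<lambda>q. unilateral phi1_term q - bilateral phi1_term q) \<zeta>
          (- 2 * \<zeta> * (\<Sum>n=1..2*k. \<zeta> ^ (2 * n * (n - 1)) / qpoch_fin (-\<zeta>) (\<zeta>\<^sup>2) n))) \<and>
     modular_in_q (Gamma1 10) (1 / 2) (\<lambda>q. bilateral phi0_term (-q)) \<and>
     modular_in_q (Gamma1 20) (1 / 2) (bilateral phi0_term) \<and>
     modular_in_q (Gamma1 10) (1 / 2) (\<lambda>q. bilateral phi1_term (-q)) \<and>
     modular_in_q (Gamma1 20) (1 / 2) (bilateral phi1_term)"
proof -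
  have odd: "odd (2 * k - 1)" using assms by (cases k) auto
  have phi_odd: "primitive_root_of_unity (2 * k - 1) (\<zeta>\<^sup>2)" "(- \<zeta>) ^ (2 * k - 1) = - 1"
    if "primitive_root_of_unity (2 * k - 1) \<zeta>"
    using primitive_root_square[OF that odd] that odd by (auto simp: primitive_root_of_unity_def power_minus_odd)
  \<comment> \<open>For order \<open>4 * k\<close> the square has order \<open>2 * k\<close>, and
    \<open>\<zeta> ^ (2 * k) = - 1\<close>; as the exponent is even, the sign in front of \<zeta>
    has no effect.\<close>
  have phi_even: "primitive_root_of_unity (2 * k) (\<zeta>\<^sup>2)" "(- \<zeta>) ^ (2 * k) = - 1"
    if "primitive_root_of_unity (4 * k) \<zeta>"
    using primitive_root_square_even[of "2 * k" \<zeta>] that by simp_all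
  show ?thesis
    by (intro conjI impI psi_radial_limits phi_radial_limits phi_odd phi_even odd modular_in_q_psi modular_in_q_phi
        modular_in_q_minus)
qed

end
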